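(* Let $\mathcal R$ be an $N_W=N$ SUSY Lie conformal algebra. Let $V=V(\mathcal R)$ be the quotient of $U(\mathrm{Lie}(\mathcal R))$ by the left ideal generated by $\mathrm{Lie}(\mathcal R)_\le$. Then $V$ admits an $N_W=N$ SUSY vertex algebra structure whose vacuum vector $|0\rangle$ is the image of $1$ in $V$, and whose translation operators $T$, $S^i$ ($i=1,\dots,N$) are obtained by extending the corresponding derivations $T,S^i$ of $\mathrm{Lie}(\mathcal R)$ by the Leibniz rule.
   Context: Ground field $\mathbb C$; $N\ge0$ a fixed integer. In exponents of $-1$, $a$ means the parity of $a$ and $J$ means $\#J$; "$N$" as a set means $\{1,\dots,N\}$. $Z=(z,\theta^1,\dots,\theta^N)$, $W=(w,\zeta^1,\dots,\zeta^N)$, $z,w$ even, $\theta^i,\zeta^i$ odd, odd variables anticommuting with each other and supercommuting with elements of superspaces. For $J=\{j_1<\dots<j_k\}$, $\theta^J=\theta^{j_1}\cdots\theta^{j_k}$, $Z^{j|J}=z^j\theta^J$ (similarly $W^{j|J}$). For disjoint $I,J$, $\sigma(I,J)=\pm1$ is defined by $\theta^I\theta^J=\sigma(I,J)\theta^{I\cup J}$; $\sigma(I,J)=0$ if $I\cap J\ne\emptyset$; $\sigma(I)=\sigma(I,N\setminus I)$; terms with $J\not\subset I$ in an expression involving $I\setminus J$ and $\sigma(J,I\setminus J)$ are omitted. $\Lambda=(\lambda,\chi^1,\dots,\chi^N)$: $\lambda$ even, $\chi^i$ odd, freely generating the commutative superalgebra $\mathbb C[\Lambda]$; $\Lambda^{j|J}=\lambda^j\chi^{j_1}\cdots\chi^{j_k}$,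 $\Lambda^{(j|J)}=\frac{(-1)^{J(J+1)/2}}{j!}\Lambda^{j|J}$. An $N_W=N$ SUSY Lie conformal algebra is a $\mathbb Z/2\mathbb Z$-graded module $\mathcal R$ over the commutative superalgebra $\mathbb C[T,S^1,\dots,S^N]$ freely generated by an even $T$ and odd $S^i$, with a $\mathbb C$-bilinear map $[\,_\Lambda\,]:\mathcal R\otimes\mathcal R\to\mathbb C[\Lambda]\otimes\mathcal R$ of parity $N\bmod2$ satisfying: (1) $[Ta_\Lambda b]=-\lambda[a_\Lambda b]$, $[a_\Lambda Tb]=(T+\lambda)[a_\Lambda b]$, $[S^ia_\Lambda b]=-(-1)^N\chi^i[a_\Lambda b]$, $[a_\Lambda S^ib]=(-1)^{a+N}(S^i+\chi^i)[a_\Lambda b]$; (2) $[b_\Lambda a]=-(-1)^{ab+N}[a_{-\Lambda-\nabla}b]$, $\nabla=(T,S^1,\dots,S^N)$, meaning: compute $[a_\Gamma b]=\sum\Gamma^{j|J}c_{j|J}$ and substitute $\Gamma=-\Lambda-\nabla$ with $T,S^i$ acting on $c_{j|J}$ ($\chi^i$ anticommuting with $S^j$); (3) $[a_\Lambda[b_\Gamma c]]=(-1)^{aN+N}[[a_\Lambda b]_{\Lambda+\Gamma}c]+(-1)^{(a+N)(b+N)}[b_\Gamma[a_\Lambda c]]$, with $\Gamma=(\gamma,\eta^i)$ a second set of parameters, $\mathbb C[\Lambda,\Gamma]$ commutative, and $[\chi^ia_\Gamma b]=(-1)^N\chi^i[a_\Gamma b]$, $[a_\Gamma\chi^ib]=(-1)^{a+N}\chi^i[a_\Gamma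 b]$. The products $a_{(j|J)}b\in\mathcal R$ ($j\ge0$) are defined by $[a_\Lambda b]=\sum_{j\ge0,J}(-1)^{JN}\Lambda^{(j|J)}a_{(j|J)}b$. The Lie superalgebra $\mathrm{Lie}(\mathcal R)$: let $L(\mathcal R)$ be the quotient of $\mathcal R\otimes\mathbb C[w,w^{-1},\zeta^1,\dots,\zeta^N]$ by the span of all $Ta\otimes f+a\otimes\partial_wf$ and $S^ia\otimes f+(-1)^aa\otimes\partial_{\zeta^i}f$; let $a_{<n|I>}$ be the image of $a\otimes W^{n|I}$. The bracket $$\{a_{<n|I>},b_{<k|K>}\}=\sum_{j\ge0,J}(-1)^{aJ+b(I-J)}\tbinom nj\,\sigma(J,I\setminus J)\,\sigma(I\setminus J,K)\,(a_{(j|J)}b)_{<n-j+k|K\cup(I\setminus J)>}$$ is well defined on $L(\mathcal R)$. $\mathrm{Lie}(\mathcal R)$ is $L(\mathcal R)$ with parity shifted by $N\bmod2$ and bracket $[x,y]=(-1)^{p(x)N+N}\{x,y\}$, $p(x)$ being the parity in $L(\mathcal R)$; it is a Lie superalgebra. Put $a_{(n|I)}=(-1)^{aI}\sigma(I)a_{<n|I>}\in\mathrm{Lie}(\mathcal R)$. $\mathrm{Lie}(\mathcal R)$ carries an even derivation $T$ and odd derivations $S^i$ given by $T(a_{(j|J)})=-j\,a_{(j-1|J)}$, and $S^i(a_{(j|J)})=\sigma(N\setminus J,\{i\})\,a_{(j|J\setminus\{i\})}$ if $i\in J$, $S^i(a_{(j|J)})=0$ if $i\notin J$. $\mathrm{Lie}(\mathcal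 R)_\le$ is the span of all $a_{(j|J)}$ with $a\in\mathcal R$, $j\ge0$; it is a subalgebra stable under $T,S^i$. $U(\cdot)$ is the universal enveloping superalgebra. An $N_W=N$ SUSY vertex algebra is a vector superspace $V$ with an even vector $|0\rangle$, an even operator $T$, odd operators $S^1,\dots,S^N$, and a parity preserving linear map $a\mapsto Y(a,Z)$ from $V$ to $\mathrm{End}(V)$-valued fields (formal sums $\sum_{n\in\mathbb Z,I}Z^{n|I}A_{n|I}$, $A_{n|I}\in\mathrm{End}(V)$, mapping each $v\in V$ into $V((z))[\theta^1,\dots,\theta^N]$) such that: $Y(a,Z)|0\rangle\in V[[z]][\theta^1,\dots,\theta^N]$ has value $a$ at $Z=0$, $T|0\rangle=S^i|0\rangle=0$; $[T,Y(a,Z)]=\partial_zY(a,Z)$, $[S^i,Y(a,Z)]=\partial_{\theta^i}Y(a,Z)$; for all $a,b$, $(z-w)^n[Y(a,Z),Y(b,W)]=0$ for some $n\ge0$. *)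

theory Defs
  imports Complex_Main "HOL-Library.Poly_Mapping" "HOL-Algebra.Module" "HOL-Algebra.QuotRing"
begin

section \<open>Superspaces\<close>

text \<open>
  The record \<^term>\<open>module\<close> of HOL-Algebra extends \<^term>\<open>ring\<close>; its fields \<^term>\<open>mult\<close> and
  \<^term>\<open>one\<close> are meaningful only for superspaces that are superalgebras.
\<close>

definition complex_ring :: "complex ring" where
  "complex_ring = \<lparr>carrier = UNIV, mult = (*), one = 1, zero = 0, add = (+)\<rparr>"

record 'a superspace = "(complex, 'a) module" +
  even_part :: "'a set"
  odd_part :: "'a set"

text \<open>Only the parity of the second argument matters, so that parities can be added freely.\<close>

definition gr :: "('a, 'm) superspace_scheme \<Rightarrow> nat \<Rightarrow> 'a set" where
  "gr V p = (if even p then even_part V else odd_part V)"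

definition is_superspace :: "('a, 'm) superspace_scheme \<Rightarrow> bool" where
  "is_superspace V \<longleftrightarrow>
     Module.module complex_ring V \<and>
     submodule (even_part V) complex_ring V \<and>
     submodule (odd_part V) complex_ring V \<and>
     even_part V \<inter> odd_part V = {\<zero>\<^bsub>V\<^esub>} \<and>
     carrier V = even_part V <+>\<^bsub>V\<^esub> odd_part V"

definition lin_endo :: "('a, 'm) superspace_scheme \<Rightarrow> ('a \<Rightarrow> 'a) \<Rightarrow> bool" where
  "lin_endo V f \<longleftrightarrow>
     f \<in> carrier V \<rightarrow> carrier V \<and>
     (\<forall>x\<in>carrier V. \<forall>y\<in>carrier V. f (x \<oplus>\<^bsub>V\<^esub> y) = f x \<oplus>\<^bsub>V\<^esub> f y) \<and>
     (\<forall>c. \<forall>x\<in>carrier V. f (c \<odot>\<^bsub>V\<^esub> x) = c \<odot>\<^bsub>V\<^esub> f x)"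

definition has_parity :: "('a, 'm) superspace_scheme \<Rightarrow> nat \<Rightarrow> ('a \<Rightarrow> 'a) \<Rightarrow> bool" where
  "has_parity V p f \<longleftrightarrow> (\<forall>q. \<forall>x\<in>gr V q. f x \<in> gr V (p + q))"

definition lin_span :: "('a, 'm) superspace_scheme \<Rightarrow> 'a set \<Rightarrow> 'a set" where
  "lin_span V X = \<Inter>{H. submodule H complex_ring V \<and> X \<subseteq> H}"

text \<open>
  The quotient by a subspace \<open>K\<close>: on the ring fields this is \<^term>\<open>FactRing V K\<close>, so it is the
  quotient superalgebra when \<open>K\<close> is a two-sided ideal.
\<close>

definition quot :: "('a, 'm) superspace_scheme \<Rightarrow> 'a set \<Rightarrow> 'a set superspace" where
  "quot V K = \<lparr>carrier = a_rcosets\<^bsub>V\<^esub> K, mult = rcoset_mult V K, one = K +>\<^bsub>V\<^esub> \<one>\<^bsub>V\<^esub>,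
     zero = K, add = set_add V, smult = (\<lambda>c X. \<Union>x\<in>X. K +>\<^bsub>V\<^esub> (c \<odot>\<^bsub>V\<^esub> x)),
     even_part = (\<lambda>x. K +>\<^bsub>V\<^esub> x) ` even_part V,
     odd_part = (\<lambda>x. K +>\<^bsub>V\<^esub> x) ` odd_part V\<rparr>"


section \<open>Signs and linear extension\<close>

text \<open>
  \<open>\<theta>\<^sup>I \<theta>\<^sup>J = sgm I J \<theta>\<^bsup>I \<union> J\<^esup>\<close>, where the factors of \<open>\<theta>\<^sup>I\<close> and \<open>\<theta>\<^sup>J\<close> are in increasing order: sorting the
  product transposes exactly the pairs \<open>(i, j)\<close> with \<open>j < i\<close>.
\<close>

definition sgm :: "nat set \<Rightarrow> nat set \<Rightarrow> complex" where
  "sgm I J = (if I \<inter> J \<noteq> {} then 0 else (-1) ^ card {(i, j). i \<in> I \<and> j \<in> J \<and> j < i})"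

text \<open>
  An element of \<open>\<complex>[\<Lambda>] \<otimes> R\<close> (or of a similar tensor product) is represented by its finitely supported
  family of coefficients; \<open>single k r\<close> is the monomial with exponent \<open>k\<close> tensored with \<open>r\<close>, and
  \<open>pext \<phi>\<close> is the additive map which sends this element to \<open>\<phi> k r\<close> (for \<open>\<phi> k\<close> additive).
\<close>

definition pext :: "('k \<Rightarrow> 'a::zero \<Rightarrow> 'b::comm_monoid_add) \<Rightarrow> ('k \<Rightarrow>\<^sub>0 'a) \<Rightarrow> 'b" where
  "pext \<phi> f = (\<Sum>k\<in>Poly_Mapping.keys f. \<phi> k (Poly_Mapping.lookup f k))"


section \<open>SUSY Lie conformal algebras\<close>

text \<open>
  The bracket \<open>conf_br R a b\<close> is the family of coefficients \<open>c\<close> in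
  \<open>[a\<^sub>\<Lambda> b] = (\<Sum>j J. \<Lambda>\<^bsup>j|J\<^esup> c (j, J))\<close>, with \<open>\<Lambda>\<^bsup>j|J\<^esup> = \<lambda>\<^sup>j \<chi>\<^sup>J\<close>.
\<close>

record (overloaded) 'r conf_data =
  conf_scale :: "complex \<Rightarrow> 'r \<Rightarrow> 'r"
  conf_even :: "'r set"
  conf_odd :: "'r set"
  conf_T :: "'r \<Rightarrow> 'r"
  conf_S :: "nat \<Rightarrow> 'r \<Rightarrow> 'r"
  conf_br :: "'r \<Rightarrow> 'r \<Rightarrow> (nat \<times> nat set) \<Rightarrow>\<^sub>0 'r"

definition conf_gr :: "'r conf_data \<Rightarrow> nat \<Rightarrow> 'r set" where
  "conf_gr R p = (if even p then conf_even R else conf_odd R)"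

definition pscale :: "'r::ab_group_add conf_data \<Rightarrow> complex \<Rightarrow> ('k \<Rightarrow>\<^sub>0 'r) \<Rightarrow> ('k \<Rightarrow>\<^sub>0 'r)" where
  "pscale R c = Poly_Mapping.map (conf_scale R c)"

text \<open>Left multiplication by \<open>\<lambda>\<close> and \<open>\<chi>\<^sup>i\<close>, and the action of \<open>T\<close> and \<open>S\<^sup>i\<close>, on \<open>\<complex>[\<Lambda>] \<otimes> R\<close>.\<close>

definition mul_lam :: "((nat \<times> nat set) \<Rightarrow>\<^sub>0 'r::ab_group_add) \<Rightarrow> ((nat \<times> nat set) \<Rightarrow>\<^sub>0 'r)" where
  "mul_lam = pext (\<lambda>(j, J) r. Poly_Mapping.single (Suc j, J) r)"

definition mul_chi ::
  "'r::ab_group_add conf_data \<Rightarrow> nat \<Rightarrow> ((nat \<times> nat set) \<Rightarrow>\<^sub>0 'r) \<Rightarrow> ((nat \<times> nat set) \<Rightarrow>\<^sub>0 'r)" where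
  "mul_chi R i = pext (\<lambda>(j, J) r.
     Poly_Mapping.single (j, insert i J) (conf_scale R (sgm {i} J) r))"

definition act_T ::
  "'r::ab_group_add conf_data \<Rightarrow> ((nat \<times> nat set) \<Rightarrow>\<^sub>0 'r) \<Rightarrow> ((nat \<times> nat set) \<Rightarrow>\<^sub>0 'r)" where
  "act_T R = pext (\<lambda>k r. Poly_Mapping.single k (conf_T R r))"

definition act_S ::
  "'r::ab_group_add conf_data \<Rightarrow> nat \<Rightarrow> ((nat \<times> nat set) \<Rightarrow>\<^sub>0 'r) \<Rightarrow> ((nat \<times> nat set) \<Rightarrow>\<^sub>0 'r)" where
  "act_S R i = pext (\<lambda>(j, J) r.
     Poly_Mapping.single (j, J) (conf_scale R ((-1) ^ card J) (conf_S R i r)))"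

text \<open>\<open>[a\<^bsub>-\<Lambda>-\<nabla>\<^esub> b]\<close>\<close>

definition br_minus_nabla ::
  "'r::ab_group_add conf_data \<Rightarrow> 'r \<Rightarrow> 'r \<Rightarrow> (nat \<times> nat set) \<Rightarrow>\<^sub>0 'r" where
  "br_minus_nabla R a b = pext (\<lambda>(j, J) r.
     ((\<lambda>x. - mul_lam x - act_T R x) ^^ j)
       (foldr (\<lambda>i x. - mul_chi R i x - act_S R i x) (sorted_list_of_set J)
         (Poly_Mapping.single (0, {}) r))) (conf_br R a b)"

text \<open>
  In \<open>\<complex>[\<Lambda>, \<Gamma>] \<otimes> R\<close> the exponent \<open>((j, J), (k, K))\<close> stands for \<open>\<Lambda>\<^bsup>j|J\<^esup> \<Gamma>\<^bsup>k|K\<^esup>\<close>.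
\<close>

type_synonym 'r two_param = "((nat \<times> nat set) \<times> (nat \<times> nat set)) \<Rightarrow>\<^sub>0 'r"

definition mul_lam2 :: "'r::ab_group_add two_param \<Rightarrow> 'r two_param" where
  "mul_lam2 = pext (\<lambda>((j, J), (k, K)) r. Poly_Mapping.single ((Suc j, J), (k, K)) r)"

definition mul_gam2 :: "'r::ab_group_add two_param \<Rightarrow> 'r two_param" where
  "mul_gam2 = pext (\<lambda>((j, J), (k, K)) r. Poly_Mapping.single ((j, J), (Suc k, K)) r)"

definition mul_chi2 :: "'r::ab_group_add conf_data \<Rightarrow> nat \<Rightarrow> 'r two_param \<Rightarrow> 'r two_param" where
  "mul_chi2 R i = pext (\<lambda>((j, J), (k, K)) r.
     Poly_Mapping.single ((j, insert i J), (k, K)) (conf_scale R (sgm {i} J) r))"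

definition mul_eta2 :: "'r::ab_group_add conf_data \<Rightarrow> nat \<Rightarrow> 'r two_param \<Rightarrow> 'r two_param" where
  "mul_eta2 R i = pext (\<lambda>((j, J), (k, K)) r.
     Poly_Mapping.single ((j, J), (k, insert i K)) (conf_scale R ((-1) ^ card J * sgm {i} K) r))"

definition mul_Lam2 :: "'r::ab_group_add conf_data \<Rightarrow> nat \<Rightarrow> nat set \<Rightarrow> 'r two_param \<Rightarrow> 'r two_param" where
  "mul_Lam2 R j J x = (mul_lam2 ^^ j) (foldr (mul_chi2 R) (sorted_list_of_set J) x)"

definition mul_Gam2 :: "'r::ab_group_add conf_data \<Rightarrow> nat \<Rightarrow> nat set \<Rightarrow> 'r two_param \<Rightarrow> 'r two_param" where
  "mul_Gam2 R k K x = (mul_gam2 ^^ k) (foldr (mul_eta2 R) (sorted_list_of_set K) x)"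

text \<open>\<open>[a\<^sub>\<Lambda> b]\<close>, \<open>[a\<^sub>\<Gamma> b]\<close> and \<open>[a\<^bsub>\<Lambda>+\<Gamma>\<^esub> b]\<close> as elements of \<open>\<complex>[\<Lambda>, \<Gamma>] \<otimes> R\<close>\<close>

definition br_Lam :: "'r::ab_group_add conf_data \<Rightarrow> 'r \<Rightarrow> 'r \<Rightarrow> 'r two_param" where
  "br_Lam R a b = pext (\<lambda>k r. Poly_Mapping.single (k, (0, {})) r) (conf_br R a b)"

definition br_Gam :: "'r::ab_group_add conf_data \<Rightarrow> 'r \<Rightarrow> 'r \<Rightarrow> 'r two_param" where
  "br_Gam R a b = pext (\<lambda>k r. Poly_Mapping.single ((0, {}), k) r) (conf_br R a b)"

definition br_Lam_Gam :: "'r::ab_group_add conf_data \<Rightarrow> 'r \<Rightarrow> 'r \<Rightarrow> 'r two_param" where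
  "br_Lam_Gam R a b = pext (\<lambda>(k, K) r.
     ((\<lambda>x. mul_lam2 x + mul_gam2 x) ^^ k)
       (foldr (\<lambda>i x. mul_chi2 R i x + mul_eta2 R i x) (sorted_list_of_set K)
         (Poly_Mapping.single ((0, {}), (0, {})) r))) (conf_br R a b)"

text \<open>
  The iterated brackets of the Jacobi identity. The signs move the inner parameters out of the outer
  bracket, by \<open>[a\<^sub>\<Lambda> \<eta>\<^sup>i b] = (-1)\<^bsup>a+N\<^esup> \<eta>\<^sup>i [a\<^sub>\<Lambda> b]\<close> and \<open>[\<chi>\<^sup>i a\<^sub>\<Gamma> b] = (-1)\<^sup>N \<chi>\<^sup>i [a\<^sub>\<Gamma> b]\<close>; \<open>p\<close> is the
  parity of \<open>a\<close>, and \<open>q\<close> the parity of \<open>b\<close>.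
\<close>

definition jac_a_bc :: "nat \<Rightarrow> 'r::ab_group_add conf_data \<Rightarrow> nat \<Rightarrow> 'r \<Rightarrow> 'r \<Rightarrow> 'r \<Rightarrow> 'r two_param" where
  "jac_a_bc N R p a b c = pext (\<lambda>(k, K) r.
     pscale R ((-1) ^ ((p + N) * card K)) (mul_Gam2 R k K (br_Lam R a r))) (conf_br R b c)"

definition jac_ab_c :: "nat \<Rightarrow> 'r::ab_group_add conf_data \<Rightarrow> 'r \<Rightarrow> 'r \<Rightarrow> 'r \<Rightarrow> 'r two_param" where
  "jac_ab_c N R a b c = pext (\<lambda>(j, J) r.
     pscale R ((-1) ^ (N * card J)) (mul_Lam2 R j J (br_Lam_Gam R r c))) (conf_br R a b)"

definition jac_b_ac :: "nat \<Rightarrow> 'r::ab_group_add conf_data \<Rightarrow> nat \<Rightarrow> 'r \<Rightarrow> 'r \<Rightarrow> 'r \<Rightarrow> 'r two_param" where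
  "jac_b_ac N R q a b c = pext (\<lambda>(j, J) r.
     pscale R ((-1) ^ ((q + N) * card J)) (mul_Lam2 R j J (br_Gam R b r))) (conf_br R a c)"

locale susy_lie_conformal_algebra =
  fixes N :: nat and R :: "'r::ab_group_add conf_data"
  assumes vector_space: "vector_space (conf_scale R)"
    and subspace_gr: "\<And>p. module.subspace (conf_scale R) (conf_gr R p)"
    and even_Int_odd: "conf_even R \<inter> conf_odd R = {0}"
    and even_plus_odd: "\<And>r. \<exists>x\<in>conf_even R. \<exists>y\<in>conf_odd R. r = x + y"
    and linear_T: "Vector_Spaces.linear (conf_scale R) (conf_scale R) (conf_T R)"
    and linear_S: "\<And>i. i \<in> {1..N} \<Longrightarrow> Vector_Spaces.linear (conf_scale R) (conf_scale R) (conf_S R i)"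
    and even_T: "\<And>p a. a \<in> conf_gr R p \<Longrightarrow> conf_T R a \<in> conf_gr R p"
    and odd_S: "\<And>i p a. i \<in> {1..N} \<Longrightarrow> a \<in> conf_gr R p \<Longrightarrow> conf_S R i a \<in> conf_gr R (p + 1)"
    and T_S: "\<And>i a. i \<in> {1..N} \<Longrightarrow> conf_T R (conf_S R i a) = conf_S R i (conf_T R a)"
    and S_S: "\<And>i k a. i \<in> {1..N} \<Longrightarrow> k \<in> {1..N} \<Longrightarrow>
        conf_S R i (conf_S R k a) = - conf_S R k (conf_S R i a)"
    and keys_br: "\<And>a b. Poly_Mapping.keys (conf_br R a b) \<subseteq> UNIV \<times> Pow {1..N}"
    and linear_br_left: "\<And>b. Vector_Spaces.linear (conf_scale R) (pscale R) (\<lambda>a. conf_br R a b)"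
    and linear_br_right: "\<And>a. Vector_Spaces.linear (conf_scale R) (pscale R) (\<lambda>b. conf_br R a b)"
    and parity_br: "\<And>p q a b j J. a \<in> conf_gr R p \<Longrightarrow> b \<in> conf_gr R q \<Longrightarrow>
        Poly_Mapping.lookup (conf_br R a b) (j, J) \<in> conf_gr R (p + q + N + card J)"
    and br_T_left: "\<And>a b. conf_br R (conf_T R a) b = - mul_lam (conf_br R a b)"
    and br_T_right: "\<And>a b. conf_br R a (conf_T R b) =
        act_T R (conf_br R a b) + mul_lam (conf_br R a b)"
    and br_S_left: "\<And>i a b. i \<in> {1..N} \<Longrightarrow>
        conf_br R (conf_S R i a) b = pscale R (- ((-1) ^ N)) (mul_chi R i (conf_br R a b))"
    and br_S_right: "\<And>i p a b. i \<in> {1..N} \<Longrightarrow> a \<in> conf_gr R p \<Longrightarrow>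
        conf_br R a (conf_S R i b) =
          pscale R ((-1) ^ (p + N)) (act_S R i (conf_br R a b) + mul_chi R i (conf_br R a b))"
    and br_skew: "\<And>p q a b. a \<in> conf_gr R p \<Longrightarrow> b \<in> conf_gr R q \<Longrightarrow>
        conf_br R b a = pscale R (- ((-1) ^ (p * q + N))) (br_minus_nabla R a b)"
    and br_jacobi: "\<And>p q a b c. a \<in> conf_gr R p \<Longrightarrow> b \<in> conf_gr R q \<Longrightarrow>
        jac_a_bc N R p a b c =
          pscale R ((-1) ^ (p * N + N)) (jac_ab_c N R a b c) +
          pscale R ((-1) ^ ((p + N) * (q + N))) (jac_b_ac N R q a b c)"

text \<open>
  \<open>a\<^bsub>(j|J)\<^esub> b\<close>, obtained by inverting
  \<open>[a\<^sub>\<Lambda> b] = (\<Sum>j J. (-1)\<^bsup>JN\<^esup> (-1)\<^bsup>J(J+1)/2\<^esup> / j! \<Lambda>\<^bsup>j|J\<^esup> a\<^bsub>(j|J)\<^esub> b)\<close>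
\<close>

definition nprod :: "nat \<Rightarrow> 'r::ab_group_add conf_data \<Rightarrow> 'r \<Rightarrow> nat \<Rightarrow> nat set \<Rightarrow> 'r \<Rightarrow> 'r" where
  "nprod N R a j J b =
     conf_scale R ((-1) ^ (card J * N + card J * (card J + 1) div 2) * fact j)
       (Poly_Mapping.lookup (conf_br R a b) (j, J))"


section \<open>The Lie superalgebra of a SUSY Lie conformal algebra\<close>

record 'a lie_superalgebra = "'a superspace" +
  lie_br :: "'a \<Rightarrow> 'a \<Rightarrow> 'a"

text \<open>
  \<open>R \<otimes> \<complex>[w, w\<^sup>-\<^sup>1, \<zeta>\<^sup>1, \<dots>, \<zeta>\<^sup>N]\<close>, where \<open>single (n, I) a\<close> is \<open>a \<otimes> W\<^bsup>n|I\<^esup>\<close>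
\<close>

type_synonym 'r loops = "(int \<times> nat set) \<Rightarrow>\<^sub>0 'r"

definition loop_space :: "nat \<Rightarrow> 'r::ab_group_add conf_data \<Rightarrow> 'r loops superspace" where
  "loop_space N R =
     (let C = {f. Poly_Mapping.keys f \<subseteq> UNIV \<times> Pow {1..N}};
          G = (\<lambda>p. {f\<in>C. \<forall>n I. Poly_Mapping.lookup f (n, I) \<in> conf_gr R (p + card I)})
      in \<lparr>carrier = C, mult = undefined, one = undefined, zero = 0, add = (+),
          smult = pscale R, even_part = G 0, odd_part = G 1\<rparr>)"

definition loop_rels :: "nat \<Rightarrow> 'r::ab_group_add conf_data \<Rightarrow> 'r loops set" where
  "loop_rels N R =
     {Poly_Mapping.single (n, I) (conf_T R a)
        + Poly_Mapping.single (n - 1, I) (conf_scale R (of_int n) a) | a n I. I \<subseteq> {1..N}} \<union>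
     {Poly_Mapping.single (n, I) (conf_S R i a)
        + (if i \<in> I then Poly_Mapping.single (n, I - {i})
             (conf_scale R ((-1) ^ p * sgm {i} (I - {i})) a) else 0)
      | i p a n I. i \<in> {1..N} \<and> a \<in> conf_gr R p \<and> I \<subseteq> {1..N}}"

definition loop_ker :: "nat \<Rightarrow> 'r::ab_group_add conf_data \<Rightarrow> 'r loops set" where
  "loop_ker N R = lin_span (loop_space N R) (loop_rels N R)"

definition L_space :: "nat \<Rightarrow> 'r::ab_group_add conf_data \<Rightarrow> 'r loops set superspace" where
  "L_space N R = quot (loop_space N R) (loop_ker N R)"

definition L_class :: "nat \<Rightarrow> 'r::ab_group_add conf_data \<Rightarrow> 'r loops \<Rightarrow> 'r loops set" where
  "L_class N R f = loop_ker N R +>\<^bsub>loop_space N R\<^esub> f"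

definition conf_proj :: "'r::ab_group_add conf_data \<Rightarrow> nat \<Rightarrow> 'r \<Rightarrow> 'r" where
  "conf_proj R p a = (THE x. x \<in> conf_gr R p \<and> a - x \<in> conf_gr R (p + 1))"

definition loop_proj :: "'r::ab_group_add conf_data \<Rightarrow> nat \<Rightarrow> 'r loops \<Rightarrow> 'r loops" where
  "loop_proj R p = pext (\<lambda>(n, I) a. Poly_Mapping.single (n, I) (conf_proj R (p + card I) a))"

text \<open>\<open>{a\<^bsub><n|I>\<^esub>, b\<^bsub><k|K>\<^esub>}\<close> for \<open>a\<close>, \<open>b\<close> of parities \<open>p\<close>, \<open>q\<close>, as an element of the loop space\<close>

definition curly_mono ::
  "nat \<Rightarrow> 'r::ab_group_add conf_data \<Rightarrow> nat \<Rightarrow> 'r \<Rightarrow> int \<Rightarrow> nat set \<Rightarrow> nat \<Rightarrow> 'r \<Rightarrow> int \<Rightarrow> nat set \<Rightarrow> 'r loops" where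
  "curly_mono N R p a n I q b k K =
     (\<Sum>(j, J)\<in>{(j, J)\<in>Poly_Mapping.keys (conf_br R a b). J \<subseteq> I}.
        Poly_Mapping.single (n - int j + k, K \<union> (I - J))
          (conf_scale R ((-1) ^ (p * card J + q * card (I - J)) * (of_int n gchoose j)
              * sgm J (I - J) * sgm (I - J) K)
            (nprod N R a j J b)))"

definition curly :: "nat \<Rightarrow> 'r::ab_group_add conf_data \<Rightarrow> 'r loops \<Rightarrow> 'r loops \<Rightarrow> 'r loops" where
  "curly N R f g = pext (\<lambda>(n, I) a. pext (\<lambda>(k, K) b.
     \<Sum>p<2. \<Sum>q<2. curly_mono N R p (conf_proj R p a) n I q (conf_proj R q b) k K) g) f"

text \<open>\<open>[x, y] = (-1)\<^bsup>p(x)N+N\<^esup> {x, y}\<close>, with \<open>p\<close> the parity before the shift\<close>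

definition loop_br :: "nat \<Rightarrow> 'r::ab_group_add conf_data \<Rightarrow> 'r loops \<Rightarrow> 'r loops \<Rightarrow> 'r loops" where
  "loop_br N R f g = (\<Sum>p<2. pscale R ((-1) ^ (p * N + N)) (curly N R (loop_proj R p f) g))"

definition Lie :: "nat \<Rightarrow> 'r::ab_group_add conf_data \<Rightarrow> 'r loops set lie_superalgebra" where
  "Lie N R = superspace.extend
     ((L_space N R)\<lparr>even_part := gr (L_space N R) N, odd_part := gr (L_space N R) (N + 1)\<rparr>)
     (lie_superalgebra.fields (\<lambda>X Y. \<Union>x\<in>X. \<Union>y\<in>Y. L_class N R (loop_br N R x y)))"

text \<open>\<open>a\<^bsub>(n|I)\<^esub>\<close> for \<open>a\<close> of parity \<open>p\<close>\<close>

definition fmode ::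
  "nat \<Rightarrow> 'r::ab_group_add conf_data \<Rightarrow> nat \<Rightarrow> 'r \<Rightarrow> int \<Rightarrow> nat set \<Rightarrow> 'r loops set" where
  "fmode N R p a n I = L_class N R
     (Poly_Mapping.single (n, I) (conf_scale R ((-1) ^ (p * card I) * sgm I ({1..N} - I)) a))"

definition Lie_le :: "nat \<Rightarrow> 'r::ab_group_add conf_data \<Rightarrow> 'r loops set set" where
  "Lie_le N R = lin_span (Lie N R)
     {fmode N R p a j J | p a j J. a \<in> conf_gr R p \<and> j \<ge> 0 \<and> J \<subseteq> {1..N}}"

definition lie_derivation :: "'g lie_superalgebra \<Rightarrow> nat \<Rightarrow> ('g \<Rightarrow> 'g) \<Rightarrow> bool" where
  "lie_derivation g p \<delta> \<longleftrightarrow>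
     lin_endo g \<delta> \<and> has_parity g p \<delta> \<and>
     (\<forall>q. \<forall>x\<in>gr g q. \<forall>y\<in>carrier g.
        \<delta> (lie_br g x y) = lie_br g (\<delta> x) y \<oplus>\<^bsub>g\<^esub> (-1) ^ (p * q) \<odot>\<^bsub>g\<^esub> lie_br g x (\<delta> y))"

definition is_Lie_T :: "nat \<Rightarrow> 'r::ab_group_add conf_data \<Rightarrow> ('r loops set \<Rightarrow> 'r loops set) \<Rightarrow> bool" where
  "is_Lie_T N R \<delta> \<longleftrightarrow>
     lie_derivation (Lie N R) 0 \<delta> \<and>
     (\<forall>p. \<forall>a\<in>conf_gr R p. \<forall>j. \<forall>J\<subseteq>{1..N}.
        \<delta> (fmode N R p a j J) = (- of_int j) \<odot>\<^bsub>Lie N R\<^esub> fmode N R p a (j - 1) J)"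

definition is_Lie_S ::
  "nat \<Rightarrow> 'r::ab_group_add conf_data \<Rightarrow> nat \<Rightarrow> ('r loops set \<Rightarrow> 'r loops set) \<Rightarrow> bool" where
  "is_Lie_S N R i \<delta> \<longleftrightarrow>
     lie_derivation (Lie N R) 1 \<delta> \<and>
     (\<forall>p. \<forall>a\<in>conf_gr R p. \<forall>j. \<forall>J\<subseteq>{1..N}.
        \<delta> (fmode N R p a j J) =
          (if i \<in> J then sgm ({1..N} - J) {i} \<odot>\<^bsub>Lie N R\<^esub> fmode N R p a j (J - {i})
           else \<zero>\<^bsub>Lie N R\<^esub>))"


section \<open>Universal enveloping superalgebras\<close>

text \<open>Words under concatenation, written additively so that \<open>'a word \<Rightarrow>\<^sub>0 complex\<close> is the free algebra\<close>

datatype 'a word = Word (letters: "'a list")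

instantiation word :: (type) monoid_add
begin

definition zero_word :: "'a word" where
  "zero_word = Word []"

definition plus_word :: "'a word \<Rightarrow> 'a word \<Rightarrow> 'a word" where
  "plus_word u v = Word (letters u @ letters v)"

instance
  by standard (simp_all add: zero_word_def plus_word_def)

end

definition fconst :: "complex \<Rightarrow> 'g word \<Rightarrow>\<^sub>0 complex" where
  "fconst c = Poly_Mapping.single 0 c"

definition letter :: "'g \<Rightarrow> 'g word \<Rightarrow>\<^sub>0 complex" where
  "letter x = Poly_Mapping.single (Word [x]) 1"

text \<open>
  The free algebra on the \<^emph>\<open>set\<close> \<^term>\<open>carrier g\<close>. Its \<open>even_part\<close> and \<open>odd_part\<close> are spanned by
  the words in homogeneous letters; they do not decompose the free algebra (which has inhomogeneous
  letters), but their images decompose \<open>U(g)\<close>.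
\<close>

definition free_alg :: "'g lie_superalgebra \<Rightarrow> ('g word \<Rightarrow>\<^sub>0 complex) superspace" where
  "free_alg g =
     (let F = \<lparr>carrier = {f. \<forall>w\<in>Poly_Mapping.keys f. set (letters w) \<subseteq> carrier g},
               mult = (*), one = 1, zero = 0, add = (+), smult = (\<lambda>c f. fconst c * f),
               even_part = {}, odd_part = {}\<rparr>;
          G = (\<lambda>p. lin_span F {prod_list (map letter xs) | xs ps.
                 list_all2 (\<lambda>x q. x \<in> gr g q) xs ps \<and> even (sum_list ps + p)})
      in F\<lparr>even_part := G 0, odd_part := G 1\<rparr>)"

definition env_rels :: "'g lie_superalgebra \<Rightarrow> ('g word \<Rightarrow>\<^sub>0 complex) set" where
  "env_rels g =
     {letter (x \<oplus>\<^bsub>g\<^esub> y) - letter x - letter y | x y. x \<in> carrier g \<and> y \<in> carrier g} \<union>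
     {letter (c \<odot>\<^bsub>g\<^esub> x) - fconst c * letter x | c x. x \<in> carrier g} \<union>
     {letter x * letter y - fconst ((-1) ^ (p * q)) * letter y * letter x - letter (lie_br g x y)
      | p q x y. x \<in> gr g p \<and> y \<in> gr g q}"

definition env_ideal :: "'g lie_superalgebra \<Rightarrow> ('g word \<Rightarrow>\<^sub>0 complex) set" where
  "env_ideal g = Idl\<^bsub>free_alg g\<^esub> (env_rels g)"

definition env :: "'g lie_superalgebra \<Rightarrow> ('g word \<Rightarrow>\<^sub>0 complex) set superspace" where
  "env g = quot (free_alg g) (env_ideal g)"

definition env_incl :: "'g lie_superalgebra \<Rightarrow> 'g \<Rightarrow> ('g word \<Rightarrow>\<^sub>0 complex) set" where
  "env_incl g x = env_ideal g +>\<^bsub>free_alg g\<^esub> letter x"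

definition left_ideal :: "('a, 'm) ring_scheme \<Rightarrow> 'a set \<Rightarrow> bool" where
  "left_ideal A I \<longleftrightarrow>
     additive_subgroup I A \<and> (\<forall>u\<in>carrier A. \<forall>x\<in>I. u \<otimes>\<^bsub>A\<^esub> x \<in> I)"

definition gen_left_ideal :: "('a, 'm) ring_scheme \<Rightarrow> 'a set \<Rightarrow> 'a set" where
  "gen_left_ideal A X = \<Inter>{I. left_ideal A I \<and> X \<subseteq> I}"

definition leibniz_extension ::
  "'g lie_superalgebra \<Rightarrow> nat \<Rightarrow> ('g \<Rightarrow> 'g) \<Rightarrow>
   (('g word \<Rightarrow>\<^sub>0 complex) set \<Rightarrow> ('g word \<Rightarrow>\<^sub>0 complex) set) \<Rightarrow> bool" where
  "leibniz_extension g p \<delta> \<Delta> \<longleftrightarrow>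
     lin_endo (env g) \<Delta> \<and> has_parity (env g) p \<Delta> \<and>
     (\<forall>x\<in>carrier g. \<Delta> (env_incl g x) = env_incl g (\<delta> x)) \<and>
     (\<forall>q. \<forall>u\<in>gr (env g) q. \<forall>v\<in>carrier (env g).
        \<Delta> (u \<otimes>\<^bsub>env g\<^esub> v) =
          (\<Delta> u \<otimes>\<^bsub>env g\<^esub> v) \<oplus>\<^bsub>env g\<^esub> (-1) ^ (p * q) \<odot>\<^bsub>env g\<^esub> (u \<otimes>\<^bsub>env g\<^esub> \<Delta> v))"


section \<open>The quotient \<open>V(R)\<close>\<close>

type_synonym 'r vstate = "('r loops set word \<Rightarrow>\<^sub>0 complex) set set"

definition V_ideal :: "nat \<Rightarrow> 'r::ab_group_add conf_data \<Rightarrow> 'r vstate" where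
  "V_ideal N R = gen_left_ideal (env (Lie N R)) (env_incl (Lie N R) ` Lie_le N R)"

definition V_space :: "nat \<Rightarrow> 'r::ab_group_add conf_data \<Rightarrow> 'r vstate superspace" where
  "V_space N R = quot (env (Lie N R)) (V_ideal N R)"

definition V_class ::
  "nat \<Rightarrow> 'r::ab_group_add conf_data \<Rightarrow> ('r loops set word \<Rightarrow>\<^sub>0 complex) set \<Rightarrow> 'r vstate" where
  "V_class N R u = V_ideal N R +>\<^bsub>env (Lie N R)\<^esub> u"

definition V_vacuum :: "nat \<Rightarrow> 'r::ab_group_add conf_data \<Rightarrow> 'r vstate" where
  "V_vacuum N R = V_class N R \<one>\<^bsub>env (Lie N R)\<^esub>"

text \<open>\<open>D\<close> is the operator on \<open>V(R)\<close> induced by the Leibniz extension of \<open>\<delta>\<close> to \<open>U(Lie(R))\<close>.\<close>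

definition V_leibniz ::
  "nat \<Rightarrow> 'r::ab_group_add conf_data \<Rightarrow> nat \<Rightarrow> ('r loops set \<Rightarrow> 'r loops set) \<Rightarrow>
   ('r vstate \<Rightarrow> 'r vstate) \<Rightarrow> bool" where
  "V_leibniz N R p \<delta> D \<longleftrightarrow>
     (\<exists>\<Delta>. leibniz_extension (Lie N R) p \<delta> \<Delta> \<and>
          (\<forall>u\<in>carrier (env (Lie N R)). D (V_class N R u) = V_class N R (\<Delta> u)))"


section \<open>SUSY vertex algebras\<close>

definition scomm ::
  "('v, 'm) superspace_scheme \<Rightarrow> nat \<Rightarrow> nat \<Rightarrow> ('v \<Rightarrow> 'v) \<Rightarrow> ('v \<Rightarrow> 'v) \<Rightarrow> 'v \<Rightarrow> 'v" where
  "scomm V p q A B v = A (B v) \<ominus>\<^bsub>V\<^esub> (-1) ^ (p * q) \<odot>\<^bsub>V\<^esub> B (A v)"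

text \<open>Multiplication of a formal distribution, given by its coefficients of \<open>z\<^sup>m w\<^sup>k\<close>, by \<open>z - w\<close>\<close>

definition mul_zw ::
  "('v, 'm) superspace_scheme \<Rightarrow> (int \<Rightarrow> int \<Rightarrow> 'v) \<Rightarrow> int \<Rightarrow> int \<Rightarrow> 'v" where
  "mul_zw V D m k = D (m - 1) k \<ominus>\<^bsub>V\<^esub> D m (k - 1)"

text \<open>
  \<open>Y a n I\<close> is the coefficient of \<open>Z\<^bsup>n|I\<^esup>\<close> in \<open>Y(a, Z)\<close>; for \<open>a\<close> of parity \<open>p\<close> it has parity \<open>p + |I|\<close>.
  Hence the coefficient of \<open>Z\<^bsup>m|I\<^esup> W\<^bsup>k|K\<^esup>\<close> in the supercommutator \<open>[Y(a, Z), Y(b, W)]\<close> of fields is the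
  supercommutator of the coefficients times \<open>(-1)\<^bsup>|K|(p+|I|)\<^esup>\<close>, which comes from moving \<open>\<zeta>\<^sup>K\<close> to the left.
  Likewise \<open>(-1)\<^bsup>|I|\<^esup>\<close> in \<open>translation_S\<close> comes from \<open>S\<^sup>i \<theta>\<^sup>I = (-1)\<^bsup>|I|\<^esup> \<theta>\<^sup>I S\<^sup>i\<close>, and
  \<open>sgm {i} I\<close> from \<open>\<partial>\<^bsub>\<theta>\<^sup>i\<^esub> \<theta>\<^bsup>I \<union> {i}\<^esup> = sgm {i} I \<theta>\<^sup>I\<close>.
\<close>

locale susy_vertex_algebra =
  fixes N :: nat and V :: "('v, 'm) superspace_scheme" and vac :: 'v
    and T :: "'v \<Rightarrow> 'v" and S :: "nat \<Rightarrow> 'v \<Rightarrow> 'v"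
    and Y :: "'v \<Rightarrow> int \<Rightarrow> nat set \<Rightarrow> 'v \<Rightarrow> 'v"
  assumes superspace: "is_superspace V"
    and vac_even: "vac \<in> gr V 0"
    and T_even: "lin_endo V T" "has_parity V 0 T"
    and S_odd: "\<And>i. i \<in> {1..N} \<Longrightarrow> lin_endo V (S i)" "\<And>i. i \<in> {1..N} \<Longrightarrow> has_parity V 1 (S i)"
    and Y_endo: "\<And>a n I. a \<in> carrier V \<Longrightarrow> I \<subseteq> {1..N} \<Longrightarrow> lin_endo V (Y a n I)"
    and Y_add: "\<And>a b n I v. a \<in> carrier V \<Longrightarrow> b \<in> carrier V \<Longrightarrow> I \<subseteq> {1..N} \<Longrightarrow> v \<in> carrier V \<Longrightarrow>
        Y (a \<oplus>\<^bsub>V\<^esub> b) n I v = Y a n I v \<oplus>\<^bsub>V\<^esub> Y b n I v"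
    and Y_smult: "\<And>c a n I v. a \<in> carrier V \<Longrightarrow> I \<subseteq> {1..N} \<Longrightarrow> v \<in> carrier V \<Longrightarrow>
        Y (c \<odot>\<^bsub>V\<^esub> a) n I v = c \<odot>\<^bsub>V\<^esub> Y a n I v"
    and Y_parity: "\<And>p a n I. a \<in> gr V p \<Longrightarrow> I \<subseteq> {1..N} \<Longrightarrow> has_parity V (p + card I) (Y a n I)"
    and Y_field: "\<And>a v. a \<in> carrier V \<Longrightarrow> v \<in> carrier V \<Longrightarrow>
        \<exists>M. \<forall>n<M. \<forall>I\<subseteq>{1..N}. Y a n I v = \<zero>\<^bsub>V\<^esub>"
    and vacuum_regular: "\<And>a n I. a \<in> carrier V \<Longrightarrow> n < 0 \<Longrightarrow> I \<subseteq> {1..N} \<Longrightarrow> Y a n I vac = \<zero>\<^bsub>V\<^esub>"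
    and vacuum_value: "\<And>a. a \<in> carrier V \<Longrightarrow> Y a 0 {} vac = a"
    and vacuum_T: "T vac = \<zero>\<^bsub>V\<^esub>"
    and vacuum_S: "\<And>i. i \<in> {1..N} \<Longrightarrow> S i vac = \<zero>\<^bsub>V\<^esub>"
    and translation_T: "\<And>a n I v. a \<in> carrier V \<Longrightarrow> I \<subseteq> {1..N} \<Longrightarrow> v \<in> carrier V \<Longrightarrow>
        T (Y a n I v) \<ominus>\<^bsub>V\<^esub> Y a n I (T v) = of_int (n + 1) \<odot>\<^bsub>V\<^esub> Y a (n + 1) I v"
    and translation_S: "\<And>i p a n I v. i \<in> {1..N} \<Longrightarrow> a \<in> gr V p \<Longrightarrow> I \<subseteq> {1..N} \<Longrightarrow> v \<in> carrier V \<Longrightarrow>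
        (-1) ^ card I \<odot>\<^bsub>V\<^esub> scomm V 1 (p + card I) (S i) (Y a n I) v =
          (if i \<in> I then \<zero>\<^bsub>V\<^esub> else sgm {i} I \<odot>\<^bsub>V\<^esub> Y a n (insert i I) v)"
    and locality: "\<And>p q a b. a \<in> gr V p \<Longrightarrow> b \<in> gr V q \<Longrightarrow>
        \<exists>r. \<forall>I\<subseteq>{1..N}. \<forall>K\<subseteq>{1..N}. \<forall>v\<in>carrier V. \<forall>m k.
          (mul_zw V ^^ r) (\<lambda>m k. (-1) ^ (card K * (p + card I)) \<odot>\<^bsub>V\<^esub>
             scomm V (p + card I) (q + card K) (Y a m I) (Y b k K) v) m k = \<zero>\<^bsub>V\<^esub>"

end

theory Submission
  imports Defs
begin

text \<open>
  Since \<open>S\<^sup>ia \<otimes> W\<^bsup>n|I\<^esup>\<close> is, up to sign, \<open>- a \<otimes> W\<^bsup>n|I - {i}\<^esup>\<close> modulo the relations for \<open>i \<in> I\<close>, the Lie superalgebra is spanned by the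
  modes \<open>a\<^sub>n\<close> with full odd index \<open>{1, \<dots>, N}\<close>. Their brackets
  \<open>[a\<^sub>m, b\<^sub>n] = (\<Sum>j. (m choose j) (a\<^bsub>(j|N)\<^esub> b)\<^bsub>m+n-j\<^esub>)\<close> make the fields \<open>a(z) = (\<Sum>n. z\<^bsup>-1-n\<^esup> a\<^sub>n)\<close> mutually local, and
  \<open>V\<close> is spanned by the vectors obtained from the vacuum by the operators \<open>a\<^bsub>-1\<^esub>\<close>. As in the theory of ordinary vertex
  algebras, Dong's lemma and Goddard's uniqueness produce from these fields a field \<open>y(v, z)\<close> for every state \<open>v\<close>. The
  superfield is then forced by \<open>[S\<^sup>i, Y(v, Z)] = \<partial>\<^bsub>\<theta>\<^sup>i\<^esub> Y(v, Z)\<close> to be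
  \<open>Y(v, Z) = (\<Sum>I. \<plusminus> \<theta>\<^sup>I y(S\<^sup>I v, z))\<close>.
\<close>

section \<open>Fields and locality\<close>

text \<open>Two obstacles shape the development. The odd variables would burden locality with signs
  at every step. They are confined to the two ends: to the proof that the bracket respects the
  relations of L(R), where all the signs \<sigma> occur, and to the final assembly of superfields.
  In between there are fields in z alone, with S^i acting as odd derivations. The other obstacle is
  that V is a quotient of a quotient of a free algebra over a quotient of loops, and that a word has
  a parity only modulo the enveloping relations, as letters may be inhomogeneous. Koszul signs are
  therefore traded for the automorphism \<open>tau\<close> of the free algebra induced by the parity
  involution of letters. Derivations are twisted by it, each ideal is shown to be stable under it,
  and division by 2 recovers the grading of the quotients. The field calculus takes place in a
  linear complement of the left ideal inside the free algebra, where states are elements of a type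
  with class operations; the result is carried back to V at the end.\<close>

definition sg :: "nat \<Rightarrow> 'a::ab_group_add \<Rightarrow> 'a" where
  "sg p x = (if even p then x else - x)"

lemma sg_0 [simp]: "sg p 0 = 0" and sg_zero [simp]: "sg 0 x = x" and sg_Suc: "sg (Suc p) x = - sg p x"
  and sg_add: "sg p (x + y) = sg p x + sg p y" and sg_minus: "sg p (- x) = - sg p x"
  and sg_diff: "sg p (x - y) = sg p x - sg p y" and sg_sg: "sg p (sg q x) = sg (p + q) x"
  by (auto simp: sg_def)

lemma sg_eq_0_iff [simp]: "sg p x = 0 \<longleftrightarrow> x = 0"
  by (auto simp: sg_def)

lemma sg_involutive [simp]: "sg p (sg p x) = x"
  by (auto simp: sg_def)

lemma sg_sum: "sg p (sum f A) = (\<Sum>x\<in>A. sg p (f x))"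
  by (simp add: sg_def sum_negf)

lemma additive_sg: "additive f \<Longrightarrow> f (sg p x) = sg p (f x)"
  by (auto simp: sg_def additive.minus)

lemma additive_sg_self: "additive (sg p)"
  by (simp add: additive_def sg_add)

lemma Sum_any_sg: "Sum_any (\<lambda>x. sg p (f x)) = sg p (Sum_any f)"
  by (simp add: Sum_any.expand_set sg_sum)

lemma finite_nat_support: "finite {j::nat. f j \<noteq> 0}" if "\<And>j. j \<ge> M \<Longrightarrow> f j = 0"
proof (rule finite_subset)
  show "{j. f j \<noteq> 0} \<subseteq> {..<M}" using that not_le by blast
qed simp

lemma Sum_any_lessThan:
  fixes f :: "nat \<Rightarrow> 'a::comm_monoid_add"
  assumes "\<And>j. j \<ge> M \<Longrightarrow> f j = 0"
  shows "Sum_any f = sum f {..<M}"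
proof (rule Sum_any.expand_superset)
  show "{a. f a \<noteq> 0} \<subseteq> {..<M}" using assms not_le by blast
qed simp

lemma additive_Sum_any:
  assumes "additive f" "finite {x. g x \<noteq> 0}"
  shows "f (Sum_any g) = Sum_any (\<lambda>x. f (g x))"
proof -
  have "Sum_any (\<lambda>x. f (g x)) = sum (\<lambda>x. f (g x)) {x. g x \<noteq> 0}"
    by (rule Sum_any.expand_superset) (use assms in \<open>auto simp: additive.zero\<close>)
  then show ?thesis
    by (simp add: Sum_any.expand_set additive.sum[OF assms(1)])
qed

text \<open>Multiplication by z - w of a two-variable formal distribution given by its modes. As
  index n stands for z^(-1-n), a factor z raises the index by one.\<close>

definition zw :: "(int \<Rightarrow> int \<Rightarrow> 'v::ab_group_add) \<Rightarrow> int \<Rightarrow> int \<Rightarrow> 'v" where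
  "zw X m n = X (m + 1) n - X m (n + 1)"

section \<open>Formal distributions in three variables z, w, u\<close>

type_synonym 'v arr = "int \<Rightarrow> int \<Rightarrow> int \<Rightarrow> 'v"

text \<open>In \<open>X m n l\<close> the indices are modes in z, w and u; the three operators
  multiply by z - w, z - u and w - u.\<close>

definition zw3 :: "'v::ab_group_add arr \<Rightarrow> 'v arr" where
  "zw3 X m n l = X (m + 1) n l - X m (n + 1) l"
definition zu3 :: "'v::ab_group_add arr \<Rightarrow> 'v arr" where
  "zu3 X m n l = X (m + 1) n l - X m n (l + 1)"
definition wu3 :: "'v::ab_group_add arr \<Rightarrow> 'v arr" where
  "wu3 X m n l = X m (n + 1) l - X m n (l + 1)"

lemmas arr_defs = zw3_def zu3_def wu3_def

lemma zw_pow_lin: "additive f \<Longrightarrow> (zw ^^ r) (\<lambda>m n. f (X m n)) = (\<lambda>m n. f ((zw ^^ r) X m n))"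
  by (induction r) (auto simp: zw_def fun_eq_iff additive.diff)

lemma zw_pow_add: "(zw ^^ r) (\<lambda>m n. X m n + Y m n) = (\<lambda>m n. (zw ^^ r) X m n + (zw ^^ r) Y m n)"
  by (induction r) (auto simp: zw_def fun_eq_iff)

lemma zw_pow_zero [simp]: "(zw ^^ r) (\<lambda>m n. 0) = (\<lambda>m n. 0)"
  by (induction r) (auto simp: zw_def fun_eq_iff)

lemma zw_pow_mono:
  assumes "r \<le> s" "(zw ^^ r) X = (\<lambda>m n. 0)"
  shows "(zw ^^ s) X = (\<lambda>m n. 0)"
proof -
  have "zw ^^ s = zw ^^ (s - r) \<circ> zw ^^ r"
    using assms(1) by (simp flip: funpow_add)
  then show ?thesis using assms(2) by (metis comp_apply zw_pow_zero)
qed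

lemma zw3_comm: "zw3 (zu3 X) = zu3 (zw3 X)" "zw3 (wu3 X) = wu3 (zw3 X)" "zu3 (wu3 X) = wu3 (zu3 X)"
  by (auto simp: arr_defs fun_eq_iff algebra_simps)

text \<open>Multiplication by (z - w)^i (z - u)^j (w - u)^k. The factors commute, so a product that
  vanishes still vanishes when exponents grow.\<close>

definition D3 :: "nat \<Rightarrow> nat \<Rightarrow> nat \<Rightarrow> 'v::ab_group_add arr \<Rightarrow> 'v arr" where
  "D3 i j k X = (zw3 ^^ i) ((zu3 ^^ j) ((wu3 ^^ k) X))"

lemma D3_0 [simp]: "D3 0 0 0 X = X"
  by (simp add: D3_def)

lemma D3_zw3: "zw3 (D3 i j k X) = D3 (Suc i) j k X"
  by (simp add: D3_def)

lemma D3_zu3: "zu3 (D3 i j k X) = D3 i (Suc j) k X"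
proof -
  have "zu3 ((zw3 ^^ i) Y) = (zw3 ^^ i) (zu3 Y)" for Y :: "'a arr"
    by (induction i) (simp_all add: zw3_comm[symmetric])
  then show ?thesis by (simp add: D3_def)
qed

lemma D3_wu3: "wu3 (D3 i j k X) = D3 i j (Suc k) X"
proof -
  have 1: "wu3 ((zw3 ^^ i) Y) = (zw3 ^^ i) (wu3 Y)" for Y :: "'a arr"
    by (induction i) (simp_all add: zw3_comm[symmetric])
  have 2: "wu3 ((zu3 ^^ i) Y) = (zu3 ^^ i) (wu3 Y)" for i and Y :: "'a arr"
    by (induction i) (simp_all add: zw3_comm(3)[symmetric])
  show ?thesis by (simp add: D3_def 1 2)
qed

lemma D3_lin:
  assumes "additive f"
  shows "D3 i j k (\<lambda>m n l. f (X m n l)) = (\<lambda>m n l. f (D3 i j k X m n l))"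
proof -
  have 1: "(wu3 ^^ k) (\<lambda>m n l. f (X m n l)) = (\<lambda>m n l. f ((wu3 ^^ k) X m n l))" for X
    by (induction k) (auto simp: fun_eq_iff arr_defs additive.diff[OF assms])
  have 2: "(zu3 ^^ k) (\<lambda>m n l. f (X m n l)) = (\<lambda>m n l. f ((zu3 ^^ k) X m n l))" for X k
    by (induction k) (auto simp: fun_eq_iff arr_defs additive.diff[OF assms])
  have 3: "(zw3 ^^ k) (\<lambda>m n l. f (X m n l)) = (\<lambda>m n l. f ((zw3 ^^ k) X m n l))" for X k
    by (induction k) (auto simp: fun_eq_iff arr_defs additive.diff[OF assms])
  show ?thesis by (simp add: D3_def 1 2 3)
qed

lemma D3_diff: "D3 i j k (\<lambda>m n l. X m n l - Y m n l) = (\<lambda>m n l. D3 i j k X m n l - D3 i j k Y m n l)"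
proof -
  have 1: "(wu3 ^^ k) (\<lambda>m n l. X m n l - Y m n l) = (\<lambda>m n l. (wu3 ^^ k) X m n l - (wu3 ^^ k) Y m n l)" for X Y :: "'a arr"
    by (induction k) (auto simp: fun_eq_iff arr_defs)
  have 2: "(zu3 ^^ k) (\<lambda>m n l. X m n l - Y m n l) = (\<lambda>m n l. (zu3 ^^ k) X m n l - (zu3 ^^ k) Y m n l)" for X Y :: "'a arr" and k
    by (induction k) (auto simp: fun_eq_iff arr_defs)
  have 3: "(zw3 ^^ k) (\<lambda>m n l. X m n l - Y m n l) = (\<lambda>m n l. (zw3 ^^ k) X m n l - (zw3 ^^ k) Y m n l)" for X Y :: "'a arr" and k
    by (induction k) (auto simp: fun_eq_iff arr_defs)
  show ?thesis by (simp add: D3_def 1 2 3)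
qed

lemma D3_zero [simp]: "D3 i j k (\<lambda>m n l. 0) = (\<lambda>m n l. 0)"
  using D3_diff[of i j k "\<lambda>m n l. 0" "\<lambda>m n l. 0"] by simp

lemma D3_add: "D3 (i + i') (j + j') (k + k') X = D3 i j k (D3 i' j' k' X)"
proof -
  have "(wu3 ^^ k) (D3 i' j' k' X) = D3 i' j' (k + k') X"
    by (induction k) (auto simp: D3_wu3)
  then have "D3 i j k (D3 i' j' k' X) = (zw3 ^^ i) ((zu3 ^^ j) (D3 i' j' (k + k') X))"
    by (simp add: D3_def[of i j k])
  also have "(zu3 ^^ j) (D3 i' j' (k + k') X) = D3 i' (j + j') (k + k') X"
    by (induction j) (auto simp: D3_zu3)
  also have "(zw3 ^^ i) (D3 i' (j + j') (k + k') X) = D3 (i + i') (j + j') (k + k') X"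
    by (induction i) (auto simp: D3_zw3)
  finally show ?thesis by simp
qed

lemma D3_vanish:
  assumes "D3 i j k X = (\<lambda>m n l. 0)" "i \<le> i'" "j \<le> j'" "k \<le> k'"
  shows "D3 i' j' k' X = (\<lambda>m n l. 0)"
  using D3_add[of "i' - i" i "j' - j" j "k' - k" k X] assms by simp

text \<open>The bound depends on the mode in u alone. The residues below sum along lines with m + n
  constant, where both indices move, and this uniformity makes the sums finite.\<close>

definition trunc_w :: "'v::zero arr \<Rightarrow> bool" where
  "trunc_w X \<longleftrightarrow> (\<forall>l. \<exists>M. \<forall>m n. n \<ge> M \<longrightarrow> X m n l = 0)"
definition trunc_z :: "'v::zero arr \<Rightarrow> bool" where
  "trunc_z X \<longleftrightarrow> (\<forall>l. \<exists>M. \<forall>m n. m \<ge> M \<longrightarrow> X m n l = 0)"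

lemma trunc_w2:
  assumes "trunc_w X"
  obtains M where "\<forall>m n. n \<ge> M \<longrightarrow> X m n l = 0 \<and> X m n (l + 1) = 0"
proof -
  obtain M1 where M1: "\<forall>m n. n \<ge> M1 \<longrightarrow> X m n l = 0" using assms unfolding trunc_w_def by blast
  obtain M2 where M2: "\<forall>m n. n \<ge> M2 \<longrightarrow> X m n (l + 1) = 0" using assms unfolding trunc_w_def by blast
  show thesis by (rule that[of "max M1 M2"]) (use M1 M2 in auto)
qed

lemma trunc_z2:
  assumes "trunc_z X"
  obtains M where "\<forall>m n. m \<ge> M \<longrightarrow> X m n l = 0 \<and> X m n (l + 1) = 0"
proof -
  obtain M1 where M1: "\<forall>m n. m \<ge> M1 \<longrightarrow> X m n l = 0" using assms unfolding trunc_z_def by blast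
  obtain M2 where M2: "\<forall>m n. m \<ge> M2 \<longrightarrow> X m n (l + 1) = 0" using assms unfolding trunc_z_def by blast
  show thesis by (rule that[of "max M1 M2"]) (use M1 M2 in auto)
qed

lemma trunc_w_step: "trunc_w X \<Longrightarrow> trunc_w (zw3 X)" "trunc_w X \<Longrightarrow> trunc_w (zu3 X)" "trunc_w X \<Longrightarrow> trunc_w (wu3 X)"
proof -
  assume X: "trunc_w X"
  have "\<exists>M. \<forall>m n. n \<ge> M \<longrightarrow> zw3 X m n l = 0 \<and> zu3 X m n l = 0 \<and> wu3 X m n l = 0" for l
  proof -
    obtain M where "\<forall>m n. n \<ge> M \<longrightarrow> X m n l = 0 \<and> X m n (l + 1) = 0" by (rule trunc_w2[OF X])
    then show ?thesis by (intro exI[of _ M]) (auto simp: arr_defs)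
  qed
  then show "trunc_w (zw3 X)" "trunc_w (zu3 X)" "trunc_w (wu3 X)"
    unfolding trunc_w_def by meson+
qed

lemma trunc_z_step: "trunc_z X \<Longrightarrow> trunc_z (zw3 X)" "trunc_z X \<Longrightarrow> trunc_z (zu3 X)" "trunc_z X \<Longrightarrow> trunc_z (wu3 X)"
proof -
  assume X: "trunc_z X"
  have "\<exists>M. \<forall>m n. m \<ge> M \<longrightarrow> zw3 X m n l = 0 \<and> zu3 X m n l = 0 \<and> wu3 X m n l = 0" for l
  proof -
    obtain M where "\<forall>m n. m \<ge> M \<longrightarrow> X m n l = 0 \<and> X m n (l + 1) = 0" by (rule trunc_z2[OF X])
    then show ?thesis by (intro exI[of _ M]) (auto simp: arr_defs)
  qed
  then show "trunc_z (zw3 X)" "trunc_z (zu3 X)" "trunc_z (wu3 X)"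
    unfolding trunc_z_def by meson+
qed

lemma trunc_D3: "trunc_w X \<Longrightarrow> trunc_w (D3 i j k X)" "trunc_z X \<Longrightarrow> trunc_z (D3 i j k X)"
proof -
  assume X: "trunc_w X"
  have 1: "trunc_w ((wu3 ^^ k) X)" using X by (induction k) (auto intro: trunc_w_step)
  have 2: "trunc_w ((zu3 ^^ j) ((wu3 ^^ k) X))" using 1 by (induction j) (auto intro: trunc_w_step)
  show "trunc_w (D3 i j k X)" unfolding D3_def using 2 by (induction i) (auto intro: trunc_w_step)
next
  assume X: "trunc_z X"
  have 1: "trunc_z ((wu3 ^^ k) X)" using X by (induction k) (auto intro: trunc_z_step)
  have 2: "trunc_z ((zu3 ^^ j) ((wu3 ^^ k) X))" using 1 by (induction j) (auto intro: trunc_z_step)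
  show "trunc_z (D3 i j k X)" unfolding D3_def using 2 by (induction i) (auto intro: trunc_z_step)
qed

text \<open>\<open>Res\<^sub>z\<close> of the product with \<open>1 / (z - w)\<close>, expanded in \<open>|z| > |w|\<close> and, up to sign, in \<open>|z| < |w|\<close>\<close>

definition resE :: "'v::comm_monoid_add arr \<Rightarrow> int \<Rightarrow> int \<Rightarrow> 'v" where
  "resE X n l = Sum_any (\<lambda>j::nat. X (- 1 - int j) (n + int j) l)"
definition resE' :: "'v::comm_monoid_add arr \<Rightarrow> int \<Rightarrow> int \<Rightarrow> 'v" where
  "resE' X n l = Sum_any (\<lambda>j::nat. X (int j) (n - 1 - int j) l)"

lemma resE_eq:
  assumes "\<forall>m n. n \<ge> M \<longrightarrow> X m n l = 0" "nat (M - n) \<le> k"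
  shows "resE X n l = (\<Sum>j<k. X (- 1 - int j) (n + int j) l)"
  unfolding resE_def by (rule Sum_any_lessThan) (use assms in auto)

lemma resE'_eq:
  assumes "\<forall>m n. m \<ge> M \<longrightarrow> X m n l = 0" "nat M \<le> k"
  shows "resE' X n l = (\<Sum>j<k. X (int j) (n - 1 - int j) l)"
  unfolding resE'_def by (rule Sum_any_lessThan) (use assms in auto)

text \<open>The factor z - w cancels the kernel 1 / (z - w), so only the plain residue in z, mode 0,
  remains; on modes the sum telescopes and its far end is truncated.\<close>

lemma resE_zw3:
  assumes "trunc_w X" shows "resE (zw3 X) n l = X 0 n l"
proof -
  obtain M where M: "\<forall>m n. n \<ge> M \<longrightarrow> X m n l = 0" using assms unfolding trunc_w_def by blast
  define k where "k = nat (M - n)"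
  have "resE (zw3 X) n l = (\<Sum>j<k. zw3 X (- 1 - int j) (n + int j) l)"
    by (rule resE_eq[where M = M]) (use M in \<open>auto simp: arr_defs k_def\<close>)
  also have "(\<Sum>j<k. zw3 X (- 1 - int j) (n + int j) l) = X 0 n l - X (- int k) (n + int k) l" for k
    by (induction k) (auto simp: zw3_def algebra_simps)
  also have "X (- int k) (n + int k) l = 0" using M by (auto simp: k_def)
  finally show ?thesis by simp
qed

text \<open>The sign is opposite to that in \<open>resE_zw3\<close> because \<open>resE'\<close>
  drops the sign of the expansion of 1 / (z - w) in |z| < |w|. In a normally ordered product the two
  mode 0 terms thus cancel once A and B commute up to sign.\<close>

lemma resE'_zw3:
  assumes "trunc_z X" shows "resE' (zw3 X) n l = - X 0 n l"
proof -
  obtain M where M: "\<forall>m n. m \<ge> M \<longrightarrow> X m n l = 0" using assms unfolding trunc_z_def by blast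
  define k where "k = nat M"
  have "resE' (zw3 X) n l = (\<Sum>j<k. zw3 X (int j) (n - 1 - int j) l)"
    by (rule resE'_eq[where M = M]) (use M in \<open>auto simp: arr_defs k_def\<close>)
  also have "(\<Sum>j<k. zw3 X (int j) (n - 1 - int j) l) = X (int k) (n - int k) l - X 0 n l" for k
    by (induction k) (auto simp: zw3_def algebra_simps)
  also have "X (int k) (n - int k) l = 0" using M by (auto simp: k_def)
  finally show ?thesis by simp
qed

text \<open>The residue concerns z only, so a factor w - u passes through it.\<close>

lemma resE_zw:
  assumes "trunc_w X" shows "zw (resE X) = resE (wu3 X)"
proof (intro ext)
  fix n l
  obtain M where M: "\<forall>m n. n \<ge> M \<longrightarrow> X m n l = 0 \<and> X m n (l + 1) = 0" by (rule trunc_w2[OF assms])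
  define k where "k = nat (M - n)"
  have "resE X (n + 1) l = (\<Sum>j<k. X (- 1 - int j) (n + 1 + int j) l)"
    "resE X n (l + 1) = (\<Sum>j<k. X (- 1 - int j) (n + int j) (l + 1))"
    "resE (wu3 X) n l = (\<Sum>j<k. wu3 X (- 1 - int j) (n + int j) l)"
    by (rule resE_eq[where M = M]; use M in \<open>auto simp: arr_defs k_def\<close>)+
  then show "zw (resE X) n l = resE (wu3 X) n l"
    by (simp add: zw_def wu3_def sum_subtractf algebra_simps)
qed

lemma resE'_zw:
  assumes "trunc_z X" shows "zw (resE' X) = resE' (wu3 X)"
proof (intro ext)
  fix n l
  obtain M where M: "\<forall>m n. m \<ge> M \<longrightarrow> X m n l = 0 \<and> X m n (l + 1) = 0" by (rule trunc_z2[OF assms])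
  define k where "k = nat M"
  have "resE' X (n + 1) l = (\<Sum>j<k. X (int j) (n + 1 - 1 - int j) l)"
    "resE' X n (l + 1) = (\<Sum>j<k. X (int j) (n - 1 - int j) (l + 1))"
    "resE' (wu3 X) n l = (\<Sum>j<k. wu3 X (int j) (n - 1 - int j) l)"
    by (rule resE'_eq[where M = M]; use M in \<open>auto simp: arr_defs k_def\<close>)+
  then show "zw (resE' X) n l = resE' (wu3 X) n l"
    by (simp add: zw_def wu3_def sum_subtractf algebra_simps)
qed

lemma resE_diff:
  fixes X Y :: "'v::ab_group_add arr"
  assumes "trunc_w X" "trunc_w Y"
  shows "resE (\<lambda>m n l. X m n l - Y m n l) = (\<lambda>n l. resE X n l - resE Y n l)"
proof (intro ext)
  fix n l
  obtain M1 where M1: "\<forall>m n. n \<ge> M1 \<longrightarrow> X m n l = 0" using assms(1) unfolding trunc_w_def by blast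
  obtain M2 where M2: "\<forall>m n. n \<ge> M2 \<longrightarrow> Y m n l = 0" using assms(2) unfolding trunc_w_def by blast
  define M k where "M = max M1 M2" and "k = nat (M - n)"
  have "resE X n l = (\<Sum>j<k. X (- 1 - int j) (n + int j) l)"
    "resE Y n l = (\<Sum>j<k. Y (- 1 - int j) (n + int j) l)"
    "resE (\<lambda>m n l. X m n l - Y m n l) n l = (\<Sum>j<k. X (- 1 - int j) (n + int j) l - Y (- 1 - int j) (n + int j) l)"
    by (rule resE_eq[where M = M]; use M1 M2 in \<open>auto simp: M_def k_def\<close>)+
  then show "resE (\<lambda>m n l. X m n l - Y m n l) n l = resE X n l - resE Y n l"
    by (simp add: sum_subtractf)
qed

lemma resE'_diff:
  fixes X Y :: "'v::ab_group_add arr"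
  assumes "trunc_z X" "trunc_z Y"
  shows "resE' (\<lambda>m n l. X m n l - Y m n l) = (\<lambda>n l. resE' X n l - resE' Y n l)"
proof (intro ext)
  fix n l
  obtain M1 where M1: "\<forall>m n. m \<ge> M1 \<longrightarrow> X m n l = 0" using assms(1) unfolding trunc_z_def by blast
  obtain M2 where M2: "\<forall>m n. m \<ge> M2 \<longrightarrow> Y m n l = 0" using assms(2) unfolding trunc_z_def by blast
  define M k where "M = max M1 M2" and "k = nat M"
  have "resE' X n l = (\<Sum>j<k. X (int j) (n - 1 - int j) l)"
    "resE' Y n l = (\<Sum>j<k. Y (int j) (n - 1 - int j) l)"
    "resE' (\<lambda>m n l. X m n l - Y m n l) n l = (\<Sum>j<k. X (int j) (n - 1 - int j) l - Y (int j) (n - 1 - int j) l)"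
    by (rule resE'_eq[where M = M]; use M1 M2 in \<open>auto simp: M_def k_def\<close>)+
  then show "resE' (\<lambda>m n l. X m n l - Y m n l) n l = resE' X n l - resE' Y n l"
    by (simp add: sum_subtractf)
qed

text \<open>With P, Q, P', Q' the arrays of ABC, BAC, CAB and CBA this is the supercommutator of the
  normally ordered product of A and B at w with C at u; e is the sign exponent of A against B, and
  e' that of the product against C.\<close>

definition phi3 :: "nat \<Rightarrow> nat \<Rightarrow> 'v::ab_group_add arr \<Rightarrow> 'v arr \<Rightarrow> 'v arr \<Rightarrow> 'v arr \<Rightarrow> int \<Rightarrow> int \<Rightarrow> 'v" where
  "phi3 e e' P Q P' Q' n l =
     (resE P n l + sg e (resE' Q n l)) - sg e' (resE P' n l + sg e (resE' Q' n l))"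

lemma phi3_zw:
  assumes "trunc_w P" "trunc_w P'" "trunc_z Q" "trunc_z Q'"
  shows "zw (phi3 e e' P Q P' Q') = phi3 e e' (wu3 P) (wu3 Q) (wu3 P') (wu3 Q')"
  unfolding fun_eq_iff phi3_def resE_zw[OF assms(1), symmetric] resE_zw[OF assms(2), symmetric]
    resE'_zw[OF assms(3), symmetric] resE'_zw[OF assms(4), symmetric] zw_def phi3_def
  by (simp add: sg_add sg_diff)

text \<open>
  \<open>w - u = (z - u) - (z - w)\<close>, so powers of \<open>w - u\<close> spread over those of \<open>z - u\<close> and \<open>z - w\<close>; as soon as
  either of the two is large enough, locality applies inside the residue.
\<close>

lemma dong_arrays:
  assumes P: "trunc_w P" and P': "trunc_w P'" and Q: "trunc_z Q" and Q': "trunc_z Q'"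
    and PQ: "D3 r 0 0 (\<lambda>m n l. P m n l - sg e (Q m n l)) = (\<lambda>m n l. 0)"
    and PQ': "D3 r 0 0 (\<lambda>m n l. P' m n l - sg e (Q' m n l)) = (\<lambda>m n l. 0)"
    and PP': "D3 0 r r (\<lambda>m n l. P m n l - sg e' (P' m n l)) = (\<lambda>m n l. 0)"
    and QQ': "D3 0 r r (\<lambda>m n l. Q m n l - sg e' (Q' m n l)) = (\<lambda>m n l. 0)"
  shows "(zw ^^ (3 * r + 1)) (phi3 e e' P Q P' Q') = (\<lambda>n l. 0)"
proof -
  \<comment> \<open>\<open>F i j k\<close> is the commutator with (z - w)^i (z - u)^j (w - u)^k
    inserted under the residue.\<close>
  define F where "F i j k = phi3 e e' (D3 i j k P) (D3 i j k Q) (D3 i j k P') (D3 i j k Q')" for i j k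
  note tr = trunc_D3(1)[OF P] trunc_D3(1)[OF P'] trunc_D3(2)[OF Q] trunc_D3(2)[OF Q']
  have zwF: "zw (F i j k) = F i j (Suc k)" for i j k
    unfolding F_def by (subst phi3_zw[OF tr]) (simp add: D3_wu3)
  have split: "D3 i j (Suc k) X m n l = D3 i (Suc j) k X m n l - D3 (Suc i) j k X m n l" for i j k m n l and X :: "'a arr"
    unfolding D3_wu3[symmetric] D3_zu3[symmetric] D3_zw3[symmetric] by (simp add: arr_defs)
  have splitF: "F i j (Suc k) = (\<lambda>n l. F i (Suc j) k n l - F (Suc i) j k n l)" for i j k
    unfolding F_def fun_eq_iff phi3_def split[abs_def]
    by (simp add: resE_diff[OF tr(1) tr(1)] resE_diff[OF tr(2) tr(2)] resE'_diff[OF tr(3) tr(3)]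
        resE'_diff[OF tr(4) tr(4)] sg_add sg_diff algebra_simps)
  \<comment> \<open>Either j >= r, and C can be moved past A and B under the residue; or i > r, and
    one factor z - w cancels the kernel while r others identify ABC with BAC and CAB with CBA up to
    sign.\<close>
  have base: "F i j r = (\<lambda>n l. 0)" if ij: "i + j \<ge> 2 * r + 1" for i j
  proof (cases "j \<ge> r")
    case True
    have 1: "D3 i j r P m n l = sg e' (D3 i j r P' m n l)" for m n l
      using D3_vanish[OF PP', of i j r] True
      by (simp add: D3_diff D3_lin[OF additive_sg_self] fun_eq_iff)
    have 2: "D3 i j r Q m n l = sg e' (D3 i j r Q' m n l)" for m n l
      using D3_vanish[OF QQ', of i j r] True
      by (simp add: D3_diff D3_lin[OF additive_sg_self] fun_eq_iff)
    have "resE (D3 i j r P) n l = sg e' (resE (D3 i j r P') n l)"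
      "resE' (D3 i j r Q) n l = sg e' (resE' (D3 i j r Q') n l)" for n l
      using 1 2 by (simp_all add: resE_def resE'_def Sum_any_sg)
    then show ?thesis by (simp add: F_def phi3_def fun_eq_iff sg_add sg_sg add.commute)
  next
    case False
    then obtain i' where i: "i = Suc i'" and i': "i' \<ge> r" using ij by (cases i) auto
    have 1: "D3 i' j r P m n l = sg e (D3 i' j r Q m n l)" for m n l
      using D3_vanish[OF PQ, of i' j r] i'
      by (simp add: D3_diff D3_lin[OF additive_sg_self] fun_eq_iff)
    have 2: "D3 i' j r P' m n l = sg e (D3 i' j r Q' m n l)" for m n l
      using D3_vanish[OF PQ', of i' j r] i'
      by (simp add: D3_diff D3_lin[OF additive_sg_self] fun_eq_iff)
    show ?thesis unfolding F_def i D3_zw3[symmetric] phi3_def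
      by (simp add: resE_zw3[OF tr(1)] resE_zw3[OF tr(2)] resE'_zw3[OF tr(3)] resE'_zw3[OF tr(4)] 1 2 sg_minus)
  qed
  have spread: "F i j (r + k) = (\<lambda>n l. 0)" if "i + j + k \<ge> 2 * r + 1" for i j k
    using that
  proof (induction k arbitrary: i j)
    case (Suc k)
    then show ?case using splitF[of i j "r + k"] Suc.IH[of i "Suc j"] Suc.IH[of "Suc i" j] by simp
  qed (use base in simp)
  have "(zw ^^ k) (F 0 0 0) = F 0 0 k" for k
    by (induction k) (simp_all add: zwF)
  \<comment> \<open>Of the 3r + 1 factors w - u, r stay in place for the locality of B and C; the
    other 2r + 1 are spread until one of the two cases of \<open>base\<close> applies.\<close>
  from this[of "3 * r + 1"] have "(zw ^^ (3 * r + 1)) (F 0 0 0) = F 0 0 (r + (2 * r + 1))"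
    by (simp only: mult.commute[of 3] numeral_3_eq_3 mult_Suc mult_2 add.assoc) (simp add: mult.commute)
  then show ?thesis using spread[of 0 0 "2 * r + 1"] by (simp add: F_def)
qed

section \<open>Mutual locality and normally ordered products\<close>

type_synonym 'v field = "int \<Rightarrow> 'v \<Rightarrow> 'v"

text \<open>Modes are indexed as in \<open>A(z) = (\<Sum>n. z\<^bsup>-1-n\<^esup> A\<^sub>n)\<close>; the sign is that of parities with \<open>e = p(A) p(B)\<close>.\<close>

definition mutually_local :: "nat \<Rightarrow> nat \<Rightarrow> 'v::ab_group_add field \<Rightarrow> 'v field \<Rightarrow> bool" where
  "mutually_local e r A B \<longleftrightarrow>
     (\<forall>v. (zw ^^ r) (\<lambda>m n. A m (B n v) - sg e (B n (A m v))) = (\<lambda>m n. 0))"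

definition is_field :: "'v::zero field \<Rightarrow> bool" where
  "is_field A \<longleftrightarrow> (\<forall>v. \<exists>M. \<forall>n\<ge>M. A n v = 0)"

text \<open>The modes of the normally ordered product : A(w) B(w) :, with the creation modes of A to
  the left. For fields both sums have finite support (\<open>nop_finite\<close>), so that
  \<open>Sum_any\<close> has its intended value.\<close>

definition nop :: "nat \<Rightarrow> 'v::ab_group_add field \<Rightarrow> 'v field \<Rightarrow> 'v field" where
  "nop e A B n v = Sum_any (\<lambda>j::nat. A (- 1 - int j) (B (n + int j) v)) +
     sg e (Sum_any (\<lambda>j::nat. B (n - 1 - int j) (A (int j) v)))"

lemma mutually_local_mono: "mutually_local e r A B \<Longrightarrow> r \<le> s \<Longrightarrow> mutually_local e s A B"
  unfolding mutually_local_def by (blast intro: zw_pow_mono)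

lemma mutually_local_cong: "mutually_local e r A B \<Longrightarrow> even e = even e' \<Longrightarrow> mutually_local e' r A B"
  unfolding mutually_local_def by (simp add: sg_def)

lemma D3_zw: "D3 r 0 0 X m n l = (zw ^^ r) (\<lambda>m n. X m n l) m n"
  "D3 0 r 0 X m n l = (zw ^^ r) (\<lambda>m l. X m n l) m l"
  "D3 0 0 r X m n l = (zw ^^ r) (\<lambda>n l. X m n l) n l"
  by (induction r arbitrary: m n l) (auto simp: D3_def zw_def arr_defs)

lemma nop_finite:
  assumes "is_field A" "is_field B" "\<And>n. additive (A n)" "\<And>n. additive (B n)"
  shows "finite {j::nat. A (- 1 - int j) (B (n + int j) v) \<noteq> 0}"
    "finite {j::nat. B (n - 1 - int j) (A (int j) v) \<noteq> 0}"
proof -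
  obtain M where M: "\<And>n. n \<ge> M \<Longrightarrow> B n v = 0" using assms(2) by (auto simp: is_field_def)
  show "finite {j::nat. A (- 1 - int j) (B (n + int j) v) \<noteq> 0}"
    by (rule finite_nat_support[of "nat (M - n)"])
      (simp add: M additive.zero[OF assms(3)])
  obtain M where M: "\<And>n. n \<ge> M \<Longrightarrow> A n v = 0" using assms(1) by (auto simp: is_field_def)
  show "finite {j::nat. B (n - 1 - int j) (A (int j) v) \<noteq> 0}"
    by (rule finite_nat_support[of "nat M"])
      (simp add: M additive.zero[OF assms(4)])
qed

text \<open>The three orders of locality are raised to a common r, and \<open>dong_arrays\<close>
  yields the order 3r + 1 for the product.\<close>

theorem dong:
  assumes add: "\<And>n. additive (A n)" "\<And>n. additive (B n)" "\<And>n. additive (C n)"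
    and fld: "is_field A" "is_field B"
    and AB: "mutually_local e r1 A B" and AC: "mutually_local f r2 A C" and BC: "mutually_local g r3 B C"
  shows "\<exists>r. mutually_local (f + g) r (nop e A B) C"
proof -
  define r where "r = max r1 (max r2 r3)"
  have AB: "mutually_local e r A B" by (rule mutually_local_mono[OF AB]) (simp add: r_def)
  have AC: "mutually_local f r A C" by (rule mutually_local_mono[OF AC]) (simp add: r_def)
  have BC: "mutually_local g r B C" by (rule mutually_local_mono[OF BC]) (simp add: r_def)
  have zero: "A n 0 = 0" "B n 0 = 0" "C n 0 = 0" for n
    by (simp_all add: additive.zero add)
  have "(zw ^^ (3 * r + 1)) (\<lambda>m n. nop e A B m (C n v) - sg (f + g) (C n (nop e A B m v))) = (\<lambda>m n. 0)" for v
  proof -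
    define P where "P m n l = A m (B n (C l v))" for m n l
    define Q where "Q m n l = B n (A m (C l v))" for m n l
    define P' where "P' m n l = C l (A m (B n v))" for m n l
    define Q' where "Q' m n l = C l (B n (A m v))" for m n l
    \<comment> \<open>The orders A C B and B C A lie half-way: each move of C past B costs (w -
      u)^r, and each move past A costs (z - u)^r.\<close>
    define M where "M m n l = A m (C l (B n v))" for m n l
    define M' where "M' m n l = B n (C l (A m v))" for m n l
    have "(zw ^^ (3 * r + 1)) (phi3 e (f + g) P Q P' Q') = (\<lambda>n l. 0)"
    proof (rule dong_arrays)
      have bd: "\<exists>M. \<forall>n\<ge>M. A n u = 0" "\<exists>M. \<forall>n\<ge>M. B n u = 0" for u
        using fld by (simp_all add: is_field_def)
      show "trunc_w P" unfolding trunc_w_def P_def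
      proof
        fix l show "\<exists>M. \<forall>m n. M \<le> n \<longrightarrow> A m (B n (C l v)) = 0"
          using bd(2)[of "C l v"] zero by fastforce
      qed
      show "trunc_w P'" unfolding trunc_w_def P'_def
        using bd(2)[of v] zero by fastforce
      show "trunc_z Q" unfolding trunc_z_def Q_def
      proof
        fix l show "\<exists>M. \<forall>m n. M \<le> m \<longrightarrow> B n (A m (C l v)) = 0"
          using bd(1)[of "C l v"] zero by fastforce
      qed
      show "trunc_z Q'" unfolding trunc_z_def Q'_def
        using bd(1)[of v] zero by fastforce
      show "D3 r 0 0 (\<lambda>m n l. P m n l - sg e (Q m n l)) = (\<lambda>m n l. 0)"
        using AB by (simp add: fun_eq_iff D3_zw mutually_local_def P_def Q_def)
      have "P' m n l - sg e (Q' m n l) = C l (A m (B n v) - sg e (B n (A m v)))" for m n l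
        by (simp add: P'_def Q'_def additive.diff[OF add(3)] additive_sg[OF add(3)])
      then show "D3 r 0 0 (\<lambda>m n l. P' m n l - sg e (Q' m n l)) = (\<lambda>m n l. 0)"
        using AB by (simp add: fun_eq_iff D3_zw mutually_local_def zw_pow_lin[OF add(3)] zero)
      have 1: "D3 0 0 r (\<lambda>m n l. P m n l - sg g (M m n l)) = (\<lambda>m n l. 0)"
      proof -
        have "P m n l - sg g (M m n l) = A m (B n (C l v) - sg g (C l (B n v)))" for m n l
          by (simp add: P_def M_def additive.diff[OF add(1)] additive_sg[OF add(1)])
        then show ?thesis using BC by (simp add: fun_eq_iff D3_zw mutually_local_def zw_pow_lin[OF add(1)] zero)
      qed
      have 2: "D3 0 r 0 (\<lambda>m n l. M m n l - sg f (P' m n l)) = (\<lambda>m n l. 0)"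
        using AC by (simp add: fun_eq_iff D3_zw mutually_local_def M_def P'_def)
      have 3: "D3 0 r 0 (\<lambda>m n l. Q m n l - sg f (M' m n l)) = (\<lambda>m n l. 0)"
      proof -
        have "Q m n l - sg f (M' m n l) = B n (A m (C l v) - sg f (C l (A m v)))" for m n l
          by (simp add: Q_def M'_def additive.diff[OF add(2)] additive_sg[OF add(2)])
        then show ?thesis using AC by (simp add: fun_eq_iff D3_zw mutually_local_def zw_pow_lin[OF add(2)] zero)
      qed
      have 4: "D3 0 0 r (\<lambda>m n l. M' m n l - sg g (Q' m n l)) = (\<lambda>m n l. 0)"
        using BC by (simp add: fun_eq_iff D3_zw mutually_local_def M'_def Q'_def)
      note ex = D3_diff D3_lin[OF additive_sg_self] fun_eq_iff
      have le: "(0::nat) \<le> r" "r \<le> r" "(0::nat) \<le> 0" by auto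
      show "D3 0 r r (\<lambda>m n l. P m n l - sg (f + g) (P' m n l)) = (\<lambda>m n l. 0)"
        using D3_vanish[OF 1, of 0 r r] D3_vanish[OF 2, of 0 r r]
        by (simp add: ex sg_sg add.commute)
      show "D3 0 r r (\<lambda>m n l. Q m n l - sg (f + g) (Q' m n l)) = (\<lambda>m n l. 0)"
        using D3_vanish[OF 3, of 0 r r] D3_vanish[OF 4, of 0 r r]
        by (simp add: ex sg_sg add.commute)
    qed
    moreover have "phi3 e (f + g) P Q P' Q' = (\<lambda>m n. nop e A B m (C n v) - sg (f + g) (C n (nop e A B m v)))"
      unfolding fun_eq_iff phi3_def resE_def resE'_def nop_def P_def Q_def P'_def Q'_def
      by (simp add: additive.add[OF add(3)] additive_sg[OF add(3)]
          additive_Sum_any[OF add(3) nop_finite(1)[OF fld add(1,2)]]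
          additive_Sum_any[OF add(3) nop_finite(2)[OF fld add(1,2)]])
    ultimately show ?thesis by simp
  qed
  then show ?thesis unfolding mutually_local_def by blast
qed

section \<open>Reconstruction from generating fields\<close>

text \<open>An array annihilated by z - w is constant along lines with m + n fixed, and truncation
  in n makes it zero there; the power r is removed one factor at a time.\<close>

lemma zw_pow_inj:
  assumes "(zw ^^ r) X = (\<lambda>m n. 0)" "\<And>m n. n \<ge> M \<Longrightarrow> X m n = 0"
  shows "X m n = 0"
  using assms
proof (induction r arbitrary: X m n)
  case (Suc r)
  have tr: "zw X m n = 0" if "n \<ge> M" for m n
    using that Suc.prems(2) by (simp add: zw_def)
  have "(zw ^^ r) (zw X) = (\<lambda>m n. 0)" using Suc.prems(1) by (simp add: funpow_swap1)
  then have 0: "zw X m n = 0" for m n using Suc.IH tr by blast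
  have "X m n = X (m - int k) (n + int k)" for k
  proof (induction k)
    case (Suc k)
    then show ?case using 0[of "m - int k - 1" "n + int k"] by (simp add: zw_def algebra_simps)
  qed simp
  from this[of "nat (M - n)"] show ?case using Suc.prems(2)[of "n + int (nat (M - n))"] by simp
qed (auto simp: fun_eq_iff)

lemma zw_pow_swap: "(zw ^^ r) (\<lambda>m n. X n m) m n = sg r ((zw ^^ r) X n m)"
proof (induction r arbitrary: m n)
  case (Suc r)
  then show ?case by (simp add: zw_def sg_Suc sg_diff)
qed simp

text \<open>Exchanging z and w changes (z - w)^r only by a sign, and the supercommutator only by a
  sign and a swap of indices.\<close>

lemma mutually_local_sym:
  assumes "mutually_local e r A B" shows "mutually_local e r B A"
proof -
  have "(zw ^^ r) (\<lambda>m n. B m (A n v) - sg e (A n (B m v))) = (\<lambda>m n. 0)" for v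
  proof -
    have "(zw ^^ r) (\<lambda>m n. B m (A n v) - sg e (A n (B m v))) m n = 0" for m n
    proof -
      have *: "(\<lambda>m n. B m (A n v) - sg e (A n (B m v))) =
          (\<lambda>m n. (\<lambda>m n. - sg e (A m (B n v) - sg e (B n (A m v)))) n m)"
        by (auto simp: fun_eq_iff sg_diff)
      show ?thesis unfolding * zw_pow_swap[where X = "\<lambda>m n. - sg e (A m (B n v) - sg e (B n (A m v)))"]
        using assms zw_pow_lin[of "\<lambda>x. - sg e x" r "\<lambda>m n. A m (B n v) - sg e (B n (A m v))"]
        by (simp add: mutually_local_def additive_def sg_add)
    qed
    then show ?thesis by (simp add: fun_eq_iff)
  qed
  then show ?thesis by (simp add: mutually_local_def)
qed

lemma mutually_local_add:
  assumes "mutually_local e r A B" "mutually_local e s A' B" "\<And>n. additive (B n)"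
  shows "mutually_local e (max r s) (\<lambda>n v. A n v + A' n v) B"
proof -
  have 1: "mutually_local e (max r s) A B" "mutually_local e (max r s) A' B"
    by (rule mutually_local_mono[OF assms(1)], simp) (rule mutually_local_mono[OF assms(2)], simp)
  have "(\<lambda>m n. A m (B n v) + A' m (B n v) - sg e (B n (A m v + A' m v))) =
      (\<lambda>m n. (A m (B n v) - sg e (B n (A m v))) + (A' m (B n v) - sg e (B n (A' m v))))" for v
    by (simp add: fun_eq_iff additive.add[OF assms(3)] sg_add)
  then show ?thesis using 1 by (simp add: mutually_local_def zw_pow_add)
qed

lemma is_fieldE:
  assumes "is_field A" obtains M where "\<forall>n\<ge>M. A n v = 0"
  using assms by (auto simp: is_field_def)

lemma linear_iff_additive_homogeneous:
  "Vector_Spaces.linear s t f \<longleftrightarrow> vector_space s \<and> vector_space t \<and>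
     (\<forall>u v. f (u + v) = f u + f v) \<and> (\<forall>c v. f (s c v) = t c (f v))"
  by (auto simp: Vector_Spaces.linear_def module_hom_iff module_iff_vector_space)

text \<open>
  The state space is the range of the projection \<open>P\<close>, and operators on it are functions on the whole type that
  absorb \<open>P\<close> on both sides.
\<close>

locale generating_fields = vector_space scale
  for scale :: "complex \<Rightarrow> 'v::ab_group_add \<Rightarrow> 'v" +
  fixes N :: nat and P T par :: "'v \<Rightarrow> 'v" and S :: "nat \<Rightarrow> 'v \<Rightarrow> 'v" and vac :: 'v
    and G :: "nat \<Rightarrow> 'i set" and x :: "'i \<Rightarrow> 'v field"
  assumes op_P: "Vector_Spaces.linear scale scale P" "\<And>v. P (P v) = P v"
    and op_T: "Vector_Spaces.linear scale scale T" "\<And>v. P (T v) = T v" "\<And>v. T (P v) = T v"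
    and op_par: "Vector_Spaces.linear scale scale par" "\<And>v. P (par v) = par v" "\<And>v. par (P v) = par v"
    and op_S: "\<And>i. i \<in> {1..N} \<Longrightarrow> Vector_Spaces.linear scale scale (S i)"
      "\<And>i v. i \<in> {1..N} \<Longrightarrow> P (S i v) = S i v" "\<And>i v. i \<in> {1..N} \<Longrightarrow> S i (P v) = S i v"
    and op_x: "\<And>p a n. a \<in> G p \<Longrightarrow> Vector_Spaces.linear scale scale (x a n)"
      "\<And>p a n v. a \<in> G p \<Longrightarrow> P (x a n v) = x a n v" "\<And>p a n v. a \<in> G p \<Longrightarrow> x a n (P v) = x a n v"
    and par_par: "\<And>v. par (par v) = P v"
    and P_vac: "P vac = vac" and T_vac: "T vac = 0" and par_vac: "par vac = vac"
    and S_vac: "\<And>i. i \<in> {1..N} \<Longrightarrow> S i vac = 0"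
    and par_T: "\<And>v. par (T v) = T (par v)"
    and par_S: "\<And>i v. i \<in> {1..N} \<Longrightarrow> par (S i v) = - S i (par v)"
    and S_T: "\<And>i v. i \<in> {1..N} \<Longrightarrow> S i (T v) = T (S i v)"
    and S_S: "\<And>i k v. i \<in> {1..N} \<Longrightarrow> k \<in> {1..N} \<Longrightarrow> S i (S k v) = - S k (S i v)"
    and x_field: "\<And>p a. a \<in> G p \<Longrightarrow> is_field (x a)"
    and x_vac: "\<And>p a n. a \<in> G p \<Longrightarrow> n \<ge> 0 \<Longrightarrow> x a n vac = 0"
    and x_T: "\<And>p a n v. a \<in> G p \<Longrightarrow> T (x a n v) - x a n (T v) = scale (- of_int n) (x a (n - 1) v)"
    and x_par: "\<And>p a n v. a \<in> G p \<Longrightarrow> x a n (par v) = sg p (par (x a n v))"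
    and x_S: "\<And>i p a. i \<in> {1..N} \<Longrightarrow> a \<in> G p \<Longrightarrow>
        \<exists>b\<in>G (p + 1). \<forall>n v. S i (x a n v) - sg p (x a n (S i v)) = x b n v"
    and x_local: "\<And>p q a b. a \<in> G p \<Longrightarrow> b \<in> G q \<Longrightarrow> \<exists>r. mutually_local (p * q) r (x a) (x b)"
    and x_span: "\<And>H v. subspace H \<Longrightarrow> vac \<in> H \<Longrightarrow>
        (\<And>p a v. a \<in> G p \<Longrightarrow> v \<in> H \<Longrightarrow> x a (- 1) v \<in> H) \<Longrightarrow> P v \<in> H"
begin

section \<open>Operators on the range of the projection\<close>

abbreviation "lin \<equiv> Vector_Spaces.linear scale scale"

definition "is_op A \<longleftrightarrow> lin A \<and> (\<forall>v. P (A v) = A v) \<and> (\<forall>v. A (P v) = A v)"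

lemma lin_iff: "lin A \<longleftrightarrow> (\<forall>u v. A (u + v) = A u + A v) \<and> (\<forall>c v. A (scale c v) = scale c (A v))"
  by (simp add: linear_iff_additive_homogeneous vector_space_axioms)

lemma additive_lin: "lin A \<Longrightarrow> additive A"
  by (simp add: additive_def lin_iff)

lemma linI: "(\<And>u v. A (u + v) = A u + A v) \<Longrightarrow> (\<And>c v. A (scale c v) = scale c (A v)) \<Longrightarrow> lin A"
  by (simp add: lin_iff)

lemma lin_add: "lin A \<Longrightarrow> A (u + v) = A u + A v" and lin_scale: "lin A \<Longrightarrow> A (scale c v) = scale c (A v)"
  and lin_0: "lin A \<Longrightarrow> A 0 = 0" and lin_minus: "lin A \<Longrightarrow> A (- v) = - A v"
  and lin_diff: "lin A \<Longrightarrow> A (u - v) = A u - A v" and lin_sg: "lin A \<Longrightarrow> A (sg p v) = sg p (A v)"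
proof -
  assume A: "lin A"
  show "A (u + v) = A u + A v" "A (scale c v) = scale c (A v)" using A by (auto simp: lin_iff)
  note ad = additive_lin[OF A]
  show "A 0 = 0" "A (- v) = - A v" "A (u - v) = A u - A v" "A (sg p v) = sg p (A v)"
    by (simp_all add: additive.zero[OF ad] additive.minus[OF ad] additive.diff[OF ad] additive_sg[OF ad])
qed

lemma sg_scale: "sg p (scale c v) = scale c (sg p v)"
  by (simp add: sg_def)

lemma is_op_comp: "is_op A \<Longrightarrow> is_op B \<Longrightarrow> is_op (\<lambda>v. A (B v))"
  by (auto simp: is_op_def lin_iff)

lemma is_op_add: "is_op A \<Longrightarrow> is_op B \<Longrightarrow> is_op (\<lambda>v. A v + B v)"
  using lin_add[OF op_P(1)]
  by (auto simp: is_op_def lin_iff algebra_simps)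

lemma is_op_scale: "is_op A \<Longrightarrow> is_op (\<lambda>v. scale c (A v))"
  using lin_scale[OF op_P(1)]
  by (auto simp: is_op_def lin_iff algebra_simps)

lemma is_op_sg: "is_op A \<Longrightarrow> is_op (\<lambda>v. sg p (A v))"
  using is_op_scale[of A "-1"] by (cases "even p") (simp_all add: sg_def)

lemma is_op_diff: "is_op A \<Longrightarrow> is_op B \<Longrightarrow> is_op (\<lambda>v. A v - B v)"
  using is_op_add[of A "\<lambda>v. - B v"] is_op_scale[of B "-1"] by simp

lemma is_op_0: "is_op (\<lambda>v. 0)"
  using is_op_scale[of P 0] op_P by (simp add: is_op_def)

lemma is_op_sum: "(\<And>i. i \<in> I \<Longrightarrow> is_op (A i)) \<Longrightarrow> is_op (\<lambda>v. \<Sum>i\<in>I. A i v)"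
  by (induction I rule: infinite_finite_induct) (auto intro: is_op_add is_op_0)

lemma ops: "is_op P" "is_op T" "is_op par" "i \<in> {1..N} \<Longrightarrow> is_op (S i)" "a \<in> G p \<Longrightarrow> is_op (x a n)"
  using op_P op_T op_par op_S op_x by (auto simp: is_op_def)

lemma op_lin: "is_op A \<Longrightarrow> lin A"
  by (simp add: is_op_def)

section \<open>The fields that correspond to states\<close>

definition "Vgr p = {v. P v = v \<and> par v = sg p v}"

text \<open>The candidates for y(v, z) with v of parity p. Locality is demanded against the
  generators only: uniqueness rests on just this, and it propagates through products and through
  commutators with S^i. Locality among all such fields is derived afterwards.\<close>

definition LF :: "nat \<Rightarrow> 'v field \<Rightarrow> bool" where
  "LF p B \<longleftrightarrow> (\<forall>n. is_op (B n)) \<and> is_field B \<and> (\<forall>n\<ge>0. B n vac = 0) \<and>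
     (\<forall>n v. T (B n v) - B n (T v) = scale (- of_int n) (B (n - 1) v)) \<and>
     (\<forall>n v. B n (par v) = sg p (par (B n v))) \<and>
     (\<forall>q. \<forall>a\<in>G q. \<exists>r. mutually_local (p * q) r B (x a))"

lemma LF_op: "LF p B \<Longrightarrow> is_op (B n)" and LF_field: "LF p B \<Longrightarrow> is_field B"
  and LF_vac: "LF p B \<Longrightarrow> n \<ge> 0 \<Longrightarrow> B n vac = 0"
  and LF_T: "LF p B \<Longrightarrow> T (B n v) - B n (T v) = scale (- of_int n) (B (n - 1) v)"
  and LF_par: "LF p B \<Longrightarrow> B n (par v) = sg p (par (B n v))"
  and LF_local: "LF p B \<Longrightarrow> a \<in> G q \<Longrightarrow> \<exists>r. mutually_local (p * q) r B (x a)"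
  and LF_lin: "LF p B \<Longrightarrow> lin (B n)"
  and LF_P: "LF p B \<Longrightarrow> P (B n v) = B n v" "LF p B \<Longrightarrow> B n (P v) = B n v"
  unfolding LF_def is_op_def by blast+

lemma LF_gen:
  assumes "a \<in> G p" shows "LF p (x a)"
proof -
  have "\<forall>q. \<forall>b\<in>G q. \<exists>r. mutually_local (p * q) r (x a) (x b)"
    using x_local[OF assms] by simp
  then show ?thesis
    unfolding LF_def by (simp add: ops(5)[OF assms] x_field[OF assms] x_vac[OF assms] x_T[OF assms] x_par[OF assms])
qed

lemma LF_cong:
  assumes "LF p B" "even p = even q" shows "LF q B"
proof -
  have "\<exists>r. mutually_local (q * k) r B (x a)" if a: "a \<in> G k" for k a
  proof -
    obtain r where "mutually_local (p * k) r B (x a)" using LF_local[OF assms(1) a] by blast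
    then have "mutually_local (q * k) r B (x a)" by (rule mutually_local_cong) (simp add: assms(2))
    then show ?thesis by blast
  qed
  moreover have "sg p = (sg q :: 'v \<Rightarrow> 'v)" using assms(2) by (auto simp: fun_eq_iff sg_def)
  ultimately show ?thesis using assms(1) by (simp add: LF_def)
qed

lemma mutually_local_zero: "(\<And>n. B n 0 = 0) \<Longrightarrow> mutually_local e r (\<lambda>n v. 0) B"
  by (simp add: mutually_local_def)

lemma LF_zero: "LF p (\<lambda>n v. 0)"
  unfolding LF_def
  by (auto simp: is_op_0 is_field_def lin_0[OF op_T(1)] lin_0[OF op_par(1)] lin_0[OF op_x(1)]
      intro!: mutually_local_zero)

text \<open>The field of the vacuum, with -1 as its only mode; it acts by \<open>P\<close>, which is
  the identity of the state space.\<close>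

definition idf :: "'v field" where "idf n v = (if n = - 1 then P v else 0)"

lemma idf_local:
  assumes "\<And>n. is_op (B n)" shows "mutually_local 0 0 idf B"
  using assms lin_0[OF op_lin, of "B _"] by (auto simp: mutually_local_def idf_def is_op_def fun_eq_iff)

lemma LF_idf: "LF 0 idf"
proof -
  have "is_op (idf n)" for n
    by (cases "n = -1") (simp_all add: idf_def[abs_def] ops(1) is_op_0)
  moreover have "is_field idf" unfolding is_field_def idf_def by (intro allI exI[of _ 0]) auto
  moreover have "T (idf n v) - idf n (T v) = scale (- of_int n) (idf (n - 1) v)" for n v
    by (auto simp: idf_def op_T lin_0)
  moreover have "\<exists>r. mutually_local (0 * q) r idf (x a)" if "a \<in> G q" for q a
    using idf_local ops(5)[OF that] by auto
  ultimately show ?thesis by (auto simp: LF_def idf_def op_par lin_0)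
qed

lemma LF_add: assumes "LF p A" "LF p B" shows "LF p (\<lambda>n v. A n v + B n v)"
proof -
  have "is_field (\<lambda>n v. A n v + B n v)"
    unfolding is_field_def
  proof
    fix v
    obtain M1 M2 where "\<forall>n\<ge>M1. A n v = 0" "\<forall>n\<ge>M2. B n v = 0"
      using LF_field[OF assms(1)] LF_field[OF assms(2)] by (force simp: is_field_def)
    then show "\<exists>M. \<forall>n\<ge>M. A n v + B n v = 0" by (intro exI[of _ "max M1 M2"]) auto
  qed
  moreover have "\<exists>r. mutually_local (p * q) r (\<lambda>n v. A n v + B n v) (x a)" if a: "a \<in> G q" for q a
  proof -
    obtain r s where "mutually_local (p * q) r A (x a)" "mutually_local (p * q) s B (x a)"
      using LF_local[OF assms(1) a] LF_local[OF assms(2) a] by blast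
    from mutually_local_add[OF this additive_lin[OF op_x(1)[OF a]]] show ?thesis by blast
  qed
  moreover have "T (A n v + B n v) - (A n (T v) + B n (T v)) = scale (- of_int n) (A (n - 1) v + B (n - 1) v)" for n v
    using LF_T[OF assms(1), of n v] LF_T[OF assms(2), of n v]
    by (simp add: lin_add[OF op_T(1)] scale_right_distrib algebra_simps)
  ultimately show ?thesis using assms unfolding LF_def
    by (auto intro: is_op_add simp: lin_add[OF op_par(1)] sg_add)
qed

lemma LF_scale: assumes "LF p A" shows "LF p (\<lambda>n v. scale c (A n v))"
proof -
  have "is_field (\<lambda>n v. scale c (A n v))"
    using LF_field[OF assms(1)] unfolding is_field_def by (metis scale_zero_right)
  moreover have "\<exists>r. mutually_local (p * q) r (\<lambda>n v. scale c (A n v)) (x a)" if a: "a \<in> G q" for q a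
  proof -
    obtain r where r: "mutually_local (p * q) r A (x a)" using LF_local[OF assms(1) a] by blast
    have add: "additive (scale c)" by (simp add: additive_def scale_right_distrib)
    have "mutually_local (p * q) r (\<lambda>n v. scale c (A n v)) (x a)" unfolding mutually_local_def
    proof
      fix v
      have "(\<lambda>m n. scale c (A m (x a n v)) - sg (p * q) (x a n (scale c (A m v)))) =
          (\<lambda>m n. scale c (A m (x a n v) - sg (p * q) (x a n (A m v))))"
        by (simp add: lin_scale[OF op_x(1)[OF a]] sg_scale scale_right_diff_distrib)
      then show "(zw ^^ r) (\<lambda>m n. scale c (A m (x a n v)) - sg (p * q) (x a n (scale c (A m v)))) = (\<lambda>m n. 0)"
        using r by (simp add: zw_pow_lin[OF add] mutually_local_def)
    qed
    then show ?thesis by blast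
  qed
  moreover have "T (scale c (A n v)) - (scale c (A n (T v))) = scale (- of_int n) (scale c (A (n - 1) v))" for n v
    using arg_cong[OF LF_T[OF assms(1), of n v], of "scale c"]
    by (simp add: lin_scale[OF op_T(1)] scale_right_diff_distrib mult.commute)
  ultimately show ?thesis using assms unfolding LF_def
    by (auto intro: is_op_scale simp: lin_scale[OF op_par(1)] sg_scale)
qed

text \<open>Goddard's uniqueness: the translation property determines \<open>B(z) vac\<close>, and locality then spreads it.\<close>

lemma LF_unique:
  assumes B: "LF p B" and B0: "B (- 1) vac = 0" shows "B = (\<lambda>n v. 0)"
proof -
  define H where "H = {v. \<forall>m. B m v = 0}"
  \<comment> \<open>On the vacuum, translation covariance says that T B_n vac is -n B_{n-1} vac; as
    n = -1 - k is never zero, the creation modes vanish one after the other.\<close>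
  have "B (- 1 - int k) vac = 0" for k
  proof (induction k)
    case (Suc k)
    have "scale (- of_int (- 1 - int k)) (B (- 1 - int k - 1) vac) = 0"
      using LF_T[OF B, of "- 1 - int k" vac] Suc by (simp only: T_vac lin_0[OF op_T(1)] lin_0[OF LF_lin[OF B]]) simp
    moreover have "- (of_int (- 1 - int k) :: complex) \<noteq> 0" unfolding neg_equal_0_iff_equal of_int_eq_0_iff by simp
    ultimately have "B (- 1 - int k - 1) vac = 0" by (simp only: scale_eq_0_iff) blast
    then show ?case by (simp add: algebra_simps)
  qed (use B0 in simp)
  then have neg: "B (- 1 - int (nat (- 1 - m))) vac = 0" for m by blast
  have "B m vac = 0" for m
    using neg[of m] LF_vac[OF B, of m] by (cases "m \<ge> 0") auto
  then have "vac \<in> H" by (simp add: H_def)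
  moreover have "subspace H"
    unfolding H_def using lin_add[OF LF_lin[OF B]] lin_scale[OF LF_lin[OF B]] lin_0[OF LF_lin[OF B]]
    by (auto simp: subspace_def)
  moreover have "x a (- 1) v \<in> H" if a: "a \<in> G q" and v: "v \<in> H" for q a v
  proof -
    obtain r where "mutually_local (p * q) r B (x a)" using LF_local[OF B a] by blast
    then have "(zw ^^ r) (\<lambda>m n. B m (x a n v) - sg (p * q) (x a n (B m v))) = (\<lambda>m n. 0)"
      by (simp add: mutually_local_def)
    \<comment> \<open>The reversed product drops out since B kills v. What is left is truncated in n
      because \<open>x a\<close> is a field, so \<open>zw_pow_inj\<close> applies.\<close>
    then have "(zw ^^ r) (\<lambda>m n. B m (x a n v)) = (\<lambda>m n. 0)"
      using v by (simp add: H_def lin_0[OF op_x(1)[OF a]])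
    moreover obtain M where "\<forall>n\<ge>M. x a n v = 0" using x_field[OF a] by (auto simp: is_field_def)
    ultimately have "B m (x a n v) = 0" for m n
      using zw_pow_inj[of r "\<lambda>m n. B m (x a n v)" M] lin_0[OF LF_lin[OF B]] by simp
    then show ?thesis by (simp add: H_def)
  qed
  ultimately have "P v \<in> H" for v using x_span by blast
  then show ?thesis using LF_P(2)[OF B] by (auto simp: H_def fun_eq_iff)
qed

text \<open>The second claim identifies the state of the product: on the vacuum only j = 0 survives
  in the first sum. A generator and a field for v thus combine to a field for the state
  \<open>x a (- 1) v\<close>, as the span induction requires.\<close>

lemma LF_nop:
  assumes A: "LF q A" and B: "LF p B" and loc: "\<exists>r. mutually_local (q * p) r A B"
  shows "LF (q + p) (nop (q * p) A B)" "nop (q * p) A B (- 1) vac = A (- 1) (B (- 1) vac)"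
proof -
  note addA = additive_lin[OF LF_lin[OF A]] and addB = additive_lin[OF LF_lin[OF B]]
  note z = lin_0[OF LF_lin[OF A]] lin_0[OF LF_lin[OF B]] lin_0[OF op_T(1)] lin_0[OF op_par(1)]
  \<comment> \<open>A cut-off k that is large enough for several vectors at once turns each property
    of \<open>nop\<close> into an identity between finite sums of products of modes.\<close>
  have expand: "\<exists>K. \<forall>k\<ge>K. nop (q * p) A B n v =
      (\<Sum>j<k. A (- 1 - int j) (B (n + int j) v)) + sg (q * p) (\<Sum>j<k. B (n - 1 - int j) (A (int j) v))" for n v
  proof -
    obtain M1 M2 where M: "\<forall>n\<ge>M1. A n v = 0" "\<forall>n\<ge>M2. B n v = 0"
      using LF_field[OF A] LF_field[OF B] by (force simp: is_field_def)
    show ?thesis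
    proof (intro exI allI impI)
      fix k assume k: "k \<ge> max (nat M1) (nat (M2 - n))"
      show "nop (q * p) A B n v = (\<Sum>j<k. A (- 1 - int j) (B (n + int j) v)) + sg (q * p) (\<Sum>j<k. B (n - 1 - int j) (A (int j) v))"
        unfolding nop_def by (subst (1 2) Sum_any_lessThan[of k]) (use k M z in auto)
    qed
  qed
  define K where "K n v = (SOME K. \<forall>k\<ge>K. nop (q * p) A B n v =
      (\<Sum>j<k. A (- 1 - int j) (B (n + int j) v)) + sg (q * p) (\<Sum>j<k. B (n - 1 - int j) (A (int j) v)))" for n v
  have K: "nop (q * p) A B n v =
      (\<Sum>j<k. A (- 1 - int j) (B (n + int j) v)) + sg (q * p) (\<Sum>j<k. B (n - 1 - int j) (A (int j) v))"
    if "k \<ge> K n v" for n v k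
    using someI_ex[OF expand] that unfolding K_def by blast
  have op: "is_op (nop (q * p) A B n)" for n
  proof -
    have AB: "is_op (\<lambda>v. A i (B j v))" "is_op (\<lambda>v. B i (A j v))" for i j
      using LF_op[OF A] LF_op[OF B] is_op_comp by blast+
    define F where "F k v = (\<Sum>j<k. A (- 1 - int j) (B (n + int j) v)) + sg (q * p) (\<Sum>j<k. B (n - 1 - int j) (A (int j) v))" for k::nat and v
    have F: "is_op (F k)" for k unfolding F_def
      by (intro is_op_add is_op_sg is_op_sum AB)
    have ex: "\<exists>k. nop (q * p) A B n u = F k u \<and> nop (q * p) A B n v = F k v \<and> nop (q * p) A B n w = F k w" for u v w
      by (intro exI[of _ "max (K n u) (max (K n v) (K n w))"]) (auto simp: K F_def)
    have "nop (q * p) A B n (u + v) = nop (q * p) A B n u + nop (q * p) A B n v" for u v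
      using ex[of u v "u + v"] lin_add[OF op_lin[OF F]] by metis
    moreover have "nop (q * p) A B n (scale c v) = scale c (nop (q * p) A B n v)" for c v
      using ex[of v "scale c v" v] lin_scale[OF op_lin[OF F]] by metis
    moreover have "P (nop (q * p) A B n v) = nop (q * p) A B n v" "nop (q * p) A B n (P v) = nop (q * p) A B n v" for v
      using ex[of v "P v" v] F unfolding is_op_def by metis+
    ultimately show ?thesis by (auto simp: is_op_def intro: linI)
  qed
  have fld: "is_field (nop (q * p) A B)" unfolding is_field_def
  proof
    fix v
    obtain M1 M2 where M: "\<forall>n\<ge>M1. A n v = 0" "\<forall>n\<ge>M2. B n v = 0"
      using LF_field[OF A] LF_field[OF B] by (force simp: is_field_def)
    have "\<forall>u. \<exists>M. \<forall>n\<ge>M. B n u = 0" using LF_field[OF B] by (auto simp: is_field_def)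
    then obtain m where m: "\<And>u n. n \<ge> m u \<Longrightarrow> B n u = 0" by metis
    \<comment> \<open>In the second sum the vector A_j v varies with j, but only the finitely many j
      < M1 matter, so that the bounds for B have a maximum.\<close>
    define M3 where "M3 = Max (insert 0 ((\<lambda>j. m (A (int j) v) + int j + 1) ` {..<nat M1}))"
    show "\<exists>M. \<forall>n\<ge>M. nop (q * p) A B n v = 0"
    proof (intro exI allI impI)
      fix n assume n: "n \<ge> max M2 M3"
      have "B (n - 1 - int j) (A (int j) v) = 0" for j
      proof (cases "j < nat M1")
        case True
        then have "m (A (int j) v) + int j + 1 \<le> M3" unfolding M3_def by (intro Max_ge) auto
        then show ?thesis using n by (intro m) auto
      next
        case False then show ?thesis using M z by auto
      qed
      moreover have "B (n + int j) v = 0" for j using M n by auto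
      ultimately show "nop (q * p) A B n v = 0" by (simp add: nop_def z)
    qed
  qed
  have vac0: "nop (q * p) A B n vac = 0" if "n \<ge> 0" for n
    using that by (simp add: nop_def LF_vac[OF A] LF_vac[OF B] z)
  have "nop (q * p) A B (- 1) vac = (\<Sum>j<1. A (- 1 - int j) (B (- 1 + int j) vac))"
    unfolding nop_def by (subst (1) Sum_any_lessThan[of 1]) (auto simp: LF_vac[OF A] LF_vac[OF B] z)
  then show "nop (q * p) A B (- 1) vac = A (- 1) (B (- 1) vac)" by simp
  have par: "nop (q * p) A B n (par v) = sg (q + p) (par (nop (q * p) A B n v))" for n v
  proof -
    define k where "k = max (K n v) (K n (par v))"
    have k: "nop (q * p) A B n v =
      (\<Sum>j<k. A (- 1 - int j) (B (n + int j) v)) + sg (q * p) (\<Sum>j<k. B (n - 1 - int j) (A (int j) v))"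
      "nop (q * p) A B n (par v) =
      (\<Sum>j<k. A (- 1 - int j) (B (n + int j) (par v))) + sg (q * p) (\<Sum>j<k. B (n - 1 - int j) (A (int j) (par v)))"
      by (rule K; simp add: k_def)+
    have ps: "par (sum f I) = (\<Sum>i\<in>I. par (f i))" for f and I :: "nat set"
      by (rule additive.sum[OF additive_lin[OF op_par(1)]])
    show ?thesis unfolding k
      by (simp add: LF_par[OF A] LF_par[OF B] lin_sg[OF LF_lin[OF A]] lin_sg[OF LF_lin[OF B]] lin_add[OF op_par(1)]
          lin_sg[OF op_par(1)] ps sg_add sg_sg sg_sum[symmetric] ac_simps)
  qed
  have T: "T (nop (q * p) A B n v) - nop (q * p) A B n (T v) = scale (- of_int n) (nop (q * p) A B (n - 1) v)" for n v
  proof -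
    obtain M1 M2 where M: "\<forall>n\<ge>M1. A n v = 0" "\<forall>n\<ge>M2. B n v = 0"
      using LF_field[OF A] LF_field[OF B] by (force simp: is_field_def)
    \<comment> \<open>The margins of one make the boundary terms \<open>c k\<close> and
      \<open>d k\<close> of the summation by parts vanish: they contain the mode n - 1 + k of B and
      the mode k - 1 of A.\<close>
    define k where "k = K n v + K n (T v) + K (n - 1) v + nat (M1 + 1) + nat (M2 - n + 1)"
    have k: "k \<ge> K n v" "k \<ge> K n (T v)" "k \<ge> K (n - 1) v" "int k \<ge> M1 + 1" "int k \<ge> M2 - n + 1" by (auto simp: k_def)
    have Ts: "T (sum f I) = (\<Sum>i\<in>I. T (f i))" for f and I :: "nat set"
      by (rule additive.sum[OF additive_lin[OF op_T(1)]])
    have TA: "T (A i u) = A i (T u) - scale (of_int i) (A (i - 1) u)"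
      and TB: "T (B i u) = B i (T u) - scale (of_int i) (B (i - 1) u)" for i u
      using LF_T[OF A, of i u] LF_T[OF B, of i u] by (simp_all add: algebra_simps)
    define c where "c j = A (- 1 - int j) (B (n - 1 + int j) v)" for j
    define d where "d j = B (n - 1 - int j) (A (int j - 1) v)" for j
    have 1: "T (A (- 1 - int j) (B (n + int j) v)) - A (- 1 - int j) (B (n + int j) (T v)) =
        scale (of_nat (Suc j)) (c (Suc j)) - scale (of_int n + of_nat j) (c j)" for j
      by (simp add: TA TB c_def lin_diff[OF LF_lin[OF A]] lin_scale[OF LF_lin[OF A]] lin_add[OF LF_lin[OF A]] scale_left_distrib
          scale_left_diff_distrib scale_minus_left algebra_simps)
    have 2: "T (B (n - 1 - int j) (A (int j) v)) - B (n - 1 - int j) (A (int j) (T v)) =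
        - scale (of_int n - 1 - of_nat j) (d (Suc j)) - scale (of_nat j) (d j)" for j
      by (simp add: TA TB d_def lin_diff[OF LF_lin[OF B]] lin_scale[OF LF_lin[OF B]] lin_add[OF LF_lin[OF B]] scale_left_distrib
          scale_left_diff_distrib scale_minus_left algebra_simps)
    \<comment> \<open>Summation by parts: the weights j and -(n + j) of c_j coming from neighbouring
      summands add up to -n, the covariance factor of the product.\<close>
    have 3: "(\<Sum>j<k. scale (of_nat (Suc j)) (c (Suc j)) - scale (of_int n + of_nat j) (c j)) =
        scale (of_nat k) (c k) - scale (of_int n) (\<Sum>j<k. c j)" for k
      by (induction k) (simp_all add: scale_left_distrib scale_right_distrib algebra_simps)
    have 4: "(\<Sum>j<k. - scale (of_int n - 1 - of_nat j) (d (Suc j)) - scale (of_nat j) (d j)) =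
        scale (of_nat k) (d k) - scale (of_int n) (\<Sum>j<k. d (Suc j))" for k
      by (induction k) (simp_all add: scale_left_distrib scale_right_distrib scale_left_diff_distrib algebra_simps)
    have "c k = 0" "d k = 0" using M k by (auto simp: c_def d_def z)
    then have 5: "T (\<Sum>j<k. A (- 1 - int j) (B (n + int j) v)) - (\<Sum>j<k. A (- 1 - int j) (B (n + int j) (T v))) =
          scale (- of_int n) (\<Sum>j<k. c j)"
      "T (\<Sum>j<k. B (n - 1 - int j) (A (int j) v)) - (\<Sum>j<k. B (n - 1 - int j) (A (int j) (T v))) =
          scale (- of_int n) (\<Sum>j<k. d (Suc j))"
      unfolding Ts sum_subtractf[symmetric] 1 2 3 4 by (simp_all add: scale_minus_left)
    have "nop (q * p) A B (n - 1) v = (\<Sum>j<k. c j) + sg (q * p) (\<Sum>j<k. d (Suc j))"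
      using K[OF k(3)] by (simp add: c_def d_def algebra_simps)
    then show ?thesis using 5
      by (simp add: K[OF k(1)] K[OF k(2)] lin_add[OF op_T(1)] lin_sg[OF op_T(1)] scale_right_distrib sg_scale[symmetric] sg_diff[symmetric] add_diff_add)
  qed
  have "\<exists>r. mutually_local ((q + p) * t) r (nop (q * p) A B) (x a)" if a: "a \<in> G t" for t a
  proof -
    obtain r1 r2 r3 where "mutually_local (q * p) r1 A B" "mutually_local (q * t) r2 A (x a)" "mutually_local (p * t) r3 B (x a)"
      using loc LF_local[OF A a] LF_local[OF B a] by blast
    then show ?thesis
      using dong[OF addA addB additive_lin[OF op_x(1)[OF a]] LF_field[OF A] LF_field[OF B]]
      by (simp add: add_mult_distrib)
  qed
  then show "LF (q + p) (nop (q * p) A B)"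
    unfolding LF_def using op fld vac0 T par by blast
qed

text \<open>Locality is the super Jacobi identity: the commutator of [S^i, B] with x_a is made of
  [S^i, [B, x_a]] and [B, [S^i, x_a]], and [S^i, x_a] is again a generating field by
  \<open>x_S\<close>.\<close>

lemma LF_S:
  assumes B: "LF p B" and i: "i \<in> {1..N}"
  shows "LF (p + 1) (\<lambda>n v. S i (B n v) - sg p (B n (S i v)))"
proof -
  note Sl = op_S(1)[OF i] and Bl = LF_lin[OF B]
  note z = lin_0[OF Sl] lin_0[OF Bl]
  have op: "is_op (\<lambda>v. S i (B n v) - sg p (B n (S i v)))" for n
  proof -
    have "is_op (\<lambda>v. B n (S i v))" by (rule is_op_comp[OF LF_op[OF B] ops(4)[OF i]])
    moreover have "is_op (\<lambda>v. S i (B n v))" by (rule is_op_comp[OF ops(4)[OF i] LF_op[OF B]])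
    ultimately show ?thesis by (intro is_op_diff is_op_sg)
  qed
  have fld: "is_field (\<lambda>n v. S i (B n v) - sg p (B n (S i v)))" unfolding is_field_def
  proof
    fix v
    obtain M1 where "\<forall>n\<ge>M1. B n v = 0" using LF_field[OF B] by (auto simp: is_field_def)
    moreover obtain M2 where "\<forall>n\<ge>M2. B n (S i v) = 0" using LF_field[OF B] by (auto simp: is_field_def)
    ultimately show "\<exists>M. \<forall>n\<ge>M. S i (B n v) - sg p (B n (S i v)) = 0"
      by (intro exI[of _ "max M1 M2"]) (simp add: z)
  qed
  have T: "T (S i (B n v) - sg p (B n (S i v))) - (S i (B n (T v)) - sg p (B n (S i (T v)))) =
      scale (- of_int n) (S i (B (n - 1) v) - sg p (B (n - 1) (S i v)))" for n v
  proof -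
    have TB: "T (B n u) = B n (T u) + scale (- of_int n) (B (n - 1) u)" for u
      using LF_T[OF B, of n u] by (simp add: algebra_simps)
    show ?thesis
      by (simp add: lin_diff[OF op_T(1)] lin_sg[OF op_T(1)] S_T[OF i, symmetric] TB lin_add[OF Sl] lin_scale[OF Sl]
         lin_minus[OF Sl] lin_diff[OF Sl] sg_diff sg_add sg_minus sg_scale scale_right_diff_distrib)
  qed
  have par: "S i (B n (par v)) - sg p (B n (S i (par v))) = sg (p + 1) (par (S i (B n v) - sg p (B n (S i v))))" for n v
  proof -
    have "S i (par u) = - par (S i u)" for u using par_S[OF i, of u] by simp
    then show ?thesis
      by (simp add: LF_par[OF B] lin_sg[OF Sl] lin_minus[OF Bl] lin_diff[OF op_par(1)] lin_sg[OF op_par(1)] sg_diff sg_minus sg_Suc)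
  qed
  have loc: "\<exists>r. mutually_local ((p + 1) * q) r (\<lambda>n v. S i (B n v) - sg p (B n (S i v))) (x a)" if a: "a \<in> G q" for q a
  proof -
    note xl = op_x(1)[OF a]
    obtain b where b: "b \<in> G (q + 1)" "\<And>n v. S i (x a n v) - sg q (x a n (S i v)) = x b n v"
      using x_S[OF i a] by (elim bexE) (rule that, simp_all)
    obtain r1 where r1: "mutually_local (p * q) r1 B (x a)" using LF_local[OF B a] by blast
    obtain r2 where r2: "mutually_local (p * (q + 1)) r2 B (x b)" using LF_local[OF B b(1)] by blast
    define r where "r = max r1 r2"
    have r1: "mutually_local (p * q) r B (x a)" using mutually_local_mono[OF r1] by (simp add: r_def)
    have r2: "mutually_local (p * (q + 1)) r B (x b)" using mutually_local_mono[OF r2] by (simp add: r_def)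
    define L where "L m n v = B m (x a n v) - sg (p * q) (x a n (B m v))" for m n v
    define L' where "L' m n v = B m (x b n v) - sg (p * (q + 1)) (x b n (B m v))" for m n v
    have Sx: "S i (x a n v) = x b n v + sg q (x a n (S i v))" for n v
      using b(2)[of n v] by (simp add: algebra_simps)
    have "(S i (B m (x a n v)) - sg p (B m (S i (x a n v)))) - sg ((p + 1) * q) (x a n (S i (B m v) - sg p (B m (S i v)))) =
        S i (L m n v) + (- sg (p + q) (L m n (S i v)) + - sg p (L' m n v))" for m n v
    proof -
      have 1: "sg ((p + 1) * q) y = sg (p * q) (sg q y)" for y :: 'v by (simp add: sg_sg algebra_simps)
      have 2: "sg (p * (q + 1)) y = sg (p * q) (sg p y)" for y :: 'v by (simp add: sg_sg algebra_simps)
      have 3: "sg (p + q) y = sg p (sg q y)" for y :: 'v by (simp add: sg_sg)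
      show ?thesis unfolding L_def L'_def 1 2 3
        by (simp add: lin_diff[OF Sl] lin_sg[OF Sl] lin_sg[OF Bl] lin_add[OF Bl] lin_diff[OF xl] lin_sg[OF xl] Sx
            sg_add sg_diff sg_minus) (simp add: sg_def)
    qed
    moreover have "(zw ^^ r) (\<lambda>m n. S i (L m n v) + (- sg (p + q) (L m n (S i v)) + - sg p (L' m n v))) = (\<lambda>m n. 0)" for v
    proof -
      have L: "(zw ^^ r) (\<lambda>m n. L m n u) = (\<lambda>m n. 0)" "(zw ^^ r) (\<lambda>m n. L' m n u) = (\<lambda>m n. 0)" for u
        using r1 r2 by (simp_all add: mutually_local_def L_def L'_def)
      have ad: "additive (\<lambda>u::'v. - sg k u)" for k by (simp add: additive_def sg_add)
      show ?thesis
        unfolding zw_pow_add zw_pow_lin[OF additive_lin[OF Sl], of r "\<lambda>m n. L m n v"]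
            zw_pow_lin[OF ad[of "p + q"], of r "\<lambda>m n. L m n (S i v)"] zw_pow_lin[OF ad[of p], of r "\<lambda>m n. L' m n v"] L
        by (simp add: z)
    qed
    ultimately show ?thesis by (auto simp: mutually_local_def intro!: exI[of _ r])
  qed
  show ?thesis unfolding LF_def
    using op fld T par loc by (simp add: LF_vac[OF B] S_vac[OF i] z)
qed

section \<open>The state-field correspondence\<close>

definition pr :: "nat \<Rightarrow> 'v \<Rightarrow> 'v" where
  "pr p v = scale (1 / 2) (P v + sg p (par v))"

lemma pr_lin: "lin (pr p)"
  unfolding pr_def by (rule linI)
    (simp_all add: lin_add[OF op_P(1)] lin_add[OF op_par(1)] lin_scale[OF op_P(1)] lin_scale[OF op_par(1)]
      sg_add sg_scale scale_right_distrib mult.commute)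

lemma pr_Vgr: "pr p v \<in> Vgr p"
  by (simp add: Vgr_def pr_def lin_scale[OF op_P(1)] lin_scale[OF op_par(1)] lin_add[OF op_P(1)] lin_add[OF op_par(1)]
     lin_sg[OF op_P(1)] lin_sg[OF op_par(1)] op_P op_par par_par sg_scale sg_add add.commute)

lemma scale_half: "scale (1 / 2) (v + v) = v"
  by (simp add: scale_right_distrib flip: scale_left_distrib)

lemma pr_eq: "v \<in> Vgr p \<Longrightarrow> pr q v = (if even p = even q then v else 0)"
  by (auto simp: pr_def Vgr_def sg_sg scale_half) (auto simp: sg_def scale_half)

lemma pr_sum: "pr 0 v + pr 1 v = P v"
proof -
  have "pr 0 v + pr 1 v = scale (1 / 2) (P v + P v)"
    by (simp add: pr_def sg_Suc flip: scale_right_distrib)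
  then show ?thesis by (simp add: scale_half)
qed

lemma vac_Vgr: "vac \<in> Vgr 0"
  by (simp add: Vgr_def P_vac par_vac)

lemma LF_vac_Vgr: "LF p B \<Longrightarrow> B n vac \<in> Vgr p"
  using arg_cong[OF LF_par[of p B n vac], of "sg p"] by (simp add: Vgr_def LF_P par_vac)

lemma pr_x: "a \<in> G q \<Longrightarrow> pr p (x a n v) = x a n (pr (p + q) v)"
  by (simp add: pr_def lin_scale[OF op_x(1)] lin_add[OF op_x(1)] lin_sg[OF op_x(1)] op_x x_par sg_sg)
    (simp add: sg_def)

text \<open>Span induction, with a normally ordered product realising \<open>x a (- 1)\<close>. The
  set H asks for a field for each parity component of v, as fields are homogeneous whereas a
  subspace contains mixed vectors.\<close>

lemma LF_exists: assumes "v \<in> Vgr p" shows "\<exists>B. LF p B \<and> B (- 1) vac = v"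
proof -
  define H where "H = {v. \<forall>p. \<exists>B. LF p B \<and> B (- 1) vac = pr p v}"
  have "subspace H" unfolding subspace_def
  proof (intro conjI ballI allI)
    show "0 \<in> H" using LF_zero lin_0[OF pr_lin] unfolding H_def by fastforce
  next
    fix u v assume uv: "u \<in> H" "v \<in> H"
    have "\<exists>B. LF p B \<and> B (- 1) vac = pr p (u + v)" for p
    proof -
      obtain A B where "LF p A" "A (- 1) vac = pr p u" "LF p B" "B (- 1) vac = pr p v" using uv unfolding H_def by blast
      then show ?thesis by (intro exI[of _ "\<lambda>n v. A n v + B n v"]) (simp add: LF_add lin_add[OF pr_lin])
    qed
    then show "u + v \<in> H" by (simp add: H_def)
  next
    fix c v assume v: "v \<in> H"
    have "\<exists>B. LF p B \<and> B (- 1) vac = pr p (scale c v)" for p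
    proof -
      obtain B where "LF p B" "B (- 1) vac = pr p v" using v unfolding H_def by blast
      then show ?thesis by (intro exI[of _ "\<lambda>n v. scale c (B n v)"]) (simp add: LF_scale lin_scale[OF pr_lin])
    qed
    then show "scale c v \<in> H" by (simp add: H_def)
  qed
  moreover have "vac \<in> H"
  proof -
    have "\<exists>B. LF p B \<and> B (- 1) vac = pr p vac" for p
    proof (cases "even p")
      case True
      then show ?thesis using LF_cong[OF LF_idf, of p] by (intro exI[of _ idf]) (simp add: pr_eq[OF vac_Vgr] idf_def P_vac)
    next
      case False
      then show ?thesis using LF_zero[of p] by (intro exI[of _ "\<lambda>n v. 0"]) (simp add: pr_eq[OF vac_Vgr])
    qed
    then show ?thesis by (simp add: H_def)
  qed
  moreover have "x a (- 1) v \<in> H" if a: "a \<in> G q" and v: "v \<in> H" for q a v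
  proof -
    have "\<exists>B. LF p B \<and> B (- 1) vac = pr p (x a (- 1) v)" for p
    proof -
      \<comment> \<open>The component of parity p of \<open>x a (- 1) v\<close> comes from the
        component of v of parity p - q, which is p + q modulo 2.\<close>
      obtain B where B: "LF (p + q) B" "B (- 1) vac = pr (p + q) v" using v unfolding H_def by blast
      obtain r where "mutually_local ((p + q) * q) r B (x a)" using LF_local[OF B(1) a] by blast
      then have "\<exists>r. mutually_local (q * (p + q)) r (x a) B" by (metis mult.commute mutually_local_sym)
      note nop = LF_nop[OF LF_gen[OF a] B(1) this]
      have "even (q + (p + q)) = even p" by auto
      from LF_cong[OF nop(1) this] nop(2)
      show ?thesis using B(2) by (intro exI[of _ "nop (q * (p + q)) (x a) B"]) (simp add: pr_x[OF a])
    qed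
    then show ?thesis by (simp add: H_def)
  qed
  ultimately have "P v \<in> H" using x_span by blast
  moreover have "pr p (P v) = v" using assms pr_eq[OF assms, of p] by (simp add: Vgr_def)
  ultimately show ?thesis by (force simp: H_def)
qed

definition fld :: "nat \<Rightarrow> 'v \<Rightarrow> 'v field" where
  "fld p v = (THE B. LF p B \<and> B (- 1) vac = v)"

text \<open>Goddard's uniqueness, applied to the difference of two fields with the same
  state.\<close>

lemma fld_eq: assumes B: "LF p B" shows "fld p (B (- 1) vac) = B"
  unfolding fld_def
proof (rule the_equality)
  fix A assume A: "LF p A \<and> A (- 1) vac = B (- 1) vac"
  have "LF p (\<lambda>n v. A n v + scale (- 1) (B n v))" by (intro LF_add LF_scale B A[THEN conjunct1])
  from LF_unique[OF this] A show "A = B" by (simp add: fun_eq_iff)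
qed (simp add: B)

lemma fld_LF: "v \<in> Vgr p \<Longrightarrow> LF p (fld p v)" "v \<in> Vgr p \<Longrightarrow> fld p v (- 1) vac = v"
proof -
  assume "v \<in> Vgr p"
  then obtain B where "LF p B" "B (- 1) vac = v" using LF_exists by blast
  then show "LF p (fld p v)" "fld p v (- 1) vac = v" using fld_eq by auto
qed

lemma fld_add: "u \<in> Vgr p \<Longrightarrow> v \<in> Vgr p \<Longrightarrow> fld p (u + v) = (\<lambda>n w. fld p u n w + fld p v n w)"
  using fld_eq[OF LF_add[OF fld_LF(1) fld_LF(1)], of u p v] by (simp add: fld_LF)

lemma fld_scale: "v \<in> Vgr p \<Longrightarrow> fld p (scale c v) = (\<lambda>n w. scale c (fld p v n w))"
  using fld_eq[OF LF_scale[OF fld_LF(1)], of v p c] by (simp add: fld_LF)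

lemma fld_0: "fld p 0 = (\<lambda>n w. 0)"
  using fld_eq[OF LF_zero, of p] by simp

lemma fld_cong: "even p = even q \<Longrightarrow> fld p = fld q"
proof -
  assume "even p = even q"
  then have "LF p B \<longleftrightarrow> LF q B" for B using LF_cong by blast
  then show ?thesis by (simp add: fld_def fun_eq_iff)
qed

definition y :: "'v \<Rightarrow> 'v field" where
  "y v n w = fld 0 (pr 0 v) n w + fld 1 (pr 1 v) n w"

lemma y_Vgr: "v \<in> Vgr p \<Longrightarrow> y v = fld p v"
  using fld_cong[of p 0] fld_cong[of p 1]
  by (cases "even p") (simp_all add: y_def fun_eq_iff pr_eq fld_0)

lemma LF_y: "v \<in> Vgr p \<Longrightarrow> LF p (y v)" "v \<in> Vgr p \<Longrightarrow> y v (- 1) vac = v"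
  by (simp_all add: y_Vgr fld_LF)

lemma y_eq: "LF p B \<Longrightarrow> y (B (- 1) vac) = B"
  by (simp add: y_Vgr[OF LF_vac_Vgr] fld_eq)

lemma y_add: "y (u + v) n w = y u n w + y v n w"
  by (simp add: y_def lin_add[OF pr_lin] fld_add[OF pr_Vgr pr_Vgr])

lemma y_scale: "y (scale c v) n w = scale c (y v n w)"
  by (simp add: y_def lin_scale[OF pr_lin] fld_scale[OF pr_Vgr] scale_right_distrib)

lemma y_0: "y 0 n w = 0"
  using y_scale[of 0 0] by simp


lemma y_split: "y v n w = y (pr 0 v) n w + y (pr 1 v) n w"
  by (simp add: y_Vgr[OF pr_Vgr] y_def)

lemma y_op: "is_op (y v n)"
proof -
  have "is_op (\<lambda>w. y (pr 0 v) n w + y (pr 1 v) n w)"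
    by (rule is_op_add[OF LF_op[OF LF_y(1)[OF pr_Vgr]] LF_op[OF LF_y(1)[OF pr_Vgr]]])
  moreover have "y v n = (\<lambda>w. y (pr 0 v) n w + y (pr 1 v) n w)" by (rule ext) (rule y_split)
  ultimately show ?thesis by (simp only:)
qed

lemma y_field: "is_field (y v)" unfolding is_field_def
proof
  fix w
  obtain M1 where "\<forall>n\<ge>M1. y (pr 0 v) n w = 0"
    by (rule is_fieldE[OF LF_field[OF LF_y(1)[OF pr_Vgr]]])
  moreover obtain M2 where "\<forall>n\<ge>M2. y (pr 1 v) n w = 0"
    by (rule is_fieldE[OF LF_field[OF LF_y(1)[OF pr_Vgr]]])
  ultimately show "\<exists>M. \<forall>n\<ge>M. y v n w = 0"
    unfolding y_split[of v] by (intro exI[of _ "max M1 M2"]) simp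
qed

lemma y_vac: "n \<ge> 0 \<Longrightarrow> y v n vac = 0"
  using y_split[of v n vac] by (simp add: LF_vac[OF LF_y(1)[OF pr_Vgr]])

lemma y_vac_value: "y v (- 1) vac = P v"
  using y_split[of v "-1" vac] by (simp only: LF_y(2)[OF pr_Vgr] pr_sum)

lemma y_T: "T (y v n w) - y v n (T w) = scale (- of_int n) (y v (n - 1) w)"
  using LF_T[OF LF_y(1)[OF pr_Vgr[of 0 v]], of n w] LF_T[OF LF_y(1)[OF pr_Vgr[of 1 v]], of n w]
  by (subst (1 2 3) y_split) (simp add: lin_add[OF op_T(1)] scale_right_distrib algebra_simps)

lemma y_par: "v \<in> Vgr p \<Longrightarrow> y v n (par w) = sg p (par (y v n w))"
  using LF_par[OF LF_y(1)] by blast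

lemma S_Vgr: "i \<in> {1..N} \<Longrightarrow> v \<in> Vgr p \<Longrightarrow> S i v \<in> Vgr (p + 1)"
  by (simp add: Vgr_def op_S par_S lin_sg[OF op_S(1)] sg_Suc)

text \<open>The left side is an admissible field by \<open>LF_S\<close>. Since S^i kills the vacuum
  its state is S^i v, and a field is determined by its state.\<close>

lemma y_S:
  assumes i: "i \<in> {1..N}" and v: "v \<in> Vgr p"
  shows "S i (y v n w) - sg p (y v n (S i w)) = y (S i v) n w"
  using y_eq[OF LF_S[OF LF_y(1)[OF v] i]]
  by (simp add: LF_y(2)[OF v] S_vac[OF i] lin_0[OF LF_lin[OF LF_y(1)[OF v]]] fun_eq_iff)

text \<open>\<open>LF\<close> gives locality with the generators; the span induction extends it to
  all states, with A kept fixed. The field of \<open>x a (- 1) v\<close> is a normally ordered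
  product, local with A by Dong's lemma as both factors are.\<close>

lemma y_local_LF:
  assumes v: "v \<in> Vgr p" and A: "LF q A"
  shows "\<exists>r. mutually_local (p * q) r (y v) A"
proof -
  define H where "H = {v. \<forall>p. \<exists>r. mutually_local (p * q) r (y (pr p v)) A}"
  note Aadd = additive_lin[OF LF_lin[OF A]]
  have "subspace H" unfolding subspace_def
  proof (intro conjI ballI allI)
    show "0 \<in> H" using mutually_local_zero[of A] lin_0[OF LF_lin[OF A]]
      by (simp add: H_def lin_0[OF pr_lin] y_0[abs_def])
  next
    fix u v assume uv: "u \<in> H" "v \<in> H"
    have "\<exists>r. mutually_local (p * q) r (y (pr p (u + v))) A" for p
    proof -
      obtain r s where "mutually_local (p * q) r (y (pr p u)) A" "mutually_local (p * q) s (y (pr p v)) A"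
        using uv unfolding H_def by blast
      from mutually_local_add[OF this Aadd] show ?thesis
        by (auto simp: lin_add[OF pr_lin] y_add[abs_def])
    qed
    then show "u + v \<in> H" by (simp add: H_def)
  next
    fix c v assume v: "v \<in> H"
    have "\<exists>r. mutually_local (p * q) r (y (pr p (scale c v))) A" for p
    proof -
      obtain r where r: "mutually_local (p * q) r (y (pr p v)) A"
        using v unfolding H_def by blast
      have ad: "additive (scale c)" by (simp add: additive_def scale_right_distrib)
      have "mutually_local (p * q) r (y (pr p (scale c v))) A" unfolding mutually_local_def
      proof
        fix w
        have "(\<lambda>m n. y (pr p (scale c v)) m (A n w) - sg (p * q) (A n (y (pr p (scale c v)) m w))) =
            (\<lambda>m n. scale c (y (pr p v) m (A n w) - sg (p * q) (A n (y (pr p v) m w))))"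
          by (simp add: lin_scale[OF pr_lin] y_scale lin_scale[OF LF_lin[OF A]] sg_scale scale_right_diff_distrib)
        then show "(zw ^^ r) (\<lambda>m n. y (pr p (scale c v)) m (A n w) - sg (p * q) (A n (y (pr p (scale c v)) m w))) = (\<lambda>m n. 0)"
          using r by (simp add: zw_pow_lin[OF ad] mutually_local_def)
      qed
      then show ?thesis by blast
    qed
    then show "scale c v \<in> H" by (simp add: H_def)
  qed
  moreover have "vac \<in> H"
  proof -
    have "\<exists>r. mutually_local (p * q) r (y (pr p vac)) A" for p
    proof (cases "even p")
      case True
      have "y vac = idf" using y_eq[OF LF_idf] by (simp add: idf_def P_vac)
      then have "mutually_local (p * q) 0 (y (pr p vac)) A"
        using True mutually_local_cong[OF idf_local[OF LF_op[OF A]], of "p * q"] by (simp add: pr_eq[OF vac_Vgr])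
      then show ?thesis by blast
    next
      case False
      then show ?thesis using mutually_local_zero[of A] lin_0[OF LF_lin[OF A]] by (simp add: pr_eq[OF vac_Vgr] y_0[abs_def])
    qed
    then show ?thesis by (simp add: H_def)
  qed
  moreover have "x a (- 1) v \<in> H" if a: "a \<in> G t" and v: "v \<in> H" for t a v
  proof -
    have "\<exists>r. mutually_local (p * q) r (y (pr p (x a (- 1) v))) A" for p
    proof -
      define B where "B = y (pr (p + t) v)"
      have B: "LF (p + t) B" "B (- 1) vac = pr (p + t) v" by (simp_all add: B_def LF_y[OF pr_Vgr])
      obtain r where "mutually_local ((p + t) * t) r B (x a)" using LF_local[OF B(1) a] by blast
      then have loc: "mutually_local (t * (p + t)) r (x a) B" by (metis mult.commute mutually_local_sym)
      then have "\<exists>r. mutually_local (t * (p + t)) r (x a) B" by blast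
      note nop = LF_nop[OF LF_gen[OF a] B(1) this]
      have "y (pr p (x a (- 1) v)) = nop (t * (p + t)) (x a) B"
        using y_eq[OF nop(1)] by (simp add: nop(2) B(2) pr_x[OF a])
      moreover obtain r1 where "mutually_local (q * t) r1 A (x a)" using LF_local[OF A a] by blast
      then have r1: "mutually_local (q * t) r1 (x a) A" by (rule mutually_local_sym)
      moreover obtain r2 where r2: "mutually_local ((p + t) * q) r2 B A" using v unfolding H_def B_def by blast
      ultimately obtain r where "mutually_local (q * t + (p + t) * q) r (y (pr p (x a (- 1) v))) A"
        using dong[OF additive_lin[OF op_x(1)[OF a]] additive_lin[OF LF_lin[OF B(1)]] Aadd x_field[OF a] LF_field[OF B(1)] loc r1 r2]
        by auto
      then show ?thesis using mutually_local_cong[of "q * t + (p + t) * q" r _ A "p * q"] by (auto simp: algebra_simps)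
    qed
    then show ?thesis by (simp add: H_def)
  qed
  ultimately have "P v \<in> H" using x_span by blast
  then obtain r where "mutually_local (p * q) r (y (pr p (P v))) A" unfolding H_def by blast
  moreover have "pr p (P v) = v" using v pr_eq[OF v, of p] by (simp add: Vgr_def)
  ultimately show ?thesis by auto
qed

lemma y_local: "u \<in> Vgr p \<Longrightarrow> v \<in> Vgr q \<Longrightarrow> \<exists>r. mutually_local (p * q) r (y u) (y v)"
  using y_local_LF LF_y(1) by blast

section \<open>Superfields\<close>

definition SS :: "nat set \<Rightarrow> 'v \<Rightarrow> 'v" where
  "SS I = foldr S (sorted_list_of_set I)"

text \<open>S^i is moved to its sorted position with one sign for each smaller index. If i already
  occurs, the two copies meet and give zero, since S^i anticommutes with itself.\<close>

lemma S_foldr: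
  assumes "sorted xs" "distinct xs" "set xs \<subseteq> {1..N}" "i \<in> {1..N}"
  shows "S i (foldr S xs v) =
    (if i \<in> set xs then 0 else sg (length (filter (\<lambda>j. j < i) xs)) (foldr S (insort i xs) v))"
  using assms
proof (induction xs)
  case (Cons j xs)
  have IH: "S i (foldr S xs v) =
    (if i \<in> set xs then 0 else sg (length (filter (\<lambda>j. j < i) xs)) (foldr S (insort i xs) v))"
    using Cons by simp
  have i: "i \<in> {1..N}" and j: "j \<in> {1..N}" using Cons.prems by auto
  consider "i < j" | "i = j" | "j < i" by linarith
  then show ?case
  proof cases
    case 1
    then have "filter (\<lambda>j. j < i) (j # xs) = []" "i \<notin> set (j # xs)" using Cons.prems
      by (auto simp: filter_empty_conv)
    then show ?thesis using 1 by (simp del: filter.simps)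
  next
    case 2
    define u where "u = S i (S i (foldr S xs v))"
    have "u = - u" unfolding u_def by (rule S_S[OF i i])
    then have "scale 2 u = 0" using scale_left_distrib[of 1 1 u] by (metis add.right_inverse one_add_one scale_one)
    then have "u = 0" by simp
    then show ?thesis using 2 by (simp add: u_def)
  next
    case 3
    have "S i (foldr S (j # xs) v) = - S j (S i (foldr S xs v))" using S_S[OF i j] by simp
    then show ?thesis using 3 by (simp add: IH lin_0[OF op_S(1)[OF j]] lin_sg[OF op_S(1)[OF j]] sg_Suc)
  qed
qed simp

lemma sgm_singleton: "i \<notin> I \<Longrightarrow> finite I \<Longrightarrow> sgm {i} I = (- 1) ^ length (filter (\<lambda>j. j < i) (sorted_list_of_set I))"
proof -
  assume i: "i \<notin> I" "finite I"
  have "{(i', j). i' \<in> {i} \<and> j \<in> I \<and> j < i'} = Pair i ` {j \<in> I. j < i}" by auto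
  then have "card {(i', j). i' \<in> {i} \<and> j \<in> I \<and> j < i'} = card {j \<in> I. j < i}"
    by (simp add: card_image inj_on_def)
  also have "{j \<in> I. j < i} = set (filter (\<lambda>j. j < i) (sorted_list_of_set I))" using i by auto
  also have "card \<dots> = length (filter (\<lambda>j. j < i) (sorted_list_of_set I))"
    by (rule distinct_card) simp
  finally show ?thesis using i by (simp add: sgm_def)
qed

lemma S_SS:
  assumes "i \<in> {1..N}" "I \<subseteq> {1..N}"
  shows "S i (SS I v) = (if i \<in> I then 0 else scale (sgm {i} I) (SS (insert i I) v))"
proof -
  have fin: "finite I" using assms finite_subset by blast
  have "sg k u = scale ((- 1) ^ k) u" for k u by (simp add: sg_def)
  then show ?thesis using S_foldr[of "sorted_list_of_set I" i v] assms fin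
    by (simp add: SS_def sgm_singleton sorted_list_of_set_insert)
qed

lemma SS_Vgr: "I \<subseteq> {1..N} \<Longrightarrow> v \<in> Vgr p \<Longrightarrow> SS I v \<in> Vgr (p + card I)"
proof -
  assume I: "I \<subseteq> {1..N}" and v: "v \<in> Vgr p"
  have "foldr S xs v \<in> Vgr (p + length xs)" if "set xs \<subseteq> {1..N}" for xs
    using that v S_Vgr by (induction xs) auto
  from this[of "sorted_list_of_set I"] show ?thesis
    using I finite_subset[OF I] by (simp add: SS_def distinct_card[symmetric])
qed

lemma SS_lin: "I \<subseteq> {1..N} \<Longrightarrow> lin (SS I)"
proof -
  assume I: "I \<subseteq> {1..N}"
  have "lin (foldr S xs)" if "set xs \<subseteq> {1..N}" for xs
    using that op_S(1) by (induction xs) (auto simp: lin_iff)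
  then show ?thesis using I finite_subset[OF I] by (simp add: SS_def)
qed

text \<open>Since \<open>[S\<^sup>i, Y(a, Z)] = \<partial>\<^bsub>\<theta>\<^sup>i\<^esub> Y(a, Z)\<close>, the superfield \<open>Y(a, Z)\<close> is \<open>e\<^bsup>\<theta> S\<^esup>\<close> applied to the state \<open>a\<close> of \<open>y\<close>.\<close>

definition Y :: "'v \<Rightarrow> int \<Rightarrow> nat set \<Rightarrow> 'v \<Rightarrow> 'v" where
  "Y v n I w = sg (card I * (card I - 1) div 2) (y (SS I v) (- 1 - n) w)"

lemma Y_op: "is_op (Y v n I)"
  unfolding Y_def[abs_def] by (intro is_op_sg y_op)

lemma Y_add: "I \<subseteq> {1..N} \<Longrightarrow> Y (u + v) n I w = Y u n I w + Y v n I w"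
  by (simp add: Y_def lin_add[OF SS_lin] y_add sg_add)

lemma Y_scale: "I \<subseteq> {1..N} \<Longrightarrow> Y (scale c v) n I w = scale c (Y v n I w)"
  by (simp add: Y_def lin_scale[OF SS_lin] y_scale sg_scale)

lemma Y_par: "I \<subseteq> {1..N} \<Longrightarrow> v \<in> Vgr p \<Longrightarrow> Y v n I (par w) = sg (p + card I) (par (Y v n I w))"
  by (simp add: Y_def y_par[OF SS_Vgr] lin_sg[OF op_par(1)] sg_sg add.commute)

lemma Y_field: "\<exists>M. \<forall>n<M. \<forall>I\<subseteq>{1..N}. Y v n I w = 0"
proof -
  have "\<exists>M. \<forall>I\<in>Pow {1..N}. \<forall>n\<ge>M. y (SS I v) n w = 0"
  proof -
    have "\<forall>I. \<exists>M. \<forall>n\<ge>M. y (SS I v) n w = 0" using y_field by (simp add: is_field_def)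
    then obtain M where M: "\<And>I n. n \<ge> M I \<Longrightarrow> y (SS I v) n w = 0" by metis
    have "M I \<le> Max (M ` Pow {1..N})" if "I \<in> Pow {1..N}" for I by (rule Max_ge) (use that in auto)
    then show ?thesis by (intro exI[of _ "Max (M ` Pow {1..N})"]) (meson M order_trans)
  qed
  then obtain M where "\<forall>I\<in>Pow {1..N}. \<forall>n\<ge>M. y (SS I v) n w = 0" by blast
  then show ?thesis by (intro exI[of _ "- M"]) (simp add: Y_def)
qed

lemma Y_vac: "n < 0 \<Longrightarrow> Y v n I vac = 0"
  by (simp add: Y_def y_vac)

lemma Y_vac_value: "Y v 0 {} vac = P v"
  by (simp add: Y_def SS_def y_vac_value)

lemma Y_T: "T (Y v n I w) - Y v n I (T w) = scale (of_int (n + 1)) (Y v (n + 1) I w)"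
proof -
  have "- (- 1 - n) = n + 1" and "- 1 - n - 1 = - 1 - (n + 1)" by simp_all
  then show ?thesis
    using y_T[of "SS I v" "- 1 - n" w] unfolding of_int_minus[symmetric]
    by (simp only: Y_def lin_sg[OF op_T(1)] sg_scale[symmetric] sg_diff[symmetric])
qed

text \<open>By \<open>y_S\<close> the commutator replaces the state S^I v by S^i S^I v, and
  \<open>S_SS\<close> sorts this into \<sigma>({i}, I) times the ordered monomial, or into zero for
  i in I.\<close>

lemma Y_S:
  assumes i: "i \<in> {1..N}" and I: "I \<subseteq> {1..N}" and v: "v \<in> Vgr p"
  shows "sg (card I) (S i (Y v n I w) - sg (p + card I) (Y v n I (S i w))) =
    (if i \<in> I then 0 else scale (sgm {i} I) (Y v n (insert i I) w))"
proof -
  \<comment> \<open>The sign exponent in \<open>Y\<close> reorders \<theta>^{i1} S^{i1}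
    \<theta>^{i2} S^{i2} ... into \<theta>^I S^I. Its increment |I| absorbs the sign (-1)^|I| on the
    left side.\<close>
  define t where "t k = k * (k - 1) div 2" for k :: nat
  have t: "t (Suc k) = k + t k" for k
    unfolding t_def by (cases k) (auto simp: algebra_simps)
  have fin: "finite I" using I finite_subset by blast
  have "S i (Y v n I w) - sg (p + card I) (Y v n I (S i w)) =
      sg (t (card I)) (S i (y (SS I v) (- 1 - n) w) - sg (p + card I) (y (SS I v) (- 1 - n) (S i w)))"
    by (simp add: Y_def t_def lin_sg[OF op_S(1)[OF i]] sg_diff sg_sg add.commute)
  also have "\<dots> = sg (t (card I)) (y (S i (SS I v)) (- 1 - n) w)"
    by (simp add: y_S[OF i SS_Vgr[OF I v]])
  finally have 1: "S i (Y v n I w) - sg (p + card I) (Y v n I (S i w)) = sg (t (card I)) (y (S i (SS I v)) (- 1 - n) w)" .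
  have 2: "Y v n (insert i I) w = sg (card I + t (card I)) (y (SS (insert i I) v) (- 1 - n) w)" if "i \<notin> I"
    using that fin by (simp add: Y_def flip: t t_def) (simp add: t_def)
  show ?thesis
    unfolding 1 using 2 by (simp add: S_SS[OF i I] y_0 y_scale sg_sg sg_scale)
qed

text \<open>There are finitely many pairs I, K, so the maximum of their locality orders serves all.
  The indices -1 - m turn exponents back into modes, on which \<open>zw\<close> acts.\<close>

lemma Y_local:
  assumes u: "u \<in> Vgr p" and v: "v \<in> Vgr q"
  shows "\<exists>r. \<forall>I\<subseteq>{1..N}. \<forall>K\<subseteq>{1..N}. \<forall>w. \<forall>m k.
    (zw ^^ r) (\<lambda>m k. sg (card K * (p + card I)) (Y u (- 1 - m) I (Y v (- 1 - k) K w)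
      - sg ((p + card I) * (q + card K)) (Y v (- 1 - k) K (Y u (- 1 - m) I w)))) m k = 0"
proof -
  have "\<forall>I K. \<exists>r. I \<in> Pow {1..N} \<longrightarrow> K \<in> Pow {1..N} \<longrightarrow>
      mutually_local ((p + card I) * (q + card K)) r (y (SS I u)) (y (SS K v))"
    using y_local[OF SS_Vgr[OF _ u] SS_Vgr[OF _ v]] by simp
  then obtain r where r: "\<And>I K. I \<in> Pow {1..N} \<Longrightarrow> K \<in> Pow {1..N} \<Longrightarrow>
      mutually_local ((p + card I) * (q + card K)) (r I K) (y (SS I u)) (y (SS K v))"
    by metis
  define s where "s = Max ((\<lambda>(I, K). r I K) ` (Pow {1..N} \<times> Pow {1..N}))"
  have loc: "mutually_local ((p + card I) * (q + card K)) s (y (SS I u)) (y (SS K v))"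
    if "I \<subseteq> {1..N}" "K \<subseteq> {1..N}" for I K
  proof (rule mutually_local_mono[OF r])
    show "r I K \<le> s" unfolding s_def by (rule Max_ge) (use that in auto)
  qed (use that in auto)
  have "(zw ^^ s) (\<lambda>m k. sg (card K * (p + card I)) (Y u (- 1 - m) I (Y v (- 1 - k) K w)
      - sg ((p + card I) * (q + card K)) (Y v (- 1 - k) K (Y u (- 1 - m) I w)))) = (\<lambda>m k. 0)"
    if I: "I \<subseteq> {1..N}" and K: "K \<subseteq> {1..N}" for I K w
  proof -
    define e where "e = card K * (p + card I) + card I * (card I - 1) div 2 + card K * (card K - 1) div 2"
    have "sg (card K * (p + card I)) (Y u (- 1 - m) I (Y v (- 1 - k) K w)
      - sg ((p + card I) * (q + card K)) (Y v (- 1 - k) K (Y u (- 1 - m) I w))) =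
      sg e (y (SS I u) m (y (SS K v) k w) - sg ((p + card I) * (q + card K)) (y (SS K v) k (y (SS I u) m w)))" for m k
      by (simp add: Y_def lin_sg[OF op_lin[OF y_op]] sg_diff sg_sg e_def ac_simps)
    moreover have "(zw ^^ s) (\<lambda>m k. y (SS I u) m (y (SS K v) k w)
        - sg ((p + card I) * (q + card K)) (y (SS K v) k (y (SS I u) m w))) = (\<lambda>m k. 0)"
      using loc[OF I K] by (simp add: mutually_local_def)
    ultimately show ?thesis by (simp only: zw_pow_lin[OF additive_sg_self] sg_0)
  qed
  then show ?thesis by (intro exI[of _ s]) (simp add: fun_eq_iff)
qed

end

section \<open>Quotients of superspaces\<close>

lemma complex_ring_simps [simp]: "carrier complex_ring = UNIV" "mult complex_ring = (*)"
  "one complex_ring = 1" "zero complex_ring = 0" "add complex_ring = (+)"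
  by (simp_all add: complex_ring_def)

lemma cring_complex_ring: "cring complex_ring"
proof (rule cringI)
  show "abelian_group complex_ring"
    by (rule abelian_groupI) (auto simp: algebra_simps intro: exI[of _ "- x" for x] right_minus)
  show "comm_monoid complex_ring"
    by (rule comm_monoidI) (auto simp: algebra_simps)
qed (auto simp: algebra_simps)

text \<open>\<open>quot\<close> occurs in three layers, for the loop space, the free algebra and the
  enveloping superalgebra; this locale serves them all.\<close>

locale quotient_module =
  fixes V :: "('a, 'm) superspace_scheme" (structure) and K :: "'a set"
  assumes mod: "Module.module complex_ring V" and sub: "submodule K complex_ring V"
begin

sublocale M: Module.module complex_ring V by (rule mod)

lemma K_subset: "K \<subseteq> carrier V" and K_zero: "\<zero> \<in> K" and K_neg: "x \<in> K \<Longrightarrow> \<ominus> x \<in> K"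
  and K_smult: "x \<in> K \<Longrightarrow> c \<odot> x \<in> K" and K_add: "x \<in> K \<Longrightarrow> y \<in> K \<Longrightarrow> x \<oplus> y \<in> K"
proof -
  note K = M.submoduleE[OF sub]
  show "K \<subseteq> carrier V" "x \<in> K \<Longrightarrow> \<ominus> x \<in> K" "x \<in> K \<Longrightarrow> c \<odot> x \<in> K" "x \<in> K \<Longrightarrow> y \<in> K \<Longrightarrow> x \<oplus> y \<in> K"
    using K by auto
  obtain k where "k \<in> K" using K(2) by blast
  then have "k \<oplus> \<ominus> k \<in> K" using K by blast
  then show "\<zero> \<in> K" using \<open>k \<in> K\<close> K(1) by (simp add: M.r_neg subset_iff)
qed

lemma abelian_subgroup: "abelian_subgroup K V"
proof (rule abelian_subgroupI3)
  show "additive_subgroup K V" using sub by (simp add: additive_subgroup_def submodule_def)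
qed (rule M.abelian_group_axioms)

sublocale S: abelian_subgroup K V by (rule abelian_subgroup)

abbreviation "q x \<equiv> K +> x"

lemma q_eq_iff: "x \<in> carrier V \<Longrightarrow> y \<in> carrier V \<Longrightarrow> q x = q y \<longleftrightarrow> x \<ominus> y \<in> K"
proof -
  assume xy: "x \<in> carrier V" "y \<in> carrier V"
  have "q x = q y \<longleftrightarrow> x \<in> q y"
    using S.a_repr_independence' S.a_rcos_self xy by metis
  also have "\<dots> \<longleftrightarrow> x \<ominus> y \<in> K"
  proof
    assume "x \<in> q y"
    then obtain k where "k \<in> K" "x = k \<oplus> y" by (auto simp: a_r_coset_def')
    then show "x \<ominus> y \<in> K" using xy K_subset by (auto simp: a_minus_def M.a_assoc M.r_neg)
  next
    assume "x \<ominus> y \<in> K"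
    moreover have "x = (x \<ominus> y) \<oplus> y" using xy by (simp add: a_minus_def M.a_assoc M.l_neg)
    ultimately show "x \<in> q y" by (auto simp: a_r_coset_def')
  qed
  finally show ?thesis .
qed

lemma q_eq_K_iff: "x \<in> carrier V \<Longrightarrow> q x = K \<longleftrightarrow> x \<in> K"
  using S.a_rcos_self S.a_rcos_const by blast

lemma quot_carrier: "carrier (quot V K) = q ` carrier V"
  by (auto simp: quot_def A_RCOSETS_def')

lemma quot_add: "x \<in> carrier V \<Longrightarrow> y \<in> carrier V \<Longrightarrow> q x \<oplus>\<^bsub>quot V K\<^esub> q y = q (x \<oplus> y)"
  by (simp add: quot_def S.a_rcos_sum)

lemma quot_zero: "\<zero>\<^bsub>quot V K\<^esub> = K" "q \<zero> = K"
  by (simp_all add: quot_def q_eq_K_iff K_zero)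

text \<open>The union in the definition of \<open>quot\<close> collapses: all members of a coset
  yield the same class.\<close>

lemma quot_smult: assumes "x \<in> carrier V" shows "c \<odot>\<^bsub>quot V K\<^esub> q x = q (c \<odot> x)"
proof -
  have "q (c \<odot> y) = q (c \<odot> x)" if "y \<in> q x" for y
  proof -
    have y: "y \<in> carrier V" using that assms S.a_rcosets_carrier[of "q x"] by (auto simp: A_RCOSETS_def')
    have "q y = q x" using that assms S.a_repr_independence' by metis
    then have "y \<ominus> x \<in> K" using q_eq_iff y assms by blast
    then have "c \<odot> (y \<ominus> x) \<in> K" by (rule K_smult)
    then have "c \<odot> y \<ominus> c \<odot> x \<in> K" using y assms by (simp add: a_minus_def M.smult_r_distr M.smult_r_minus)
    then show ?thesis using q_eq_iff y assms by simp
  qed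
  then have "(\<Union>y\<in>q x. q (c \<odot> y)) = (\<Union>y\<in>q x. q (c \<odot> x))" by (rule SUP_cong[OF refl])
  also have "\<dots> = q (c \<odot> x)" using S.a_rcos_self[OF assms] by blast
  finally show ?thesis by (simp add: quot_def)
qed

lemma gr_quot: "gr (quot V K) p = q ` gr V p"
  by (simp add: gr_def quot_def)

lemma module_quot: "Module.module complex_ring (quot V K)"
proof (rule Module.moduleI[OF cring_complex_ring])
  show "abelian_group (quot V K)"
  proof (rule abelian_groupI)
    show "\<zero>\<^bsub>quot V K\<^esub> \<in> carrier (quot V K)"
      using quot_zero by (auto simp: quot_carrier intro: image_eqI[of _ _ "\<zero>"])
    show "\<And>x. x \<in> carrier (quot V K) \<Longrightarrow> \<exists>y\<in>carrier (quot V K). y \<oplus>\<^bsub>quot V K\<^esub> x = \<zero>\<^bsub>quot V K\<^esub>"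
    proof -
      fix X assume "X \<in> carrier (quot V K)"
      then obtain x where x: "x \<in> carrier V" "X = q x" by (auto simp: quot_carrier)
      then show "\<exists>y\<in>carrier (quot V K). y \<oplus>\<^bsub>quot V K\<^esub> X = \<zero>\<^bsub>quot V K\<^esub>"
        by (intro bexI[of _ "q (\<ominus> x)"]) (auto simp: quot_carrier quot_add M.l_neg quot_zero)
    qed
    show "\<And>x. x \<in> carrier (quot V K) \<Longrightarrow> \<zero>\<^bsub>quot V K\<^esub> \<oplus>\<^bsub>quot V K\<^esub> x = x"
      using quot_add[OF M.zero_closed] by (auto simp: quot_carrier quot_zero)
  qed (auto simp: quot_carrier quot_add M.add.m_ac)
qed (auto simp: quot_carrier quot_add quot_smult M.smult_closed[simplified] M.smult_r_distr[simplified]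
    M.smult_l_distr[simplified] M.smult_assoc1[simplified] M.smult_one[simplified])

lemma quot_neg: "x \<in> carrier V \<Longrightarrow> \<ominus>\<^bsub>quot V K\<^esub> q x = q (\<ominus> x)"
proof -
  assume x: "x \<in> carrier V"
  interpret Q: Module.module complex_ring "quot V K" by (rule module_quot)
  have "q (\<ominus> x) \<oplus>\<^bsub>quot V K\<^esub> q x = \<zero>\<^bsub>quot V K\<^esub>" using x by (simp add: quot_add M.l_neg quot_zero)
  then show ?thesis using x Q.minus_equality[of "q (\<ominus> x)" "q x"] by (auto simp: quot_carrier)
qed

lemma quot_minus: "x \<in> carrier V \<Longrightarrow> y \<in> carrier V \<Longrightarrow> q x \<ominus>\<^bsub>quot V K\<^esub> q y = q (x \<ominus> y)"
  by (simp add: a_minus_def quot_neg quot_add)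

lemma submodule_image:
  assumes "submodule H complex_ring V" shows "submodule (q ` H) complex_ring (quot V K)"
proof -
  interpret Q: Module.module complex_ring "quot V K" by (rule module_quot)
  interpret H: quotient_module V H by (rule quotient_module.intro[OF mod assms])
  have H: "H \<subseteq> carrier V" by (rule H.K_subset)
  show ?thesis
  proof (rule Q.submoduleI)
    show "q ` H \<subseteq> carrier (quot V K)" using H by (auto simp: quot_carrier)
    show "\<zero>\<^bsub>quot V K\<^esub> \<in> q ` H" using H.K_zero quot_zero by (metis image_eqI)
    show "\<And>a. a \<in> q ` H \<Longrightarrow> \<ominus>\<^bsub>quot V K\<^esub> a \<in> q ` H" using H H.K_neg by (auto simp: quot_neg subset_iff)
    show "\<And>a b. a \<in> q ` H \<Longrightarrow> b \<in> q ` H \<Longrightarrow> a \<oplus>\<^bsub>quot V K\<^esub> b \<in> q ` H"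
      using H H.K_add by (auto simp: quot_add subset_iff)
    show "\<And>a x. a \<in> carrier complex_ring \<Longrightarrow> x \<in> q ` H \<Longrightarrow> a \<odot>\<^bsub>quot V K\<^esub> x \<in> q ` H"
      using H H.K_smult by (auto simp: quot_smult subset_iff)
  qed
qed

text \<open>The two parts are asked to decompose V only modulo K. This covers the free algebra,
  whose parts are spanned by words in homogeneous letters and miss the inhomogeneous
  letters.\<close>

lemma is_superspace_quot:
  assumes ev: "submodule (even_part V) complex_ring V" and od: "submodule (odd_part V) complex_ring V"
    and Int: "\<And>x y. x \<in> even_part V \<Longrightarrow> y \<in> odd_part V \<Longrightarrow> x \<ominus> y \<in> K \<Longrightarrow> x \<in> K"
    and Un: "\<And>x. x \<in> carrier V \<Longrightarrow> \<exists>y\<in>even_part V. \<exists>z\<in>odd_part V. x \<ominus> (y \<oplus> z) \<in> K"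
  shows "is_superspace (quot V K)"
proof -
  have e: "even_part V \<subseteq> carrier V" "odd_part V \<subseteq> carrier V"
    using M.submoduleE(1) ev od by auto
  have 0: "\<zero> \<in> even_part V" "\<zero> \<in> odd_part V"
    using ev od quotient_module.K_zero[OF quotient_module.intro[OF mod]] by auto
  have parts: "even_part (quot V K) = q ` even_part V" "odd_part (quot V K) = q ` odd_part V"
    by (simp_all add: quot_def)
  have "q ` even_part V \<inter> q ` odd_part V = {\<zero>\<^bsub>quot V K\<^esub>}"
  proof (intro equalityI subsetI)
    fix X assume "X \<in> q ` even_part V \<inter> q ` odd_part V"
    then obtain x y where xy: "x \<in> even_part V" "y \<in> odd_part V" "X = q x" "q x = q y" by auto
    then have "x \<ominus> y \<in> K" using q_eq_iff e by blast
    then have "x \<in> K" using Int xy by blast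
    then have "q x = K" using q_eq_K_iff[of x] e xy(1) by blast
    then show "X \<in> {\<zero>\<^bsub>quot V K\<^esub>}" using xy by (simp add: quot_zero)
  qed (use 0 quot_zero in \<open>auto intro: image_eqI[of _ _ \<zero>]\<close>)
  moreover have "carrier (quot V K) = q ` even_part V <+>\<^bsub>quot V K\<^esub> q ` odd_part V"
  proof (intro equalityI subsetI)
    fix X assume "X \<in> carrier (quot V K)"
    then obtain x where x: "x \<in> carrier V" "X = q x" by (auto simp: quot_carrier)
    obtain y z where yz: "y \<in> even_part V" "z \<in> odd_part V" "x \<ominus> (y \<oplus> z) \<in> K" using Un x by blast
    then have "y \<in> carrier V" "z \<in> carrier V" using e by auto
    then have "X = q y \<oplus>\<^bsub>quot V K\<^esub> q z" using yz x q_eq_iff by (simp add: quot_add)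
    then show "X \<in> q ` even_part V <+>\<^bsub>quot V K\<^esub> q ` odd_part V" using yz by (auto simp: set_add_def')
  next
    fix X assume "X \<in> q ` even_part V <+>\<^bsub>quot V K\<^esub> q ` odd_part V"
    then obtain y z where "y \<in> even_part V" "z \<in> odd_part V" "X = q y \<oplus>\<^bsub>quot V K\<^esub> q z" by (auto simp: set_add_def')
    moreover then have "y \<in> carrier V" "z \<in> carrier V" using e by auto
    ultimately show "X \<in> carrier (quot V K)" by (simp add: quot_add quot_carrier)
  qed
  ultimately show ?thesis
    using module_quot submodule_image[OF ev] submodule_image[OF od]
    by (simp add: is_superspace_def parts)
qed

end

text \<open>
  Superspaces whose operations are those of a vector space given by type classes: the loop space and
  the free algebra.
\<close>

locale concrete_space = vector_space scale
  for scale :: "complex \<Rightarrow> 'a::ab_group_add \<Rightarrow> 'a" +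
  fixes V :: "('a, 'm) superspace_scheme"
  assumes add_V: "add V = (+)" and zero_V: "zero V = 0" and smult_V: "smult V = scale"
    and carrier_V: "subspace (carrier V)"
begin

lemma module_V: "Module.module complex_ring V"
proof (rule Module.moduleI[OF cring_complex_ring])
  note c = subspace_0[OF carrier_V] subspace_add[OF carrier_V] subspace_neg[OF carrier_V] subspace_scale[OF carrier_V]
  show "abelian_group V"
    by (rule abelian_groupI) (auto simp: add_V zero_V c algebra_simps intro: bexI[of _ "- x" for x])
qed (auto simp: add_V zero_V smult_V subspace_scale[OF carrier_V] scale_left_distrib scale_right_distrib)

sublocale M: Module.module complex_ring V by (rule module_V)

lemma a_inv_V: "x \<in> carrier V \<Longrightarrow> \<ominus>\<^bsub>V\<^esub> x = - x"
  by (rule M.minus_equality) (auto simp: add_V zero_V subspace_neg[OF carrier_V])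

lemma a_minus_V: "y \<in> carrier V \<Longrightarrow> x \<ominus>\<^bsub>V\<^esub> y = x - y"
  by (simp add: a_minus_def a_inv_V add_V)

lemma submodule_iff: "submodule H complex_ring V \<longleftrightarrow> subspace H \<and> H \<subseteq> carrier V"
proof
  assume H: "submodule H complex_ring V"
  interpret H: quotient_module V H by (rule quotient_module.intro[OF module_V H])
  show "subspace H \<and> H \<subseteq> carrier V"
    using H.K_zero H.K_add H.K_smult H.K_subset by (auto simp: subspace_def add_V zero_V smult_V)
next
  assume "subspace H \<and> H \<subseteq> carrier V"
  then show "submodule H complex_ring V"
    by (intro M.submoduleI) (auto simp: add_V zero_V smult_V a_inv_V subset_iff subspace_0 subspace_add subspace_neg subspace_scale)
qed

lemma lin_span_eq: "X \<subseteq> carrier V \<Longrightarrow> lin_span V X = span X"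
proof (intro equalityI)
  assume X: "X \<subseteq> carrier V"
  have "submodule (span X) complex_ring V"
    using X carrier_V by (simp add: submodule_iff subspace_span span_minimal)
  then show "lin_span V X \<subseteq> span X" using span_superset by (auto simp: lin_span_def)
  show "span X \<subseteq> lin_span V X"
    unfolding lin_span_def submodule_iff using span_minimal by blast
qed

end

section \<open>Free algebras and universal enveloping superalgebras\<close>

lemma poly_mapping_sum_single:
  fixes f :: "'k \<Rightarrow>\<^sub>0 'b::comm_monoid_add"
  shows "f = (\<Sum>k\<in>Poly_Mapping.keys f. Poly_Mapping.single k (Poly_Mapping.lookup f k))"
proof (rule poly_mapping_eqI)
  fix k
  show "Poly_Mapping.lookup f k = Poly_Mapping.lookup (\<Sum>k\<in>Poly_Mapping.keys f. Poly_Mapping.single k (Poly_Mapping.lookup f k)) k"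
    by (simp add: lookup_sum lookup_single when_def in_keys_iff)
qed

lemma poly_mapping_single_induct [case_names zero single add]:
  fixes f :: "'k \<Rightarrow>\<^sub>0 'b::comm_monoid_add"
  assumes "P 0" "\<And>k. k \<in> Poly_Mapping.keys f \<Longrightarrow> P (Poly_Mapping.single k (Poly_Mapping.lookup f k))"
    and "\<And>f g. P f \<Longrightarrow> P g \<Longrightarrow> P (f + g)"
  shows "P f"
proof -
  have "P (\<Sum>k\<in>K. Poly_Mapping.single k (Poly_Mapping.lookup f k))" if "K \<subseteq> Poly_Mapping.keys f" for K
    using finite_subset[OF that finite_keys] that by (induction K) (auto intro: assms)
  from this[OF order_refl] show ?thesis by (simp flip: poly_mapping_sum_single)
qed

lemma pext_superset:
  assumes "finite K" "Poly_Mapping.keys f \<subseteq> K" "\<And>k. \<phi> k 0 = 0"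
  shows "pext \<phi> f = (\<Sum>k\<in>K. \<phi> k (Poly_Mapping.lookup f k))"
  unfolding pext_def by (rule sum.mono_neutral_left) (use assms in \<open>auto simp: in_keys_iff\<close>)

lemma pext_add:
  assumes "\<And>k x y. \<phi> k (x + y) = \<phi> k x + \<phi> k y" "\<And>k. \<phi> k 0 = 0"
  shows "pext \<phi> (f + g) = pext \<phi> f + pext \<phi> g"
proof -
  define K where "K = Poly_Mapping.keys f \<union> Poly_Mapping.keys g"
  have "finite K" "Poly_Mapping.keys f \<subseteq> K" "Poly_Mapping.keys g \<subseteq> K" "Poly_Mapping.keys (f + g) \<subseteq> K"
    using keys_add[of f g] by (auto simp: K_def)
  then show ?thesis by (simp add: pext_superset[of K] assms lookup_add sum.distrib)
qed

lemma pext_single: "(\<phi> k 0 = 0) \<Longrightarrow> pext \<phi> (Poly_Mapping.single k x) = \<phi> k x"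
  by (cases "x = 0") (simp_all add: pext_def)

lemma pext_zero [simp]: "pext \<phi> 0 = 0"
  by (simp add: pext_def)

section \<open>Linear maps, homomorphisms and twisted derivations on the free algebra\<close>

abbreviation fscale :: "complex \<Rightarrow> ('g word \<Rightarrow>\<^sub>0 complex) \<Rightarrow> ('g word \<Rightarrow>\<^sub>0 complex)" where
  "fscale c f \<equiv> fconst c * f"

lemma fconst_simps: "fconst 0 = 0" "fconst 1 = 1" "fconst (a + b) = fconst a + fconst b"
  "fconst (- a) = - fconst a" "fconst (a * b) = fconst a * fconst b"
  by (simp_all add: fconst_def single_add single_uminus mult_single)

lemma fconst_single: "fconst c * Poly_Mapping.single w a = Poly_Mapping.single w (c * a)"
  "Poly_Mapping.single w a * fconst c = Poly_Mapping.single w (c * a)"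
  by (simp_all add: fconst_def mult_single mult.commute)

lemma fconst_commute: "f * fconst c = fconst c * f"
  by (induction f rule: poly_mapping_single_induct) (simp_all add: fconst_single algebra_simps)

lemma fconst_left_commute: "f * (fconst c * h) = fconst c * (f * h)"
  by (metis fconst_commute mult.assoc)

lemma vector_space_fscale: "vector_space fscale"
  by standard (simp_all add: algebra_simps fconst_simps)

interpretation FS: vector_space fscale by (rule vector_space_fscale)

definition wd :: "'g list \<Rightarrow> 'g word \<Rightarrow>\<^sub>0 complex" where
  "wd xs = Poly_Mapping.single (Word xs) 1"

lemma wd_append: "wd (xs @ ys) = wd xs * wd ys"
  by (simp add: wd_def mult_single plus_word_def)

lemma wd_Nil: "wd [] = 1"
  by (metis single_one wd_def zero_word_def)

lemma wd_Cons: "wd (x # xs) = letter x * wd xs"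
  using wd_append[of "[x]" xs] by (simp add: wd_def letter_def)

lemma prod_list_letter: "prod_list (map letter xs) = wd xs"
  by (induction xs) (simp_all add: wd_Nil wd_Cons)

definition lext :: "('g list \<Rightarrow> 'h word \<Rightarrow>\<^sub>0 complex) \<Rightarrow> ('g word \<Rightarrow>\<^sub>0 complex) \<Rightarrow> 'h word \<Rightarrow>\<^sub>0 complex" where
  "lext b = pext (\<lambda>w c. fconst c * b (letters w))"

lemma lext_add: "lext b (f + h) = lext b f + lext b h"
  unfolding lext_def by (rule pext_add) (simp_all add: fconst_simps algebra_simps)

lemma lext_0 [simp]: "lext b 0 = 0"
  by (simp add: lext_def)

lemma lext_wd: "lext b (Poly_Mapping.single w c) = fconst c * b (letters w)" "lext b (wd xs) = b xs"
  by (simp_all add: lext_def wd_def pext_single fconst_simps)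

lemma lext_fscale: "lext b (fconst c * f) = fconst c * lext b f"
proof (induction f rule: poly_mapping_single_induct)
  case (single k)
  show ?case by (simp only: fconst_single lext_wd fconst_simps(5) mult.assoc)
qed (simp_all add: lext_add distrib_left)

lemma lext_minus: "lext b (- f) = - lext b f" and lext_diff: "lext b (f - h) = lext b f - lext b h"
proof -
  show "lext b (- f) = - lext b f" for f using lext_fscale[of b "-1" f] by (simp add: fconst_simps)
  from this[of h] show "lext b (f - h) = lext b f - lext b h" using lext_add[of b f "- h"] by simp
qed

lemma word_span_induct [case_names zero word add scale]:
  assumes "P 0" "\<And>xs. Word xs \<in> Poly_Mapping.keys f \<Longrightarrow> P (wd xs)"
    and "\<And>f g. P f \<Longrightarrow> P g \<Longrightarrow> P (f + g)" "\<And>c f. P f \<Longrightarrow> P (fconst c * f)"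
  shows "P f"
proof (induction f rule: poly_mapping_single_induct)
  case (single k)
  obtain xs where k: "k = Word xs" by (cases k)
  have "Poly_Mapping.single k (Poly_Mapping.lookup f k) = fconst (Poly_Mapping.lookup f k) * wd xs"
    by (simp add: wd_def fconst_single k)
  then show ?case using assms single k by simp
qed (use assms in auto)

definition lmap :: "('g \<Rightarrow> 'h) \<Rightarrow> ('g word \<Rightarrow>\<^sub>0 complex) \<Rightarrow> 'h word \<Rightarrow>\<^sub>0 complex" where
  "lmap t = lext (\<lambda>xs. wd (map t xs))"

lemma lmap_wd: "lmap t (wd xs) = wd (map t xs)" and lmap_letter: "lmap t (letter x) = letter (t x)"
  and lmap_add: "lmap t (f + h) = lmap t f + lmap t h" and lmap_fscale: "lmap t (fconst c * f) = fconst c * lmap t f"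
  and lmap_diff: "lmap t (f - h) = lmap t f - lmap t h" and lmap_0: "lmap t 0 = 0"
  using lext_wd(2)[of "\<lambda>xs. wd (map t xs)" "[x]"]
  by (simp_all add: lmap_def lext_wd lext_add lext_fscale lext_diff wd_def letter_def)

lemma lmap_mult: "lmap t (f * h) = lmap t f * lmap t h"
proof (induction f rule: word_span_induct)
  case (word xs)
  show ?case
    by (induction h rule: word_span_induct)
      (simp_all add: lmap_0 lmap_add lmap_fscale lmap_wd distrib_left fconst_left_commute flip: wd_append)
qed (simp_all add: lmap_0 lmap_add lmap_fscale distrib_right mult.assoc)

lemma lmap_id: "lmap id f = f"
  by (induction f rule: word_span_induct) (simp_all add: lmap_0 lmap_add lmap_fscale lmap_wd)

text \<open>The derivation of the free algebra with \<open>D x = d x\<close> on letters, twisted by the automorphism \<open>t\<close>.\<close>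

fun dword :: "('g \<Rightarrow> 'g) \<Rightarrow> ('g \<Rightarrow> 'g) \<Rightarrow> 'g list \<Rightarrow> 'g word \<Rightarrow>\<^sub>0 complex" where
  "dword t d [] = 0"
| "dword t d (x # xs) = letter (d x) * wd xs + letter (t x) * dword t d xs"

definition lder :: "('g \<Rightarrow> 'g) \<Rightarrow> ('g \<Rightarrow> 'g) \<Rightarrow> ('g word \<Rightarrow>\<^sub>0 complex) \<Rightarrow> 'g word \<Rightarrow>\<^sub>0 complex" where
  "lder t d = lext (dword t d)"

lemma lder_add: "lder t d (f + h) = lder t d f + lder t d h" and lder_fscale: "lder t d (fconst c * f) = fconst c * lder t d f"
  and lder_diff: "lder t d (f - h) = lder t d f - lder t d h" and lder_0: "lder t d 0 = 0"
  and lder_wd: "lder t d (wd xs) = dword t d xs"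
  by (simp_all add: lder_def lext_add lext_fscale lext_diff lext_wd)

lemma lder_letter: "lder t d (letter x) = letter (d x)"
  using lder_wd[of t d "[x]"] by (simp add: wd_Cons wd_Nil)

lemma dword_append: "dword t d (xs @ ys) = dword t d xs * wd ys + wd (map t xs) * dword t d ys"
  by (induction xs) (simp_all add: wd_Nil wd_Cons wd_append algebra_simps)

lemma lder_mult: "lder t d (f * h) = lder t d f * h + lmap t f * lder t d h"
proof (induction f rule: word_span_induct)
  case (word xs)
  show ?case
    by (induction h rule: word_span_induct)
      (simp_all add: lder_0 lder_add lder_fscale lder_wd lmap_wd dword_append distrib_left fconst_left_commute flip: wd_append)
qed (simp_all add: lmap_0 lmap_add lmap_fscale lder_0 lder_add lder_fscale distrib_left distrib_right mult.assoc)

section \<open>Elements with letters in a given set\<close>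

definition letters_in :: "'g set \<Rightarrow> ('g word \<Rightarrow>\<^sub>0 complex) set" where
  "letters_in G = {f. \<forall>w\<in>Poly_Mapping.keys f. set (letters w) \<subseteq> G}"

lemma letters_in_wd: "wd xs \<in> letters_in G \<longleftrightarrow> set xs \<subseteq> G"
  by (simp add: letters_in_def wd_def)

lemma letters_in_letter: "letter x \<in> letters_in G \<longleftrightarrow> x \<in> G"
  by (simp add: letters_in_def letter_def)

lemma letters_in_fconst: "fconst c \<in> letters_in G"
  by (simp add: letters_in_def fconst_def zero_word_def)

lemma letters_in_0: "0 \<in> letters_in G" and letters_in_1: "1 \<in> letters_in G"
  by (simp add: letters_in_def) (metis fconst_simps(2) letters_in_fconst)

lemma letters_in_add: "f \<in> letters_in G \<Longrightarrow> h \<in> letters_in G \<Longrightarrow> f + h \<in> letters_in G"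
  unfolding letters_in_def using keys_add[of f h] by auto

lemma letters_in_mult: "f \<in> letters_in G \<Longrightarrow> h \<in> letters_in G \<Longrightarrow> f * h \<in> letters_in G"
  unfolding letters_in_def using keys_mult[of f h] by (force simp: plus_word_def)

lemma letters_in_subspace: "FS.subspace (letters_in G)"
  by (simp add: FS.subspace_def letters_in_0 letters_in_add letters_in_mult letters_in_fconst)

lemmas letters_in_diff = FS.subspace_diff[OF letters_in_subspace]

lemma letters_in_induct [consumes 1, case_names zero word add scale]:
  assumes "f \<in> letters_in G" "P 0" "\<And>xs. set xs \<subseteq> G \<Longrightarrow> P (wd xs)"
    and "\<And>f g. P f \<Longrightarrow> P g \<Longrightarrow> P (f + g)" "\<And>c f. P f \<Longrightarrow> P (fconst c * f)"
  shows "P f"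
proof (rule word_span_induct[of P f])
  fix xs assume "Word xs \<in> Poly_Mapping.keys f"
  then have "set xs \<subseteq> G" using assms(1) by (force simp: letters_in_def)
  then show "P (wd xs)" by (rule assms(3))
qed (use assms in auto)

lemma lmap_letters_in:
  assumes "f \<in> letters_in G" "t ` G \<subseteq> G" shows "lmap t f \<in> letters_in G"
  using assms(1)
proof (induction rule: letters_in_induct)
  case (word xs) then show ?case using assms(2) by (auto simp: lmap_wd letters_in_wd)
qed (simp_all add: lmap_0 lmap_add lmap_fscale letters_in_0 letters_in_add letters_in_mult letters_in_fconst)

lemma lder_letters_in:
  assumes "f \<in> letters_in G" "t ` G \<subseteq> G" "d ` G \<subseteq> G" shows "lder t d f \<in> letters_in G"
  using assms(1)
proof (induction rule: letters_in_induct)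
  case (word xs)
  have cl: "t x \<in> G" "d x \<in> G" if "x \<in> G" for x using that assms(2,3) by auto
  show ?case unfolding lder_wd using word
    by (induction xs) (simp_all add: letters_in_0 letters_in_add letters_in_mult letters_in_letter letters_in_wd cl)
qed (simp_all add: lder_0 lder_add lder_fscale letters_in_0 letters_in_add letters_in_mult letters_in_fconst)

section \<open>The enveloping ideal and the parity automorphism\<close>

locale env_data =
  fixes g :: "'g lie_superalgebra"
  assumes superspace: "is_superspace g"
    and br_gr: "\<And>p q x y. x \<in> gr g p \<Longrightarrow> y \<in> gr g q \<Longrightarrow> lie_br g x y \<in> gr g (p + q)"
begin

lemma mod_g: "Module.module complex_ring g"
  using superspace by (simp add: is_superspace_def)

sublocale G: Module.module complex_ring g by (rule mod_g)

abbreviation "C \<equiv> letters_in (carrier g)"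
abbreviation "F \<equiv> free_alg g"
abbreviation "I \<equiv> env_ideal g"

lemma submodule_gr: "submodule (gr g p) complex_ring g"
  using superspace by (simp add: is_superspace_def gr_def)

lemma gr_carrier: "x \<in> gr g p \<Longrightarrow> x \<in> carrier g"
  using G.submoduleE(1)[OF submodule_gr] by blast

lemma gr_add: "x \<in> gr g p \<Longrightarrow> y \<in> gr g p \<Longrightarrow> x \<oplus>\<^bsub>g\<^esub> y \<in> gr g p"
  and gr_smult: "x \<in> gr g p \<Longrightarrow> c \<odot>\<^bsub>g\<^esub> x \<in> gr g p"
  using G.submoduleE(4,5)[OF submodule_gr] by auto

lemma gr_zero: "\<zero>\<^bsub>g\<^esub> \<in> gr g p"
  using quotient_module.K_zero[OF quotient_module.intro[OF mod_g submodule_gr]] .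

lemma gr_decomp: "x \<in> carrier g \<Longrightarrow> \<exists>y\<in>gr g 0. \<exists>z\<in>gr g 1. x = y \<oplus>\<^bsub>g\<^esub> z"
  using superspace by (auto simp: is_superspace_def gr_def set_add_def')

lemma gr_Int: "x \<in> gr g 0 \<Longrightarrow> x \<in> gr g 1 \<Longrightarrow> x = \<zero>\<^bsub>g\<^esub>"
  using superspace by (auto simp: is_superspace_def gr_def)

definition gpar :: "'g \<Rightarrow> 'g" where
  "gpar x = (THE u. \<exists>y\<in>gr g 0. \<exists>z\<in>gr g 1. x = y \<oplus>\<^bsub>g\<^esub> z \<and> u = y \<oplus>\<^bsub>g\<^esub> (- 1) \<odot>\<^bsub>g\<^esub> z)"

text \<open>The decomposition is unique: the difference of two decompositions lies in both parts and
  so is zero.\<close>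

lemma gpar_eq:
  assumes "y \<in> gr g 0" "z \<in> gr g 1"
  shows "gpar (y \<oplus>\<^bsub>g\<^esub> z) = y \<oplus>\<^bsub>g\<^esub> (- 1) \<odot>\<^bsub>g\<^esub> z"
  unfolding gpar_def
proof (rule the_equality)
  fix u assume "\<exists>y'\<in>gr g 0. \<exists>z'\<in>gr g 1. y \<oplus>\<^bsub>g\<^esub> z = y' \<oplus>\<^bsub>g\<^esub> z' \<and> u = y' \<oplus>\<^bsub>g\<^esub> (- 1) \<odot>\<^bsub>g\<^esub> z'"
  then obtain y' z' where yz: "y' \<in> gr g 0" "z' \<in> gr g 1" "y \<oplus>\<^bsub>g\<^esub> z = y' \<oplus>\<^bsub>g\<^esub> z'" "u = y' \<oplus>\<^bsub>g\<^esub> (- 1) \<odot>\<^bsub>g\<^esub> z'" by blast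
  note c = gr_carrier[OF assms(1)] gr_carrier[OF assms(2)] gr_carrier[OF yz(1)] gr_carrier[OF yz(2)]
  have neg: "\<ominus>\<^bsub>g\<^esub> x \<in> gr g p" if "x \<in> gr g p" for x p using G.submoduleE(3)[OF submodule_gr] that by blast
  have "y \<oplus>\<^bsub>g\<^esub> \<ominus>\<^bsub>g\<^esub> y' = z' \<oplus>\<^bsub>g\<^esub> \<ominus>\<^bsub>g\<^esub> z"
  proof -
    have "(y \<oplus>\<^bsub>g\<^esub> z) \<oplus>\<^bsub>g\<^esub> (\<ominus>\<^bsub>g\<^esub> y' \<oplus>\<^bsub>g\<^esub> \<ominus>\<^bsub>g\<^esub> z) = (y' \<oplus>\<^bsub>g\<^esub> z') \<oplus>\<^bsub>g\<^esub> (\<ominus>\<^bsub>g\<^esub> y' \<oplus>\<^bsub>g\<^esub> \<ominus>\<^bsub>g\<^esub> z)" using yz(3) by simp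
    moreover have "(y \<oplus>\<^bsub>g\<^esub> z) \<oplus>\<^bsub>g\<^esub> (\<ominus>\<^bsub>g\<^esub> y' \<oplus>\<^bsub>g\<^esub> \<ominus>\<^bsub>g\<^esub> z) = (y \<oplus>\<^bsub>g\<^esub> \<ominus>\<^bsub>g\<^esub> y') \<oplus>\<^bsub>g\<^esub> (z \<oplus>\<^bsub>g\<^esub> \<ominus>\<^bsub>g\<^esub> z)" using c by (simp add: G.add.m_ac)
    moreover have "(y' \<oplus>\<^bsub>g\<^esub> z') \<oplus>\<^bsub>g\<^esub> (\<ominus>\<^bsub>g\<^esub> y' \<oplus>\<^bsub>g\<^esub> \<ominus>\<^bsub>g\<^esub> z) = (y' \<oplus>\<^bsub>g\<^esub> \<ominus>\<^bsub>g\<^esub> y') \<oplus>\<^bsub>g\<^esub> (z' \<oplus>\<^bsub>g\<^esub> \<ominus>\<^bsub>g\<^esub> z)" using c by (simp add: G.add.m_ac)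
    ultimately show ?thesis using c by (simp add: G.r_neg)
  qed
  then have "y \<oplus>\<^bsub>g\<^esub> \<ominus>\<^bsub>g\<^esub> y' = \<zero>\<^bsub>g\<^esub>" "z' \<oplus>\<^bsub>g\<^esub> \<ominus>\<^bsub>g\<^esub> z = \<zero>\<^bsub>g\<^esub>"
    using gr_Int gr_add neg assms yz by metis+
  then have "y = y'" "z' = z" using c by (metis G.minus_equality G.minus_minus G.a_inv_closed)+
  then show "u = y \<oplus>\<^bsub>g\<^esub> (- 1) \<odot>\<^bsub>g\<^esub> z" using yz by simp
qed (use assms in blast)

lemma gpar_gr: "x \<in> gr g q \<Longrightarrow> gpar x = (- 1) ^ q \<odot>\<^bsub>g\<^esub> x"
proof (cases "even q")
  case True
  assume x: "x \<in> gr g q"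
  then have "x \<in> gr g 0" using True by (simp add: gr_def)
  moreover have "(- 1) \<odot>\<^bsub>g\<^esub> \<zero>\<^bsub>g\<^esub> = \<zero>\<^bsub>g\<^esub>" by (rule G.smult_r_null) simp
  ultimately show ?thesis using gpar_eq[OF _ gr_zero, of x] True gr_carrier[OF x] G.smult_one[of x] by simp
next
  case False
  assume x: "x \<in> gr g q"
  then have "x \<in> gr g 1" using False by (simp add: gr_def)
  then show ?thesis using gpar_eq[OF gr_zero, of x] False gr_carrier[OF x] by simp
qed

lemma gpar_gr_closed: "x \<in> gr g q \<Longrightarrow> gpar x \<in> gr g q"
  by (simp add: gpar_gr gr_smult)

lemma gpar_add:
  assumes "x \<in> carrier g" "y \<in> carrier g" shows "gpar (x \<oplus>\<^bsub>g\<^esub> y) = gpar x \<oplus>\<^bsub>g\<^esub> gpar y"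
proof -
  obtain x0 x1 y0 y1 where xy: "x0 \<in> gr g 0" "x1 \<in> gr g 1" "x = x0 \<oplus>\<^bsub>g\<^esub> x1" "y0 \<in> gr g 0" "y1 \<in> gr g 1" "y = y0 \<oplus>\<^bsub>g\<^esub> y1"
    using gr_decomp assms by metis
  note c = gr_carrier[OF xy(1)] gr_carrier[OF xy(2)] gr_carrier[OF xy(4)] gr_carrier[OF xy(5)]
  have "x \<oplus>\<^bsub>g\<^esub> y = (x0 \<oplus>\<^bsub>g\<^esub> y0) \<oplus>\<^bsub>g\<^esub> (x1 \<oplus>\<^bsub>g\<^esub> y1)" using c xy by (simp add: G.add.m_ac)
  then have "gpar (x \<oplus>\<^bsub>g\<^esub> y) = (x0 \<oplus>\<^bsub>g\<^esub> y0) \<oplus>\<^bsub>g\<^esub> (- 1) \<odot>\<^bsub>g\<^esub> (x1 \<oplus>\<^bsub>g\<^esub> y1)" using xy by (simp add: gpar_eq gr_add)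
  then show ?thesis using c G.smult_r_distr[of "-1" x1 y1] xy by (simp add: gpar_eq G.add.m_ac)
qed

lemma gpar_smult:
  assumes "x \<in> carrier g" shows "gpar (c \<odot>\<^bsub>g\<^esub> x) = c \<odot>\<^bsub>g\<^esub> gpar x"
proof -
  obtain x0 x1 where x: "x0 \<in> gr g 0" "x1 \<in> gr g 1" "x = x0 \<oplus>\<^bsub>g\<^esub> x1" using gr_decomp assms by metis
  note c = gr_carrier[OF x(1)] gr_carrier[OF x(2)]
  show ?thesis using c x G.smult_r_distr[of c] G.smult_assoc1[of c "-1" x1] G.smult_assoc1[of "-1" c x1]
    by (simp add: gpar_eq gr_smult mult.commute)
qed

lemma gpar_closed: "x \<in> carrier g \<Longrightarrow> gpar x \<in> carrier g"
proof -
  assume "x \<in> carrier g"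
  then obtain x0 x1 where x: "x0 \<in> gr g 0" "x1 \<in> gr g 1" "x = x0 \<oplus>\<^bsub>g\<^esub> x1" using gr_decomp by metis
  then show ?thesis using gr_carrier by (simp add: gpar_eq)
qed

lemma free_alg_simps: "carrier F = C" "mult F = (*)" "one F = 1" "zero F = 0" "add F = (+)" "smult F = fscale"
  by (simp_all add: free_alg_def Let_def letters_in_def)

sublocale F: concrete_space fscale F
  by (intro concrete_space.intro vector_space_fscale concrete_space_axioms.intro)
    (simp_all add: free_alg_simps letters_in_subspace)

definition hwords :: "nat \<Rightarrow> ('g word \<Rightarrow>\<^sub>0 complex) set" where
  "hwords p = {wd xs | xs ps. list_all2 (\<lambda>x q. x \<in> gr g q) xs ps \<and> even (sum_list ps + p)}"

lemma hwords_C: "hwords p \<subseteq> C"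
proof -
  have "set xs \<subseteq> carrier g" if "list_all2 (\<lambda>x q. x \<in> gr g q) xs ps" for xs ps
    using that by (induction rule: list_all2_induct) (auto dest: gr_carrier)
  then show ?thesis by (auto simp: hwords_def letters_in_wd)
qed

lemma gr_F: "gr F p = FS.span (hwords p)"
proof -
  \<comment> \<open>\<open>free_alg\<close> forms its parts as spans inside a preliminary record
    with empty parts; F0 names that record.\<close>
  define F0 :: "('g word \<Rightarrow>\<^sub>0 complex) superspace" where "F0 = \<lparr>carrier = C, mult = (*), one = 1, zero = 0, add = (+), smult = fscale,
     even_part = {}, odd_part = {}\<rparr>"
  interpret F0: concrete_space fscale F0
    by (intro concrete_space.intro vector_space_fscale concrete_space_axioms.intro)
      (simp_all add: F0_def letters_in_subspace)
  have *: "even (sum_list ps) = even p" if "even (sum_list ps + q)" "even q = even p" for ps and q :: nat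
    using that by auto
  have "hwords p = hwords 0" if "even p" using that by (auto simp: hwords_def)
  moreover have "hwords p = hwords 1" if "odd p" using that by (auto simp: hwords_def)
  moreover have "gr F p = (if even p then lin_span F0 (hwords 0) else lin_span F0 (hwords 1))"
    by (simp add: gr_def free_alg_def Let_def F0_def hwords_def prod_list_letter flip: letters_in_def)
  moreover have "lin_span F0 (hwords q) = FS.span (hwords q)" for q
    by (rule F0.lin_span_eq) (use hwords_C in \<open>simp add: F0_def\<close>)
  ultimately show ?thesis by simp
qed

lemma gr_F_C: "gr F p \<subseteq> C"
  unfolding gr_F by (rule FS.span_minimal[OF hwords_C letters_in_subspace])

lemma ring_F: "ring F"
proof (rule ringI)
  show "abelian_group F" by (rule F.M.abelian_group_axioms)
  show "Group.monoid F"
    by (rule Group.monoidI) (auto simp: free_alg_simps letters_in_mult letters_in_1 mult.assoc)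
qed (auto simp: free_alg_simps algebra_simps)

lemma env_rels_C: "env_rels g \<subseteq> C"
proof
  fix f assume "f \<in> env_rels g"
  then consider x y where "x \<in> carrier g" "y \<in> carrier g" "f = letter (x \<oplus>\<^bsub>g\<^esub> y) - letter x - letter y"
    | c x where "x \<in> carrier g" "f = letter (c \<odot>\<^bsub>g\<^esub> x) - fconst c * letter x"
    | p q x y where "x \<in> gr g p" "y \<in> gr g q"
        "f = letter x * letter y - fconst ((-1) ^ (p * q)) * letter y * letter x - letter (lie_br g x y)"
    unfolding env_rels_def by blast
  then show "f \<in> C"
  proof cases
    case 3
    then have "x \<in> carrier g" "y \<in> carrier g" "lie_br g x y \<in> carrier g"
      using gr_carrier br_gr by blast+
    then show ?thesis
      using 3(3) by (simp add: letters_in_diff letters_in_mult letters_in_fconst letters_in_letter)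
  qed (simp_all add: letters_in_diff letters_in_mult letters_in_fconst letters_in_letter)
qed

lemma ideal_I: "ideal I F"
  unfolding env_ideal_def by (rule ring.genideal_ideal[OF ring_F]) (simp add: free_alg_simps env_rels_C)

sublocale I: ideal I F by (rule ideal_I)

lemma I_C: "I \<subseteq> C"
  using I.a_subset by (simp add: free_alg_simps)

lemma I_rel: "f \<in> env_rels g \<Longrightarrow> f \<in> I"
  using ring.genideal_self[OF ring_F, of "env_rels g"] env_rels_C by (auto simp: env_ideal_def free_alg_simps)

lemma I_mult: "f \<in> I \<Longrightarrow> h \<in> C \<Longrightarrow> h * f \<in> I" "f \<in> I \<Longrightarrow> h \<in> C \<Longrightarrow> f * h \<in> I"
  using I.I_l_closed I.I_r_closed by (simp_all add: free_alg_simps)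

lemma I_subspace: "FS.subspace I"
proof -
  have "0 \<in> I" "\<And>x y. x \<in> I \<Longrightarrow> y \<in> I \<Longrightarrow> x + y \<in> I"
    using I.zero_closed I.a_closed by (simp_all add: free_alg_simps)
  then show ?thesis by (simp add: FS.subspace_def I_mult letters_in_fconst)
qed

lemmas I_add = FS.subspace_add[OF I_subspace] and I_diff = FS.subspace_diff[OF I_subspace]
  and I_0 = FS.subspace_0[OF I_subspace]

lemma submodule_I: "submodule I complex_ring F"
  using I_subspace I_C by (simp add: F.submodule_iff free_alg_simps)

text \<open>An induction principle: to show that a map preserves I, the elements with the desired
  property are shown to form an ideal that contains the relations.\<close>

lemma I_minimal:
  assumes "\<And>f. f \<in> H \<Longrightarrow> f \<in> C" "0 \<in> H" "\<And>f h. f \<in> H \<Longrightarrow> h \<in> H \<Longrightarrow> f + h \<in> H"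
    and "\<And>f h. f \<in> H \<Longrightarrow> h \<in> C \<Longrightarrow> h * f \<in> H" "\<And>f h. f \<in> H \<Longrightarrow> h \<in> C \<Longrightarrow> f * h \<in> H"
    and "env_rels g \<subseteq> H"
  shows "I \<subseteq> H"
proof -
  have "ideal H F"
  proof (rule idealI[OF ring_F])
    have neg: "- f \<in> H" if "f \<in> H" for f
      using assms(4)[OF that letters_in_fconst[of "-1"]] by (simp add: fconst_simps)
    have "submodule H complex_ring F"
      using assms(1-4) by (auto simp: F.submodule_iff free_alg_simps FS.subspace_def letters_in_fconst)
    then show "subgroup H (add_monoid F)" by (simp add: submodule_def)
  qed (use assms in \<open>auto simp: free_alg_simps\<close>)
  then show ?thesis unfolding env_ideal_def using ring.genideal_minimal[OF ring_F] assms(6) by blast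
qed

end

lemma fconst_fconst: "fconst a * (fconst b * f) = fconst (a * b) * f"
  by (simp only: fconst_simps(5) mult.assoc)

context env_data
begin

lemma I_cong_mult:
  assumes "a - a' \<in> I" "b - b' \<in> I" "b \<in> C" "a' \<in> C" shows "a * b - a' * b' \<in> I"
proof -
  have "a * b - a' * b' = (a - a') * b + a' * (b - b')" by (simp add: algebra_simps)
  then show ?thesis using assms by (simp add: I_add I_mult)
qed

lemma I_fscale: "f \<in> I \<Longrightarrow> fconst c * f \<in> I"
  by (simp add: I_mult letters_in_fconst)

lemma letter_add:
  assumes "x \<in> carrier g" "y \<in> carrier g" shows "letter (x \<oplus>\<^bsub>g\<^esub> y) - (letter x + letter y) \<in> I"
proof -
  have "letter (x \<oplus>\<^bsub>g\<^esub> y) - letter x - letter y \<in> I" using assms by (intro I_rel) (auto simp: env_rels_def)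
  then show ?thesis by (simp add: diff_diff_eq)
qed

lemma letter_smult: "x \<in> carrier g \<Longrightarrow> letter (c \<odot>\<^bsub>g\<^esub> x) - fconst c * letter x \<in> I"
  by (intro I_rel) (auto simp: env_rels_def)

lemma letter_br: "x \<in> gr g p \<Longrightarrow> y \<in> gr g q \<Longrightarrow>
  letter x * letter y - fconst ((- 1) ^ (p * q)) * letter y * letter x - letter (lie_br g x y) \<in> I"
  by (intro I_rel) (auto simp: env_rels_def)

text \<open>The p-th power of the parity involution: the twist that a derivation of parity p
  acquires in passing a letter, inhomogeneous letters included.\<close>

definition tp :: "nat \<Rightarrow> 'g \<Rightarrow> 'g" where
  "tp p = (if even p then id else gpar)"

lemma tp_add: "x \<in> carrier g \<Longrightarrow> y \<in> carrier g \<Longrightarrow> tp p (x \<oplus>\<^bsub>g\<^esub> y) = tp p x \<oplus>\<^bsub>g\<^esub> tp p y"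
  and tp_smult: "x \<in> carrier g \<Longrightarrow> tp p (c \<odot>\<^bsub>g\<^esub> x) = c \<odot>\<^bsub>g\<^esub> tp p x"
  and tp_closed: "x \<in> carrier g \<Longrightarrow> tp p x \<in> carrier g"
  and tp_gr: "x \<in> gr g q \<Longrightarrow> tp p x \<in> gr g q"
  by (simp_all add: tp_def gpar_add gpar_smult gpar_closed gpar_gr_closed)

text \<open>Only a congruence, since in the free algebra the letter of a multiple of x is not the
  multiple of the letter x.\<close>

lemma letter_tp: "x \<in> gr g q \<Longrightarrow> letter (tp p x) - fconst ((- 1) ^ (p * q)) * letter x \<in> I"
  using letter_smult[OF gr_carrier, of x q "(- 1) ^ q"]
  by (cases "even p") (auto simp: tp_def I_0 fconst_simps(2) gpar_gr power_mult)

definition tau :: "nat \<Rightarrow> ('g word \<Rightarrow>\<^sub>0 complex) \<Rightarrow> ('g word \<Rightarrow>\<^sub>0 complex)" where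
  "tau p = lmap (tp p)"

lemma tau_mult: "tau p (f * h) = tau p f * tau p h" and tau_add: "tau p (f + h) = tau p f + tau p h"
  and tau_diff: "tau p (f - h) = tau p f - tau p h" and tau_0: "tau p 0 = 0"
  and tau_letter: "tau p (letter x) = letter (tp p x)"
  and tau_wd: "tau p (wd xs) = wd (map (tp p) xs)"
  by (simp_all add: tau_def lmap_mult lmap_add lmap_diff lmap_0 lmap_letter lmap_wd)

lemma tau_fscale: "tau p (fconst c * f) = fconst c * tau p f"
  by (simp only: tau_def lmap_fscale)

lemma tau_fconst: "tau p (fconst c) = fconst c"
  using tau_fscale[of p c 1] tau_wd[of p "[]"] by (simp add: wd_Nil)

lemma tau_C: "f \<in> C \<Longrightarrow> tau p f \<in> C"
  unfolding tau_def by (rule lmap_letters_in) (auto intro: tp_closed)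

lemma env_rels_cases [consumes 1, case_names add smult br]:
  assumes "f \<in> env_rels g"
  obtains x y where "x \<in> carrier g" "y \<in> carrier g" "f = letter (x \<oplus>\<^bsub>g\<^esub> y) - letter x - letter y"
  | c x where "x \<in> carrier g" "f = letter (c \<odot>\<^bsub>g\<^esub> x) - fconst c * letter x"
  | p q x y where "x \<in> gr g p" "y \<in> gr g q"
        "f = letter x * letter y - fconst ((-1) ^ (p * q)) * letter y * letter x - letter (lie_br g x y)"
  using assms unfolding env_rels_def by blast

lemma letter_C: "x \<in> carrier g \<Longrightarrow> letter x \<in> C"
  by (simp add: letters_in_letter)

text \<open>The twist multiplies homogeneous x, y and their bracket by signs, and the sign of the
  bracket is the product of the other two because its parity is the sum. Each bracket relation is
  thus rescaled modulo I.\<close>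

lemma tau_I: "f \<in> I \<Longrightarrow> tau p f \<in> I"
proof -
  have "I \<subseteq> {f \<in> C. tau p f \<in> I}"
  proof (rule I_minimal)
    show "env_rels g \<subseteq> {f \<in> C. tau p f \<in> I}"
    proof
      fix f assume f: "f \<in> env_rels g"
      have "tau p f \<in> I" using f
      proof (cases rule: env_rels_cases)
        case (add x y)
        then show ?thesis using letter_add[of "tp p x" "tp p y"]
          by (simp add: tau_diff tau_add tau_letter tp_add tp_closed diff_diff_eq)
      next
        case (smult c x)
        then show ?thesis using letter_smult[of "tp p x" c]
          by (simp add: tau_diff tau_fscale tau_letter tp_smult tp_closed)
      next
        case (br r s x y)
        define X Y B where "X = letter x" and "Y = letter y" and "B = letter (lie_br g x y)"
        define X' Y' B' where "X' = letter (tp p x)" and "Y' = letter (tp p y)" and "B' = letter (tp p (lie_br g x y))"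
        define cx cy :: complex where "cx = (- 1) ^ (p * r)" and "cy = (- 1) ^ (p * s)"
        define \<epsilon> :: complex where "\<epsilon> = (- 1) ^ (r * s)"
        have brc: "lie_br g x y \<in> gr g (r + s)" using br br_gr by blast
        have XY: "X' - fconst cx * X \<in> I" "Y' - fconst cy * Y \<in> I" "B' - fconst (cx * cy) * B \<in> I"
          using letter_tp[OF br(1), of p] letter_tp[OF br(2), of p] letter_tp[OF brc, of p]
          by (simp_all add: X_def Y_def B_def X'_def Y'_def B'_def cx_def cy_def distrib_left power_add)
        have C: "X \<in> C" "Y \<in> C" "X' \<in> C" "Y' \<in> C"
          using br gr_carrier by (simp_all add: X_def Y_def X'_def Y'_def letter_C tp_closed)
        have rel: "X * Y - fconst \<epsilon> * (Y * X) - B \<in> I"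
          using letter_br[OF br(1,2)] by (simp add: X_def Y_def B_def \<epsilon>_def mult.assoc)
        have 1: "X' * Y' - (fconst cx * X) * (fconst cy * Y) \<in> I" "Y' * X' - (fconst cy * Y) * (fconst cx * X) \<in> I"
          by (rule I_cong_mult; use XY C in \<open>simp add: letters_in_mult letters_in_fconst\<close>)+
        \<comment> \<open>All terms but the last are corrections that replace twisted letters by
          signed ones; the last is the rescaled relation.\<close>
        have "tau p f = (X' * Y' - (fconst cx * X) * (fconst cy * Y))
            - fconst \<epsilon> * (Y' * X' - (fconst cy * Y) * (fconst cx * X)) - (B' - fconst (cx * cy) * B)
            + fconst (cx * cy) * (X * Y - fconst \<epsilon> * (Y * X) - B)"
        proof -
          have "tau p f = X' * Y' - fconst \<epsilon> * (Y' * X') - B'"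
            unfolding br(3) by (simp add: tau_diff tau_mult tau_fconst tau_letter X'_def Y'_def B'_def \<epsilon>_def mult.assoc)
          then show ?thesis
            by (simp add: algebra_simps fconst_left_commute[of X] fconst_left_commute[of Y] fconst_fconst)
        qed
        then show ?thesis using 1 XY rel by (simp add: I_add I_diff I_fscale)
      qed
      then show "f \<in> {f \<in> C. tau p f \<in> I}" using f env_rels_C by auto
    qed
  qed (auto simp: tau_0 tau_add tau_mult tau_C I_0 I_add I_mult letters_in_0 letters_in_add letters_in_mult)
  then show "f \<in> I \<Longrightarrow> tau p f \<in> I" by auto
qed

end

section \<open>The Leibniz extension of a derivation\<close>

locale env_derivation = env_data g for g :: "'g lie_superalgebra" +
  fixes p :: nat and \<delta> :: "'g \<Rightarrow> 'g"
  assumes der: "lie_derivation g p \<delta>"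
begin

lemma \<delta>_closed: "x \<in> carrier g \<Longrightarrow> \<delta> x \<in> carrier g"
  and \<delta>_add: "x \<in> carrier g \<Longrightarrow> y \<in> carrier g \<Longrightarrow> \<delta> (x \<oplus>\<^bsub>g\<^esub> y) = \<delta> x \<oplus>\<^bsub>g\<^esub> \<delta> y"
  and \<delta>_smult: "x \<in> carrier g \<Longrightarrow> \<delta> (c \<odot>\<^bsub>g\<^esub> x) = c \<odot>\<^bsub>g\<^esub> \<delta> x"
  and \<delta>_gr: "x \<in> gr g q \<Longrightarrow> \<delta> x \<in> gr g (p + q)"
  and \<delta>_br: "x \<in> gr g q \<Longrightarrow> y \<in> carrier g \<Longrightarrow>
    \<delta> (lie_br g x y) = lie_br g (\<delta> x) y \<oplus>\<^bsub>g\<^esub> (-1) ^ (p * q) \<odot>\<^bsub>g\<^esub> lie_br g x (\<delta> y)"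
  using der by (auto simp: lie_derivation_def lin_endo_def has_parity_def)

text \<open>The twist by \<open>tau p\<close> stands in for the Koszul sign of the Leibniz rule,
  which has no meaning for inhomogeneous letters; on homogeneous elements the two agree modulo I by
  \<open>tau_gr\<close>.\<close>

definition Dr :: "('g word \<Rightarrow>\<^sub>0 complex) \<Rightarrow> ('g word \<Rightarrow>\<^sub>0 complex)" where
  "Dr = lder (tp p) \<delta>"

lemma Dr_mult: "Dr (f * h) = Dr f * h + tau p f * Dr h" and Dr_add: "Dr (f + h) = Dr f + Dr h"
  and Dr_diff: "Dr (f - h) = Dr f - Dr h" and Dr_0: "Dr 0 = 0"
  and Dr_letter: "Dr (letter x) = letter (\<delta> x)"
  and Dr_wd: "Dr (wd xs) = dword (tp p) \<delta> xs"
  by (simp_all add: Dr_def tau_def lder_mult lder_add lder_diff lder_0 lder_letter lder_wd)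

lemma Dr_fscale: "Dr (fconst c * f) = fconst c * Dr f"
  by (simp only: Dr_def lder_fscale)

lemma Dr_fconst: "Dr (fconst c) = 0"
  using Dr_fscale[of c 1] Dr_wd[of "[]"] by (simp add: wd_Nil)

lemma Dr_C: "f \<in> C \<Longrightarrow> Dr f \<in> C"
  unfolding Dr_def by (rule lder_letters_in) (auto intro: tp_closed \<delta>_closed)

text \<open>The set tested keeps f in I along with Dr f: in Dr (f h) = Dr f h + tau p f Dr h the
  second term lies in I because tau p f does. On a bracket relation the claim reduces to the
  derivation property of \<delta>.\<close>

lemma Dr_I: "f \<in> I \<Longrightarrow> Dr f \<in> I"
proof -
  have "I \<subseteq> {f \<in> I. Dr f \<in> I}"
  proof (rule I_minimal)
    show "env_rels g \<subseteq> {f \<in> I. Dr f \<in> I}"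
    proof
      fix f assume f: "f \<in> env_rels g"
      have "Dr f \<in> I" using f
      proof (cases rule: env_rels_cases)
        case (add x y)
        then show ?thesis using letter_add[of "\<delta> x" "\<delta> y"]
          by (simp add: Dr_diff Dr_add Dr_letter \<delta>_add \<delta>_closed diff_diff_eq)
      next
        case (smult c x)
        then show ?thesis using letter_smult[of "\<delta> x" c]
          by (simp add: Dr_diff Dr_fscale Dr_letter \<delta>_smult \<delta>_closed)
      next
        case (br r s x y)
        define X Y where "X = letter x" and "Y = letter y"
        define X' Y' where "X' = letter (tp p x)" and "Y' = letter (tp p y)"
        define DX DY where "DX = letter (\<delta> x)" and "DY = letter (\<delta> y)"
        define B1 B2 DB where "B1 = letter (lie_br g (\<delta> x) y)" and "B2 = letter (lie_br g x (\<delta> y))"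
          and "DB = letter (\<delta> (lie_br g x y))"
        define cx cy :: complex where "cx = (- 1) ^ (p * r)" and "cy = (- 1) ^ (p * s)"
        define \<epsilon> :: complex where "\<epsilon> = (- 1) ^ (r * s)"
        have c2: "cx * cx = 1" "cy * cy = 1" by (simp_all add: cx_def cy_def flip: power_add mult_2)
        have b1: "lie_br g (\<delta> x) y \<in> gr g (p + r + s)" and b2: "lie_br g x (\<delta> y) \<in> gr g (r + (p + s))"
          using br br_gr \<delta>_gr by blast+
        have XY: "X' - fconst cx * X \<in> I" "Y' - fconst cy * Y \<in> I"
          using letter_tp[OF br(1), of p] letter_tp[OF br(2), of p]
          by (simp_all add: X_def Y_def X'_def Y'_def cx_def cy_def)
        have C: "DX \<in> C" "DY \<in> C"
          using br gr_carrier by (simp_all add: DX_def DY_def letter_C \<delta>_closed)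
        have DB: "DB - (B1 + fconst cx * B2) \<in> I"
        proof -
          have "DB = letter (lie_br g (\<delta> x) y \<oplus>\<^bsub>g\<^esub> cx \<odot>\<^bsub>g\<^esub> lie_br g x (\<delta> y))"
            using \<delta>_br[OF br(1) gr_carrier[OF br(2)]] by (simp add: DB_def cx_def)
          then have "DB - (B1 + letter (cx \<odot>\<^bsub>g\<^esub> lie_br g x (\<delta> y))) \<in> I"
            using letter_add[of "lie_br g (\<delta> x) y" "cx \<odot>\<^bsub>g\<^esub> lie_br g x (\<delta> y)"] gr_carrier[OF b1] gr_carrier[OF b2]
            by (simp add: B1_def)
          from I_add[OF this letter_smult[OF gr_carrier[OF b2], of cx]] show ?thesis
            by (simp add: B2_def algebra_simps)
        qed
        have A: "DX * Y - fconst (cy * \<epsilon>) * (Y * DX) - B1 \<in> I"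
          using letter_br[OF \<delta>_gr[OF br(1)] br(2)]
          by (simp add: DX_def Y_def B1_def cy_def \<epsilon>_def mult.assoc power_add distrib_right)
        have B: "X * DY - fconst (cx * \<epsilon>) * (DY * X) - B2 \<in> I"
          using letter_br[OF br(1) \<delta>_gr[OF br(2)]]
          by (simp add: DY_def X_def B2_def cx_def \<epsilon>_def mult.assoc power_add distrib_left mult.commute[of r p])
        have "Dr f = (DX * Y + X' * DY) - fconst \<epsilon> * (DY * X + Y' * DX) - DB"
          unfolding br(3)
          by (simp add: mult.assoc Dr_diff Dr_mult Dr_fconst tau_fconst Dr_letter tau_letter X_def Y_def X'_def Y'_def DX_def DY_def DB_def \<epsilon>_def)
        \<comment> \<open>The image of the relation for x, y is the relation for \<delta> x, y plus
          \<open>cx\<close> times the relation for x, \<delta> y, up to corrections for the twisted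
          letters and for splitting the letter of \<delta> [x, y].\<close>
        also have "\<dots> = (DX * Y - fconst (cy * \<epsilon>) * (Y * DX) - B1) + fconst cx * (X * DY - fconst (cx * \<epsilon>) * (DY * X) - B2)
            + (X' - fconst cx * X) * DY - fconst \<epsilon> * ((Y' - fconst cy * Y) * DX) - (DB - (B1 + fconst cx * B2))"
        proof -
          have "cx * (cx * \<epsilon>) = \<epsilon>" using c2 by (simp flip: mult.assoc)
          then show ?thesis
            by (simp add: algebra_simps fconst_fconst fconst_left_commute[of X] fconst_left_commute[of Y])
        qed
        also have "\<dots> \<in> I"
          by (rule I_diff[OF I_diff[OF I_add[OF I_add[OF A I_fscale[OF B]] I_mult(2)[OF XY(1) C(2)]]
            I_fscale[OF I_mult(2)[OF XY(2) C(1)]]] DB])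
        finally show ?thesis .
      qed
      then show "f \<in> {f \<in> I. Dr f \<in> I}" using f I_rel by auto
    qed
  qed (use I_C in \<open>auto simp: Dr_0 Dr_add Dr_mult Dr_C tau_C tau_I I_0 I_add I_mult\<close>)
  then show "f \<in> I \<Longrightarrow> Dr f \<in> I" by auto
qed

end

section \<open>The enveloping superalgebra and its grading\<close>

context env_data
begin

abbreviation "E \<equiv> env g"

sublocale Q: quotient_module F I
  by (rule quotient_module.intro[OF F.module_V submodule_I])

abbreviation "cl f \<equiv> I +>\<^bsub>F\<^esub> f"

lemma E_simps: "carrier E = cl ` C" "f \<in> C \<Longrightarrow> h \<in> C \<Longrightarrow> cl f \<oplus>\<^bsub>E\<^esub> cl h = cl (f + h)"
  "f \<in> C \<Longrightarrow> c \<odot>\<^bsub>E\<^esub> cl f = cl (fconst c * f)" "f \<in> C \<Longrightarrow> h \<in> C \<Longrightarrow> cl f \<otimes>\<^bsub>E\<^esub> cl h = cl (f * h)"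
  "\<zero>\<^bsub>E\<^esub> = cl 0" "\<one>\<^bsub>E\<^esub> = cl 1" "f \<in> C \<Longrightarrow> h \<in> C \<Longrightarrow> cl f = cl h \<longleftrightarrow> f - h \<in> I"
  "gr E q = cl ` gr F q" "f \<in> C \<Longrightarrow> h \<in> C \<Longrightarrow> cl f \<ominus>\<^bsub>E\<^esub> cl h = cl (f - h)"
  "env_incl g x = cl (letter x)"
  using Q.quot_carrier Q.quot_add[of f h] Q.quot_smult[of f c] Q.quot_zero Q.q_eq_iff[of f h] Q.gr_quot[of q]
    Q.quot_minus[of f h] F.a_minus_V[of h f] ideal.rcoset_mult_add[OF ideal_I, of f h]
  by (simp_all add: env_def free_alg_simps env_incl_def) (simp_all add: quot_def free_alg_simps)

lemma module_E: "Module.module complex_ring E"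
  using Q.module_quot by (simp add: env_def)

lemma gr_F_subspace: "FS.subspace (gr F q)"
  by (simp add: gr_F)

lemma gr_F_cong: "even q = even r \<Longrightarrow> gr F q = gr F r"
  by (simp add: gr_def)

lemma hwordI: "list_all2 (\<lambda>x q. x \<in> gr g q) xs ps \<Longrightarrow> wd xs \<in> gr F (sum_list ps)"
  unfolding gr_F by (rule FS.span_base) (auto simp: hwords_def)

lemma gr_F_letter: "x \<in> gr g q \<Longrightarrow> letter x \<in> gr F q"
  using hwordI[of "[x]" "[q]"] by (simp add: wd_Cons wd_Nil)

lemma gr_F_1: "1 \<in> gr F 0"
  using hwordI[of "[]" "[]"] by (simp add: wd_Nil)

lemma gr_F_induct [consumes 1, case_names zero word add scale]:
  assumes "f \<in> gr F q" "P 0"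
    and "\<And>xs ps. list_all2 (\<lambda>x q. x \<in> gr g q) xs ps \<Longrightarrow> even (sum_list ps) = even q \<Longrightarrow> P (wd xs)"
    and "\<And>f g. P f \<Longrightarrow> P g \<Longrightarrow> P (f + g)" "\<And>c f. P f \<Longrightarrow> P (fconst c * f)"
  shows "P f"
  using assms(1) unfolding gr_F
proof (rule FS.span_induct[where P = P])
  show "FS.subspace {x. P x}" using assms by (simp add: FS.subspace_def)
  fix f assume "f \<in> hwords q"
  then show "P f" using assms(3) by (auto simp: hwords_def)
qed

lemma gr_F_mult: assumes "f \<in> gr F q" "h \<in> gr F r" shows "f * h \<in> gr F (q + r)"
proof -
  note s = FS.subspace_0[OF gr_F_subspace] FS.subspace_add[OF gr_F_subspace] FS.subspace_scale[OF gr_F_subspace]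
  show ?thesis using assms(1)
  proof (induction rule: gr_F_induct)
    case (word xs ps)
    show ?case using assms(2)
    proof (induction rule: gr_F_induct)
      case (word ys qs)
      have "wd (xs @ ys) \<in> gr F (sum_list (ps @ qs))"
        by (rule hwordI, rule list_all2_appendI) fact+
      moreover have "gr F (sum_list (ps @ qs)) = gr F (q + r)"
        by (rule gr_F_cong) (use word \<open>even (sum_list ps) = even q\<close> in auto)
      ultimately show ?case by (simp add: wd_append)
    qed (simp_all add: s algebra_simps fconst_left_commute)
  qed (simp_all add: s algebra_simps)
qed

text \<open>In a word with homogeneous letters each letter contributes its sign modulo I. This links
  the twist of \<open>Dr\<close> to the sign (-1)^(p q) in the Leibniz rule on U(g).\<close>

lemma tau_gr: assumes "f \<in> gr F q" shows "tau p f - fconst ((- 1) ^ (p * q)) * f \<in> I"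
  using assms
proof (induction rule: gr_F_induct)
  case (word xs ps)
  have "wd (map (tp p) xs) - fconst ((- 1) ^ (p * sum_list ps)) * wd xs \<in> I" using word(1)
  proof (induction rule: list_all2_induct)
    case (Cons x xs q qs)
    have c: "x \<in> carrier g" "set (map (tp p) xs) \<subseteq> carrier g"
    proof -
      have "set xs \<subseteq> carrier g" using Cons(2) by (induction rule: list_all2_induct) (auto dest: gr_carrier)
      then show "set (map (tp p) xs) \<subseteq> carrier g" using tp_closed by auto
    qed (use Cons gr_carrier in auto)
    have "letter (tp p x) * wd (map (tp p) xs) - (fconst ((- 1) ^ (p * q)) * letter x) * (fconst ((- 1) ^ (p * sum_list qs)) * wd xs) \<in> I"
      by (rule I_cong_mult) (use Cons c in \<open>simp_all add: letter_tp letters_in_mult letters_in_fconst letters_in_letter letters_in_wd\<close>)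
    then show ?case
      by (simp add: wd_Cons mult.assoc fconst_left_commute[of "letter x"] fconst_fconst distrib_left power_add)
  qed (simp add: I_0 fconst_simps)
  moreover have "(- 1 :: complex) ^ (p * sum_list ps) = (- 1) ^ (p * q)"
    using word(2) by (simp add: minus_one_power_iff)
  ultimately show ?case by (simp add: tau_wd)
next
  case (add f h)
  then show ?case using I_add[OF add] by (simp add: tau_add algebra_simps)
next
  case (scale c f)
  then show ?case using I_fscale[OF scale, of c]
    by (simp add: tau_fscale right_diff_distrib fconst_fconst mult.commute[of c])
qed (simp add: tau_0 I_0)

text \<open>A letter splits into homogeneous letters only modulo I; expanding a word letter by
  letter then sorts the terms by parity.\<close>

lemma gr_F_decomp: assumes "f \<in> C" shows "\<exists>f0\<in>gr F 0. \<exists>f1\<in>gr F 1. f - (f0 + f1) \<in> I"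
  using assms
proof (induction rule: letters_in_induct)
  case zero
  show ?case using FS.subspace_0[OF gr_F_subspace] I_0 by (intro bexI[of _ 0]) auto
next
  case (word xs)
  then show ?case
  proof (induction xs)
    case Nil
    show ?case using FS.subspace_0[OF gr_F_subspace, of 1] gr_F_1 I_0
      by (intro bexI[of _ 1] bexI[of _ 0]) (auto simp: wd_Nil)
  next
    case (Cons x xs)
    then obtain f0 f1 where f: "f0 \<in> gr F 0" "f1 \<in> gr F 1" "wd xs - (f0 + f1) \<in> I" by auto
    obtain x0 x1 where x: "x0 \<in> gr g 0" "x1 \<in> gr g 1" "x = x0 \<oplus>\<^bsub>g\<^esub> x1" using gr_decomp Cons.prems by force
    have "letter x * wd xs - (letter x0 + letter x1) * (f0 + f1) \<in> I"
    proof (rule I_cong_mult)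
      show "letter x - (letter x0 + letter x1) \<in> I" using x gr_carrier by (simp add: letter_add)
      show "letter x0 + letter x1 \<in> C" using x gr_carrier by (simp add: letter_C letters_in_add)
    qed (use f Cons.prems in \<open>auto simp: letters_in_wd\<close>)
    moreover have "letter x0 * f0 + letter x1 * f1 \<in> gr F 0"
      using gr_F_mult[OF gr_F_letter[OF x(1)] f(1)] gr_F_mult[OF gr_F_letter[OF x(2)] f(2)] gr_F_cong[of "1 + 1" 0]
      by (intro FS.subspace_add[OF gr_F_subspace]) auto
    moreover have "letter x0 * f1 + letter x1 * f0 \<in> gr F 1"
      using gr_F_mult[OF gr_F_letter[OF x(1)] f(2)] gr_F_mult[OF gr_F_letter[OF x(2)] f(1)]
      by (intro FS.subspace_add[OF gr_F_subspace]) auto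
    moreover have "letter x * wd xs - ((letter x0 * f0 + letter x1 * f1) + (letter x0 * f1 + letter x1 * f0)) =
        letter x * wd xs - (letter x0 + letter x1) * (f0 + f1)" by (simp add: algebra_simps)
    ultimately show ?case unfolding wd_Cons by metis
  qed
next
  case (add f h)
  then obtain f0 f1 h0 h1 where f: "f0 \<in> gr F 0" "f1 \<in> gr F 1" "f - (f0 + f1) \<in> I"
    and h: "h0 \<in> gr F 0" "h1 \<in> gr F 1" "h - (h0 + h1) \<in> I" by blast
  have "f0 + h0 \<in> gr F 0" "f1 + h1 \<in> gr F 1" using f h FS.subspace_add[OF gr_F_subspace] by auto
  moreover have "f + h - ((f0 + h0) + (f1 + h1)) \<in> I" using I_add[OF f(3) h(3)] by (simp add: algebra_simps)
  ultimately show ?case by blast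
next
  case (scale c f)
  then obtain f0 f1 where f: "f0 \<in> gr F 0" "f1 \<in> gr F 1" "f - (f0 + f1) \<in> I" by blast
  have "fconst c * f0 \<in> gr F 0" "fconst c * f1 \<in> gr F 1" using f FS.subspace_scale[OF gr_F_subspace] by auto
  moreover have "fconst c * f - (fconst c * f0 + fconst c * f1) \<in> I" using I_fscale[OF f(3), of c] by (simp add: algebra_simps)
  ultimately show ?case by blast
qed

lemma submodule_gr_F: "submodule (gr F q) complex_ring F"
  using gr_F_subspace gr_F_C by (simp add: F.submodule_iff free_alg_simps)

text \<open>Applying the involution to f - h gives f + h modulo H, so 2f lies in H. The lemma serves
  for H = I and for the preimage of the left ideal.\<close>

lemma graded_Int:
  assumes H: "FS.subspace H" "I \<subseteq> H" "\<And>f. f \<in> H \<Longrightarrow> tau 1 f \<in> H"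
    and fh: "f \<in> gr F 0" "h \<in> gr F 1" "f - h \<in> H"
  shows "f \<in> H"
proof -
  have a: "tau 1 f - tau 1 h \<in> H" using H(3)[OF fh(3)] by (simp add: tau_diff)
  have b: "tau 1 f - f \<in> H" "tau 1 h - - h \<in> H"
    using tau_gr[OF fh(1), of 1] tau_gr[OF fh(2), of 1] H(2) by (auto simp: fconst_simps)
  note sub = FS.subspace_diff[OF H(1)] and add = FS.subspace_add[OF H(1)]
  have "(tau 1 f - tau 1 h) - (tau 1 f - f) + (tau 1 h - - h) + (f - h) \<in> H"
    by (rule add[OF add[OF sub[OF a b(1)] b(2)] fh(3)])
  then have "f + f \<in> H" by (simp add: algebra_simps)
  then have "fconst (1 / 2) * (f + f) \<in> H" by (rule FS.subspace_scale[OF H(1)])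
  moreover have "fconst (1 / 2) * (f + f) = fconst (1 / 2 + 1 / 2) * f"
    unfolding fconst_simps(3) by (simp only: distrib_left distrib_right)
  ultimately show ?thesis by (simp add: fconst_simps)
qed

lemma is_superspace_E: "is_superspace E"
  unfolding env_def
proof (rule Q.is_superspace_quot)
  have gr: "even_part F = gr F 0" "odd_part F = gr F 1" by (simp_all add: gr_def)
  show "submodule (even_part F) complex_ring F" "submodule (odd_part F) complex_ring F"
    using submodule_gr_F by (simp_all add: gr)
  show "\<And>x y. x \<in> even_part F \<Longrightarrow> y \<in> odd_part F \<Longrightarrow> x \<ominus>\<^bsub>F\<^esub> y \<in> I \<Longrightarrow> x \<in> I"
    unfolding gr using graded_Int[OF I_subspace subset_refl tau_I] gr_F_C F.a_minus_V by (auto simp: free_alg_simps subset_iff)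
  show "\<exists>y\<in>even_part F. \<exists>z\<in>odd_part F. x \<ominus>\<^bsub>F\<^esub> (y \<oplus>\<^bsub>F\<^esub> z) \<in> I" if "x \<in> carrier F" for x
  proof -
    have "x \<in> C" using that by (simp add: free_alg_simps)
    then obtain y z where yz: "y \<in> gr F 0" "z \<in> gr F 1" "x - (y + z) \<in> I" using gr_F_decomp by blast
    then have "y + z \<in> C" using gr_F_C by (auto intro: letters_in_add)
    then have "x \<ominus>\<^bsub>F\<^esub> (y \<oplus>\<^bsub>F\<^esub> z) \<in> I" using F.a_minus_V[of "y + z" x] yz by (simp add: free_alg_simps)
    then show ?thesis unfolding gr using yz by blast
  qed
qed

end

context env_derivation
begin

definition Dl :: "('g word \<Rightarrow>\<^sub>0 complex) set \<Rightarrow> ('g word \<Rightarrow>\<^sub>0 complex) set" where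
  "Dl X = cl (Dr (SOME f. f \<in> C \<and> cl f = X))"

text \<open>The choice of a representative does not matter, by \<open>Dr_I\<close>.\<close>

lemma Dl_cl: assumes "f \<in> C" shows "Dl (cl f) = cl (Dr f)"
proof -
  define h where "h = (SOME h. h \<in> C \<and> cl h = cl f)"
  have "h \<in> C \<and> cl h = cl f"
    unfolding h_def by (rule someI[of "\<lambda>h. h \<in> C \<and> cl h = cl f" f]) (simp add: assms)
  then have h: "h \<in> C" "h - f \<in> I" using assms E_simps(7)[of h f] by blast+
  have "Dl (cl f) = cl (Dr h)" by (simp add: Dl_def h_def)
  also have "\<dots> = cl (Dr f)" using Dr_I[OF h(2)] h(1) assms by (simp add: E_simps Dr_C Dr_diff)
  finally show ?thesis .
qed

lemma Dr_gr: assumes "f \<in> gr F q" shows "Dr f \<in> gr F (p + q)"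
proof -
  note s = FS.subspace_0[OF gr_F_subspace] FS.subspace_add[OF gr_F_subspace] FS.subspace_scale[OF gr_F_subspace]
  show ?thesis using assms
  proof (induction rule: gr_F_induct)
    case (word xs ps)
    have "dword (tp p) \<delta> xs \<in> gr F (p + sum_list ps)" using word(1)
    proof (induction rule: list_all2_induct)
      case (Cons x xs q qs)
      have "letter (\<delta> x) * wd xs \<in> gr F (p + q + sum_list qs)"
        by (rule gr_F_mult[OF gr_F_letter[OF \<delta>_gr] hwordI]) (use Cons in auto)
      moreover have "letter (tp p x) * dword (tp p) \<delta> xs \<in> gr F (q + (p + sum_list qs))"
        by (rule gr_F_mult[OF gr_F_letter[OF tp_gr]]) (use Cons in auto)
      ultimately show ?case by (simp add: s add.assoc add.left_commute)
    qed (simp add: s)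
    moreover have "gr F (p + sum_list ps) = gr F (p + q)" by (rule gr_F_cong) (use word in auto)
    ultimately show ?case by (simp add: Dr_wd)
  qed (simp_all add: Dr_0 Dr_add Dr_fscale s)
qed

lemma Dl_leibniz: "leibniz_extension g p \<delta> Dl"
  unfolding leibniz_extension_def
proof (intro conjI allI ballI)
  show "lin_endo E Dl"
    by (auto simp: lin_endo_def E_simps Dl_cl Dr_C Dr_add Dr_fscale letters_in_add letters_in_mult letters_in_fconst)
  have "X \<in> gr E q \<Longrightarrow> Dl X \<in> gr E (p + q)" for q X
    using gr_F_C Dr_gr by (force simp: E_simps Dl_cl)
  then show "has_parity E p Dl" by (simp add: has_parity_def)
  show "Dl (env_incl g x) = env_incl g (\<delta> x)" if "x \<in> carrier g" for x
    using that by (simp add: E_simps Dl_cl letter_C Dr_letter)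
next
  fix q u v assume u: "u \<in> gr E q" and v: "v \<in> carrier E"
  obtain f h where f: "f \<in> gr F q" "u = cl f" and h: "h \<in> C" "v = cl h" using u v by (auto simp: E_simps)
  then have fC: "f \<in> C" using gr_F_C by blast
  have "(Dr f * h + tau p f * Dr h) - (Dr f * h + fconst ((- 1) ^ (p * q)) * (f * Dr h)) =
      (tau p f - fconst ((- 1) ^ (p * q)) * f) * Dr h" by (simp add: algebra_simps)
  also have "\<dots> \<in> I" by (rule I_mult(2)[OF tau_gr[OF f(1)] Dr_C[OF h(1)]])
  finally show "Dl (u \<otimes>\<^bsub>E\<^esub> v) = Dl u \<otimes>\<^bsub>E\<^esub> v \<oplus>\<^bsub>E\<^esub> (- 1) ^ (p * q) \<odot>\<^bsub>E\<^esub> (u \<otimes>\<^bsub>E\<^esub> Dl v)"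
    using f h fC by (simp add: E_simps Dl_cl Dr_C tau_C Dr_mult letters_in_mult letters_in_add letters_in_fconst)
qed

end

section \<open>The quotient of the enveloping superalgebra by a left ideal\<close>

locale env_module = env_data g for g :: "'g lie_superalgebra" +
  fixes L :: "'g set"
  assumes L_carrier: "L \<subseteq> carrier g" and L_par: "\<And>x. x \<in> L \<Longrightarrow> gpar x \<in> L"
begin

definition "J = gen_left_ideal E (env_incl g ` L)"
text \<open>The preimage of the left ideal in the free algebra. Thus V is C modulo
  \<open>JF\<close>, and later computations are congruences between polynomials in letters instead
  of equations between sets of sets.\<close>

definition "JF = {f \<in> C. cl f \<in> J}"

lemma left_ideal_E: "left_ideal E H \<longleftrightarrow> H \<subseteq> carrier E \<and> cl 0 \<in> H \<and>
    (\<forall>x\<in>H. \<forall>y\<in>H. x \<oplus>\<^bsub>E\<^esub> y \<in> H) \<and> (\<forall>f\<in>C. \<forall>x\<in>H. cl f \<otimes>\<^bsub>E\<^esub> x \<in> H)"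
proof
  interpret E: Module.module complex_ring E by (rule module_E)
  assume H: "left_ideal E H"
  then interpret H: additive_subgroup H E by (simp add: left_ideal_def)
  show "H \<subseteq> carrier E \<and> cl 0 \<in> H \<and>
    (\<forall>x\<in>H. \<forall>y\<in>H. x \<oplus>\<^bsub>E\<^esub> y \<in> H) \<and> (\<forall>f\<in>C. \<forall>x\<in>H. cl f \<otimes>\<^bsub>E\<^esub> x \<in> H)"
    using H.a_subset H.zero_closed H by (auto simp: E_simps left_ideal_def)
next
  interpret E: Module.module complex_ring E by (rule module_E)
  assume H: "H \<subseteq> carrier E \<and> cl 0 \<in> H \<and>
    (\<forall>x\<in>H. \<forall>y\<in>H. x \<oplus>\<^bsub>E\<^esub> y \<in> H) \<and> (\<forall>f\<in>C. \<forall>x\<in>H. cl f \<otimes>\<^bsub>E\<^esub> x \<in> H)"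
  have ex: "\<exists>f\<in>C. x = cl f" if "x \<in> H" for x using that H unfolding E_simps(1) by blast
  have sm: "c \<odot>\<^bsub>E\<^esub> x \<in> H" if x: "x \<in> H" for c x
  proof -
    obtain f where f: "f \<in> C" "x = cl f" using ex[OF x] by blast
    have "cl (fconst c) \<otimes>\<^bsub>E\<^esub> x \<in> H" using H x letters_in_fconst by blast
    then show ?thesis using f by (simp add: E_simps letters_in_fconst)
  qed
  have "\<ominus>\<^bsub>E\<^esub> x \<in> H" if x: "x \<in> H" for x
  proof -
    obtain f where f: "f \<in> C" "x = cl f" using ex[OF x] by blast
    then have "\<ominus>\<^bsub>E\<^esub> x = (- 1) \<odot>\<^bsub>E\<^esub> x"
      using Q.quot_neg[of f] F.a_inv_V[of f] by (simp add: E_simps(3) free_alg_simps fconst_simps flip: env_def)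
    then show ?thesis using sm[OF x] by simp
  qed
  then have "submodule H complex_ring E"
    by (intro E.submoduleI) (use H sm in \<open>auto simp: E_simps\<close>)
  then show "left_ideal E H"
    using H by (auto simp: left_ideal_def additive_subgroup_def submodule_def E_simps)
qed

lemma E_C: "left_ideal E (carrier E)"
  using letters_in_0 by (auto simp: left_ideal_E E_simps letters_in_add letters_in_mult)

lemma incl_L: "env_incl g ` L \<subseteq> carrier E"
  using L_carrier by (auto simp: E_simps letter_C)

lemma left_ideal_J: "left_ideal E J" and incl_J: "x \<in> L \<Longrightarrow> cl (letter x) \<in> J"
proof -
  have "J \<subseteq> carrier E" using E_C incl_L by (auto simp: J_def gen_left_ideal_def)
  then show "left_ideal E J"
    unfolding left_ideal_E by (auto simp: J_def gen_left_ideal_def left_ideal_E)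
  show "x \<in> L \<Longrightarrow> cl (letter x) \<in> J" by (auto simp: J_def gen_left_ideal_def E_simps)
qed

lemma JF_C: "JF \<subseteq> C" and JF_0: "0 \<in> JF" and JF_add: "f \<in> JF \<Longrightarrow> h \<in> JF \<Longrightarrow> f + h \<in> JF"
  and JF_mult: "u \<in> C \<Longrightarrow> f \<in> JF \<Longrightarrow> u * f \<in> JF" and JF_letter: "x \<in> L \<Longrightarrow> letter x \<in> JF"
proof -
  note J = left_ideal_J[unfolded left_ideal_E]
  show "JF \<subseteq> C" "0 \<in> JF" using J by (auto simp: JF_def letters_in_0)
  show "f \<in> JF \<Longrightarrow> h \<in> JF \<Longrightarrow> f + h \<in> JF" using J by (simp add: JF_def letters_in_add flip: E_simps(2))
  show "u \<in> C \<Longrightarrow> f \<in> JF \<Longrightarrow> u * f \<in> JF" using J by (simp add: JF_def letters_in_mult flip: E_simps(4))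
  show "x \<in> L \<Longrightarrow> letter x \<in> JF" using incl_J L_carrier by (auto simp: JF_def letter_C)
qed

lemma I_JF: "I \<subseteq> JF"
proof
  fix f assume "f \<in> I"
  then have "f \<in> C" "cl f = cl 0" using I_C E_simps(7)[of f 0] letters_in_0 by auto
  then show "f \<in> JF" using JF_0 by (simp add: JF_def)
qed

lemma JF_subspace: "FS.subspace JF"
  by (simp add: FS.subspace_def JF_0 JF_add JF_mult letters_in_fconst)

text \<open>Pushed forward to the enveloping superalgebra, H is a left ideal with the generators, so
  it contains the generated one; as H contains I, nothing is lost in pulling back.\<close>

lemma JF_minimal:
  assumes "\<And>f. f \<in> H \<Longrightarrow> f \<in> C" "\<And>f h. f \<in> H \<Longrightarrow> h \<in> H \<Longrightarrow> f + h \<in> H"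
    and "\<And>u f. u \<in> C \<Longrightarrow> f \<in> H \<Longrightarrow> u * f \<in> H" "I \<subseteq> H" "\<And>x. x \<in> L \<Longrightarrow> letter x \<in> H"
  shows "JF \<subseteq> H"
proof
  have "left_ideal E (cl ` H)"
    unfolding left_ideal_E
  proof (intro conjI ballI)
    show "cl 0 \<in> cl ` H" using assms(4) I_0 by auto
  qed (use assms in \<open>auto simp: E_simps\<close>)
  moreover have "env_incl g ` L \<subseteq> cl ` H" using assms(5) by (auto simp: E_simps)
  ultimately have J: "J \<subseteq> cl ` H" by (auto simp: J_def gen_left_ideal_def)
  fix f assume "f \<in> JF"
  then obtain h where h: "h \<in> H" "cl f = cl h" "f \<in> C" using J by (auto simp: JF_def)
  then have "f - h \<in> H" using assms(1,4) E_simps(7)[of f h] by blast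
  from assms(2)[OF this h(1)] show "f \<in> H" by simp
qed

lemma tau_JF: "f \<in> JF \<Longrightarrow> tau p f \<in> JF"
proof -
  have "tp p x \<in> L" if "x \<in> L" for x using that L_par by (simp add: tp_def)
  then have "JF \<subseteq> {f \<in> C. tau p f \<in> JF}"
    by (intro JF_minimal) (use I_C I_JF tau_I in \<open>auto simp: letters_in_add letters_in_mult tau_add tau_mult JF_add JF_mult tau_C
        tau_letter JF_letter letter_C subsetD[OF L_carrier]\<close>)
  then show "f \<in> JF \<Longrightarrow> tau p f \<in> JF" by auto
qed

lemma submodule_J: "submodule J complex_ring E"
proof -
  have "submodule JF complex_ring F" using JF_subspace JF_C by (simp add: F.submodule_iff free_alg_simps)
  then have "submodule (cl ` JF) complex_ring E" using Q.submodule_image by (simp add: env_def)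
  moreover have "cl ` JF = J" using left_ideal_J unfolding left_ideal_E by (auto simp: JF_def E_simps)
  ultimately show ?thesis by simp
qed

sublocale QV: quotient_module E J
  by (rule quotient_module.intro[OF module_E submodule_J])

abbreviation "V \<equiv> quot E J"
definition "Vc f = J +>\<^bsub>E\<^esub> cl f"

lemma V_simps: "carrier V = Vc ` C" "f \<in> C \<Longrightarrow> h \<in> C \<Longrightarrow> Vc f \<oplus>\<^bsub>V\<^esub> Vc h = Vc (f + h)"
  "f \<in> C \<Longrightarrow> c \<odot>\<^bsub>V\<^esub> Vc f = Vc (fconst c * f)" "\<zero>\<^bsub>V\<^esub> = Vc 0"
  "f \<in> C \<Longrightarrow> h \<in> C \<Longrightarrow> Vc f \<ominus>\<^bsub>V\<^esub> Vc h = Vc (f - h)"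
  "f \<in> C \<Longrightarrow> h \<in> C \<Longrightarrow> Vc f = Vc h \<longleftrightarrow> f - h \<in> JF"
  "gr V q = Vc ` gr F q"
proof -
  have cC: "f \<in> C \<Longrightarrow> cl f \<in> carrier E" for f by (simp add: E_simps)
  show "carrier V = Vc ` C" "gr V q = Vc ` gr F q" using QV.quot_carrier QV.gr_quot[of q] by (auto simp: E_simps Vc_def)
  show "f \<in> C \<Longrightarrow> h \<in> C \<Longrightarrow> Vc f \<oplus>\<^bsub>V\<^esub> Vc h = Vc (f + h)" "f \<in> C \<Longrightarrow> c \<odot>\<^bsub>V\<^esub> Vc f = Vc (fconst c * f)"
    "f \<in> C \<Longrightarrow> h \<in> C \<Longrightarrow> Vc f \<ominus>\<^bsub>V\<^esub> Vc h = Vc (f - h)"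
    using QV.quot_add[OF cC cC] QV.quot_smult[OF cC] QV.quot_minus[OF cC cC] by (simp_all add: Vc_def E_simps)
  show "\<zero>\<^bsub>V\<^esub> = Vc 0" using QV.quot_zero by (simp add: Vc_def E_simps)
  show "f \<in> C \<Longrightarrow> h \<in> C \<Longrightarrow> Vc f = Vc h \<longleftrightarrow> f - h \<in> JF"
    using QV.q_eq_iff[OF cC cC] by (simp add: Vc_def E_simps JF_def letters_in_diff)
qed

lemma is_superspace_V: "is_superspace V"
proof (rule QV.is_superspace_quot)
  have gr: "even_part E = gr E 0" "odd_part E = gr E 1" by (simp_all add: gr_def)
  show "submodule (even_part E) complex_ring E" "submodule (odd_part E) complex_ring E"
    using is_superspace_E by (simp_all add: is_superspace_def)
  show "x \<in> J" if xy: "x \<in> even_part E" "y \<in> odd_part E" "x \<ominus>\<^bsub>E\<^esub> y \<in> J" for x y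
  proof -
    obtain f h where fh: "f \<in> gr F 0" "h \<in> gr F 1" "x = cl f" "y = cl h" using xy unfolding gr E_simps by blast
    then have "f \<in> C" "h \<in> C" using gr_F_C by auto
    then have "f - h \<in> JF" using xy fh by (simp add: E_simps JF_def letters_in_diff)
    from graded_Int[OF JF_subspace I_JF tau_JF fh(1,2) this] show "x \<in> J" by (simp add: fh JF_def)
  qed
  show "\<exists>y\<in>even_part E. \<exists>z\<in>odd_part E. x \<ominus>\<^bsub>E\<^esub> (y \<oplus>\<^bsub>E\<^esub> z) \<in> J" if "x \<in> carrier E" for x
  proof -
    have "carrier E = even_part E <+>\<^bsub>E\<^esub> odd_part E" using is_superspace_E unfolding is_superspace_def by blast
    then have "x \<in> even_part E <+>\<^bsub>E\<^esub> odd_part E" using that by blast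
    then obtain y z where yz: "y \<in> even_part E" "z \<in> odd_part E" "x = y \<oplus>\<^bsub>E\<^esub> z"
      by (auto simp: set_add_def')
    moreover have "x \<ominus>\<^bsub>E\<^esub> x = \<zero>\<^bsub>E\<^esub>" using that by (simp add: a_minus_def QV.M.r_neg)
    moreover have "\<zero>\<^bsub>E\<^esub> \<in> J" using left_ideal_J by (simp add: left_ideal_E E_simps)
    ultimately show ?thesis by metis
  qed
qed

end

section \<open>Derivations that descend to the quotient\<close>

locale env_module_derivation = env_module g L + env_derivation g p \<delta>
  for g :: "'g lie_superalgebra" and L p \<delta> +
  assumes \<delta>_L: "\<And>x. x \<in> L \<Longrightarrow> \<delta> x \<in> L"
begin

lemma Dr_JF: "f \<in> JF \<Longrightarrow> Dr f \<in> JF"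
proof -
  have "JF \<subseteq> {f \<in> JF. Dr f \<in> JF}"
    by (intro JF_minimal) (use JF_C I_JF Dr_I in \<open>auto simp: Dr_add Dr_mult JF_add JF_mult tau_C Dr_C Dr_letter JF_letter \<delta>_L\<close>)
  then show "f \<in> JF \<Longrightarrow> Dr f \<in> JF" by auto
qed

definition "Dv X = Vc (Dr (SOME f. f \<in> C \<and> Vc f = X))"

lemma Dv_Vc: assumes "f \<in> C" shows "Dv (Vc f) = Vc (Dr f)"
proof -
  define h where "h = (SOME h. h \<in> C \<and> Vc h = Vc f)"
  have "h \<in> C \<and> Vc h = Vc f"
    unfolding h_def by (rule someI[of "\<lambda>h. h \<in> C \<and> Vc h = Vc f" f]) (simp add: assms)
  then have h: "h \<in> C" "h - f \<in> JF" using assms V_simps(6)[of h f] by blast+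
  have "Dv (Vc f) = Vc (Dr h)" by (simp add: Dv_def h_def)
  also have "\<dots> = Vc (Dr f)" using Dr_JF[OF h(2)] h(1) assms by (simp add: V_simps Dr_C Dr_diff)
  finally show ?thesis .
qed

end

section \<open>Signs\<close>

definition inversions :: "nat set \<Rightarrow> nat set \<Rightarrow> (nat \<times> nat) set" where
  "inversions I J = {(i, j). i \<in> I \<and> j \<in> J \<and> j < i}"

lemma finite_inversions: "finite I \<Longrightarrow> finite J \<Longrightarrow> finite (inversions I J)"
  by (rule finite_subset[of _ "I \<times> J"]) (auto simp: inversions_def)

lemma sgm_inversions: "sgm I J = (if I \<inter> J \<noteq> {} then 0 else (- 1) ^ card (inversions I J))"
  by (simp add: sgm_def inversions_def)

lemma card_inversions_Un:
  assumes "finite I" "finite J" "finite K"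
  shows "I \<inter> J = {} \<Longrightarrow> card (inversions (I \<union> J) K) = card (inversions I K) + card (inversions J K)"
    "J \<inter> K = {} \<Longrightarrow> card (inversions I (J \<union> K)) = card (inversions I J) + card (inversions I K)"
proof -
  assume "I \<inter> J = {}"
  then have "inversions (I \<union> J) K = inversions I K \<union> inversions J K" "inversions I K \<inter> inversions J K = {}"
    by (auto simp: inversions_def)
  then show "card (inversions (I \<union> J) K) = card (inversions I K) + card (inversions J K)"
    using assms by (simp add: card_Un_disjoint finite_inversions)
next
  assume "J \<inter> K = {}"
  then have "inversions I (J \<union> K) = inversions I J \<union> inversions I K" "inversions I J \<inter> inversions I K = {}"
    by (auto simp: inversions_def)
  then show "card (inversions I (J \<union> K)) = card (inversions I J) + card (inversions I K)"
    using assms by (simp add: card_Un_disjoint finite_inversions)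
qed

text \<open>Both sides are the sign of \<theta>^I \<theta>^J \<theta>^K with the product bracketed
  in two ways; inversion numbers are additive over disjoint unions in each argument.\<close>

lemma sgm_assoc:
  assumes "finite I" "finite J" "finite K"
  shows "sgm I J * sgm (I \<union> J) K = sgm J K * sgm I (J \<union> K)"
proof (cases "I \<inter> J = {} \<and> J \<inter> K = {} \<and> I \<inter> K = {}")
  case True
  then have "(I \<union> J) \<inter> K = {}" "I \<inter> (J \<union> K) = {}" by auto
  then show ?thesis using True assms by (simp add: sgm_inversions card_inversions_Un power_add)
next
  case False
  then show ?thesis by (auto simp: sgm_inversions)
qed

text \<open>Each pair in I x J is an inversion in exactly one of the two orders, so the inversion
  numbers add up to |I| |J|.\<close>

lemma sgm_commute:
  assumes "finite I" "finite J" "I \<inter> J = {}"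
  shows "sgm I J = (- 1) ^ (card I * card J) * sgm J I"
proof -
  have "I \<times> J = inversions I J \<union> (\<lambda>(j, i). (i, j)) ` inversions J I"
    using assms(3) by (auto simp: inversions_def image_iff)
  moreover have "inversions I J \<inter> (\<lambda>(j, i). (i, j)) ` inversions J I = {}"
    by (auto simp: inversions_def)
  moreover have "card ((\<lambda>(j, i). (i, j)) ` inversions J I) = card (inversions J I)"
    by (rule card_image) (auto simp: inj_on_def)
  ultimately have "card I * card J = card (inversions I J) + card (inversions J I)"
    using assms by (metis card_Un_disjoint card_cartesian_product finite_cartesian_product finite_Un)
  then have "(- 1 :: complex) ^ (card I * card J) * (- 1) ^ card (inversions J I) = (- 1) ^ card (inversions I J)"
    by (simp add: power_add mult.assoc flip: power_mult_distrib)
  then show ?thesis using assms(3) by (simp add: sgm_inversions Int_commute)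
qed

lemma sgm_square: "I \<inter> J = {} \<Longrightarrow> sgm I J * sgm I J = 1"
  by (simp add: sgm_inversions flip: power_mult_distrib)

lemma sgm_empty [simp]: "sgm I {} = 1" "sgm {} I = 1"
  by (simp_all add: sgm_inversions inversions_def)

lemma sgm_insert_left:
  "finite P \<Longrightarrow> finite K \<Longrightarrow> sgm {i} P * sgm (insert i P) K = sgm P K * sgm {i} (P \<union> K)"
  using sgm_assoc[of "{i}" P K] by simp

text \<open>Here \<theta>^i is moved past \<theta>^P: associativity for P, {i}, K combined with the
  commutation sign of P and {i}.\<close>

lemma sgm_insert_right:
  assumes "finite P" "finite K" "i \<notin> P"
  shows "sgm {i} K * sgm P (insert i K) = (- 1) ^ card P * (sgm P K * sgm {i} (P \<union> K))"
proof -
  have "sgm P {i} * sgm (insert i P) K = sgm {i} K * sgm P (insert i K)"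
    using sgm_assoc[of P "{i}" K] assms by simp
  moreover have "sgm P {i} = (- 1) ^ card P * sgm {i} P" using sgm_commute[of P "{i}"] assms by simp
  ultimately show ?thesis using sgm_insert_left[OF assms(1,2), of i] by (simp add: mult.assoc)
qed

text \<open>The sign in \<open>{a\<^bsub><n|I>\<^esub>, b\<^bsub><k|K>\<^esub>}\<close> in front of \<open>a\<^bsub>(j|J)\<^esub> b\<close>, for \<open>a\<close>, \<open>b\<close> of parities \<open>p\<close>, \<open>q\<close>\<close>

definition csign :: "nat \<Rightarrow> nat \<Rightarrow> nat set \<Rightarrow> nat set \<Rightarrow> nat set \<Rightarrow> complex" where
  "csign p q I K J = (- 1) ^ (p * card J + q * card (I - J)) * sgm J (I - J) * sgm (I - J) K"

abbreviation "m1 k \<equiv> (- 1 :: complex) ^ k"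

lemma m1_cong: "even k = even l \<Longrightarrow> m1 k = m1 l"
  by (simp add: minus_one_power_iff)

lemma m1_square: "m1 k * m1 k = 1" "m1 k * (m1 k * x) = x"
  by (simp_all flip: power_mult_distrib mult.assoc)

text \<open>The cancellation behind the relation for S^i in the first argument: the term of {S^i a,
  b} at \<open>insert i J\<close> against the term at J of the bracket in which \<zeta>^i has been
  differentiated away.\<close>

lemma csign_S_left:
  assumes fin: "finite I" "finite K" and J: "J \<subseteq> I" "i \<in> I" "i \<notin> J"
  shows "csign (p + 1) q I K (insert i J) * (m1 (card J) * sgm {i} J) +
    m1 p * sgm {i} (I - {i}) * csign p q (I - {i}) K J = 0"
proof -
  define P where "P = I - insert i J"
  have P: "I - {i} - J = P" "I - insert i J = P" "I - {i} = J \<union> P" using J by (auto simp: P_def)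
  have finJ: "finite J" "finite P" using fin J finite_subset by (auto simp: P_def)
  have *: "sgm (insert i J) P * sgm {i} J = sgm {i} (J \<union> P) * sgm J P"
    using sgm_insert_left[OF finJ, of i] by (simp add: mult.commute)
  have "csign (p + 1) q I K (insert i J) * (m1 (card J) * sgm {i} J) =
      m1 ((p + 1) * (card J + 1) + q * card P) * m1 (card J) * (sgm (insert i J) P * sgm {i} J) * sgm P K"
    using J finJ by (simp add: csign_def P)
  also have "m1 ((p + 1) * (card J + 1) + q * card P) * m1 (card J) = - (m1 p * m1 (p * card J + q * card P))"
    by (simp add: minus_one_power_iff)
  finally have "csign (p + 1) q I K (insert i J) * (m1 (card J) * sgm {i} J) =
      - (m1 p * sgm {i} (J \<union> P) * (m1 (p * card J + q * card P) * sgm J P * sgm P K))"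
    unfolding * by (simp add: mult_ac)
  moreover have "csign p q (I - {i}) K J = m1 (p * card J + q * card P) * sgm J P * sgm P K"
    by (simp add: csign_def P(1))
  ultimately show ?thesis using P(3) by simp
qed

text \<open>The sign identities for the relation for S^i in the second argument, according to
  whether i lies in K, in I - J or in both. In the last case \<zeta>^i would occur twice, so the
  coefficient at J vanishes and two other terms cancel each other.\<close>

lemma csign_S_right:
  assumes fin: "finite I" "finite K" and J: "J \<subseteq> I"
  shows "i \<in> K \<Longrightarrow> i \<notin> I - J \<Longrightarrow>
      csign p (q + 1) I K J * sgm {i} (K \<union> (I - J) - {i}) = sgm {i} (K - {i}) * csign p q I (K - {i}) J"
    and "i \<notin> K \<Longrightarrow> i \<in> I - J \<Longrightarrow>
      m1 q * csign p (q + 1) I K J * sgm {i} (K \<union> (I - J) - {i}) = csign p (q + 1) I K (insert i J) * (m1 (p + card J + 1) * sgm {i} J)"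
    and "i \<in> K \<Longrightarrow> i \<in> I - J \<Longrightarrow>
      csign p (q + 1) I K (insert i J) * (m1 (p + card J + 1) * sgm {i} J) + m1 q * sgm {i} (K - {i}) * csign p q I (K - {i}) J = 0"
    and "i \<in> K \<Longrightarrow> i \<in> I - J \<Longrightarrow> csign p (q + 1) I K J = 0"
proof -
  define K' where "K' = K - {i}"
  have finK: "finite K'" using fin by (simp add: K'_def)
  have finJ: "finite J" "finite (I - J)" using fin J finite_subset by auto
  {
    assume i: "i \<in> K" "i \<notin> I - J"
    define P where "P = I - J"
    have K: "K = insert i K'" "i \<notin> K'" "K \<union> P - {i} = P \<union> K'" using i by (auto simp: K'_def P_def)
    have "sgm P K * sgm {i} (P \<union> K') = m1 (card P) * sgm {i} K' * sgm P K'"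
    proof (cases "P \<inter> K' = {}")
      case True
      have "sgm {i} K' * sgm P K = m1 (card P) * (sgm P K' * sgm {i} (P \<union> K'))"
        using sgm_insert_right[of P K' i] finJ finK i by (simp add: K P_def)
      from arg_cong[OF this, of "\<lambda>t. sgm {i} K' * t * sgm {i} (P \<union> K')"]
      have "(sgm {i} K' * sgm {i} K') * sgm P K * sgm {i} (P \<union> K') =
          m1 (card P) * sgm {i} K' * sgm P K' * (sgm {i} (P \<union> K') * sgm {i} (P \<union> K'))"
        by (simp only: mult_ac)
      moreover have "{i} \<inter> (P \<union> K') = {}" using i K by (auto simp: P_def)
      ultimately show ?thesis using K by (simp add: sgm_square)
    next
      case False
      then have "P \<inter> K \<noteq> {}" using K by auto
      then show ?thesis using False by (simp add: sgm_inversions)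
    qed
    then have "csign p (q + 1) I K J * sgm {i} (K \<union> P - {i}) =
        m1 (p * card J + (q + 1) * card P) * m1 (card P) * sgm {i} K' * sgm J P * sgm P K'"
      unfolding K(3) by (simp add: csign_def flip: P_def)
    also have "m1 (p * card J + (q + 1) * card P) * m1 (card P) = m1 (p * card J + q * card P)"
      by (simp add: minus_one_power_iff)
    finally show "csign p (q + 1) I K J * sgm {i} (K \<union> (I - J) - {i}) = sgm {i} (K - {i}) * csign p q I (K - {i}) J"
      by (simp add: csign_def mult_ac flip: P_def K'_def)
  }
  {
    assume i: "i \<in> I - J"
    define P where "P = I - insert i J"
    have P: "I - J = insert i P" "i \<notin> P" "I - insert i J = P" "finite P" "J \<inter> P = {}" using i fin by (auto simp: P_def)
    have iJ: "i \<notin> J" using i by auto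
    have a: "sgm (insert i J) P * sgm {i} J = m1 (card J) * sgm {i} P * sgm J (insert i P)"
    proof -
      have 1: "sgm {i} P * sgm J (insert i P) = m1 (card J) * (sgm J P * sgm {i} (J \<union> P))"
        by (rule sgm_insert_right) (use finJ P iJ in auto)
      have 2: "sgm {i} J * sgm (insert i J) P = sgm J P * sgm {i} (J \<union> P)"
        by (rule sgm_insert_left) (use finJ P in auto)
      have "m1 (card J) * (sgm {i} P * sgm J (insert i P)) = sgm J P * sgm {i} (J \<union> P)"
        unfolding 1 by (simp only: m1_square)
      then show ?thesis using 2 by (simp only: mult_ac)
    qed
    have cc: "csign p (q + 1) I K (insert i J) * (m1 (p + card J + 1) * sgm {i} J) =
        m1 (p * (card J + 1) + (q + 1) * card P) * m1 (p + card J + 1) * m1 (card J) * sgm {i} P * sgm J (insert i P) * sgm P K"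
      using a finJ iJ by (simp add: csign_def P mult_ac)
    {
      assume K: "i \<notin> K"
      have "sgm (insert i P) K * sgm {i} (P \<union> K) = sgm {i} P * sgm P K"
      proof (cases "P \<inter> K = {}")
        case True
        have "sgm {i} P * sgm (insert i P) K = sgm P K * sgm {i} (P \<union> K)" by (rule sgm_insert_left) (use P fin in auto)
        from arg_cong[OF this, of "\<lambda>t. sgm {i} P * t * sgm {i} (P \<union> K)"]
        have "(sgm {i} P * sgm {i} P) * sgm (insert i P) K * sgm {i} (P \<union> K) = sgm {i} P * sgm P K * (sgm {i} (P \<union> K) * sgm {i} (P \<union> K))"
          by (simp only: mult_ac)
        then show ?thesis using K P by (simp add: sgm_square)
      next
        case False
        then have "insert i P \<inter> K \<noteq> {}" by auto
        then show ?thesis using False by (simp add: sgm_inversions)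
      qed
      moreover have "K \<union> insert i P - {i} = P \<union> K" using K P by auto
      ultimately have "m1 q * csign p (q + 1) I K J * sgm {i} (K \<union> (I - J) - {i}) =
          m1 q * m1 (p * card J + (q + 1) * (card P + 1)) * sgm J (insert i P) * (sgm {i} P * sgm P K)"
        using P by (simp add: csign_def)
      also have "m1 q * m1 (p * card J + (q + 1) * (card P + 1)) =
          m1 (p * (card J + 1) + (q + 1) * card P) * m1 (p + card J + 1) * m1 (card J)"
        by (simp add: minus_one_power_iff)
      finally show "m1 q * csign p (q + 1) I K J * sgm {i} (K \<union> (I - J) - {i}) = csign p (q + 1) I K (insert i J) * (m1 (p + card J + 1) * sgm {i} J)"
        unfolding cc by (simp add: mult_ac)
    }
    {
      assume K: "i \<in> K"
      have K': "K = insert i K'" "i \<notin> K'" using K by (auto simp: K'_def)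
      have "sgm {i} P * sgm P K = m1 (card P) * sgm {i} K' * sgm (insert i P) K'"
      proof -
        have 1: "sgm {i} K' * sgm P K = m1 (card P) * (sgm P K' * sgm {i} (P \<union> K'))"
          using sgm_insert_right[of P K' i] P finK by (simp add: K')
        have 2: "sgm {i} P * sgm (insert i P) K' = sgm P K' * sgm {i} (P \<union> K')"
          using sgm_insert_left[of P K' i] P finK by simp
        have "(sgm {i} K' * sgm {i} K') * (sgm {i} P * sgm P K) =
            m1 (card P) * sgm {i} K' * (sgm {i} P * sgm {i} P) * sgm (insert i P) K'"
          using arg_cong[OF 1, of "\<lambda>t. sgm {i} K' * sgm {i} P * t"] arg_cong[OF 2, of "\<lambda>t. m1 (card P) * sgm {i} K' * sgm {i} P * t"]
          by (simp only: mult_ac)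
        then show ?thesis using K' P by (simp add: sgm_square)
      qed
      then have "csign p (q + 1) I K (insert i J) * (m1 (p + card J + 1) * sgm {i} J) =
          m1 (p * (card J + 1) + (q + 1) * card P) * m1 (p + card J + 1) * m1 (card J) * m1 (card P) * sgm {i} K' * (sgm J (insert i P) * sgm (insert i P) K')"
        unfolding cc by (simp add: mult_ac)
      also have "m1 (p * (card J + 1) + (q + 1) * card P) * m1 (p + card J + 1) * m1 (card J) * m1 (card P) =
          - (m1 q * m1 (p * card J + q * (card P + 1)))"
        by (simp add: minus_one_power_iff)
      finally show "csign p (q + 1) I K (insert i J) * (m1 (p + card J + 1) * sgm {i} J) + m1 q * sgm {i} (K - {i}) * csign p q I (K - {i}) J = 0"
        using P by (simp add: csign_def mult_ac flip: K'_def)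
      show "csign p (q + 1) I K J = 0" using i K by (auto simp: csign_def sgm_inversions)
    }
  }
qed

section \<open>Modes of a SUSY Lie conformal algebra\<close>

text \<open>The product formulas for S^i produce terms at \<open>J - {i}\<close>; reindexing makes
  them comparable with the terms at J.\<close>

lemma sum_Pow_insert:
  assumes "finite I"
  shows "(\<Sum>J\<in>Pow I. if i \<in> J then f (J - {i}) else 0) = (\<Sum>J\<in>Pow I. if i \<in> I - J then f J else (0::'a::comm_monoid_add))"
proof -
  have "(\<Sum>J\<in>Pow I. if i \<in> J then f (J - {i}) else 0) = (\<Sum>J\<in>{J \<in> Pow I. i \<in> J}. f (J - {i}))"
    using assms by (subst sum.inter_filter) auto
  also have "\<dots> = (\<Sum>J\<in>{J \<in> Pow I. i \<in> I - J}. f J)"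
    by (rule sum.reindex_bij_witness[of _ "insert i" "\<lambda>J. J - {i}"]) auto
  also have "\<dots> = (\<Sum>J\<in>Pow I. if i \<in> I - J then f J else 0)"
    using assms by (subst sum.inter_filter) auto
  finally show ?thesis .
qed

context susy_lie_conformal_algebra
begin

section \<open>Parity components and coefficients of the bracket\<close>

abbreviation "s \<equiv> conf_scale R"
abbreviation "cg \<equiv> conf_gr R"

sublocale R: vector_space s by (rule vector_space)

lemma lookup_pscale: "Poly_Mapping.lookup (pscale R c f) k = s c (Poly_Mapping.lookup f k)"
  by (simp add: pscale_def Poly_Mapping.map.rep_eq when_def)

lemma pscale_single: "pscale R c (Poly_Mapping.single k a) = Poly_Mapping.single k (s c a)"
  by (rule poly_mapping_eqI) (simp add: lookup_pscale lookup_single when_def)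

sublocale LP: vector_space "pscale R :: complex \<Rightarrow> 'r loops \<Rightarrow> 'r loops"
  by standard (auto intro!: poly_mapping_eqI simp: lookup_pscale lookup_add R.scale_right_distrib R.scale_left_distrib)

lemma lookup_pext_single:
  fixes f :: "'k \<Rightarrow>\<^sub>0 'r" and \<phi> :: "'k \<Rightarrow> 'r \<Rightarrow> 'r"
  assumes "\<And>k x y. \<phi> k (x + y) = \<phi> k x + \<phi> k y"
  shows "Poly_Mapping.lookup (pext (\<lambda>k r. Poly_Mapping.single k (\<phi> k r)) f) k = \<phi> k (Poly_Mapping.lookup f k)"
proof -
  have 0: "\<phi> k 0 = 0" for k using assms[of k 0 0] by simp
  show ?thesis
    by (simp add: pext_def lookup_sum lookup_single when_def in_keys_iff 0)
qed

lemma linear_add: "Vector_Spaces.linear s s f \<Longrightarrow> f (a + b) = f a + f b"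
  and linear_scale: "Vector_Spaces.linear s s f \<Longrightarrow> f (s c a) = s c (f a)"
  and linear_0: "Vector_Spaces.linear s s f \<Longrightarrow> f 0 = 0"
proof -
  assume f: "Vector_Spaces.linear s s f"
  show "f (a + b) = f a + f b" "f (s c a) = s c (f a)" using f by (auto simp: linear_iff_additive_homogeneous)
  have ad: "additive f" using f by (simp add: linear_iff_additive_homogeneous additive_def)
  show "f 0 = 0" by (rule additive.zero[OF ad])
qed

lemmas T_add = linear_add[OF linear_T] and T_scale = linear_scale[OF linear_T] and T_0 = linear_0[OF linear_T]
lemmas S_add = linear_add[OF linear_S] and S_scale = linear_scale[OF linear_S] and S_0 = linear_0[OF linear_S]

lemma cg_0: "0 \<in> cg p" and cg_add: "a \<in> cg p \<Longrightarrow> b \<in> cg p \<Longrightarrow> a + b \<in> cg p"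
  and cg_scale: "a \<in> cg p \<Longrightarrow> s c a \<in> cg p"
  using subspace_gr[of p] by (auto simp: R.subspace_def)

lemma cg_diff: "a \<in> cg p \<Longrightarrow> b \<in> cg p \<Longrightarrow> a - b \<in> cg p"
  by (rule R.subspace_diff[OF subspace_gr])

lemma cg_cong: "even p = even q \<Longrightarrow> cg p = cg q"
  by (simp add: conf_gr_def)

lemma cg_Int: "a \<in> cg p \<Longrightarrow> a \<in> cg q \<Longrightarrow> even p \<noteq> even q \<Longrightarrow> a = 0"
  using even_Int_odd by (auto simp: conf_gr_def split: if_splits)

abbreviation "cp \<equiv> conf_proj R"

lemma cp_unique: assumes "x \<in> cg p" "a - x \<in> cg (p + 1)" shows "cp p a = x"
  unfolding conf_proj_def
proof (rule the_equality)
  fix y assume y: "y \<in> cg p \<and> a - y \<in> cg (p + 1)"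
  have "(a - y) - (a - x) \<in> cg (p + 1)" using y assms cg_diff by blast
  then have "x - y \<in> cg (p + 1)" by simp
  moreover have "x - y \<in> cg p" using y assms cg_diff by blast
  ultimately have "x - y = 0" using cg_Int[of "x - y" p "p + 1"] by simp
  then show "y = x" by simp
qed (use assms in simp)

lemma cp_gr: "cp p a \<in> cg p" and cp_compl: "a - cp p a \<in> cg (p + 1)"
proof -
  obtain x y where xy: "x \<in> conf_even R" "y \<in> conf_odd R" "a = x + y" using even_plus_odd by blast
  have "\<exists>u. u \<in> cg p \<and> a - u \<in> cg (p + 1)"
    by (rule exI[of _ "if even p then x else y"]) (use xy in \<open>auto simp: conf_gr_def\<close>)
  then obtain u where u: "u \<in> cg p" "a - u \<in> cg (p + 1)" by blast
  then show "cp p a \<in> cg p" "a - cp p a \<in> cg (p + 1)" using cp_unique[OF u] by simp_all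
qed

lemma cp_add: "cp p (a + b) = cp p a + cp p b"
proof (rule cp_unique)
  show "cp p a + cp p b \<in> cg p" by (intro cg_add cp_gr)
  have "(a - cp p a) + (b - cp p b) \<in> cg (p + 1)" by (intro cg_add cp_compl)
  then show "a + b - (cp p a + cp p b) \<in> cg (p + 1)" by (simp add: algebra_simps)
qed

lemma cp_scale: "cp p (s c a) = s c (cp p a)"
proof (rule cp_unique)
  show "s c (cp p a) \<in> cg p" by (intro cg_scale cp_gr)
  have "s c (a - cp p a) \<in> cg (p + 1)" by (intro cg_scale cp_compl)
  then show "s c a - s c (cp p a) \<in> cg (p + 1)" by (simp add: R.scale_right_diff_distrib)
qed

lemma cp_eq: "a \<in> cg q \<Longrightarrow> cp p a = (if even p = even q then a else 0)"
proof -
  assume a: "a \<in> cg q"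
  show ?thesis
  proof (cases "even p = even q")
    case True
    then have "a \<in> cg p" using a cg_cong by blast
    then show ?thesis using True cg_0 by (intro cp_unique) auto
  next
    case False
    then have "a \<in> cg (p + 1)" using a cg_cong[of q "p + 1"] by auto
    then show ?thesis using False cg_0 by (intro cp_unique) auto
  qed
qed

lemma cp_0: "cp p 0 = 0"
  using cp_eq[OF cg_0] by simp

lemma cp_cong: "even p = even q \<Longrightarrow> cp p a = cp q a"
  using cp_unique[of "cp q a" p a] cp_gr[of q a] cp_compl[of a q] cg_cong[of p q] cg_cong[of "p + 1" "q + 1"] by auto

lemma cp_sum: "cp 0 a + cp 1 a = a"
proof -
  have "cp 1 a = a - cp 0 a"
    by (rule cp_unique) (use cp_compl[of a 0] cp_gr[of 0 a] cg_cong[of 0 "1 + 1"] in simp_all)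
  then show ?thesis by simp
qed

lemma lookup_mul_lam: "Poly_Mapping.lookup (mul_lam x) (0, J) = 0"
  "Poly_Mapping.lookup (mul_lam x) (Suc j, J) = Poly_Mapping.lookup x (j, J)" for x :: "(nat \<times> nat set) \<Rightarrow>\<^sub>0 'r"
proof -
  have eq: "mul_lam x = (\<Sum>k\<in>Poly_Mapping.keys x. Poly_Mapping.single (Suc (fst k), snd k) (Poly_Mapping.lookup x k))"
    by (simp add: mul_lam_def pext_def case_prod_beta)
  show "Poly_Mapping.lookup (mul_lam x) (0, J) = 0"
    by (simp add: eq lookup_sum lookup_single when_def)
  have "Poly_Mapping.lookup (mul_lam x) (Suc j, J) = (\<Sum>k\<in>Poly_Mapping.keys x. if k = (j, J) then Poly_Mapping.lookup x k else 0)"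
    unfolding eq lookup_sum lookup_single when_def by (intro sum.cong refl) (auto simp: prod_eq_iff)
  then show "Poly_Mapping.lookup (mul_lam x) (Suc j, J) = Poly_Mapping.lookup x (j, J)"
    by (simp add: in_keys_iff)
qed

lemma lookup_mul_chi:
  "i \<notin> J \<Longrightarrow> Poly_Mapping.lookup (mul_chi R i x) (j, J) = 0"
  "i \<notin> J \<Longrightarrow> Poly_Mapping.lookup (mul_chi R i x) (j, insert i J) = s (sgm {i} J) (Poly_Mapping.lookup x (j, J))"
proof -
  assume i: "i \<notin> J"
  have eq: "mul_chi R i x = (\<Sum>k\<in>Poly_Mapping.keys x. Poly_Mapping.single (fst k, insert i (snd k)) (s (sgm {i} (snd k)) (Poly_Mapping.lookup x k)))"
    by (simp add: mul_chi_def pext_def case_prod_beta)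
  show "Poly_Mapping.lookup (mul_chi R i x) (j, J) = 0"
    unfolding eq lookup_sum lookup_single when_def using i by (intro sum.neutral) auto
  have "Poly_Mapping.lookup (mul_chi R i x) (j, insert i J) =
      (\<Sum>k\<in>Poly_Mapping.keys x. if k = (j, J) then s (sgm {i} J) (Poly_Mapping.lookup x k) else 0)"
    unfolding eq lookup_sum lookup_single when_def
  proof (intro sum.cong refl)
    fix k :: "nat \<times> nat set"
    show "(if (fst k, insert i (snd k)) = (j, insert i J) then s (sgm {i} (snd k)) (Poly_Mapping.lookup x k) else 0) =
        (if k = (j, J) then s (sgm {i} J) (Poly_Mapping.lookup x k) else 0)"
    proof (cases "i \<in> snd k")
      case True
      then have "sgm {i} (snd k) = 0" "k \<noteq> (j, J)" using i by (auto simp: sgm_def)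
      then show ?thesis by simp
    next
      case False
      then have "insert i (snd k) = insert i J \<longleftrightarrow> snd k = J" using i by (metis insert_ident)
      then show ?thesis by (auto simp: prod_eq_iff)
    qed
  qed
  then show "Poly_Mapping.lookup (mul_chi R i x) (j, insert i J) = s (sgm {i} J) (Poly_Mapping.lookup x (j, J))"
    by (simp add: in_keys_iff)
qed

lemma lookup_act_T: "Poly_Mapping.lookup (act_T R x) k = conf_T R (Poly_Mapping.lookup x k)"
  unfolding act_T_def by (rule lookup_pext_single) (simp add: T_add)

lemma lookup_act_S: "i \<in> {1..N} \<Longrightarrow>
  Poly_Mapping.lookup (act_S R i x) (j, J) = s (m1 (card J)) (conf_S R i (Poly_Mapping.lookup x (j, J)))"
proof -
  assume i: "i \<in> {1..N}"
  have "act_S R i x = pext (\<lambda>k r. Poly_Mapping.single k (s (m1 (card (snd k))) (conf_S R i r))) x"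
    by (simp add: act_S_def case_prod_beta')
  moreover have "Poly_Mapping.lookup (pext (\<lambda>k r. Poly_Mapping.single k (s (m1 (card (snd k))) (conf_S R i r))) x) (j, J) =
      s (m1 (card (snd (j, J)))) (conf_S R i (Poly_Mapping.lookup x (j, J)))"
    by (rule lookup_pext_single) (simp add: S_add[OF i] R.scale_right_distrib)
  ultimately show ?thesis by simp
qed

section \<open>The products and their sesquilinearity\<close>

abbreviation "np \<equiv> nprod N R"

text \<open>The factor between the coefficient of \<Lambda>^(j|J) and the product a_(j|J) b for |J|
  = k. Its recursions in k and j turn multiplication by \<chi>^i and \<lambda> into the signs and
  integers of the formulas for products.\<close>

definition "nc j k = m1 (k * N + k * (k + 1) div 2) * fact j"

lemma np_def: "np a j J b = s (nc j (card J)) (Poly_Mapping.lookup (conf_br R a b) (j, J))"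
  by (simp add: nprod_def nc_def)

lemma nc_Suc: "nc j (Suc k) = m1 (N + k + 1) * nc j k" "nc (Suc j) k = of_nat (Suc j) * nc j k"
proof -
  have "Suc k * (Suc k + 1) div 2 = k * (k + 1) div 2 + Suc k" by (simp add: algebra_simps)
  then show "nc j (Suc k) = m1 (N + k + 1) * nc j k" by (simp add: nc_def power_add algebra_simps)
qed (simp add: nc_def)

lemma br_add: "conf_br R (a + a') b = conf_br R a b + conf_br R a' b" "conf_br R a (b + b') = conf_br R a b + conf_br R a b'"
  and br_scale: "conf_br R (s c a) b = pscale R c (conf_br R a b)" "conf_br R a (s c b) = pscale R c (conf_br R a b)"
  using linear_br_left[of b] linear_br_right[of a] by (simp_all add: linear_iff_additive_homogeneous)

lemma np_add: "np (a + a') j J b = np a j J b + np a' j J b" "np a j J (b + b') = np a j J b + np a j J b'"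
  and np_scale: "np (s c a) j J b = s c (np a j J b)" "np a j J (s c b) = s c (np a j J b)"
  by (simp_all add: np_def br_add br_scale lookup_add lookup_pscale R.scale_right_distrib mult.commute)

lemma np_0: "np 0 j J b = 0" "np a j J 0 = 0"
  using np_scale(1)[of 0 0] np_scale(2)[of _ _ _ 0 0] by simp_all

lemma np_gr: "a \<in> cg p \<Longrightarrow> b \<in> cg q \<Longrightarrow> np a j J b \<in> cg (p + q + N + card J)"
  unfolding np_def by (intro cg_scale parity_br)

lemma np_bounded: "\<exists>M. \<forall>j\<ge>M. \<forall>J. np a j J b = 0"
proof -
  define M where "M = Suc (Max (insert 0 (fst ` Poly_Mapping.keys (conf_br R a b))))"
  have "np a j J b = 0" if "j \<ge> M" for j J
  proof -
    have "(j, J) \<notin> Poly_Mapping.keys (conf_br R a b)"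
    proof
      assume "(j, J) \<in> Poly_Mapping.keys (conf_br R a b)"
      then have "j \<le> Max (insert 0 (fst ` Poly_Mapping.keys (conf_br R a b)))" by (intro Max_ge) force+
      then show False using that by (simp add: M_def)
    qed
    then show ?thesis by (simp add: np_def in_keys_iff)
  qed
  then show ?thesis by blast
qed

lemma np_T_left: "np (conf_T R a) 0 J b = 0" "np (conf_T R a) (Suc j) J b = s (- of_nat (Suc j)) (np a j J b)"
  by (simp_all add: np_def br_T_left lookup_mul_lam nc_Suc R.scale_minus_left mult.commute del: of_nat_Suc)

lemma np_T_right: "np a 0 J (conf_T R b) = conf_T R (np a 0 J b)"
  "np a (Suc j) J (conf_T R b) = conf_T R (np a (Suc j) J b) + s (of_nat (Suc j)) (np a j J b)"
  by (simp_all add: np_def br_T_right lookup_add lookup_act_T lookup_mul_lam T_scale R.scale_right_distrib nc_Suc mult.commute)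

text \<open>Left multiplication by \<chi>^i produces only monomials that contain \<chi>^i, hence the
  vanishing at J; at \<open>insert i J\<close> the sign (-1)^N of the bracket cancels against the
  one in \<open>nc_Suc\<close>.\<close>

lemma np_S_left:
  assumes i: "i \<in> {1..N}" "i \<notin> J"
  shows "np (conf_S R i a) j J b = 0"
    "finite J \<Longrightarrow> np (conf_S R i a) j (insert i J) b = s (m1 (card J) * sgm {i} J) (np a j J b)"
proof -
  show "np (conf_S R i a) j J b = 0"
    by (simp add: np_def br_S_left[OF i(1)] lookup_pscale lookup_mul_chi(1)[OF i(2)])
  assume "finite J"
  then have c: "card (insert i J) = Suc (card J)" using i by simp
  have "nc j (Suc (card J)) * (m1 N * sgm {i} J) = - (m1 (card J) * sgm {i} J * nc j (card J))"
    by (simp add: nc_Suc power_add mult_ac m1_square)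
  then show "np (conf_S R i a) j (insert i J) b = s (m1 (card J) * sgm {i} J) (np a j J b)"
    by (simp add: np_def br_S_left[OF i(1)] lookup_pscale lookup_mul_chi(2)[OF i(2)] c)
qed

lemma np_S_right:
  assumes i: "i \<in> {1..N}" "i \<notin> J" and a: "a \<in> cg p"
  shows "np a j J (conf_S R i b) = s (m1 (p + N + card J)) (conf_S R i (np a j J b))"
    "finite J \<Longrightarrow> np a j (insert i J) (conf_S R i b) =
      s (m1 (p + N + card (insert i J))) (conf_S R i (np a j (insert i J) b)) + s (m1 (p + card J + 1) * sgm {i} J) (np a j J b)"
proof -
  show "np a j J (conf_S R i b) = s (m1 (p + N + card J)) (conf_S R i (np a j J b))"
    by (simp add: np_def br_S_right[OF i(1) a] lookup_pscale lookup_add lookup_mul_chi(1)[OF i(2)] lookup_act_S[OF i(1)]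
        S_scale[OF i(1)] power_add mult_ac)
  assume "finite J"
  then have c: "card (insert i J) = Suc (card J)" using i by simp
  have e1: "nc j (Suc (card J)) * (m1 (p + N) * m1 (Suc (card J))) = m1 (p + N + Suc (card J)) * nc j (Suc (card J))"
    by (simp add: power_add)
  have e2: "nc j (Suc (card J)) * (m1 (p + N) * sgm {i} J) = m1 (p + card J + 1) * (sgm {i} J * nc j (card J))"
    by (simp add: nc_Suc power_add mult_ac m1_square)
  then show "np a j (insert i J) (conf_S R i b) =
      s (m1 (p + N + card (insert i J))) (conf_S R i (np a j (insert i J) b)) + s (m1 (p + card J + 1) * sgm {i} J) (np a j J b)"
    by (simp only: np_def br_S_right[OF i(1) a] lookup_pscale lookup_add lookup_mul_chi(2)[OF i(2)] lookup_act_S[OF i(1)]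
        S_scale[OF i(1)] R.scale_right_distrib R.scale_scale c mult.assoc e1 e2)
qed

end

lemma pext_linear:
  fixes \<phi> :: "'k \<Rightarrow> 'a::zero \<Rightarrow> 'b::ab_group_add"
  assumes "\<And>k x. \<phi> k (u x) = t (\<phi> k x)" "\<And>k. \<phi> k 0 = 0" "additive t"
    and "\<And>k. Poly_Mapping.lookup g k = u (Poly_Mapping.lookup f k)" "u 0 = 0"
  shows "pext \<phi> g = t (pext \<phi> f)"
proof -
  have "Poly_Mapping.keys g \<subseteq> Poly_Mapping.keys f" using assms(4,5) by (auto simp: in_keys_iff)
  then have "pext \<phi> g = (\<Sum>k\<in>Poly_Mapping.keys f. \<phi> k (Poly_Mapping.lookup g k))"
    by (intro pext_superset assms(2)) auto
  then show ?thesis by (simp add: assms pext_def additive.sum[OF assms(3)])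
qed

context susy_lie_conformal_algebra
begin

section \<open>The loop space and its relations\<close>

abbreviation "sing \<equiv> Poly_Mapping.single :: int \<times> nat set \<Rightarrow> 'r \<Rightarrow> 'r loops"

definition "LC = {f :: 'r loops. Poly_Mapping.keys f \<subseteq> UNIV \<times> Pow {1..N}}"

lemma LC_single: "I \<subseteq> {1..N} \<Longrightarrow> sing (n, I) a \<in> LC"
  by (simp add: LC_def)

lemma LC_subspace: "LP.subspace LC"
proof -
  have "f + h \<in> LC" if "f \<in> LC" "h \<in> LC" for f h using that keys_add[of f h] by (auto simp: LC_def)
  moreover have "pscale R c f \<in> LC" if "f \<in> LC" for c f
    using that by (auto simp: LC_def in_keys_iff lookup_pscale)
  ultimately show ?thesis by (simp add: LP.subspace_def LC_def)
qed

lemma loop_space_simps: "carrier (loop_space N R) = LC" "zero (loop_space N R) = 0" "add (loop_space N R) = (+)"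
  "smult (loop_space N R) = pscale R"
  by (simp_all add: loop_space_def Let_def LC_def)

definition "Lgr p = {f \<in> LC. \<forall>n I. Poly_Mapping.lookup f (n, I) \<in> cg (p + card I)}"

lemma Lgr_cong: "even p = even q \<Longrightarrow> Lgr p = Lgr q"
proof -
  assume "even p = even q"
  then have "cg (p + k) = cg (q + k)" for k by (intro cg_cong) simp
  then show ?thesis by (simp add: Lgr_def)
qed

lemma gr_loop_space: "gr (loop_space N R) p = Lgr p"
  using Lgr_cong[of p 0] Lgr_cong[of p 1]
  by (auto simp: gr_def loop_space_def Let_def Lgr_def LC_def)

lemma Lgr_subspace: "LP.subspace (Lgr p)"
  using LC_subspace by (auto simp: Lgr_def LP.subspace_def lookup_add lookup_pscale cg_0 cg_add cg_scale)

lemma Lgr_single: "I \<subseteq> {1..N} \<Longrightarrow> a \<in> cg (p + card I) \<Longrightarrow> sing (n, I) a \<in> Lgr p"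
  by (auto simp: Lgr_def LC_single lookup_single when_def cg_0)

lemma loops_induct [consumes 1, case_names zero single add]:
  assumes "f \<in> LC" "P 0" "\<And>n I p a. I \<subseteq> {1..N} \<Longrightarrow> a \<in> cg p \<Longrightarrow> P (sing (n, I) a)"
    and "\<And>f g. P f \<Longrightarrow> P g \<Longrightarrow> P (f + g)"
  shows "P f"
proof (rule poly_mapping_single_induct[of P f])
  fix k assume k: "k \<in> Poly_Mapping.keys f"
  obtain n I where nI: "k = (n, I)" by (cases k)
  have I: "I \<subseteq> {1..N}" using k nI assms(1) by (auto simp: LC_def)
  have "Poly_Mapping.single k (Poly_Mapping.lookup f k) = sing (n, I) (cp 0 (Poly_Mapping.lookup f k)) + sing (n, I) (cp 1 (Poly_Mapping.lookup f k))"
    using cp_sum[of "Poly_Mapping.lookup f k"] by (simp add: nI flip: single_add)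
  then show "P (Poly_Mapping.single k (Poly_Mapping.lookup f k))" using assms(3)[OF I cp_gr] assms(4) by metis
qed (use assms in auto)

lemma Lgr_induct [consumes 1, case_names zero single add]:
  assumes "f \<in> Lgr p" "P 0" "\<And>n I a. I \<subseteq> {1..N} \<Longrightarrow> a \<in> cg (p + card I) \<Longrightarrow> P (sing (n, I) a)"
    and "\<And>f g. P f \<Longrightarrow> P g \<Longrightarrow> P (f + g)"
  shows "P f"
proof (rule poly_mapping_single_induct[of P f])
  fix k assume k: "k \<in> Poly_Mapping.keys f"
  obtain n I where nI: "k = (n, I)" by (cases k)
  have I: "I \<subseteq> {1..N}" using k nI assms(1) by (auto simp: LC_def Lgr_def)
  show "P (Poly_Mapping.single k (Poly_Mapping.lookup f k))" using assms(1) assms(3)[OF I] by (simp add: nI Lgr_def)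
qed (use assms in auto)

text \<open>The span by type class operations; \<open>loop_ker_eq\<close> identifies it with the
  span in the record of the loop space.\<close>

definition "ker = LP.span (loop_rels N R)"

lemma loop_rels_LC: "loop_rels N R \<subseteq> LC"
proof -
  note add = LP.subspace_add[OF LC_subspace] and zero = LP.subspace_0[OF LC_subspace]
  show ?thesis unfolding loop_rels_def by (auto intro!: add LC_single simp: zero)
qed

lemma ker_LC: "ker \<subseteq> LC"
  unfolding ker_def by (rule LP.span_minimal[OF loop_rels_LC LC_subspace])

lemma ker_subspace: "LP.subspace ker"
  by (simp add: ker_def)

lemmas ker_0 = LP.subspace_0[OF ker_subspace] and ker_add = LP.subspace_add[OF ker_subspace]
  and ker_scale = LP.subspace_scale[OF ker_subspace] and ker_diff = LP.subspace_diff[OF ker_subspace]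
  and ker_neg = LP.subspace_neg[OF ker_subspace]

lemma ker_sum: "(\<And>x. x \<in> A \<Longrightarrow> f x \<in> ker) \<Longrightarrow> sum f A \<in> ker"
  by (rule LP.subspace_sum[OF ker_subspace])

lemma ker_T: "I \<subseteq> {1..N} \<Longrightarrow> sing (n, I) (conf_T R a) + sing (n - 1, I) (s (of_int n) a) \<in> ker"
  unfolding ker_def by (rule LP.span_base) (auto simp: loop_rels_def)

lemma ker_S: "i \<in> {1..N} \<Longrightarrow> a \<in> cg p \<Longrightarrow> I \<subseteq> {1..N} \<Longrightarrow> i \<notin> I \<Longrightarrow> sing (n, I) (conf_S R i a) \<in> ker"
proof -
  assume *: "i \<in> {1..N}" "a \<in> cg p" "I \<subseteq> {1..N}" "i \<notin> I"
  have "sing (n, I) (conf_S R i a) + (if i \<in> I then sing (n, I - {i}) (s (m1 p * sgm {i} (I - {i})) a) else 0) \<in> ker"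
    unfolding ker_def by (rule LP.span_base) (use * in \<open>unfold loop_rels_def, blast\<close>)
  then show ?thesis using * by simp
qed

lemma ker_S_insert: "i \<in> {1..N} \<Longrightarrow> a \<in> cg p \<Longrightarrow> I \<subseteq> {1..N} \<Longrightarrow> i \<in> I \<Longrightarrow>
   sing (n, I) (conf_S R i a) + sing (n, I - {i}) (s (m1 p * sgm {i} (I - {i})) a) \<in> ker"
proof -
  assume *: "i \<in> {1..N}" "a \<in> cg p" "I \<subseteq> {1..N}" "i \<in> I"
  have "sing (n, I) (conf_S R i a) + (if i \<in> I then sing (n, I - {i}) (s (m1 p * sgm {i} (I - {i})) a) else 0) \<in> ker"
    unfolding ker_def by (rule LP.span_base) (use * in \<open>unfold loop_rels_def, blast\<close>)
  then show ?thesis using * by simp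
qed

section \<open>The bracket of monomials modulo the relations\<close>

abbreviation "cm \<equiv> curly_mono N R"

text \<open>Different brackets have different supports, so their sums do not match term by term.
  Here the support is enlarged to a rectangle: all j below a common bound M and all subsets J of
  I.\<close>

lemma cm_expand:
  assumes "finite I" "\<forall>j\<ge>M. \<forall>J. np a j J b = 0"
  shows "cm p a n I q b k K = (\<Sum>j<M. \<Sum>J\<in>Pow I. sing (n - int j + k, K \<union> (I - J))
    (s (csign p q I K J * (of_int n gchoose j)) (np a j J b)))"
proof -
  have "cm p a n I q b k K = (\<Sum>(j, J)\<in>{(j, J) \<in> Poly_Mapping.keys (conf_br R a b). J \<subseteq> I}. sing (n - int j + k, K \<union> (I - J))
    (s (csign p q I K J * (of_int n gchoose j)) (np a j J b)))"
    unfolding curly_mono_def csign_def by (intro sum.cong refl) (auto simp: mult_ac)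
  also have "\<dots> = (\<Sum>(j, J)\<in>{..<M} \<times> Pow I. sing (n - int j + k, K \<union> (I - J))
    (s (csign p q I K J * (of_int n gchoose j)) (np a j J b)))"
  proof (rule sum.mono_neutral_cong)
    show "finite {(j, J). (j, J) \<in> Poly_Mapping.keys (conf_br R a b) \<and> J \<subseteq> I}"
      by (rule finite_subset[of _ "Poly_Mapping.keys (conf_br R a b)"]) auto
    show "finite ({..<M} \<times> Pow I)" using assms(1) by simp
    fix x assume "x \<in> {(j, J). (j, J) \<in> Poly_Mapping.keys (conf_br R a b) \<and> J \<subseteq> I} - {..<M} \<times> Pow I"
    then show "(case x of (j, J) \<Rightarrow> sing (n - int j + k, K \<union> (I - J)) (s (csign p q I K J * (of_int n gchoose j)) (np a j J b))) = 0"
    proof -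
      obtain j J where "x = (j, J)" "\<not> j < M" using \<open>x \<in> _\<close> by auto
      then show ?thesis using assms(2) by simp
    qed
  next
    fix x assume "x \<in> {..<M} \<times> Pow I - {(j, J). (j, J) \<in> Poly_Mapping.keys (conf_br R a b) \<and> J \<subseteq> I}"
    then show "(case x of (j, J) \<Rightarrow> sing (n - int j + k, K \<union> (I - J)) (s (csign p q I K J * (of_int n gchoose j)) (np a j J b))) = 0"
      by (auto simp: np_def in_keys_iff)
  qed simp
  also have "\<dots> = (\<Sum>j<M. \<Sum>J\<in>Pow I. sing (n - int j + k, K \<union> (I - J))
    (s (csign p q I K J * (of_int n gchoose j)) (np a j J b)))"
    by (rule sum.cartesian_product[symmetric])
  finally show ?thesis .
qed

lemma np_bound2: obtains M where "\<forall>j\<ge>M. \<forall>J. np a j J b = 0" "\<forall>j\<ge>M. \<forall>J. np a' j J b' = 0"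
proof -
  obtain M1 where 1: "\<forall>j\<ge>M1. \<forall>J. np a j J b = 0" using np_bounded by blast
  obtain M2 where 2: "\<forall>j\<ge>M2. \<forall>J. np a' j J b' = 0" using np_bounded by blast
  show thesis by (rule that[of "max M1 M2"]) (use 1 2 in auto)
qed

lemma cm_superset:
  assumes "finite X" "Poly_Mapping.keys (conf_br R a b) \<subseteq> X"
  shows "cm p a n I q b k K = (\<Sum>x\<in>{x \<in> X. snd x \<subseteq> I}. sing (n - int (fst x) + k, K \<union> (I - snd x))
    (s (csign p q I K (snd x) * (of_int n gchoose fst x)) (np a (fst x) (snd x) b)))"
proof -
  have "cm p a n I q b k K = (\<Sum>x\<in>{x \<in> Poly_Mapping.keys (conf_br R a b). snd x \<subseteq> I}. sing (n - int (fst x) + k, K \<union> (I - snd x))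
    (s (csign p q I K (snd x) * (of_int n gchoose fst x)) (np a (fst x) (snd x) b)))"
    unfolding curly_mono_def csign_def by (intro sum.cong) (auto simp: mult_ac)
  also have "\<dots> = (\<Sum>x\<in>{x \<in> X. snd x \<subseteq> I}. sing (n - int (fst x) + k, K \<union> (I - snd x))
    (s (csign p q I K (snd x) * (of_int n gchoose fst x)) (np a (fst x) (snd x) b)))"
  proof (rule sum.mono_neutral_left)
    show "\<forall>x\<in>{x \<in> X. snd x \<subseteq> I} - {x \<in> Poly_Mapping.keys (conf_br R a b). snd x \<subseteq> I}.
        sing (n - int (fst x) + k, K \<union> (I - snd x)) (s (csign p q I K (snd x) * (of_int n gchoose fst x)) (np a (fst x) (snd x) b)) = 0"
      by (auto simp: np_def in_keys_iff)
  qed (use assms in auto)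
  finally show ?thesis .
qed

lemma cm_add:
  "cm p (a + a') n I q b k K = cm p a n I q b k K + cm p a' n I q b k K" (is ?left)
  "cm p a n I q (b + b') k K = cm p a n I q b k K + cm p a n I q b' k K" (is ?right)
proof -
  define X where "X = Poly_Mapping.keys (conf_br R a b) \<union> Poly_Mapping.keys (conf_br R a' b) \<union> Poly_Mapping.keys (conf_br R a b')"
  have X: "finite X" "Poly_Mapping.keys (conf_br R a b) \<subseteq> X" "Poly_Mapping.keys (conf_br R a' b) \<subseteq> X" "Poly_Mapping.keys (conf_br R a b') \<subseteq> X"
    "Poly_Mapping.keys (conf_br R (a + a') b) \<subseteq> X" "Poly_Mapping.keys (conf_br R a (b + b')) \<subseteq> X"
    using keys_add[of "conf_br R a b" "conf_br R a' b"] keys_add[of "conf_br R a b" "conf_br R a b'"] by (auto simp: X_def br_add)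
  show ?left ?right
    by (simp_all add: cm_superset[OF X(1)] X np_add R.scale_right_distrib single_add sum.distrib)
qed

lemma pscale_sum: "pscale R c (sum f A) = (\<Sum>x\<in>A. pscale R c (f x :: 'r loops))"
  by (rule LP.scale_sum_right)

lemma cm_scale:
  "cm p (s c a) n I q b k K = pscale R c (cm p a n I q b k K)" (is ?left)
  "cm p a n I q (s c b) k K = pscale R c (cm p a n I q b k K)" (is ?right)
proof -
  define X where "X = Poly_Mapping.keys (conf_br R a b)"
  have X: "finite X" "Poly_Mapping.keys (conf_br R a b) \<subseteq> X" "Poly_Mapping.keys (conf_br R (s c a) b) \<subseteq> X" "Poly_Mapping.keys (conf_br R a (s c b)) \<subseteq> X"
    by (auto simp: X_def br_scale in_keys_iff lookup_pscale)
  show ?left ?right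
    by (simp_all add: cm_superset[OF X(1)] X np_scale pscale_sum pscale_single mult_ac)
qed

lemma cm_0: "cm p 0 n I q b k K = 0" "cm p a n I q 0 k K = 0"
  by (simp_all add: curly_mono_def np_0)

lemma cm_cong: "even p = even p' \<Longrightarrow> even q = even q' \<Longrightarrow> cm p a n I q b k K = cm p' a n I q' b k K"
proof -
  assume *: "even p = even p'" "even q = even q'"
  have "m1 (p * u + q * v) = m1 (p' * u + q' * v)" for u v using * by (intro m1_cong) auto
  then show ?thesis by (simp add: curly_mono_def)
qed

lemma cm_LC:
  assumes "I \<subseteq> {1..N}" "K \<subseteq> {1..N}" shows "cm p a n I q b k K \<in> LC"
proof -
  obtain M where "\<forall>j\<ge>M. \<forall>J. np a j J b = 0" using np_bounded by blast
  then show ?thesis using assms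
    by (subst cm_expand[of I M]) (auto intro!: LP.subspace_sum[OF LC_subspace] LC_single intro: finite_subset)
qed

text \<open>An exact identity in the loop space: the factor -(j + 1) in (T a)_(j+1|J) b turns the
  binomial coefficient (n over j + 1) into n times (n - 1 over j).\<close>

lemma cm_T_left:
  assumes "finite I" shows "cm p (conf_T R a) n I q b k K + cm p (s (of_int n) a) (n - 1) I q b k K = 0"
proof -
  obtain M where M: "\<forall>j\<ge>M. \<forall>J. np a j J b = 0" using np_bounded by blast
  have M2: "\<forall>j\<ge>Suc M. \<forall>J. np (conf_T R a) j J b = 0"
  proof (intro allI impI)
    fix j J assume jM: "j \<ge> Suc M"
    obtain j' where j': "j = Suc j'" "j' \<ge> M" using jM by (cases j) auto
    then show "np (conf_T R a) j J b = 0" using M by (simp add: j'(1) np_T_left)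
  qed
  have M3: "\<forall>j\<ge>M. \<forall>J. np (s (of_int n) a) j J b = 0" using M by (simp add: np_scale)
  have "cm p (conf_T R a) n I q b k K = (\<Sum>j<Suc M. \<Sum>J\<in>Pow I. sing (n - int j + k, K \<union> (I - J))
      (s (csign p q I K J * (of_int n gchoose j)) (np (conf_T R a) j J b)))"
    by (rule cm_expand[OF assms M2])
  also have "\<dots> = (\<Sum>j<M. \<Sum>J\<in>Pow I. sing (n - int (Suc j) + k, K \<union> (I - J))
      (s (csign p q I K J * (of_int n gchoose Suc j)) (np (conf_T R a) (Suc j) J b)))"
    by (subst sum.lessThan_Suc_shift) (simp add: np_T_left)
  also have "\<dots> = (\<Sum>j<M. \<Sum>J\<in>Pow I. - sing (n - 1 - int j + k, K \<union> (I - J))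
      (s (csign p q I K J * (of_int (n - 1) gchoose j)) (np (s (of_int n) a) j J b)))"
  proof (intro sum.cong refl)
    fix j J
    have "of_nat (Suc j) * (of_int n gchoose Suc j) = (of_int n :: complex) * (of_int (n - 1) gchoose j)"
      using gbinomial_absorption[of j "of_int n :: complex"] by simp
    then have e: "csign p q I K J * (of_int n gchoose Suc j) * - of_nat (Suc j) = - (csign p q I K J * (of_int (n - 1) gchoose j) * of_int n)"
      by (simp add: mult.assoc mult.commute[of _ "of_nat (Suc j)"] mult.commute[of _ "of_int n :: complex"] del: of_nat_Suc)
    have ix: "n - int (Suc j) + k = n - 1 - int j + k" by simp
    show "sing (n - int (Suc j) + k, K \<union> (I - J)) (s (csign p q I K J * (of_int n gchoose Suc j)) (np (conf_T R a) (Suc j) J b)) =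
        - sing (n - 1 - int j + k, K \<union> (I - J)) (s (csign p q I K J * (of_int (n - 1) gchoose j)) (np (s (of_int n) a) j J b))"
      unfolding np_T_left(2) np_scale(1) R.scale_scale e ix unfolding R.scale_minus_left single_uminus by (rule refl)
  qed
  also have "\<dots> = - cm p (s (of_int n) a) (n - 1) I q b k K"
    using cm_expand[OF assms M3, where n = "n - 1"] by (simp add: sum_negf)
  finally show ?thesis by simp
qed

text \<open>Here T also acts on the products themselves, so the sum vanishes only modulo the
  relations; once they are used the remaining terms telescope in j.\<close>

lemma cm_T_right:
  assumes "I \<subseteq> {1..N}" "K \<subseteq> {1..N}"
  shows "cm p a n I q (conf_T R b) k K + cm p a n I q (s (of_int k) b) (k - 1) K \<in> ker"
proof -
  have fin: "finite I" using assms finite_subset by blast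
  obtain M where M: "\<forall>j\<ge>M. \<forall>J. np a j J b = 0" using np_bounded by blast
  have M2: "\<forall>j\<ge>Suc M. \<forall>J. np a j J (conf_T R b) = 0"
  proof (intro allI impI)
    fix j J assume jM: "j \<ge> Suc M"
    obtain j' where j': "j = Suc j'" "j' \<ge> M" using jM by (cases j) auto
    then show "np a j J (conf_T R b) = 0" using M by (simp add: j'(1) np_T_right T_0)
  qed
  have M3: "\<forall>j\<ge>Suc M. \<forall>J. np a j J (s (of_int k) b) = 0" using M by (simp add: np_scale)
  define cs where "cs J = csign p q I K J" for J
  define gc where "gc j = (of_int n :: complex) gchoose j" for j
  \<comment> \<open>B collects the terms produced by \<lambda>, which start at j = 1; A is T applied
    to the products, A' the other half of the corresponding relation, and D the second half of the
    relation under test.\<close>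
  define B where "B j = (case j of 0 \<Rightarrow> 0 | Suc j' \<Rightarrow> \<Sum>J\<in>Pow I. sing (n - int j + k, K \<union> (I - J)) (s (cs J * gc j * of_nat j) (np a j' J b)))" for j
  define A where "A j = (\<Sum>J\<in>Pow I. sing (n - int j + k, K \<union> (I - J)) (conf_T R (s (cs J * gc j) (np a j J b))))" for j
  define A' where "A' j = (\<Sum>J\<in>Pow I. sing (n - int j + k - 1, K \<union> (I - J)) (s (of_int (n - int j + k)) (s (cs J * gc j) (np a j J b))))" for j
  define D where "D j = (\<Sum>J\<in>Pow I. sing (n - int j + (k - 1), K \<union> (I - J)) (s (cs J * gc j) (np a j J (s (of_int k) b))))" for j
  have "(\<Sum>J\<in>Pow I. sing (n - int j + k, K \<union> (I - J)) (s (cs J * gc j) (np a j J (conf_T R b)))) = A j + B j" for j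
  proof (cases j)
    case 0
    then show ?thesis by (simp add: A_def B_def np_T_right T_scale)
  next
    case (Suc j')
    then show ?thesis by (simp add: A_def B_def np_T_right T_scale R.scale_right_distrib single_add sum.distrib del: of_nat_Suc)
  qed
  then have X: "cm p a n I q (conf_T R b) k K = (\<Sum>j<Suc M. A j + B j)"
    unfolding cm_expand[OF fin M2] cs_def gc_def by (simp del: sum.lessThan_Suc)
  have Y: "cm p a n I q (s (of_int k) b) (k - 1) K = (\<Sum>j<Suc M. D j)"
    unfolding cm_expand[OF fin M3] D_def cs_def gc_def by simp
  have "A j + A' j \<in> ker" for j
  proof -
    have "K \<union> (I - J) \<subseteq> {1..N}" for J using assms by auto
    then show ?thesis unfolding A_def A'_def sum.distrib[symmetric] by (intro ker_sum ker_T)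
  qed
  then have "(\<Sum>j<Suc M. A j + A' j) \<in> ker" by (intro ker_sum)
  moreover have "(\<Sum>j<Suc M. B j + D j - A' j) = 0"
  proof -
    define c where "c j = (\<Sum>J\<in>Pow I. sing (n - int j + k - 1, K \<union> (I - J)) (s (cs J * ((of_int n - of_nat j) * gc j)) (np a j J b)))" for j
    have Bc: "B (Suc j) = c j" for j
    proof -
      have "gc (Suc j) * of_nat (Suc j) = (of_int n - of_nat j) * gc j"
        unfolding gc_def by (metis gbinomial_absorb_comp gbinomial_absorption mult.commute)
      then have "cs J * gc (Suc j) * of_nat (Suc j) = cs J * ((of_int n - of_nat j) * gc j)" for J
        by (simp only: mult.assoc)
      moreover have "n - int (Suc j) + k = n - int j + k - 1" by simp
      ultimately show ?thesis by (simp only: B_def c_def nat.case)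
    qed
    \<comment> \<open>The weights k in D and n - j + k in A' leave -(n - j), which matches the
      weight of B at j + 1 by absorption.\<close>
    have "D j - A' j = - c j" for j
      unfolding D_def A'_def c_def sum_subtractf[symmetric] sum_negf[symmetric]
      by (intro sum.cong refl)
        (simp add: np_scale algebra_simps R.scale_left_distrib R.scale_left_diff_distrib single_add single_diff single_uminus flip: R.scale_minus_left)
    then have "B j + D j - A' j = B j - c j" for j by (metis add_diff_eq add_uminus_conv_diff)
    then have "(\<Sum>j<Suc M. B j + D j - A' j) = (\<Sum>j<Suc M. B j - c j)" by (simp only:)
    also have "\<dots> = B 0 - c M"
    proof (induction M)
      case (Suc m) then show ?case by (simp add: Bc)
    qed simp
    also have "\<dots> = 0" using M by (simp add: B_def c_def)
    finally show ?thesis .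
  qed
  ultimately have "(\<Sum>j<Suc M. A j + A' j) + (\<Sum>j<Suc M. B j + D j - A' j) \<in> ker" by simp
  then show ?thesis unfolding X Y sum.distrib[symmetric] by (simp add: algebra_simps)
qed

lemma cm_S_left:
  assumes i: "i \<in> {1..N}" and I: "finite I" and K: "finite K"
  shows "cm (p + 1) (conf_S R i a) n I q b k K +
    (if i \<in> I then pscale R (m1 p * sgm {i} (I - {i})) (cm p a n (I - {i}) q b k K) else 0) = 0"
proof -
  obtain M where M: "\<forall>j\<ge>M. \<forall>J. np a j J b = 0" "\<forall>j\<ge>M. \<forall>J. np (conf_S R i a) j J b = 0" using np_bound2[of a b "conf_S R i a" b] by blast
  define gc where "gc j = (of_int n :: complex) gchoose j" for j
  \<comment> \<open>\<open>B j J\<close> is the term of the first bracket at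
    \<open>insert i J\<close> and \<open>D j J\<close> the term of the second at J;
    \<open>csign_S_left\<close> cancels them pairwise.\<close>
  define B where "B j J = sing (n - int j + k, K \<union> (I - insert i J)) (s (csign (p + 1) q I K (insert i J) * gc j * (m1 (card J) * sgm {i} J)) (np a j J b))" for j J
  define D where "D j J = sing (n - int j + k, K \<union> (I - {i} - J)) (s (m1 p * sgm {i} (I - {i}) * (csign p q (I - {i}) K J * gc j)) (np a j J b))" for j J
  have tm: "sing (n - int j + k, K \<union> (I - J)) (s (csign (p + 1) q I K J * gc j) (np (conf_S R i a) j J b)) =
      (if i \<in> J then B j (J - {i}) else 0)" if "J \<in> Pow I" for j J
  proof (cases "i \<in> J")
    case True
    then have J: "insert i (J - {i}) = J" by auto
    have fJ: "finite (J - {i})" using that I finite_subset by auto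
    have "np (conf_S R i a) j (insert i (J - {i})) b = s (m1 (card (J - {i})) * sgm {i} (J - {i})) (np a j (J - {i}) b)"
      by (rule np_S_left(2)[OF i _ fJ]) simp
    then show ?thesis unfolding B_def J using True by (simp only: if_True R.scale_scale)
  qed (use np_S_left(1)[OF i] in simp)
  have X: "cm (p + 1) (conf_S R i a) n I q b k K = (\<Sum>j<M. \<Sum>J\<in>Pow I. if i \<in> I - J then B j J else 0)"
    unfolding cm_expand[OF I M(2)] gc_def[symmetric] sum_Pow_insert[OF I, symmetric] by (intro sum.cong refl tm)
  show ?thesis
  proof (cases "i \<in> I")
    case True
    have "B j J + D j J = 0" if "J \<subseteq> I" "i \<notin> J" for j J
    proof -
      have "csign (p + 1) q I K (insert i J) * gc j * (m1 (card J) * sgm {i} J) + m1 p * sgm {i} (I - {i}) * (csign p q (I - {i}) K J * gc j) =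
          (csign (p + 1) q I K (insert i J) * (m1 (card J) * sgm {i} J) + m1 p * sgm {i} (I - {i}) * csign p q (I - {i}) K J) * gc j"
        by (simp add: algebra_simps)
      also have "\<dots> = 0" unfolding csign_S_left[OF I K that(1) True that(2)] by simp
      finally have sum0: "csign (p + 1) q I K (insert i J) * gc j * (m1 (card J) * sgm {i} J) +
          m1 p * sgm {i} (I - {i}) * (csign p q (I - {i}) K J * gc j) = 0" .
      have ix: "I - insert i J = I - {i} - J" by auto
      show ?thesis
        unfolding B_def D_def ix single_add[symmetric] R.scale_left_distrib[symmetric] sum0 by simp
    qed
    moreover have "pscale R (m1 p * sgm {i} (I - {i})) (cm p a n (I - {i}) q b k K) = (\<Sum>j<M. \<Sum>J\<in>Pow (I - {i}). D j J)"
      using I by (simp add: cm_expand[of "I - {i}" M] M D_def pscale_sum pscale_single gc_def)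
    moreover have "(\<Sum>J\<in>Pow I. if i \<in> I - J then B j J else 0) = (\<Sum>J\<in>Pow (I - {i}). B j J)" for j
      by (rule sum.mono_neutral_cong_right) (use I True in auto)
    ultimately show ?thesis using True unfolding X by (simp flip: sum.distrib) (intro sum.neutral ballI, auto)
  next
    case False
    then show ?thesis unfolding X by simp
  qed
qed

text \<open>S^i applied to the products is removed modulo the relations, as A + A' lies in
  \<open>ker\<close>. What remains, B + D = A', is a sign identity decided by whether i lies in K
  and in I - J.\<close>

lemma cm_S_right:
  assumes i: "i \<in> {1..N}" and I: "I \<subseteq> {1..N}" and K: "K \<subseteq> {1..N}" and a: "a \<in> cg p" and b: "b \<in> cg q"
  shows "cm p a n I (q + 1) (conf_S R i b) k K +
    (if i \<in> K then pscale R (m1 q * sgm {i} (K - {i})) (cm p a n I q b k (K - {i})) else 0) \<in> ker"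
proof -
  have fin: "finite I" "finite K" using I K finite_subset by auto
  obtain M where M: "\<forall>j\<ge>M. \<forall>J. np a j J b = 0" "\<forall>j\<ge>M. \<forall>J. np a j J (conf_S R i b) = 0" using np_bound2[of a b a "conf_S R i b"] by blast
  define gc where "gc j = (of_int n :: complex) gchoose j" for j
  define cs where "cs J = csign p (q + 1) I K J" for J
  define A where "A j J = sing (n - int j + k, K \<union> (I - J)) (s (cs J * gc j * m1 (p + N + card J)) (conf_S R i (np a j J b)))" for j J
  define A' where "A' j J = (if i \<in> K \<union> (I - J) then sing (n - int j + k, K \<union> (I - J) - {i})
     (s (cs J * gc j * m1 (p + N + card J) * (m1 (p + q + N + card J) * sgm {i} (K \<union> (I - J) - {i}))) (np a j J b)) else 0)" for j J
  define B where "B j J = sing (n - int j + k, K \<union> (I - insert i J)) (s (cs (insert i J) * gc j * (m1 (p + card J + 1) * sgm {i} J)) (np a j J b))" for j J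
  define D where "D j J = (if i \<in> K then sing (n - int j + k, (K - {i}) \<union> (I - J)) (s (m1 q * sgm {i} (K - {i}) * (csign p q I (K - {i}) J * gc j)) (np a j J b)) else 0)" for j J
  have tm: "sing (n - int j + k, K \<union> (I - J)) (s (cs J * gc j) (np a j J (conf_S R i b))) =
      A j J + (if i \<in> J then B j (J - {i}) else 0)" if "J \<in> Pow I" for j J
  proof (cases "i \<in> J")
    case True
    then have J: "insert i (J - {i}) = J" by auto
    have fJ: "finite (J - {i})" using that fin finite_subset by auto
    have "np a j (insert i (J - {i})) (conf_S R i b) =
      s (m1 (p + N + card (insert i (J - {i})))) (conf_S R i (np a j (insert i (J - {i})) b)) +
      s (m1 (p + card (J - {i}) + 1) * sgm {i} (J - {i})) (np a j (J - {i}) b)"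
      by (rule np_S_right(2)[OF i _ a fJ]) simp
    then show ?thesis unfolding A_def B_def J using True
      by (simp only: if_True R.scale_right_distrib single_add R.scale_scale)
  next
    case False
    then show ?thesis using np_S_right(1)[OF i False a] by (simp add: A_def)
  qed
  have X: "cm p a n I (q + 1) (conf_S R i b) k K = (\<Sum>j<M. \<Sum>J\<in>Pow I. A j J + (if i \<in> I - J then B j J else 0))"
    unfolding cm_expand[OF fin(1) M(2)] gc_def[symmetric] sum.distrib sum_Pow_insert[OF fin(1), symmetric]
    unfolding sum.distrib[symmetric] cs_def[symmetric] by (intro sum.cong refl tm)
  have Y: "(if i \<in> K then pscale R (m1 q * sgm {i} (K - {i})) (cm p a n I q b k (K - {i})) else 0) = (\<Sum>j<M. \<Sum>J\<in>Pow I. D j J)"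
    using fin by (simp add: cm_expand[of I M] M D_def pscale_sum pscale_single gc_def)
  have AA': "A j J + A' j J \<in> ker" if "J \<subseteq> I" for j J
  proof -
    define c where "c = cs J * gc j * m1 (p + N + card J)"
    have sub: "K \<union> (I - J) \<subseteq> {1..N}" using I K by auto
    have gr: "s c (np a j J b) \<in> cg (p + q + N + card J)" by (intro cg_scale np_gr a b)
    have A: "A j J = sing (n - int j + k, K \<union> (I - J)) (conf_S R i (s c (np a j J b)))"
      by (simp add: A_def c_def S_scale[OF i])
    show ?thesis
    proof (cases "i \<in> K \<union> (I - J)")
      case True
      then have "A' j J = sing (n - int j + k, K \<union> (I - J) - {i}) (s (m1 (p + q + N + card J) * sgm {i} (K \<union> (I - J) - {i})) (s c (np a j J b)))"
        by (simp add: A'_def c_def mult_ac)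
      then show ?thesis unfolding A using ker_S_insert[OF i gr sub True] by simp
    next
      case False
      show ?thesis unfolding A A'_def if_not_P[OF False] add_0_right by (rule ker_S[OF i gr sub False])
    qed
  qed
  have BD: "(if i \<in> I - J then B j J else 0) + D j J = A' j J" if J: "J \<subseteq> I" for j J
  proof -
    have sg: "cs J * gc j * m1 (p + N + card J) * (m1 (p + q + N + card J) * z) = gc j * (m1 q * cs J * z)" for z
    proof -
      have e: "m1 (p + N + card J) * m1 (p + q + N + card J) = m1 q"
        unfolding power_add[symmetric] by (rule m1_cong) presburger
      have "cs J * gc j * m1 (p + N + card J) * (m1 (p + q + N + card J) * z) =
          gc j * ((m1 (p + N + card J) * m1 (p + q + N + card J)) * cs J * z)" by (simp only: mult_ac)
      then show ?thesis by (simp only: e)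
    qed
    note cR = csign_S_right[OF fin J, where i = i and p = p and q = q, folded cs_def]
    consider "i \<in> K" "i \<notin> I - J" | "i \<notin> K" "i \<in> I - J" | "i \<in> K" "i \<in> I - J" | "i \<notin> K" "i \<notin> I - J" by blast
    then show ?thesis
    proof cases
      case 1
      have e: "K \<union> (I - J) - {i} = (K - {i}) \<union> (I - J)" and M: "i \<in> K \<union> (I - J)" using 1 by auto
      have "gc j * (m1 q * cs J * sgm {i} ((K - {i}) \<union> (I - J))) = gc j * m1 q * (cs J * sgm {i} ((K - {i}) \<union> (I - J)))"
        by (simp only: mult_ac)
      also have "\<dots> = m1 q * sgm {i} (K - {i}) * (csign p q I (K - {i}) J * gc j)"
        unfolding cR(1)[OF 1, unfolded e] by (simp only: mult_ac)
      finally have "A' j J = D j J" unfolding A'_def D_def if_P[OF M] if_P[OF 1(1)] sg e by (simp only:)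
      then show ?thesis by (simp only: if_not_P[OF 1(2)] add_0_left)
    next
      case 2
      have e: "K \<union> (I - J) - {i} = K \<union> (I - insert i J)" and M: "i \<in> K \<union> (I - J)" using 2 by auto
      have "gc j * (m1 q * cs J * sgm {i} (K \<union> (I - insert i J))) = gc j * (cs (insert i J) * (m1 (p + card J + 1) * sgm {i} J))"
        using arg_cong[OF cR(2)[OF 2], of "\<lambda>t. gc j * t"] unfolding e by (simp only: mult.assoc)
      also have "\<dots> = cs (insert i J) * gc j * (m1 (p + card J + 1) * sgm {i} J)" by (simp only: mult_ac)
      finally have "A' j J = B j J" unfolding A'_def B_def if_P[OF M] sg e by (simp only:)
      then show ?thesis by (simp only: D_def if_P[OF 2(2)] if_not_P[OF 2(1)] add_0_right)
    next
      case 3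
      have e: "K \<union> (I - insert i J) = (K - {i}) \<union> (I - J)" using 3 by auto
      have "cs (insert i J) * gc j * (m1 (p + card J + 1) * sgm {i} J) + m1 q * sgm {i} (K - {i}) * (csign p q I (K - {i}) J * gc j) =
          (cs (insert i J) * (m1 (p + card J + 1) * sgm {i} J) + m1 q * sgm {i} (K - {i}) * csign p q I (K - {i}) J) * gc j"
        by (simp add: algebra_simps)
      also have "\<dots> = 0" unfolding cR(3)[OF 3] by simp
      finally have sum0: "cs (insert i J) * gc j * (m1 (p + card J + 1) * sgm {i} J) +
          m1 q * sgm {i} (K - {i}) * (csign p q I (K - {i}) J * gc j) = 0" .
      have "B j J + D j J = 0"
        unfolding B_def D_def e if_P[OF 3(1)] single_add[symmetric] R.scale_left_distrib[symmetric] sum0 by simp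
      moreover have "A' j J = 0" using cR(4)[OF 3] by (simp add: A'_def)
      ultimately show ?thesis by (simp only: if_P[OF 3(2)])
    next
      case 4
      then have M: "i \<notin> K \<union> (I - J)" by auto
      show ?thesis by (simp only: A'_def D_def if_not_P[OF M] if_not_P[OF 4(1)] if_not_P[OF 4(2)] add_0_right)
    qed
  qed
  have "(\<Sum>j<M. \<Sum>J\<in>Pow I. A j J + (if i \<in> I - J then B j J else 0)) + (\<Sum>j<M. \<Sum>J\<in>Pow I. D j J) =
      (\<Sum>j<M. \<Sum>J\<in>Pow I. A j J + A' j J)"
    unfolding sum.distrib[symmetric] by (intro sum.cong refl) (use BD in \<open>auto simp: add.assoc\<close>)
  also have "\<dots> \<in> ker" using AA' by (intro ker_sum) auto
  finally show ?thesis unfolding X Y .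
qed

end

lemma a_inv_complex_ring: "\<ominus>\<^bsub>complex_ring\<^esub> c = - c"
proof -
  interpret C: cring complex_ring by (rule cring_complex_ring)
  show ?thesis by (rule C.minus_equality) simp_all
qed

lemma module_a_inv: "Module.module complex_ring V \<Longrightarrow> x \<in> carrier V \<Longrightarrow> \<ominus>\<^bsub>V\<^esub> x = (- 1) \<odot>\<^bsub>V\<^esub> x"
proof -
  assume V: "Module.module complex_ring V" and x: "x \<in> carrier V"
  interpret M: Module.module complex_ring V by (rule V)
  show ?thesis using M.smult_l_minus[of 1 x] M.smult_one[of x] x by (simp add: a_inv_complex_ring)
qed

text \<open>The Lie superalgebra is a record of another type with shifted parts; the superspace
  property depends only on the linear structure and the parts, so it can be read off a plain
  quotient.\<close>

lemma is_superspace_transfer: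
  assumes V: "is_superspace V"
    and eq: "carrier V' = carrier V" "zero V' = zero V" "add V' = add V" "smult V' = smult V"
      "even_part V' = even_part V" "odd_part V' = odd_part V"
  shows "is_superspace V'"
proof -
  interpret M: Module.module complex_ring V using V by (simp add: is_superspace_def)
  have mod: "Module.module complex_ring V'"
  proof (rule Module.moduleI[OF cring_complex_ring])
    show "abelian_group V'"
    proof (rule abelian_groupI)
      fix x assume "x \<in> carrier V'"
      then show "\<exists>y\<in>carrier V'. y \<oplus>\<^bsub>V'\<^esub> x = \<zero>\<^bsub>V'\<^esub>"
        by (intro bexI[of _ "\<ominus>\<^bsub>V\<^esub> x"]) (auto simp: eq M.l_neg)
    qed (auto simp: eq M.add.m_ac)
  qed (use M.smult_closed M.smult_l_distr M.smult_r_distr M.smult_assoc1 M.smult_one in \<open>auto simp: eq\<close>)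
  interpret M': Module.module complex_ring V' by (rule mod)
  have sub: "submodule H complex_ring V'" if "submodule H complex_ring V" for H
  proof -
    interpret H: quotient_module V H by (rule quotient_module.intro[OF M.module_axioms that])
    have inv: "\<ominus>\<^bsub>V'\<^esub> x \<in> H" if "x \<in> H" for x
      using that H.K_smult H.K_subset module_a_inv[OF mod, of x] by (auto simp: eq)
    show ?thesis
      by (rule M'.submoduleI) (use H.K_subset H.K_zero H.K_add H.K_smult inv in \<open>auto simp: eq\<close>)
  qed
  have "even_part V <+>\<^bsub>V'\<^esub> odd_part V = even_part V <+>\<^bsub>V\<^esub> odd_part V" by (simp add: set_add_def' eq)
  then show ?thesis using V mod sub by (auto simp: is_superspace_def eq)
qed

context susy_lie_conformal_algebra
begin

section \<open>The bracket on the loop space\<close>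

abbreviation "lp \<equiv> loop_proj R"

lemma loop_proj_add: "lp p (f + h) = lp p f + lp p h"
  unfolding loop_proj_def by (rule pext_add) (auto simp: cp_add single_add cp_0)

lemma loop_proj_scale: "lp p (pscale R c f) = pscale R c (lp p f)"
  unfolding loop_proj_def
  by (rule pext_linear[where u = "s c"])
    (auto simp: cp_scale cp_0 pscale_single lookup_pscale additive_def LP.scale_right_distrib)

lemma loop_proj_single: "lp p (sing (n, I) a) = sing (n, I) (cp (p + card I) a)"
  unfolding loop_proj_def by (subst pext_single) (auto simp: cp_0)

lemma loop_proj_0: "lp p 0 = 0"
  by (simp add: loop_proj_def)

definition bm :: "int \<times> nat set \<Rightarrow> 'r \<Rightarrow> int \<times> nat set \<Rightarrow> 'r \<Rightarrow> 'r loops" where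
  "bm k a l b = (\<Sum>p<2. \<Sum>q<2. cm p (cp p a) (fst k) (snd k) q (cp q b) (fst l) (snd l))"

lemma bm_add: "bm k (a + a') l b = bm k a l b + bm k a' l b" "bm k a l (b + b') = bm k a l b + bm k a l b'"
  and bm_scale: "bm k (s c a) l b = pscale R c (bm k a l b)" "bm k a l (s c b) = pscale R c (bm k a l b)"
  and bm_0: "bm k 0 l b = 0" "bm k a l 0 = 0"
  by (simp_all add: bm_def cp_add cp_scale cp_0 cm_add cm_scale cm_0 sum.distrib pscale_sum)

lemma curly_bm: "curly N R f h = pext (\<lambda>k a. pext (\<lambda>l b. bm k a l b) h) f"
  unfolding curly_def bm_def by (simp add: case_prod_beta')

lemma pext_bm: "pext (bm k 0) h = 0" "pext (bm k (a + a')) h = pext (bm k a) h + pext (bm k a') h"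
  "pext (bm k (s c a)) h = pscale R c (pext (bm k a) h)"
  by (simp_all add: pext_def bm_0 bm_add bm_scale sum.distrib pscale_sum)

lemma pext_fun_add: "pext (\<lambda>l b. \<phi> l b + \<psi> l b) h = pext \<phi> h + pext \<psi> h" for h :: "'r loops"
  by (simp add: pext_def sum.distrib)

lemma pext_fun_pscale: "pext (\<lambda>l b. pscale R c (\<phi> l b)) h = pscale R c (pext \<phi> h :: 'r loops)" for h :: "'r loops"
  by (simp add: pext_def pscale_sum)

lemma additive_pscale: "additive (pscale R c :: 'r loops \<Rightarrow> 'r loops)"
  by (simp add: additive_def LP.scale_right_distrib)

lemma curly_add: "curly N R (f + f') h = curly N R f h + curly N R f' h" "curly N R f (h + h') = curly N R f h + curly N R f h'"
proof -
  show "curly N R (f + f') h = curly N R f h + curly N R f' h"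
    unfolding curly_bm by (rule pext_add) (simp_all add: pext_bm)
  have "pext (\<lambda>l b. bm k a l b) (h + h') = pext (\<lambda>l b. bm k a l b) h + pext (\<lambda>l b. bm k a l b) h'" for k a
    by (rule pext_add) (simp_all add: bm_add bm_0)
  then show "curly N R f (h + h') = curly N R f h + curly N R f h'"
    unfolding curly_bm by (simp add: pext_fun_add)
qed

lemma curly_scale: "curly N R (pscale R c f) h = pscale R c (curly N R f h)" "curly N R f (pscale R c h) = pscale R c (curly N R f h)"
proof -
  show "curly N R (pscale R c f) h = pscale R c (curly N R f h)"
    unfolding curly_bm by (rule pext_linear[where u = "s c"])
      (simp_all add: pext_bm additive_pscale lookup_pscale)
  have "pext (\<lambda>l b. bm k a l b) (pscale R c h) = pscale R c (pext (\<lambda>l b. bm k a l b) h)" for k a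
    by (rule pext_linear[where u = "s c"]) (simp_all add: bm_scale bm_0 additive_pscale lookup_pscale)
  then show "curly N R f (pscale R c h) = pscale R c (curly N R f h)"
    unfolding curly_bm by (simp add: pext_fun_pscale)
qed

lemma curly_single: "curly N R (Poly_Mapping.single k a) (Poly_Mapping.single l b) = bm k a l b"
proof -
  have "pext (bm k a) (Poly_Mapping.single l b) = bm k a l b" by (rule pext_single) (rule bm_0)
  then show ?thesis unfolding curly_bm by (subst pext_single) (simp_all add: pext_bm)
qed

lemma curly_0: "curly N R 0 h = 0"
  by (simp add: curly_bm)

abbreviation "lb \<equiv> loop_br N R"

lemma lb_add: "lb (f + f') h = lb f h + lb f' h" "lb f (h + h') = lb f h + lb f h'"
  and lb_scale: "lb (pscale R c f) h = pscale R c (lb f h)" "lb f (pscale R c h) = pscale R c (lb f h)"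
  by (simp_all add: loop_br_def loop_proj_add loop_proj_scale curly_add curly_scale LP.scale_right_distrib sum.distrib pscale_sum mult.commute)

lemma lb_0: "lb 0 h = 0" "lb f 0 = 0"
  using lb_scale(1)[of 0 0 h] lb_scale(2)[of f 0 0] by simp_all

lemma sum_parity: "(\<Sum>p<(2::nat). if even p = even q then f p else 0) = f (q mod 2)" for f :: "nat \<Rightarrow> 'b::comm_monoid_add"
proof -
  have "{..<2::nat} = {0, 1}" by auto
  then show ?thesis by (simp add: mod_2_eq_odd)
qed

text \<open>For homogeneous a and b exactly one summand over parities survives; p + |I| is the
  parity of a_<n|I> before the shift.\<close>

lemma lb_single:
  assumes a: "a \<in> cg p" and b: "b \<in> cg q"
  shows "lb (sing (n, I) a) (sing (k, K) b) = pscale R (m1 ((p + card I) * N + N)) (cm p a n I q b k K)"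
proof -
  have bm: "bm (n, I) a (k, K) b = cm p a n I q b k K"
  proof -
    have "bm (n, I) a (k, K) b = (\<Sum>p'<2. \<Sum>q'<2. if even q' = even q then (if even p' = even p then cm p' a n I q' b k K else 0) else 0)"
      unfolding bm_def by (intro sum.cong refl) (simp add: cp_eq[OF a] cp_eq[OF b] cm_0)
    also have "\<dots> = (\<Sum>p'<2. if even p' = even p then cm p' a n I (q mod 2) b k K else 0)"
      by (simp only: sum_parity)
    also have "\<dots> = cm (p mod 2) a n I (q mod 2) b k K" by (simp only: sum_parity)
    also have "\<dots> = cm p a n I q b k K" by (rule cm_cong) auto
    finally show ?thesis .
  qed
  have "lb (sing (n, I) a) (sing (k, K) b) = (\<Sum>r<2. if even r = even (p + card I) then pscale R (m1 (r * N + N)) (cm p a n I q b k K) else 0)"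
    unfolding loop_br_def
  proof (intro sum.cong refl)
    fix r :: nat
    have "(even (r + card I) = even p) = (even r = even (p + card I))" by auto
    then have e: "lp r (sing (n, I) a) = sing (n, I) (if even r = even (p + card I) then a else 0)"
      by (simp only: loop_proj_single cp_eq[OF a])
    show "pscale R (m1 (r * N + N)) (curly N R (lp r (sing (n, I) a)) (sing (k, K) b)) =
        (if even r = even (p + card I) then pscale R (m1 (r * N + N)) (cm p a n I q b k K) else 0)"
    proof (cases "even r = even (p + card I)")
      case True
      show ?thesis unfolding e if_P[OF True] curly_single bm by (rule refl)
    next
      case False
      show ?thesis unfolding e if_not_P[OF False] single_zero curly_0 by (rule LP.scale_zero_right)
    qed
  qed
  also have "\<dots> = pscale R (m1 ((p + card I) mod 2 * N + N)) (cm p a n I q b k K)" by (simp only: sum_parity)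
  also have "m1 ((p + card I) mod 2 * N + N) = m1 ((p + card I) * N + N)" by (rule m1_cong) auto
  finally show ?thesis .
qed

lemma LC_sub: "LP.subspace {f. \<forall>h\<in>LC. lb f h \<in> W}" "LP.subspace {h. \<forall>f\<in>LC. lb f h \<in> W}"
  if "LP.subspace W" for W
  using that by (auto simp: LP.subspace_def lb_0 lb_add lb_scale)

lemma lb_induct_left:
  assumes W: "LP.subspace W" and h: "\<And>k K q b. K \<subseteq> {1..N} \<Longrightarrow> b \<in> cg q \<Longrightarrow> lb f (sing (k, K) b) \<in> W" and "h \<in> LC"
  shows "lb f h \<in> W"
  using assms(3)
proof (induction rule: loops_induct)
  case zero show ?case by (simp add: lb_0 LP.subspace_0[OF W])
next
  case (add u v) then show ?case by (simp add: lb_add LP.subspace_add[OF W])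
qed (use h in blast)

lemma lb_induct_right:
  assumes W: "LP.subspace W" and f: "\<And>n I p a. I \<subseteq> {1..N} \<Longrightarrow> a \<in> cg p \<Longrightarrow> lb (sing (n, I) a) h \<in> W" and "f \<in> LC"
  shows "lb f h \<in> W"
  using assms(3)
proof (induction rule: loops_induct)
  case zero show ?case by (simp add: lb_0 LP.subspace_0[OF W])
next
  case (add u v) then show ?case by (simp add: lb_add LP.subspace_add[OF W])
qed (use f in blast)

lemma lb_LC: "f \<in> LC \<Longrightarrow> h \<in> LC \<Longrightarrow> lb f h \<in> LC"
  by (rule lb_induct_right[OF LC_subspace], rule lb_induct_left[OF LC_subspace])
    (simp_all add: lb_single cm_LC LP.subspace_scale[OF LC_subspace])

lemma loop_rels_cases [consumes 1, case_names T S]: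
  assumes "f \<in> loop_rels N R"
  obtains a n I where "I \<subseteq> {1..N}" "f = sing (n, I) (conf_T R a) + sing (n - 1, I) (s (of_int n) a)"
  | i p a n I where "i \<in> {1..N}" "a \<in> cg p" "I \<subseteq> {1..N}"
     "f = sing (n, I) (conf_S R i a) + (if i \<in> I then sing (n, I - {i}) (s (m1 p * sgm {i} (I - {i})) a) else 0)"
  using assms unfolding loop_rels_def by blast

lemma T_rel_split: "sing (n, I) (conf_T R a) + sing (n - 1, I) (s (of_int n) a) =
  (sing (n, I) (conf_T R (cp 0 a)) + sing (n - 1, I) (s (of_int n) (cp 0 a))) +
  (sing (n, I) (conf_T R (cp 1 a)) + sing (n - 1, I) (s (of_int n) (cp 1 a)))"
proof -
  have "sing (n, I) (conf_T R (cp 0 a + cp 1 a)) + sing (n - 1, I) (s (of_int n) (cp 0 a + cp 1 a)) =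
    (sing (n, I) (conf_T R (cp 0 a)) + sing (n - 1, I) (s (of_int n) (cp 0 a))) +
    (sing (n, I) (conf_T R (cp 1 a)) + sing (n - 1, I) (s (of_int n) (cp 1 a)))"
    by (simp only: T_add R.scale_right_distrib single_add ac_simps)
  then show ?thesis by (simp only: cp_sum)
qed

text \<open>The two terms of a relation for S^i have the same parity in L(R), so the bracket
  multiplies both by the same sign.\<close>

lemma m1_shift: "i \<in> I \<Longrightarrow> finite I \<Longrightarrow> m1 ((p + 1 + card I) * N + N) = m1 ((p + card (I - {i})) * N + N)"
proof -
  assume "i \<in> I" "finite I"
  then have "card I = Suc (card (I - {i}))" by (metis card.remove)
  moreover have "m1 ((p + 1 + Suc c) * N + N) = m1 ((p + c) * N + N)" for c by (intro m1_cong) (simp, blast)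
  ultimately show ?thesis by (simp only:)
qed

text \<open>Span induction reduces f to a single relation, and h is reduced to a monomial, where
  \<open>cm_T_left\<close> and \<open>cm_S_left\<close> apply. A relation for T may have
  inhomogeneous a and is first split into its parity components.\<close>

lemma lb_ker_left: "f \<in> ker \<Longrightarrow> h \<in> LC \<Longrightarrow> lb f h \<in> ker"
proof -
  assume f: "f \<in> ker" and h: "h \<in> LC"
  have Tz: "lb (sing (n, I) (conf_T R a) + sing (n - 1, I) (s (of_int n) a)) h \<in> ker"
    if I: "I \<subseteq> {1..N}" and a: "a \<in> cg p" and h: "h \<in> LC" for n I a p h
  proof (rule lb_induct_left[OF ker_subspace _ h])
    fix k K q b assume K: "K \<subseteq> {1..N}" and b: "b \<in> cg q"
    have "cm p (conf_T R a) n I q b k K + cm p (s (of_int n) a) (n - 1) I q b k K = 0"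
      by (rule cm_T_left) (rule finite_subset[OF I], simp)
    then show "lb (sing (n, I) (conf_T R a) + sing (n - 1, I) (s (of_int n) a)) (sing (k, K) b) \<in> ker"
      by (simp add: lb_add lb_single[OF even_T[OF a] b] lb_single[OF cg_scale[OF a] b] ker_0 flip: LP.scale_right_distrib)
  qed
  have "\<forall>h\<in>LC. lb f h \<in> ker" using f unfolding ker_def
  proof (rule LP.span_induct[where P = "\<lambda>f. \<forall>h\<in>LC. lb f h \<in> LP.span (loop_rels N R)"])
    show "LP.subspace {f. \<forall>h\<in>LC. lb f h \<in> LP.span (loop_rels N R)}" by (rule LC_sub) simp
    fix f assume "f \<in> loop_rels N R"
    then have "\<forall>h\<in>LC. lb f h \<in> ker"
    proof (cases rule: loop_rels_cases)
      case (T a n I)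
      show ?thesis unfolding T(2) T_rel_split[of n I a]
      proof
        fix h assume "h \<in> LC"
        note z = Tz[OF T(1) cp_gr this]
        show "lb ((sing (n, I) (conf_T R (cp 0 a)) + sing (n - 1, I) (s (of_int n) (cp 0 a))) +
          (sing (n, I) (conf_T R (cp 1 a)) + sing (n - 1, I) (s (of_int n) (cp 1 a)))) h \<in> ker"
          by (subst lb_add(1)) (rule ker_add[OF z z])
      qed
    next
      case (S i p a n I)
      have fI: "finite I" by (rule finite_subset[OF S(3)]) simp
      show ?thesis
      proof
        fix h assume h: "h \<in> LC"
        show "lb f h \<in> ker"
        proof (rule lb_induct_left[OF ker_subspace _ h])
          fix k K q b assume K: "K \<subseteq> {1..N}" and b: "b \<in> cg q"
          have fK: "finite K" by (rule finite_subset[OF K]) simp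
          define \<epsilon> where "\<epsilon> = m1 ((p + 1 + card I) * N + N)"
          define c where "c = m1 p * sgm {i} (I - {i})"
          have "lb f (sing (k, K) b) = pscale R \<epsilon> (cm (p + 1) (conf_S R i a) n I q b k K) +
              (if i \<in> I then lb (sing (n, I - {i}) (s c a)) (sing (k, K) b) else 0)"
            unfolding S(4) c_def \<epsilon>_def by (simp add: lb_add lb_single[OF odd_S[OF S(1,2)] b] lb_0)
          also have "(if i \<in> I then lb (sing (n, I - {i}) (s c a)) (sing (k, K) b) else 0) =
              (if i \<in> I then pscale R \<epsilon> (pscale R c (cm p a n (I - {i}) q b k K)) else 0)"
            using m1_shift[OF _ fI, of i p] lb_single[OF cg_scale[OF S(2)] b] by (simp add: \<epsilon>_def cm_scale)
          also have "pscale R \<epsilon> (cm (p + 1) (conf_S R i a) n I q b k K) + \<dots> =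
             pscale R \<epsilon> (cm (p + 1) (conf_S R i a) n I q b k K + (if i \<in> I then pscale R c (cm p a n (I - {i}) q b k K) else 0))"
            by (simp add: LP.scale_right_distrib del: LP.scale_scale)
          also have "\<dots> = 0" unfolding c_def cm_S_left[OF S(1) fI fK] by simp
          finally show "lb f (sing (k, K) b) \<in> ker" by (simp add: ker_0)
        qed
      qed
    qed
    then show "\<forall>h\<in>LC. lb f h \<in> LP.span (loop_rels N R)" by (simp add: ker_def)
  qed
  then show "lb f h \<in> ker" using h by blast
qed

lemma lb_ker_right: "f \<in> LC \<Longrightarrow> h \<in> ker \<Longrightarrow> lb f h \<in> ker"
proof -
  assume f: "f \<in> LC" and h: "h \<in> ker"
  have Tz: "lb f (sing (k, K) (conf_T R b) + sing (k - 1, K) (s (of_int k) b)) \<in> ker"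
    if K: "K \<subseteq> {1..N}" and b: "b \<in> cg q" and f: "f \<in> LC" for k K b q f
  proof (rule lb_induct_right[OF ker_subspace _ f])
    fix n I p a assume I: "I \<subseteq> {1..N}" and a: "a \<in> cg p"
    show "lb (sing (n, I) a) (sing (k, K) (conf_T R b) + sing (k - 1, K) (s (of_int k) b)) \<in> ker"
      using ker_scale[OF cm_T_right[OF I K, of p a n q b k]]
      by (simp add: lb_add lb_single[OF a even_T[OF b]] lb_single[OF a cg_scale[OF b]] LP.scale_right_distrib)
  qed
  have "\<forall>f\<in>LC. lb f h \<in> ker" using h unfolding ker_def
  proof (rule LP.span_induct[where P = "\<lambda>h. \<forall>f\<in>LC. lb f h \<in> LP.span (loop_rels N R)"])
    show "LP.subspace {h. \<forall>f\<in>LC. lb f h \<in> LP.span (loop_rels N R)}" by (rule LC_sub) simp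
    fix h assume "h \<in> loop_rels N R"
    then have "\<forall>f\<in>LC. lb f h \<in> ker"
    proof (cases rule: loop_rels_cases)
      case (T b k K)
      show ?thesis unfolding T(2) T_rel_split[of k K b]
      proof
        fix f assume "f \<in> LC"
        note z = Tz[OF T(1) cp_gr this]
        show "lb f ((sing (k, K) (conf_T R (cp 0 b)) + sing (k - 1, K) (s (of_int k) (cp 0 b))) +
          (sing (k, K) (conf_T R (cp 1 b)) + sing (k - 1, K) (s (of_int k) (cp 1 b)))) \<in> ker"
          by (subst lb_add(2)) (rule ker_add[OF z z])
      qed
    next
      case (S i q b k K)
      show ?thesis
      proof
        fix f assume f: "f \<in> LC"
        show "lb f h \<in> ker"
        proof (rule lb_induct_right[OF ker_subspace _ f])
          fix n I p a assume I: "I \<subseteq> {1..N}" and a: "a \<in> cg p"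
          define \<epsilon> where "\<epsilon> = m1 ((p + card I) * N + N)"
          define c where "c = m1 q * sgm {i} (K - {i})"
          have "lb (sing (n, I) a) h = pscale R \<epsilon> (cm p a n I (q + 1) (conf_S R i b) k K) +
              (if i \<in> K then pscale R \<epsilon> (pscale R c (cm p a n I q b k (K - {i}))) else 0)"
            unfolding S(4) c_def \<epsilon>_def
            by (simp add: lb_add lb_single[OF a odd_S[OF S(1,2)]] lb_single[OF a cg_scale[OF S(2)]] lb_0 cm_scale)
          also have "\<dots> =
             pscale R \<epsilon> (cm p a n I (q + 1) (conf_S R i b) k K + (if i \<in> K then pscale R c (cm p a n I q b k (K - {i})) else 0))"
            by (simp add: LP.scale_right_distrib del: LP.scale_scale)
          also have "\<dots> \<in> ker" unfolding c_def by (rule ker_scale[OF cm_S_right[OF S(1) I S(3) a S(2)]])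
          finally show "lb (sing (n, I) a) h \<in> ker" .
        qed
      qed
    qed
    then show "\<forall>f\<in>LC. lb f h \<in> LP.span (loop_rels N R)" by (simp add: ker_def)
  qed
  then show "lb f h \<in> ker" using f by blast
qed

text \<open>The space of relations is graded: a relation for S^i is homogeneous, hence kept or
  killed by the projection, and one for T projects to a relation for T.\<close>

lemma lp_ker: "f \<in> ker \<Longrightarrow> lp r f \<in> ker"
  unfolding ker_def
proof (rule LP.span_induct[where P = "\<lambda>f. lp r f \<in> LP.span (loop_rels N R)"])
  show "LP.subspace {f. lp r f \<in> LP.span (loop_rels N R)}"
    by (auto simp: LP.subspace_def loop_proj_add loop_proj_scale loop_proj_0 LP.span_zero LP.span_add LP.span_scale)
  fix f assume f: "f \<in> loop_rels N R"
  then have "lp r f \<in> ker"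
  proof (cases rule: loop_rels_cases)
    case (T a n I)
    have "cp t (conf_T R a) = conf_T R (cp t a)" for t
      by (rule cp_unique) (use even_T[OF cp_gr] even_T[OF cp_compl] in \<open>auto simp: linear_add[OF linear_T, of "a - cp t a" "cp t a", simplified] algebra_simps\<close>)
    then show ?thesis unfolding T using ker_T[OF T(1)] by (simp add: loop_proj_add loop_proj_single cp_scale)
  next
    case (S i p a n I)
    have fI: "finite I" by (rule finite_subset[OF S(3)]) simp
    define C where "C \<longleftrightarrow> even (r + card I) = even (p + 1)"
    have 1: "cp (r + card I) (conf_S R i a) = (if C then conf_S R i a else 0)"
      unfolding C_def by (rule cp_eq[OF odd_S[OF S(1,2)]])
    have 2: "cp (r + card (I - {i})) (s c a) = (if C then s c a else 0)" if "i \<in> I" for c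
    proof -
      have "card I = Suc (card (I - {i}))" by (rule card.remove[OF fI that])
      then have "(even (r + card (I - {i})) = even p) = C" unfolding C_def by auto
      then show ?thesis using cp_eq[OF cg_scale[OF S(2)], of "r + card (I - {i})" c] by (simp only:)
    qed
    have "lp r f = (if C then f else 0)"
      unfolding S(4) by (cases "i \<in> I"; cases C) (simp_all only: loop_proj_add loop_proj_single 1 2 if_True if_False simp_thms
          loop_proj_0 single_zero add_0_right)
    then show ?thesis using f ker_0 by (simp add: ker_def LP.span_base)
  qed
  then show "lp r f \<in> LP.span (loop_rels N R)" by (simp add: ker_def)
qed (simp add: ker_def)

end

context susy_lie_conformal_algebra
begin

section \<open>The Lie superalgebra and its full modes\<close>

abbreviation "Fl \<equiv> {1..N}"
abbreviation "Lc \<equiv> L_class N R"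
abbreviation "g \<equiv> Lie N R"

lemma concrete_loop: "concrete_space (pscale R) V" if "carrier V = LC" "zero V = 0" "add V = (+)" "smult V = pscale R"
  for V :: "('r loops, 'm) superspace_scheme"
  by (intro concrete_space.intro LP.vector_space_axioms concrete_space_axioms.intro) (simp_all add: that LC_subspace)

sublocale CL: concrete_space "pscale R" "loop_space N R"
  by (rule concrete_loop) (simp_all add: loop_space_simps)

lemma loop_ker_eq: "loop_ker N R = ker"
  unfolding loop_ker_def ker_def by (rule CL.lin_span_eq) (simp add: loop_space_simps loop_rels_LC)

sublocale QL: quotient_module "loop_space N R" ker
  by (rule quotient_module.intro[OF CL.module_V])
    (simp add: CL.submodule_iff ker_subspace ker_LC loop_space_simps)

lemma Lc_eq: "Lc f = ker +>\<^bsub>loop_space N R\<^esub> f"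
  by (simp add: L_class_def loop_ker_eq)

lemma Lc_set: "Lc f = {k + f | k. k \<in> ker}"
  by (auto simp: Lc_eq a_r_coset_def' loop_space_simps)

lemma Lie_fields: "carrier g = carrier (L_space N R)" "zero g = zero (L_space N R)" "add g = add (L_space N R)"
  "smult g = smult (L_space N R)" "even_part g = gr (L_space N R) N" "odd_part g = gr (L_space N R) (N + 1)"
  "lie_br g = (\<lambda>X Y. \<Union>x\<in>X. \<Union>y\<in>Y. Lc (lb x y))"
  by (simp_all add: Lie_def superspace.defs lie_superalgebra.defs)

lemma L_space_eq: "L_space N R = quot (loop_space N R) ker"
  by (simp add: L_space_def loop_ker_eq)

lemma gr_L_space: "gr (L_space N R) p = Lc ` Lgr p"
  by (simp add: L_space_eq QL.gr_quot gr_loop_space Lc_eq[abs_def])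

lemma gr_Lie: "gr g p = Lc ` Lgr (N + p)"
  using Lgr_cong[of "N + p" N] Lgr_cong[of "N + p" "N + 1"]
  by (auto simp: gr_def[of g] Lie_fields gr_L_space)

lemma Lie_simps: "carrier g = Lc ` LC" "\<zero>\<^bsub>g\<^esub> = Lc 0" "f \<in> LC \<Longrightarrow> h \<in> LC \<Longrightarrow> Lc f \<oplus>\<^bsub>g\<^esub> Lc h = Lc (f + h)"
  "f \<in> LC \<Longrightarrow> c \<odot>\<^bsub>g\<^esub> Lc f = Lc (pscale R c f)"
  using QL.quot_carrier QL.quot_zero QL.quot_add[of f h] QL.quot_smult[of f c]
  by (simp_all add: Lie_fields L_space_eq Lc_eq[abs_def] loop_space_simps)

lemma Lc_eq_iff: "f \<in> LC \<Longrightarrow> h \<in> LC \<Longrightarrow> Lc f = Lc h \<longleftrightarrow> f - h \<in> ker"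
  using QL.q_eq_iff[of f h] CL.a_minus_V[of h f] by (simp add: Lc_eq loop_space_simps)

lemmas LC_add = LP.subspace_add[OF LC_subspace] and LC_diff = LP.subspace_diff[OF LC_subspace]
  and LC_scale = LP.subspace_scale[OF LC_subspace] and LC_0 = LP.subspace_0[OF LC_subspace]

text \<open>The union in the definition of the bracket ranges over all pairs of representatives; as
  \<open>ker\<close> is stable in both arguments, all pairs yield the same class.\<close>

lemma lie_br_Lc: assumes "f \<in> LC" "h \<in> LC" shows "lie_br g (Lc f) (Lc h) = Lc (lb f h)"
proof -
  have "Lc (lb x y) = Lc (lb f h)" if xy: "x \<in> Lc f" "y \<in> Lc h" for x y
  proof -
    obtain k l where k: "k \<in> ker" "x = k + f" and l: "l \<in> ker" "y = l + h" using xy by (auto simp: Lc_set)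
    have "k \<in> LC" "l \<in> LC" using k l ker_LC by auto
    then have C: "x \<in> LC" "y \<in> LC" using assms k l by (simp_all add: LC_add)
    have "lb x y - lb f h = lb k y + lb f l" unfolding k(2) l(2) by (simp add: lb_add algebra_simps)
    also have "\<dots> \<in> ker" using lb_ker_left[OF k(1) C(2)] lb_ker_right[OF assms(1) l(1)] by (rule ker_add)
    finally show ?thesis using assms C by (simp add: Lc_eq_iff lb_LC)
  qed
  then have "(\<Union>x\<in>Lc f. \<Union>y\<in>Lc h. Lc (lb x y)) = (\<Union>x\<in>Lc f. \<Union>y\<in>Lc h. Lc (lb f h))" by (intro SUP_cong refl)
  also have "\<dots> = Lc (lb f h)"
  proof -
    have "f \<in> Lc f" "h \<in> Lc h" using ker_0 by (force simp: Lc_set)+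
    then show ?thesis by blast
  qed
  finally show ?thesis by (simp add: Lie_fields)
qed

lemma lp_Lgr: "f \<in> Lgr p \<Longrightarrow> lp r f = (if even p = even r then f else 0)"
proof (induction rule: Lgr_induct)
  case (single n I a)
  have "(even (r + card I) = even (p + card I)) = (even p = even r)" by auto
  then show ?case by (simp only: loop_proj_single cp_eq[OF single(2)]) (simp split: if_splits)
next
  case (add f h) then show ?case by (simp only: loop_proj_add) (simp split: if_splits)
qed (simp add: loop_proj_0)

lemma lp_decomp: "f \<in> LC \<Longrightarrow> lp p f \<in> Lgr p \<and> lp p f + lp (p + 1) f = f"
proof (induction rule: loops_induct)
  case zero show ?case using LP.subspace_0[OF Lgr_subspace] by (simp add: loop_proj_0)
next
  case (single n I q a)
  have "cp (p + card I) a + cp (p + 1 + card I) a = a"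
    by (cases "even (p + card I)")
      (use cp_sum[of a] cp_cong[of "p + card I" 0 a] cp_cong[of "p + 1 + card I" 1 a] cp_cong[of "p + card I" 1 a]
        cp_cong[of "p + 1 + card I" 0 a] in \<open>simp_all add: add.commute\<close>)
  then show ?case using Lgr_single[OF single(1) cp_gr] by (simp add: loop_proj_single flip: single_add)
next
  case (add f h)
  then show ?case using LP.subspace_add[OF Lgr_subspace, of "lp p f" p "lp p h"]
    by (auto simp: loop_proj_add algebra_simps)
qed

lemma is_superspace_Lie: "is_superspace g"
proof -
  \<comment> \<open>The parity shift by N is carried out on the loop space, before the quotient is
    formed, so that \<open>is_superspace_quot\<close> applies.\<close>
  define V0 where "V0 = (loop_space N R)\<lparr>even_part := Lgr N, odd_part := Lgr (N + 1)\<rparr>"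
  have V0: "carrier V0 = LC" "zero V0 = 0" "add V0 = (+)" "smult V0 = pscale R" "even_part V0 = Lgr N" "odd_part V0 = Lgr (N + 1)"
    by (simp_all add: V0_def loop_space_simps)
  interpret C0: concrete_space "pscale R" V0 by (rule concrete_loop[OF V0(1-4)])
  interpret Q0: quotient_module V0 ker
    by (rule quotient_module.intro[OF C0.module_V]) (simp add: C0.submodule_iff ker_subspace ker_LC V0)
  have sub: "submodule (Lgr p) complex_ring V0" for p
    by (simp add: C0.submodule_iff Lgr_subspace V0) (auto simp: Lgr_def)
  have "is_superspace (quot V0 ker)"
  proof (rule Q0.is_superspace_quot)
    show "submodule (even_part V0) complex_ring V0" "submodule (odd_part V0) complex_ring V0" by (simp_all add: V0 sub del: add_0_right)
    fix x y assume xy: "x \<in> even_part V0" "y \<in> odd_part V0" "x \<ominus>\<^bsub>V0\<^esub> y \<in> ker"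
    then have xy': "x \<in> Lgr N" "y \<in> Lgr (N + 1)" by (simp_all add: V0)
    then have "x - y \<in> ker" using xy(3) C0.a_minus_V[of y x] by (simp add: V0 Lgr_def)
    then have "lp N (x - y) \<in> ker" by (rule lp_ker)
    moreover have "lp N x = x" "lp N y = 0" using lp_Lgr[OF xy'(1), of N] lp_Lgr[OF xy'(2), of N] by simp_all
    moreover have "lp N (x - y) + lp N y = lp N x" by (simp flip: loop_proj_add)
    ultimately show "x \<in> ker" by simp
  next
    fix x assume x: "x \<in> carrier V0"
    then have xC: "x \<in> LC" by (simp add: V0)
    have "lp N x \<in> even_part V0" "lp (N + 1) x \<in> odd_part V0" "lp N x + lp (N + 1) x = x"
      using lp_decomp[OF xC, of N] lp_decomp[OF xC, of "N + 1"] by (simp_all add: V0)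
    moreover have "x \<ominus>\<^bsub>V0\<^esub> x \<in> ker" using C0.a_minus_V[OF x] ker_0 by simp
    ultimately show "\<exists>y\<in>even_part V0. \<exists>z\<in>odd_part V0. x \<ominus>\<^bsub>V0\<^esub> (y \<oplus>\<^bsub>V0\<^esub> z) \<in> ker" by (metis V0(3))
  qed
  then show ?thesis
  proof (rule is_superspace_transfer)
    have q: "ker +>\<^bsub>V0\<^esub> x = Lc x" for x by (auto simp: Lc_set a_r_coset_def' V0)
    show "carrier g = carrier (quot V0 ker)" by (simp add: Q0.quot_carrier q Lie_simps V0)
    show "zero g = zero (quot V0 ker)" "add g = add (quot V0 ker)"
      by (simp_all add: Lie_fields L_space_eq quot_def set_add_def' fun_eq_iff loop_space_simps V0)
    show "smult g = smult (quot V0 ker)"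
      by (simp add: Lie_fields L_space_eq quot_def fun_eq_iff loop_space_simps V0 q flip: Lc_eq)
    show "even_part g = even_part (quot V0 ker)" "odd_part g = odd_part (quot V0 ker)"
      by (simp_all add: Lie_fields gr_L_space quot_def V0 q)
  qed
qed

text \<open>Induction on the number of missing odd indices: a relation trades a missing index i for
  S^i a, with a sign e that is its own inverse.\<close>

lemma full_rep: "I \<subseteq> Fl \<Longrightarrow> a \<in> cg p \<Longrightarrow> \<exists>a'\<in>cg (p + card (Fl - I)). sing (n, I) a - sing (n, Fl) a' \<in> ker"
proof (induction "card (Fl - I)" arbitrary: I a p)
  case 0
  then have "I = Fl" by auto
  then show ?case using 0 ker_0 by (intro bexI[of _ a]) auto
next
  case (Suc c)
  then have "Fl - I \<noteq> {}" by (metis card.empty nat.distinct(1))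
  then obtain i where i: "i \<in> Fl" "i \<notin> I" by blast
  define e where "e = m1 p * sgm {i} I"
  have ee: "e * e = 1"
  proof -
    have "sgm {i} I * sgm {i} I = 1" by (rule sgm_square) (use i in auto)
    then show ?thesis by (simp add: e_def mult_ac m1_square)
  qed
  have "sing (n, insert i I) (conf_S R i a) + sing (n, insert i I - {i}) (s (m1 p * sgm {i} (insert i I - {i})) a) \<in> ker"
    by (rule ker_S_insert) (use i Suc in auto)
  then have "sing (n, insert i I) (conf_S R i a) + sing (n, I) (s e a) \<in> ker" using i by (simp add: e_def)
  from ker_scale[OF this, of e] have 1: "sing (n, insert i I) (s e (conf_S R i a)) + sing (n, I) a \<in> ker"
    by (simp add: LP.scale_right_distrib pscale_single ee)
  have c: "card (Fl - I) = Suc (card (Fl - insert i I))"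
  proof -
    have "Fl - I = insert i (Fl - insert i I)" using i by auto
    then show ?thesis by (metis card_insert_disjoint finite_Diff finite_atLeastAtMost DiffD2 insertI1)
  qed
  have gr: "s (- e) (conf_S R i a) \<in> cg (p + 1)" by (intro cg_scale odd_S i Suc)
  have "c = card (Fl - insert i I)" using c Suc.hyps(2) by linarith
  moreover have "insert i I \<subseteq> Fl" using i Suc.prems by blast
  ultimately obtain a' where a': "a' \<in> cg (p + 1 + card (Fl - insert i I))" "sing (n, insert i I) (s (- e) (conf_S R i a)) - sing (n, Fl) a' \<in> ker"
    using Suc.hyps(1)[OF _ _ gr] by blast
  have "sing (n, I) a - sing (n, Fl) a' = (sing (n, insert i I) (s e (conf_S R i a)) + sing (n, I) a) +
      (sing (n, insert i I) (s (- e) (conf_S R i a)) - sing (n, Fl) a')"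
    by (simp add: R.scale_minus_left single_uminus)
  also have "\<dots> \<in> ker" by (rule ker_add[OF 1 a'(2)])
  finally show ?case using a'(1) c by (intro bexI[of _ a']) (simp_all add: add.assoc)
qed

text \<open>Filling up I costs |Fl - I| changes of parity, and |I| + |Fl - I| = N, so the
  coefficients of the full modes have the shifted parity q.\<close>

lemma Lgr_full_induct [consumes 1, case_names zero full add ker]:
  assumes "f \<in> Lgr (N + q)" "P 0" "\<And>n a. a \<in> cg q \<Longrightarrow> P (sing (n, Fl) a)"
    and "\<And>f h. P f \<Longrightarrow> P h \<Longrightarrow> P (f + h)" "\<And>f h. P f \<Longrightarrow> h \<in> ker \<Longrightarrow> P (f + h)"
  shows "P f"
  using assms(1)
proof (induction rule: Lgr_induct)
  case (single n I a)
  have "card I + card (Fl - I) = N" using card_Un_disjoint[of I "Fl - I"] finite_subset[OF single(1)] single(1) by (simp add: Un_absorb1)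
  then have "cg (N + q + card I + card (Fl - I)) = cg q" by (intro cg_cong) presburger
  then obtain a' where "a' \<in> cg q" "sing (n, I) a - sing (n, Fl) a' \<in> ker" using full_rep[OF single] by auto
  then show ?case using assms(3)[of a' n] assms(5)[of "sing (n, Fl) a'" "sing (n, I) a - sing (n, Fl) a'"] by simp
qed (use assms in auto)

text \<open>This is a_<n|N>, which for a of parity p differs from the mode a_(n|N) by the sign
  (-1)^(p N).\<close>

definition "md a n = Lc (sing (n, Fl) a)"
definition "pd a j b = np a j Fl b"

lemma full_LC: "sing (n, Fl) a \<in> LC"
  by (rule LC_single) simp

text \<open>With K full, \<sigma>(I - J, K) leaves only J = Fl, and the remaining sign cancels
  against that of the parity shift. The result has the shape of the commutator formula without odd
  variables, for the products a_(j|N) b.\<close>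

lemma lb_full:
  assumes a: "a \<in> cg p" and b: "b \<in> cg q" and M: "\<forall>j\<ge>M. \<forall>J. np a j J b = 0"
  shows "lb (sing (m, Fl) a) (sing (n, Fl) b) = (\<Sum>j<M. sing (m + n - int j, Fl) (s (of_int m gchoose j) (pd a j b)))"
proof -
  have "csign p q Fl Fl J = (if J = Fl then m1 (p * N) else 0)" if "J \<subseteq> Fl" for J
  proof (cases "J = Fl")
    case False
    then have "(Fl - J) \<inter> Fl \<noteq> {}" using that by blast
    then show ?thesis using False by (simp add: csign_def sgm_def)
  qed (simp add: csign_def)
  then have "(\<Sum>J\<in>Pow Fl. sing (m - int j + n, Fl \<union> (Fl - J)) (s (csign p q Fl Fl J * (of_int m gchoose j)) (np a j J b))) =
      (\<Sum>J\<in>Pow Fl. if J = Fl then sing (m + n - int j, Fl) (s (m1 (p * N) * (of_int m gchoose j)) (pd a j b)) else 0)" for j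
    by (intro sum.cong refl) (auto simp: pd_def algebra_simps)
  then have "cm p a m Fl q b n Fl = (\<Sum>j<M. sing (m + n - int j, Fl) (s (m1 (p * N) * (of_int m gchoose j)) (pd a j b)))"
    by (simp add: cm_expand[OF _ M])
  moreover have "m1 ((p + card Fl) * N + N) * (m1 (p * N) * z) = z" for z
  proof -
    have "m1 ((p + card Fl) * N + N) * m1 (p * N) = m1 0" unfolding power_add[symmetric] by (rule m1_cong) (simp, blast)
    then show ?thesis by (simp flip: mult.assoc)
  qed
  ultimately show ?thesis by (simp only: lb_single[OF a b] pscale_sum pscale_single R.scale_scale)
qed

lemma pd_gr: "a \<in> cg p \<Longrightarrow> b \<in> cg q \<Longrightarrow> pd a j b \<in> cg (p + q)"
proof -
  assume "a \<in> cg p" "b \<in> cg q"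
  moreover have "cg (p + q + N + N) = cg (p + q)" by (rule cg_cong) presburger
  ultimately show ?thesis using np_gr[of a p b q j Fl] by (simp add: pd_def)
qed

lemma full_Lgr: assumes "a \<in> cg p" shows "sing (n, Fl) a \<in> Lgr (N + p)"
proof -
  have "cg (N + p + N) = cg p" by (rule cg_cong) presburger
  then show ?thesis using Lgr_single[of Fl a "N + p" n] assms by simp
qed

text \<open>On full modes this is \<open>pd_gr\<close>. Other monomials are full modes only modulo
  the relations, hence the correction k.\<close>

lemma lb_Lgr:
  assumes "f \<in> Lgr (N + p)" "h \<in> Lgr (N + q)" shows "\<exists>k\<in>ker. lb f h + k \<in> Lgr (N + (p + q))"
proof -
  have hC: "h \<in> LC" using assms by (simp add: Lgr_def)
  show ?thesis using assms(1)
  proof (induction rule: Lgr_full_induct)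
    case zero show ?case using ker_0 LP.subspace_0[OF Lgr_subspace] by (auto simp: lb_0)
  next
    case (full n a)
    show ?case using assms(2)
    proof (induction rule: Lgr_full_induct)
      case zero show ?case using ker_0 LP.subspace_0[OF Lgr_subspace] by (auto simp: lb_0)
    next
      case (full m b)
      obtain M where M: "\<forall>j\<ge>M. \<forall>J. np a j J b = 0" using np_bounded by blast
      have "lb (sing (n, Fl) a) (sing (m, Fl) b) \<in> Lgr (N + (p + q))"
        unfolding lb_full[OF \<open>a \<in> cg p\<close> full M]
        by (intro LP.subspace_sum[OF Lgr_subspace] full_Lgr cg_scale pd_gr full \<open>a \<in> cg p\<close>)
      then show ?case using ker_0 by (intro bexI[of _ 0]) auto
    next
      case (add u v)
      then obtain k l where kl: "k \<in> ker" "lb (sing (n, Fl) a) u + k \<in> Lgr (N + (p + q))" "l \<in> ker" "lb (sing (n, Fl) a) v + l \<in> Lgr (N + (p + q))" by blast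
      have "(lb (sing (n, Fl) a) u + k) + (lb (sing (n, Fl) a) v + l) \<in> Lgr (N + (p + q))"
        using kl LP.subspace_add[OF Lgr_subspace] by blast
      then show ?case using kl by (intro bexI[of _ "k + l"]) (auto simp: lb_add ker_add algebra_simps)
    next
      case (ker u v)
      then obtain k where k: "k \<in> ker" "lb (sing (n, Fl) a) u + k \<in> Lgr (N + (p + q))" by blast
      have "lb (sing (n, Fl) a) v \<in> ker" by (rule lb_ker_right[OF full_LC ker(2)])
      then show ?case using k by (intro bexI[of _ "k - lb (sing (n, Fl) a) v"]) (auto simp: lb_add ker_diff)
    qed
  next
    case (add u v)
    then obtain k l where kl: "k \<in> ker" "lb u h + k \<in> Lgr (N + (p + q))" "l \<in> ker" "lb v h + l \<in> Lgr (N + (p + q))" by blast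
    have "(lb u h + k) + (lb v h + l) \<in> Lgr (N + (p + q))" using kl LP.subspace_add[OF Lgr_subspace] by blast
    then show ?case using kl by (intro bexI[of _ "k + l"]) (auto simp: lb_add ker_add algebra_simps)
  next
    case (ker u v)
    then obtain k where k: "k \<in> ker" "lb u h + k \<in> Lgr (N + (p + q))" by blast
    have "lb v h \<in> ker" by (rule lb_ker_left[OF ker(2) hC])
    then show ?case using k by (intro bexI[of _ "k - lb v h"]) (auto simp: lb_add ker_diff)
  qed
qed

lemma Lgr_LC: "f \<in> Lgr p \<Longrightarrow> f \<in> LC"
  by (simp add: Lgr_def)

lemma br_gr_Lie: assumes "X \<in> gr g p" "Y \<in> gr g q" shows "lie_br g X Y \<in> gr g (p + q)"
proof -
  obtain f h where fh: "f \<in> Lgr (N + p)" "h \<in> Lgr (N + q)" "X = Lc f" "Y = Lc h" using assms by (auto simp: gr_Lie)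
  obtain k where k: "k \<in> ker" "lb f h + k \<in> Lgr (N + (p + q))" using lb_Lgr[OF fh(1,2)] by blast
  have C: "f \<in> LC" "h \<in> LC" "k \<in> LC" using fh k ker_LC Lgr_LC by auto
  have "Lc (lb f h) = Lc (lb f h + k)" using C k ker_neg by (simp add: Lc_eq_iff lb_LC LC_add)
  then show ?thesis using k C by (auto simp: fh lie_br_Lc gr_Lie)
qed

sublocale E: env_data g
  by unfold_locales (rule is_superspace_Lie, rule br_gr_Lie)

end

section \<open>The derivations of the Lie superalgebra\<close>

context susy_lie_conformal_algebra
begin

definition mop :: "('r \<Rightarrow> 'r) \<Rightarrow> 'r loops \<Rightarrow> 'r loops" where
  "mop A = pext (\<lambda>k a. Poly_Mapping.single k (A a))"

definition lift :: "('r \<Rightarrow> 'r) \<Rightarrow> 'r loops set \<Rightarrow> 'r loops set" where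
  "lift A X = Lc (mop A (SOME f. f \<in> LC \<and> Lc f = X))"

abbreviation "lin_R \<equiv> Vector_Spaces.linear s s"

lemma lookup_mop: "lin_R A \<Longrightarrow> Poly_Mapping.lookup (mop A f) k = A (Poly_Mapping.lookup f k)"
  unfolding mop_def by (rule lookup_pext_single) (rule linear_add)

lemma mop_add: "lin_R A \<Longrightarrow> mop A (f + h) = mop A f + mop A h"
  and mop_scale: "lin_R A \<Longrightarrow> mop A (pscale R c f) = pscale R c (mop A f)"
  and mop_single: "lin_R A \<Longrightarrow> mop A (sing k a) = sing k (A a)"
  and mop_0: "lin_R A \<Longrightarrow> mop A 0 = 0"
  and mop_diff: "lin_R A \<Longrightarrow> mop A (f - h) = mop A f - mop A h"
proof -
  assume A: "lin_R A"
  show add: "mop A (f + h) = mop A f + mop A h" for f h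
    by (rule poly_mapping_eqI) (simp add: lookup_mop[OF A] lookup_add linear_add[OF A])
  show "mop A (pscale R c f) = pscale R c (mop A f)"
    by (rule poly_mapping_eqI) (simp add: lookup_mop[OF A] lookup_pscale linear_scale[OF A])
  show "mop A (sing k a) = sing k (A a)"
    by (rule poly_mapping_eqI) (simp add: lookup_mop[OF A] lookup_single when_def linear_0[OF A])
  show "mop A 0 = 0"
    by (rule poly_mapping_eqI) (simp add: lookup_mop[OF A] linear_0[OF A])
  show "mop A (f - h) = mop A f - mop A h"
    using add[of "f - h" h] by simp
qed

lemma mop_LC: "lin_R A \<Longrightarrow> f \<in> LC \<Longrightarrow> mop A f \<in> LC"
proof -
  assume A: "lin_R A" and f: "f \<in> LC"
  have "Poly_Mapping.keys (mop A f) \<subseteq> Poly_Mapping.keys f"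
    by (rule subsetI) (simp add: in_keys_iff lookup_mop[OF A], metis linear_0[OF A])
  then show ?thesis using f unfolding LC_def by blast
qed

lemma mop_sum: "lin_R A \<Longrightarrow> mop A (sum f I) = (\<Sum>i\<in>I. mop A (f i))"
  by (rule additive.sum) (simp add: additive_def mop_add)

lemma lift_Lc:
  assumes A: "lin_R A" and ker: "\<And>f. f \<in> ker \<Longrightarrow> mop A f \<in> ker" and f: "f \<in> LC"
  shows "lift A (Lc f) = Lc (mop A f)"
proof -
  define h where "h = (SOME h. h \<in> LC \<and> Lc h = Lc f)"
  have "h \<in> LC \<and> Lc h = Lc f"
    unfolding h_def by (rule someI[of "\<lambda>h. h \<in> LC \<and> Lc h = Lc f" f]) (simp add: f)
  then have h: "h \<in> LC" "h - f \<in> ker" using Lc_eq_iff[of h f] f by blast+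
  have "lift A (Lc f) = Lc (mop A h)" by (simp add: lift_def h_def)
  also have "\<dots> = Lc (mop A f)" using ker[OF h(2)] h(1) f by (simp add: Lc_eq_iff mop_LC[OF A] mop_diff[OF A])
  finally show ?thesis .
qed

text \<open>The defect D of the Leibniz rule is additive in each argument and maps relations to
  relations, so full modes suffice. There the bracket is built from the products \<open>pd\<close>,
  for which A is assumed to satisfy the Leibniz rule.\<close>

lemma lift_derivation:
  assumes A: "lin_R A" and ker: "\<And>f. f \<in> ker \<Longrightarrow> mop A f \<in> ker"
    and gr: "\<And>p a. a \<in> cg p \<Longrightarrow> A a \<in> cg (e + p)"
    and pd: "\<And>p q a b j. a \<in> cg p \<Longrightarrow> b \<in> cg q \<Longrightarrow> A (pd a j b) = pd (A a) j b + s (m1 (e * p)) (pd a j (A b))"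
  shows "lie_derivation g e (lift A)"
proof -
  note L = lift_Lc[OF A ker]
  define D where "D q f h = mop A (lb f h) - (lb (mop A f) h + pscale R (m1 (e * q)) (lb f (mop A h)))" for q f h
  have Dadd: "D q (f + f') h = D q f h + D q f' h" "D q f (h + h') = D q f h + D q f h'" for q f f' h h'
    by (simp_all add: D_def mop_add[OF A] lb_add LP.scale_right_distrib)
  have Dker: "f \<in> ker \<Longrightarrow> h \<in> LC \<Longrightarrow> D q f h \<in> ker" "f \<in> LC \<Longrightarrow> h \<in> ker \<Longrightarrow> D q f h \<in> ker" for q f h
    by (simp_all add: D_def ker_diff ker_add ker_scale ker lb_ker_left lb_ker_right mop_LC[OF A])
  have D: "D q f h \<in> ker" if f: "f \<in> Lgr (N + q)" and h: "h \<in> Lgr (N + r)" for q r f h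
    using f
  proof (induction rule: Lgr_full_induct)
    case zero show ?case by (simp add: D_def lb_0 mop_0[OF A] ker_0)
  next
    case (full m a)
    show ?case using h
    proof (induction rule: Lgr_full_induct)
      case zero show ?case by (simp add: D_def lb_0 mop_0[OF A] ker_0)
    next
      case (full n b)
      note a = \<open>a \<in> cg q\<close> and b = full
      obtain M1 where M1: "\<forall>j\<ge>M1. \<forall>J. np a j J b = 0" "\<forall>j\<ge>M1. \<forall>J. np (A a) j J b = 0" by (rule np_bound2)
      obtain M2 where M2: "\<forall>j\<ge>M2. \<forall>J. np a j J (A b) = 0" using np_bounded by blast
      define M where "M = max M1 M2"
      have M: "\<forall>j\<ge>M. \<forall>J. np a j J b = 0" "\<forall>j\<ge>M. \<forall>J. np (A a) j J b = 0" "\<forall>j\<ge>M. \<forall>J. np a j J (A b) = 0"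
        using M1 M2 by (auto simp: M_def)
      have "D q (sing (m, Fl) a) (sing (n, Fl) b) = 0"
        unfolding D_def mop_single[OF A] lb_full[OF a b M(1)] lb_full[OF gr[OF a] b M(2)] lb_full[OF a gr[OF b] M(3)]
          mop_sum[OF A] pscale_sum sum.distrib[symmetric] sum_subtractf[symmetric]
        by (intro sum.neutral ballI)
          (simp add: pd[OF a b] linear_scale[OF A] pscale_single R.scale_right_distrib single_add mult.commute)
      then show ?case by (simp add: ker_0)
    next
      case (add u v) then show ?case by (simp add: Dadd ker_add)
    next
      case (ker u v) show ?case unfolding Dadd by (rule ker_add[OF ker.IH Dker(2)[OF full_LC ker.hyps]])
    qed
  next
    case (add u v) then show ?case by (simp add: Dadd ker_add)
  next
    case (ker u v) show ?case unfolding Dadd by (rule ker_add[OF ker.IH Dker(1)[OF ker.hyps Lgr_LC[OF h]]])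
  qed
  have D': "D q f h \<in> ker" if f: "f \<in> Lgr (N + q)" and h: "h \<in> LC" for q f h
  proof -
    have "h = lp N h + lp (N + 1) h" "lp N h \<in> Lgr (N + 0)" "lp (N + 1) h \<in> Lgr (N + 1)"
      using lp_decomp[OF h, of N] lp_decomp[OF h, of "N + 1"] by simp_all
    then show ?thesis using D[OF f] Dadd(2)[of q f "lp N h" "lp (N + 1) h"] ker_add by metis
  qed
  show ?thesis unfolding lie_derivation_def
  proof (intro conjI allI ballI)
    show "lin_endo g (lift A)"
      by (auto simp: lin_endo_def Lie_simps L mop_LC[OF A] mop_add[OF A] mop_scale[OF A] LC_add LC_scale)
    have "lift A X \<in> gr g (e + q)" if X: "X \<in> gr g q" for q X
    proof -
      obtain f where f: "f \<in> Lgr (N + q)" "X = Lc f" using X by (auto simp: gr_Lie)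
      have "mop A f \<in> Lgr (N + (e + q))"
        using f(1) gr[of _ "N + q + k" for k] mop_LC[OF A]
        by (auto simp: Lgr_def lookup_mop[OF A]) (metis add.assoc add.left_commute gr)
      then show ?thesis using f L Lgr_LC by (auto simp: gr_Lie)
    qed
    then show "has_parity g e (lift A)" by (simp add: has_parity_def)
  next
    fix q X Y assume X: "X \<in> gr g q" and Y: "Y \<in> carrier g"
    obtain f h where f: "f \<in> Lgr (N + q)" "X = Lc f" and h: "h \<in> LC" "Y = Lc h" using X Y by (auto simp: gr_Lie Lie_simps)
    have fC: "f \<in> LC" using f Lgr_LC by blast
    show "lift A (lie_br g X Y) = lie_br g (lift A X) Y \<oplus>\<^bsub>g\<^esub> (- 1) ^ (e * q) \<odot>\<^bsub>g\<^esub> lie_br g X (lift A Y)"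
      using D'[OF f(1) h(1)] fC h(1)
      by (simp add: f(2) h(2) L lie_br_Lc mop_LC[OF A] lb_LC Lie_simps LC_add LC_scale Lc_eq_iff D_def)
  qed
qed

lemma mop_ker:
  assumes A: "lin_R A" and rels: "\<And>f. f \<in> loop_rels N R \<Longrightarrow> mop A f \<in> ker" and f: "f \<in> ker"
  shows "mop A f \<in> ker"
  using f unfolding ker_def
proof (rule LP.span_induct[where P = "\<lambda>f. mop A f \<in> LP.span (loop_rels N R)"])
  show "LP.subspace {f. mop A f \<in> LP.span (loop_rels N R)}"
    by (auto simp: LP.subspace_def mop_add[OF A] mop_scale[OF A] mop_0[OF A] LP.span_zero LP.span_add LP.span_scale)
qed (use rels in \<open>simp add: ker_def\<close>)

lemma T_ker: "f \<in> ker \<Longrightarrow> mop (conf_T R) f \<in> ker"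
proof (rule mop_ker[OF linear_T])
  fix f assume "f \<in> loop_rels N R"
  then show "mop (conf_T R) f \<in> ker"
  proof (cases rule: loop_rels_cases)
    case (T a n I)
    then show ?thesis using ker_T[OF T(1), of n "conf_T R a"] by (simp add: mop_add mop_single linear_T T_scale)
  next
    case (S i p a n I)
    have "conf_T R (conf_S R i a) = conf_S R i (conf_T R a)" by (rule T_S[OF S(1)])
    then show ?thesis using ker_S[OF S(1) even_T[OF S(2)] S(3)] ker_S_insert[OF S(1) even_T[OF S(2)] S(3)]
      by (simp add: S(4) mop_add mop_single mop_0 linear_T T_scale)
  qed
qed

text \<open>The derivation \<open>S\<^sup>i\<close> of \<open>Lie(R)\<close> is induced by \<open>(-1)\<^sup>N S\<^sup>i\<close> on \<open>R\<close>.\<close>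

definition "SN i a = s (m1 N) (conf_S R i a)"

lemma linear_SN: "i \<in> Fl \<Longrightarrow> lin_R (SN i)"
  by (simp add: linear_iff_additive_homogeneous vector_space SN_def S_add S_scale R.scale_right_distrib mult.commute)

lemma SN_gr: "i \<in> Fl \<Longrightarrow> a \<in> cg p \<Longrightarrow> SN i a \<in> cg (1 + p)"
  using odd_S[of i a p] by (simp add: SN_def cg_scale)

text \<open>\<open>SN i\<close> anticommutes with each S^k and changes the parity of a, so it sends
  the relation for S^k at a to minus the relation for S^k at \<open>SN i a\<close>.\<close>

lemma S_ker: assumes i: "i \<in> Fl" and f: "f \<in> ker" shows "mop (SN i) f \<in> ker"
proof (rule mop_ker[OF linear_SN[OF i] _ f])
  fix f assume "f \<in> loop_rels N R"
  then show "mop (SN i) f \<in> ker"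
  proof (cases rule: loop_rels_cases)
    case (T a n I)
    have "SN i (conf_T R a) = conf_T R (SN i a)" by (simp add: SN_def T_scale T_S[OF i])
    then show ?thesis using ker_T[OF T(1), of n "SN i a"] linear_scale[OF linear_SN[OF i]]
      by (simp add: T(2) mop_add mop_single linear_SN[OF i])
  next
    case (S k p a n I)
    have 1: "SN i (conf_S R k a) = - conf_S R k (SN i a)"
      by (simp add: SN_def S_S[OF i S(1)] S_scale[OF S(1)] R.scale_minus_right)
    have 2: "SN i a \<in> cg (p + 1)" using SN_gr[OF i S(2)] by simp
    have 3: "mop (SN i) f = - (sing (n, I) (conf_S R k (SN i a)) +
        (if k \<in> I then sing (n, I - {k}) (s (m1 (p + 1) * sgm {k} (I - {k})) (SN i a)) else 0))"
      by (simp add: S(4) mop_add mop_single mop_0 linear_SN[OF i] 1 linear_scale[OF linear_SN[OF i]] single_uminus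
          R.scale_minus_left)
    show ?thesis
    proof (cases "k \<in> I")
      case True
      show ?thesis unfolding 3 if_P[OF True] by (rule ker_neg[OF ker_S_insert[OF S(1) 2 S(3) True]])
    next
      case False
      show ?thesis unfolding 3 if_not_P[OF False] add_0_right by (rule ker_neg[OF ker_S[OF S(1) 2 S(3) False]])
    qed
  qed
qed

lemma T_pd: "conf_T R (pd a j b) = pd (conf_T R a) j b + pd a j (conf_T R b)"
  by (cases j) (simp_all add: pd_def np_T_left np_T_right R.scale_minus_left del: of_nat_Suc)

text \<open>The product a_(j|J) b with J = Fl - {i} appears twice, once for S^i in each argument,
  and the two terms cancel; what is left is S^i of the top product.\<close>

lemma S_pd:
  assumes i: "i \<in> Fl" and a: "a \<in> cg p"
  shows "SN i (pd a j b) = pd (SN i a) j b + s (m1 (1 * p)) (pd a j (SN i b))"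
proof -
  define J where "J = Fl - {i}"
  have J: "i \<notin> J" "insert i J = Fl" "finite J" using i by (auto simp: J_def)
  have c: "N = card J + 1" using J by (metis card_atLeastAtMost card_insert_disjoint diff_Suc_1 Suc_eq_plus1 add.commute)
  define x where "x = s (sgm {i} J) (np a j J b)"
  have 1: "np (conf_S R i a) j Fl b = s (m1 (card J)) x"
    using np_S_left(2)[OF i J(1,3), of a j b] by (simp add: J(2) x_def)
  have 2: "np a j Fl (conf_S R i b) = s (m1 (p + N + card Fl)) (conf_S R i (np a j Fl b)) + s (m1 (p + card J + 1)) x"
    using np_S_right(2)[OF i J(1) a J(3), of j b] unfolding J(2) x_def R.scale_scale .
  have e: "m1 p * m1 (p + N + card Fl) = 1" "m1 p * m1 (p + card J + 1) = - m1 (card J)"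
  proof -
    have "m1 (p + (p + N + card Fl)) = m1 0" by (rule m1_cong) (simp, blast)
    then show "m1 p * m1 (p + N + card Fl) = 1" unfolding power_add[symmetric] by simp
    have "m1 (p + (p + card J + 1)) = m1 (card J + 1)" by (rule m1_cong) (simp, blast)
    then show "m1 p * m1 (p + card J + 1) = - m1 (card J)" unfolding power_add[symmetric] by simp
  qed
  have "s (m1 p) (np a j Fl (conf_S R i b)) = conf_S R i (np a j Fl b) - s (m1 (card J)) x"
    unfolding 2 R.scale_right_distrib R.scale_scale e R.scale_minus_left by simp
  then have "conf_S R i (np a j Fl b) = np (conf_S R i a) j Fl b + s (m1 p) (np a j Fl (conf_S R i b))"
    unfolding 1 by simp
  then show ?thesis
    by (simp add: SN_def pd_def np_scale R.scale_right_distrib mult.commute)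
qed

definition "dT = lift (conf_T R)"
definition "dS i = lift (SN i)"

lemma dT_Lc: "f \<in> LC \<Longrightarrow> dT (Lc f) = Lc (mop (conf_T R) f)"
  unfolding dT_def by (rule lift_Lc[OF linear_T T_ker])

lemma dS_Lc: "i \<in> Fl \<Longrightarrow> f \<in> LC \<Longrightarrow> dS i (Lc f) = Lc (mop (SN i) f)"
  unfolding dS_def by (rule lift_Lc[OF linear_SN S_ker])

lemma der_T: "lie_derivation g 0 dT"
  unfolding dT_def by (rule lift_derivation[OF linear_T T_ker]) (simp_all add: even_T T_pd)

lemma der_S: "i \<in> Fl \<Longrightarrow> lie_derivation g 1 (dS i)"
  unfolding dS_def by (rule lift_derivation[OF linear_SN S_ker]) (use SN_gr S_pd in simp_all)

lemma fmode_eq: "fmode N R p a n J = Lc (sing (n, J) (s (m1 (p * card J) * sgm J (Fl - J)) a))"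
  by (simp add: fmode_def)

lemma is_Lie_T: "is_Lie_T N R dT"
  unfolding is_Lie_T_def
proof (intro conjI allI impI ballI)
  show "lie_derivation g 0 dT" by (rule der_T)
  fix p a j J assume a: "a \<in> cg p" and J: "J \<subseteq> Fl"
  define c where "c = m1 (p * card J) * sgm J (Fl - J)"
  have "sing (j, J) (conf_T R (s c a)) - sing (j - 1, J) (s (- of_int j) (s c a)) \<in> ker"
    using ker_T[OF J, of j "s c a"] by (simp add: R.scale_minus_left single_uminus)
  then show "dT (fmode N R p a j J) = - of_int j \<odot>\<^bsub>g\<^esub> fmode N R p a (j - 1) J"
    unfolding fmode_eq c_def[symmetric] using J by (simp add: dT_Lc LC_single mop_single linear_T Lie_simps pscale_single Lc_eq_iff)
qed

text \<open>The relation for S^i expresses S^i a at J by a at J - {i}, or makes it vanish. The work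
  lies in the sign, where the factor (-1)^N of \<open>SN\<close> makes up for the normalisation of
  the modes.\<close>

lemma is_Lie_S: assumes i: "i \<in> Fl" shows "is_Lie_S N R i (dS i)"
  unfolding is_Lie_S_def
proof (intro conjI allI impI ballI)
  show "lie_derivation g 1 (dS i)" by (rule der_S[OF i])
  fix p a j J assume a: "a \<in> cg p" and J: "J \<subseteq> Fl"
  define c where "c = m1 N * (m1 (p * card J) * sgm J (Fl - J))"
  have d: "dS i (fmode N R p a j J) = Lc (sing (j, J) (conf_S R i (s c a)))"
    using J by (simp add: fmode_eq dS_Lc[OF i] LC_single mop_single[OF linear_SN[OF i]] SN_def S_scale[OF i] c_def)
  show "dS i (fmode N R p a j J) = (if i \<in> J then sgm (Fl - J) {i} \<odot>\<^bsub>g\<^esub> fmode N R p a j (J - {i}) else \<zero>\<^bsub>g\<^esub>)"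
  proof (cases "i \<in> J")
    case False
    then show ?thesis using ker_S[OF i cg_scale[OF a] J False, of j c] J
      by (simp add: d Lie_simps Lc_eq_iff LC_single LC_0)
  next
    case True
    define J' Q where "J' = J - {i}" and "Q = Fl - J"
    have JQ: "J = insert i J'" "i \<notin> J'" "i \<notin> Q" "finite J'" "finite Q" "J' \<inter> Q = {}" "Fl - J' = insert i Q"
      using True J i finite_subset[OF J] by (auto simp: J'_def Q_def)
    have card: "N = card J' + 1 + card Q"
    proof -
      have "Fl = insert i (J' \<union> Q)" using JQ(1) J by (auto simp: Q_def)
      then have "card Fl = Suc (card J' + card Q)" using JQ by (simp add: card_Un_disjoint)
      then show ?thesis by simp
    qed
    \<comment> \<open>The sign produced by the relation against the required one, compared through
      |J'| + 1 + |Q| = N and the rules for inserting i into J' and into Q.\<close>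
    have sg: "- (c * (m1 p * sgm {i} J')) = sgm Q {i} * (m1 (p * card J') * sgm J' (insert i Q))"
    proof -
      have 1: "sgm {i} J' * sgm J Q = sgm J' Q * sgm {i} (J' \<union> Q)" unfolding JQ(1) by (rule sgm_insert_left[OF JQ(4,5)])
      have 2: "sgm {i} Q * sgm J' (insert i Q) = m1 (card J') * (sgm J' Q * sgm {i} (J' \<union> Q))"
        by (rule sgm_insert_right[OF JQ(4,5,2)])
      have 3: "sgm Q {i} = m1 (card Q) * sgm {i} Q" using sgm_commute[of Q "{i}"] JQ by simp
      have "sgm Q {i} * (m1 (p * card J') * sgm J' (insert i Q)) =
          m1 (card Q) * m1 (p * card J') * (sgm {i} Q * sgm J' (insert i Q))" unfolding 3 by (simp only: mult_ac)
      also have "\<dots> = m1 (card Q) * m1 (p * card J') * m1 (card J') * (sgm {i} J' * sgm J Q)" unfolding 1 2 by (simp only: mult_ac)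
      also have "m1 (card Q) * m1 (p * card J') * m1 (card J') = - (m1 N * m1 (p * card J) * m1 p)"
      proof -
        have "card J = Suc (card J')" using JQ by simp
        then show ?thesis unfolding card by (simp add: power_add mult_ac m1_square)
      qed
      finally show ?thesis by (simp add: c_def Q_def mult_ac)
    qed
    have "sing (j, J) (conf_S R i (s c a)) + sing (j, J') (s (m1 p * sgm {i} J') (s c a)) \<in> ker"
      using ker_S_insert[OF i cg_scale[OF a] J True] by (simp add: J'_def)
    moreover have "sing (j, J') (s (m1 p * sgm {i} J') (s c a)) = - sing (j, J') (s (- (c * (m1 p * sgm {i} J'))) a)"
      by (simp add: R.scale_minus_left single_uminus mult_ac)
    ultimately have "sing (j, J) (conf_S R i (s c a)) - sing (j, J') (s (sgm Q {i} * (m1 (p * card J') * sgm J' (insert i Q))) a) \<in> ker"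
      by (simp add: sg)
    moreover have "J' \<subseteq> Fl" using J by (auto simp: J'_def)
    ultimately show ?thesis using J
      unfolding d if_P[OF True] unfolding fmode_eq J'_def[symmetric] Q_def[symmetric] JQ(7)
      by (simp add: Lie_simps pscale_single Lc_eq_iff LC_single)
  qed
qed

end

section \<open>Transport to the quotient space\<close>

context env_module
begin

text \<open>
  \<open>Pj\<close> is a linear projection of the free algebra onto a complement of \<open>JF\<close> in \<open>C\<close>; its range represents the
  quotient \<open>V\<close>, and \<open>hat A\<close> is the operator on this range induced by \<open>A\<close>.
\<close>

definition rho :: "('g word \<Rightarrow>\<^sub>0 complex) \<Rightarrow> ('g word \<Rightarrow>\<^sub>0 complex)" where
  "rho = lext (\<lambda>xs. if set xs \<subseteq> carrier g then wd xs else 0)"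

lemma rho_add: "rho (f + h) = rho f + rho h" and rho_fscale: "rho (fconst c * f) = fconst c * rho f"
  and rho_0: "rho 0 = 0"
  by (simp_all only: rho_def lext_add lext_fscale lext_0)

lemma rho_C: "f \<in> C \<Longrightarrow> rho f = f"
  by (induction rule: letters_in_induct) (simp_all add: rho_add rho_fscale rho_0, simp add: rho_def lext_wd)

lemma rho_in: "rho f \<in> C"
proof (induction f rule: word_span_induct)
  case (word xs)
  then show ?case by (simp add: rho_def lext_wd letters_in_wd letters_in_0)
qed (simp_all add: rho_0 rho_add rho_fscale letters_in_0 letters_in_add letters_in_mult letters_in_fconst)

text \<open>A linear retraction onto \<open>JF\<close>; it exists because every subspace of a vector
  space has a complement.\<close>

definition Pk :: "('g word \<Rightarrow>\<^sub>0 complex) \<Rightarrow> ('g word \<Rightarrow>\<^sub>0 complex)" where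
  "Pk = (SOME k. Vector_Spaces.linear fscale fscale k \<and> range k \<subseteq> JF \<and> (\<forall>v\<in>JF. k v = v))"

lemma Pk: "Vector_Spaces.linear fscale fscale Pk" "Pk v \<in> JF" "v \<in> JF \<Longrightarrow> Pk v = v"
proof -
  interpret VP: vector_space_pair "fscale :: complex \<Rightarrow> ('g word \<Rightarrow>\<^sub>0 complex) \<Rightarrow> _" "fscale :: complex \<Rightarrow> ('g word \<Rightarrow>\<^sub>0 complex) \<Rightarrow> _"
    by unfold_locales
  have "Vector_Spaces.linear fscale fscale (\<lambda>v :: 'g word \<Rightarrow>\<^sub>0 complex. v)" by (rule FS.linear_ident)
  from VP.linear_exists_left_inverse_on[OF this JF_subspace]
  have "\<exists>k. Vector_Spaces.linear fscale fscale k \<and> range k \<subseteq> JF \<and> (\<forall>v\<in>JF. k v = v)" by (auto simp: inj_on_def)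
  then have "Vector_Spaces.linear fscale fscale Pk \<and> range Pk \<subseteq> JF \<and> (\<forall>v\<in>JF. Pk v = v)"
    unfolding Pk_def by (rule someI_ex)
  then show "Vector_Spaces.linear fscale fscale Pk" "Pk v \<in> JF" "v \<in> JF \<Longrightarrow> Pk v = v" by auto
qed

text \<open>The type of the free algebra also has words with letters outside
  \<open>carrier g\<close>. \<open>rho\<close> discards them, so that \<open>Pj\<close> is a
  projection of the whole type whose range lies in C.\<close>

definition Pj :: "('g word \<Rightarrow>\<^sub>0 complex) \<Rightarrow> ('g word \<Rightarrow>\<^sub>0 complex)" where
  "Pj f = rho f - Pk (rho f)"

lemma Pj_lin: "Vector_Spaces.linear fscale fscale Pj"
  using Pk(1) by (simp add: linear_iff_additive_homogeneous vector_space_fscale Pj_def rho_add rho_fscale right_diff_distrib)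

lemma Pj_add: "Pj (f + h) = Pj f + Pj h" and Pj_fscale: "Pj (fconst c * f) = fconst c * Pj f"
  and Pj_0: "Pj 0 = 0" and Pj_minus: "Pj (- f) = - Pj f" and Pj_diff: "Pj (f - h) = Pj f - Pj h"
proof -
  have ad: "additive Pj" using Pj_lin by (simp add: linear_iff_additive_homogeneous additive_def)
  show "Pj (f + h) = Pj f + Pj h" "Pj 0 = 0" "Pj (- f) = - Pj f" "Pj (f - h) = Pj f - Pj h"
    using ad by (simp_all add: additive.add additive.zero additive.minus additive.diff)
  show "Pj (fconst c * f) = fconst c * Pj f" using Pj_lin by (simp add: linear_iff_additive_homogeneous)
qed

lemma Pj_C: "Pj f \<in> C"
  unfolding Pj_def by (rule letters_in_diff[OF rho_in]) (use Pk(2) JF_C in blast)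

lemma Pj_JF: "f \<in> JF \<Longrightarrow> Pj f = 0"
  using JF_C Pk(3) by (auto simp: Pj_def rho_C)

lemma diff_Pj: "f \<in> C \<Longrightarrow> f - Pj f \<in> JF"
  by (simp add: Pj_def rho_C Pk)

lemma Pj_cong: "f - h \<in> JF \<Longrightarrow> Pj f = Pj h"
  using Pj_JF[of "f - h"] by (simp add: Pj_diff)

lemma Pj_rho: "Pj (rho f) = Pj f"
  by (simp add: Pj_def rho_C rho_in)

lemma Pj_Pj: "Pj (Pj f) = Pj f"
  using Pj_cong[OF diff_Pj[OF rho_in, of f]] by (simp add: Pj_rho)

lemma Pj_eq_iff: "f \<in> C \<Longrightarrow> h \<in> C \<Longrightarrow> Pj f = Pj h \<longleftrightarrow> f - h \<in> JF"
proof (safe intro!: Pj_cong)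
  assume fh: "f \<in> C" "h \<in> C" "Pj f = Pj h"
  have "f - h = (f - Pj f) - (h - Pj h)" using fh(3) by simp
  then show "f - h \<in> JF" using FS.subspace_diff[OF JF_subspace diff_Pj[OF fh(1)] diff_Pj[OF fh(2)]] by simp
qed

text \<open>The conditions under which an operator descends to V, which is C modulo
  \<open>JF\<close>. Multiplication by letters, the parity automorphism and the derivations meet
  them.\<close>

definition "good A \<longleftrightarrow> (\<forall>f h. A (f + h) = A f + A h) \<and> (\<forall>c f. A (fconst c * f) = fconst c * A f) \<and>
  A ` C \<subseteq> C \<and> A ` JF \<subseteq> JF" for A :: "('g word \<Rightarrow>\<^sub>0 complex) \<Rightarrow> ('g word \<Rightarrow>\<^sub>0 complex)"

definition hat :: "(('g word \<Rightarrow>\<^sub>0 complex) \<Rightarrow> ('g word \<Rightarrow>\<^sub>0 complex)) \<Rightarrow> ('g word \<Rightarrow>\<^sub>0 complex) \<Rightarrow> ('g word \<Rightarrow>\<^sub>0 complex)" where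
  "hat A v = Pj (A (rho v))"

lemma good_diff: "good A \<Longrightarrow> A (f - h) = A f - A h"
  unfolding good_def by (metis add_diff_cancel diff_add_cancel)

lemma hat_lin: "good A \<Longrightarrow> Vector_Spaces.linear fscale fscale (hat A)"
  by (simp add: linear_iff_additive_homogeneous vector_space_fscale hat_def good_def rho_add rho_fscale Pj_add Pj_fscale)

lemma Pj_hat: "Pj (hat A v) = hat A v"
  by (simp add: hat_def Pj_Pj)

lemma hat_Pj_C: "good A \<Longrightarrow> f \<in> C \<Longrightarrow> hat A (Pj f) = Pj (A f)"
proof -
  assume A: "good A" and f: "f \<in> C"
  have "A (f - Pj f) \<in> JF" using diff_Pj[OF f] A by (auto simp: good_def)
  then show ?thesis using Pj_cong[of "A f" "A (Pj f)"] by (simp add: hat_def rho_C Pj_C good_diff[OF A])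
qed

lemma hat_Pj: "good A \<Longrightarrow> hat A (Pj v) = hat A v"
  using hat_Pj_C[OF _ rho_in, of A v] by (simp add: hat_def Pj_rho)

lemma hat_hat: "good A \<Longrightarrow> B (rho v) \<in> C \<Longrightarrow> hat A (hat B v) = Pj (A (B (rho v)))"
  by (simp add: hat_def[of B] hat_Pj_C)

lemma good_letter: "x \<in> carrier g \<Longrightarrow> good (\<lambda>f. letter x * f)"
  using fconst_left_commute[of "letter x"] by (auto simp: good_def distrib_left letters_in_mult letter_C JF_mult)

lemma good_tau: "good (tau p)"
  by (auto simp: good_def tau_add tau_fscale tau_C tau_JF)

text \<open>The inverse of \<open>Vc\<close> with values in the range of \<open>Pj\<close>:
  representatives of one class have the same image under \<open>Pj\<close>.\<close>

definition "sec X = Pj (SOME f. f \<in> C \<and> Vc f = X)"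

lemma sec_Vc: assumes "f \<in> C" shows "sec (Vc f) = Pj f"
proof -
  define h where "h = (SOME h. h \<in> C \<and> Vc h = Vc f)"
  have "h \<in> C \<and> Vc h = Vc f"
    unfolding h_def by (rule someI[of "\<lambda>h. h \<in> C \<and> Vc h = Vc f" f]) (simp add: assms)
  then have "Pj h = Pj f" using V_simps(6)[of h f] Pj_cong assms by blast
  then show ?thesis by (simp add: sec_def h_def)
qed

lemma Vc_Pj: "f \<in> C \<Longrightarrow> Vc (Pj f) = Vc f"
  using diff_Pj[of f] FS.subspace_neg[OF JF_subspace, of "f - Pj f"] by (simp add: V_simps Pj_C)

lemma sg_fconst: "sg p f = fconst ((- 1) ^ p) * f"
  by (auto simp: sg_def fconst_simps)

lemma gr_V_sec:
  assumes "X \<in> gr V p"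
  shows "hat (tau 1) (sec X) = sg p (sec X)"
proof -
  obtain f where f: "f \<in> gr F p" "X = Vc f" using assms by (auto simp: V_simps)
  have fC: "f \<in> C" using f gr_F_C by blast
  have "tau 1 f - fconst ((- 1) ^ p) * f \<in> JF" using tau_gr[OF f(1), of 1] I_JF by auto
  then have "Pj (tau 1 f) = sg p (Pj f)" using Pj_cong by (simp add: sg_fconst flip: Pj_fscale)
  then show ?thesis by (simp add: f(2) sec_Vc[OF fC] hat_Pj_C[OF good_tau fC])
qed

text \<open>With f = f0 + f1 modulo I the eigenvalue equation reads f0 - f1 = +-(f0 + f1) in the
  quotient, so twice the component of the wrong parity is zero.\<close>

lemma gr_V_I:
  assumes f: "f \<in> C" and par: "hat (tau 1) (Pj f) = sg p (Pj f)" shows "Vc f \<in> gr V p"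
proof -
  obtain f0 f1 where d: "f0 \<in> gr F 0" "f1 \<in> gr F 1" "f - (f0 + f1) \<in> I" using gr_F_decomp[OF f] by blast
  have C: "f0 \<in> C" "f1 \<in> C" using d gr_F_C by auto
  have t: "Pj (tau 1 f0) = Pj f0" "Pj (tau 1 f1) = - Pj f1"
    using tau_gr[OF d(1), of 1] tau_gr[OF d(2), of 1] I_JF Pj_cong[of "tau 1 f0" f0] Pj_cong[of "tau 1 f1" "- f1"]
    by (auto simp: fconst_simps Pj_minus)
  have s: "Pj f = Pj f0 + Pj f1" using Pj_cong[of f "f0 + f1"] d(3) I_JF by (auto simp: Pj_add)
  have "hat (tau 1) (Pj f) = hat (tau 1) (Pj f0) + hat (tau 1) (Pj f1)"
    unfolding s using hat_lin[OF good_tau, of 1] by (simp add: linear_iff_additive_homogeneous)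
  then have 1: "Pj f0 - Pj f1 = sg p (Pj f0 + Pj f1)"
    using par unfolding s hat_Pj_C[OF good_tau C(1)] hat_Pj_C[OF good_tau C(2)] t by simp
  have half: "v = 0" if "v + v = 0" for v :: "'g word \<Rightarrow>\<^sub>0 complex"
  proof -
    have "fconst (1 + 1) * v = v + v" by (simp only: fconst_simps distrib_right mult_1)
    then have "fconst (1 / 2) * (fconst (1 + 1) * v) = 0" using that by simp
    then show ?thesis unfolding fconst_fconst by (simp add: fconst_simps(2))
  qed
  have eq: "Vc f = Vc h" if "Pj f = Pj h" "h \<in> C" for h using that f Pj_eq_iff V_simps(6) by blast
  show ?thesis
  proof (cases "even p")
    case True
    then have "Pj f1 + Pj f1 = 0" using 1 by (simp add: sg_def algebra_simps)
    from half[OF this] have "Pj f = Pj f0" using s by simp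
    from eq[OF this C(1)] have "Vc f = Vc f0" .
    moreover have "gr V p = gr V 0" using True by (simp add: gr_def)
    ultimately show ?thesis using d by (auto simp: V_simps)
  next
    case False
    then have "Pj f0 + Pj f0 = 0" using 1 by (simp add: sg_def algebra_simps add_eq_0_iff)
    from half[OF this] have "Pj f = Pj f1" using s by simp
    from eq[OF this C(2)] have "Vc f = Vc f1" .
    moreover have "gr V p = gr V 1" using False by (simp add: gr_def)
    ultimately show ?thesis using d by (auto simp: V_simps)
  qed
qed

lemma sec_zero: "sec (Vc 0) = 0"
  by (simp add: sec_Vc letters_in_0 Pj_0)

text \<open>\<open>mul_zw\<close> works on exponents of z and w, \<open>zw\<close> on modes; the
  substitution of -1 - m for m exchanges the two.\<close>

lemma zw_mul_zw:
  assumes "\<And>m k. D m k = Vc (X (- 1 - m) (- 1 - k))" "\<And>m k. X m k \<in> C"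
  shows "(mul_zw V ^^ r) D m k = Vc ((zw ^^ r) X (- 1 - m) (- 1 - k))"
proof -
  have "(\<forall>m k. (mul_zw V ^^ r) D m k = Vc ((zw ^^ r) X (- 1 - m) (- 1 - k))) \<and> (\<forall>m k. (zw ^^ r) X m k \<in> C)"
  proof (induction r)
    case (Suc r)
    have "- 1 - (m - 1) = - 1 - m + 1" for m :: int by simp
    then show ?case using Suc by (simp add: mul_zw_def zw_def V_simps letters_in_diff)
  qed (use assms in simp)
  then show ?thesis by blast
qed

text \<open>\<open>Vc\<close> and \<open>sec\<close> identify V with the range of \<open>Pj\<close>,
  parities included. Equations in V are tested by applying \<open>sec\<close>, which is injective on
  the carrier and turns them into facts about the generating fields.\<close>

theorem vertex_algebra_V:
  assumes gf: "generating_fields fscale N Pj (hat T) par (\<lambda>i. hat (S i)) (Pj 1) G x"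
    and par: "par = hat (tau 1)"
    and T: "good T" "\<And>f. f \<in> C \<Longrightarrow> TV (Vc f) = Vc (T f)"
    and S: "\<And>i. i \<in> {1..N} \<Longrightarrow> good (S i)" "\<And>i f. i \<in> {1..N} \<Longrightarrow> f \<in> C \<Longrightarrow> SV i (Vc f) = Vc (S i f)"
  shows "\<exists>Y. susy_vertex_algebra N V (Vc 1) TV SV Y"
proof -
  interpret generating_fields fscale N Pj "hat T" par "\<lambda>i. hat (S i)" "Pj 1" G x by (rule gf)
  define YV where "YV X n I W = Vc (Y (sec X) n I (sec W))" for X n I W
  have secC: "sec X \<in> C" for X by (simp add: sec_def Pj_C)
  have car: "X \<in> carrier V \<Longrightarrow> \<exists>f\<in>C. X = Vc f" for X by (auto simp: V_simps)
  have YC: "Y u n I w \<in> C" for u n I w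
    using Y_op[of u n I] Pj_C by (metis is_op_def)
  have YP: "Pj (Y u n I w) = Y u n I w" "Y u n I (Pj w) = Y u n I w" for u n I w
    using Y_op[of u n I] by (auto simp: is_op_def)
  have Ylin: "Y u n I (w + w') = Y u n I w + Y u n I w'" "Y u n I (fconst c * w) = fconst c * Y u n I w" for u n I w w' c
    using op_lin[OF Y_op, of u n I] by (auto simp: lin_iff)
  have YV: "YV X n I (Vc f) = Vc (Y (sec X) n I f)" if "f \<in> C" for X n I f
    by (simp add: YV_def sec_Vc[OF that] YP)
  have secYV: "sec (YV X n I W) = Y (sec X) n I (sec W)" for X n I W
    by (simp add: YV_def sec_Vc YC YP)
  have sec_add: "X \<in> carrier V \<Longrightarrow> W \<in> carrier V \<Longrightarrow> sec (X \<oplus>\<^bsub>V\<^esub> W) = sec X + sec W" for X W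
    by (auto simp: V_simps sec_Vc Pj_add letters_in_add)
  have sec_smult: "X \<in> carrier V \<Longrightarrow> sec (c \<odot>\<^bsub>V\<^esub> X) = fconst c * sec X" for X c
    by (auto simp: V_simps sec_Vc Pj_fscale letters_in_mult letters_in_fconst)
  have Vc_sec: "X \<in> carrier V \<Longrightarrow> Vc (sec X) = X" for X
    by (auto simp: V_simps sec_Vc Vc_Pj)
  have TV: "TV X = Vc (hat T (sec X))" and secTV: "sec (TV X) = hat T (sec X)" if X: "X \<in> carrier V" for X
  proof -
    obtain f where f: "f \<in> C" "X = Vc f" using car[OF X] by blast
    have "T f \<in> C" using T(1) f(1) by (auto simp: good_def)
    then show "TV X = Vc (hat T (sec X))" "sec (TV X) = hat T (sec X)"
      using f by (simp_all add: T(2) sec_Vc hat_Pj_C[OF T(1)] Vc_Pj)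
  qed
  have SV: "SV i X = Vc (hat (S i) (sec X))" and secSV: "sec (SV i X) = hat (S i) (sec X)"
    if i: "i \<in> {1..N}" and X: "X \<in> carrier V" for i X
  proof -
    obtain f where f: "f \<in> C" "X = Vc f" using car[OF X] by blast
    have "S i f \<in> C" using S(1)[OF i] f(1) by (auto simp: good_def)
    then show "SV i X = Vc (hat (S i) (sec X))" "sec (SV i X) = hat (S i) (sec X)"
      using f by (simp_all add: S(2)[OF i] sec_Vc hat_Pj_C[OF S(1)[OF i]] Vc_Pj)
  qed
  have Vgr: "sec X \<in> Vgr p" if "X \<in> gr V p" for X p
    using gr_V_sec[OF that, folded par] by (simp add: Vgr_def sec_def Pj_Pj)
  have grI: "Vc v \<in> gr V p" if "v \<in> Vgr p" for v p
  proof (rule gr_V_I[folded par])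
    have v: "Pj v = v" "par v = sg p v" using that by (auto simp: Vgr_def)
    show "v \<in> C" using Pj_C[of v] v by simp
    show "par (Pj v) = sg p (Pj v)" using v by simp
  qed
  have gr_car: "X \<in> carrier V" if "X \<in> gr V p" for X p
    using that gr_F_C by (auto simp: V_simps)
  have hatC: "hat A v \<in> C" for A v by (simp add: hat_def Pj_C)
  have hT: "hat T (u + v) = hat T u + hat T v" "hat T (fconst c * u) = fconst c * hat T u" for u v c
    using hat_lin[OF T(1)] by (auto simp: linear_iff_additive_homogeneous)
  have hS: "hat (S i) (u + v) = hat (S i) u + hat (S i) v" "hat (S i) (fconst c * u) = fconst c * hat (S i) u"
    if "i \<in> {1..N}" for u v c i
    using hat_lin[OF S(1)[OF that]] by (auto simp: linear_iff_additive_homogeneous)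
  have YVC: "YV X n I W \<in> carrier V" for X n I W by (simp add: YV_def V_simps YC)
  have TVC: "X \<in> carrier V \<Longrightarrow> TV X \<in> carrier V" for X by (simp add: TV) (simp add: V_simps hatC)
  have SVC: "i \<in> {1..N} \<Longrightarrow> X \<in> carrier V \<Longrightarrow> SV i X \<in> carrier V" for i X by (simp add: SV) (simp add: V_simps hatC)
  have Y0: "Y u n I 0 = 0" for u n I using Ylin(2)[of u n I 0 0] by (simp add: fconst_simps)
  have inj: "X = W" if "sec X = sec W" "X \<in> carrier V" "W \<in> carrier V" for X W
    using that Vc_sec by metis
  have sec_minus: "sec (X \<ominus>\<^bsub>V\<^esub> W) = sec X - sec W" if "X \<in> carrier V" "W \<in> carrier V" for X W
    using that by (auto simp: V_simps sec_Vc Pj_diff letters_in_diff)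
  have closed: "X \<in> carrier V \<Longrightarrow> W \<in> carrier V \<Longrightarrow> X \<ominus>\<^bsub>V\<^esub> W \<in> carrier V" "X \<in> carrier V \<Longrightarrow> c \<odot>\<^bsub>V\<^esub> X \<in> carrier V"
    "X \<in> carrier V \<Longrightarrow> W \<in> carrier V \<Longrightarrow> X \<oplus>\<^bsub>V\<^esub> W \<in> carrier V" "Vc 0 \<in> carrier V" for X W c
    by (auto simp: V_simps letters_in_diff letters_in_add letters_in_mult letters_in_fconst letters_in_0)
  have vac: "sec (Vc 1) = Pj 1" "Vc 1 \<in> carrier V" by (simp_all add: sec_Vc letters_in_1 V_simps(1))
  have z: "\<zero>\<^bsub>V\<^esub> = Vc 0" by (rule V_simps(4))
  have parT: "hat T v \<in> Vgr p" if "v \<in> Vgr p" for v p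
    using that par_T[of v] lin_sg[OF op_T(1), of p v] by (simp add: Vgr_def Pj_hat)
  have parS: "hat (S i) v \<in> Vgr (1 + p)" if "v \<in> Vgr p" "i \<in> {1..N}" for v p i
    using that par_S[OF that(2), of v] lin_sg[OF op_S(1)[OF that(2)], of p v] by (simp add: Vgr_def Pj_hat sg_Suc)
  have parY: "Y u n I v \<in> Vgr (p + card I + q)" if "u \<in> Vgr p" "v \<in> Vgr q" "I \<subseteq> {1..N}" for u v p q n I
  proof -
    have "Y u n I (par v) = sg (p + card I) (par (Y u n I v))" by (rule Y_par[OF that(3,1)])
    then have "par (Y u n I v) = sg (p + card I) (Y u n I (sg q v))" using that(2) by (simp add: Vgr_def)
    then show ?thesis using lin_sg[OF op_lin[OF Y_op], of u n I q v] by (simp add: Vgr_def YP sg_sg)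
  qed
  have scomm: "sec (scomm V p q A B X) = sec (A (B X)) - sg (p * q) (sec (B (A X)))"
    if "A (B X) \<in> carrier V" "B (A X) \<in> carrier V" for p q A B X
    using that by (simp add: scomm_def sec_minus closed sec_smult sg_fconst)
  have lin_endoI: "lin_endo V A"
    if "\<And>X. X \<in> carrier V \<Longrightarrow> A X \<in> carrier V"
      "\<And>X W. X \<in> carrier V \<Longrightarrow> W \<in> carrier V \<Longrightarrow> sec (A (X \<oplus>\<^bsub>V\<^esub> W)) = sec (A X) + sec (A W)"
      "\<And>c X. X \<in> carrier V \<Longrightarrow> sec (A (c \<odot>\<^bsub>V\<^esub> X)) = fconst c * sec (A X)" for A
    unfolding lin_endo_def
  proof (intro conjI ballI allI funcsetI)
    fix X W assume XW: "X \<in> carrier V" "W \<in> carrier V"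
    show "A (X \<oplus>\<^bsub>V\<^esub> W) = A X \<oplus>\<^bsub>V\<^esub> A W" by (rule inj) (simp_all add: that XW closed sec_add)
  next
    fix c X assume X: "X \<in> carrier V"
    show "A (c \<odot>\<^bsub>V\<^esub> X) = c \<odot>\<^bsub>V\<^esub> A X" by (rule inj) (simp_all add: that X closed sec_smult)
  qed (rule that(1))
  have "susy_vertex_algebra N V (Vc 1) TV SV YV"
  proof
    show "is_superspace V" by (rule is_superspace_V)
    show "Vc 1 \<in> gr V 0" using gr_F_1 by (auto simp: V_simps)
    show "lin_endo V TV"
      by (rule lin_endoI) (simp_all add: TVC sec_add sec_smult closed secTV hT)
    show "has_parity V 0 TV"
      unfolding has_parity_def by (auto simp: TV[OF gr_car] intro!: grI parT Vgr)
    show "lin_endo V (SV i)" if "i \<in> {1..N}" for i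
      using that by (intro lin_endoI) (simp_all add: SVC sec_add sec_smult closed secSV hS)
    show "has_parity V 1 (SV i)" if i: "i \<in> {1..N}" for i
      unfolding has_parity_def using parS[OF Vgr i] by (auto simp: SV[OF i gr_car] intro!: grI)
    show "lin_endo V (YV X n I)" if "X \<in> carrier V" "I \<subseteq> {1..N}" for X n I
      by (rule lin_endoI) (simp_all add: YVC sec_add sec_smult closed secYV Ylin)
    show "YV (X \<oplus>\<^bsub>V\<^esub> X') n I W = YV X n I W \<oplus>\<^bsub>V\<^esub> YV X' n I W"
      if "X \<in> carrier V" "X' \<in> carrier V" "I \<subseteq> {1..N}" "W \<in> carrier V" for X X' n I W
      by (rule inj) (use that in \<open>simp_all add: YVC closed secYV sec_add Y_add\<close>)
    show "YV (c \<odot>\<^bsub>V\<^esub> X) n I W = c \<odot>\<^bsub>V\<^esub> YV X n I W"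
      if "X \<in> carrier V" "I \<subseteq> {1..N}" "W \<in> carrier V" for c X n I W
      by (rule inj) (use that in \<open>simp_all add: YVC closed secYV sec_smult Y_scale\<close>)
    show "has_parity V (p + card I) (YV X n I)" if "X \<in> gr V p" "I \<subseteq> {1..N}" for p X n I
      unfolding has_parity_def YV_def using parY[OF Vgr[OF that(1)] Vgr that(2)] by (auto intro!: grI)
    show "\<exists>M. \<forall>n<M. \<forall>I\<subseteq>{1..N}. YV X n I W = \<zero>\<^bsub>V\<^esub>" if "X \<in> carrier V" "W \<in> carrier V" for X W
      using Y_field[of "sec X" "sec W"] by (fastforce simp: YV_def z)
    show "YV X n I (Vc 1) = \<zero>\<^bsub>V\<^esub>" if "X \<in> carrier V" "n < 0" "I \<subseteq> {1..N}" for X n I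
      using that by (simp add: YV_def vac Y_vac z)
    show "YV X 0 {} (Vc 1) = X" if "X \<in> carrier V" for X
      using that by (intro inj) (simp_all add: YVC secYV vac Y_vac_value, simp add: sec_def Pj_Pj)
    show "TV (Vc 1) = \<zero>\<^bsub>V\<^esub>" by (simp add: TV vac T_vac z)
    show "SV i (Vc 1) = \<zero>\<^bsub>V\<^esub>" if "i \<in> {1..N}" for i using that by (simp add: SV vac S_vac z)
    show "TV (YV X n I W) \<ominus>\<^bsub>V\<^esub> YV X n I (TV W) = of_int (n + 1) \<odot>\<^bsub>V\<^esub> YV X (n + 1) I W"
      if "X \<in> carrier V" "I \<subseteq> {1..N}" "W \<in> carrier V" for X n I W
      by (rule inj) (use that Y_T[of "sec X" n I "sec W"] in \<open>simp_all add: YVC TVC closed sec_minus secYV secTV sec_smult\<close>)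
    show "(- 1) ^ card I \<odot>\<^bsub>V\<^esub> scomm V 1 (p + card I) (SV i) (YV X n I) W =
        (if i \<in> I then \<zero>\<^bsub>V\<^esub> else sgm {i} I \<odot>\<^bsub>V\<^esub> YV X n (insert i I) W)"
      if i: "i \<in> {1..N}" and X: "X \<in> gr V p" and I: "I \<subseteq> {1..N}" and W: "W \<in> carrier V" for i p X n I W
    proof (rule inj)
      have sc: "scomm V 1 (p + card I) (SV i) (YV X n I) W \<in> carrier V" by (simp add: scomm_def closed SVC[OF i] YVC)
      then show "(- 1) ^ card I \<odot>\<^bsub>V\<^esub> scomm V 1 (p + card I) (SV i) (YV X n I) W \<in> carrier V" by (rule closed(2))
      have 1: "sec (scomm V 1 (p + card I) (SV i) (YV X n I) W) =
          hat (S i) (Y (sec X) n I (sec W)) - sg (p + card I) (Y (sec X) n I (hat (S i) (sec W)))"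
        unfolding scomm[where A = "SV i" and B = "YV X n I" and X = W, OF SVC[OF i YVC] YVC] by (simp only: secSV[OF i YVC] secYV secSV[OF i W] mult_1)
      show "sec ((- 1) ^ card I \<odot>\<^bsub>V\<^esub> scomm V 1 (p + card I) (SV i) (YV X n I) W) =
         sec (if i \<in> I then \<zero>\<^bsub>V\<^esub> else sgm {i} I \<odot>\<^bsub>V\<^esub> YV X n (insert i I) W)"
        unfolding sec_smult[OF sc] 1 sg_fconst[symmetric] Y_S[OF i I Vgr[OF X]]
        by (simp add: z sec_zero sec_smult YVC secYV)
    qed (simp add: closed YVC z)
    show "\<exists>r. \<forall>I\<subseteq>{1..N}. \<forall>K\<subseteq>{1..N}. \<forall>W\<in>carrier V. \<forall>m k.
        (mul_zw V ^^ r) (\<lambda>m k. (- 1) ^ (card K * (p + card I)) \<odot>\<^bsub>V\<^esub>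
          scomm V (p + card I) (q + card K) (YV X m I) (YV X' k K) W) m k = \<zero>\<^bsub>V\<^esub>"
      if X: "X \<in> gr V p" and X': "X' \<in> gr V q" for p q X X'
    proof -
      \<comment> \<open>The supercommutator indexed by modes: the exponents of the axiom enter as -1
        - m and -1 - k, the form that \<open>zw_mul_zw\<close> expects.\<close>
      define D where "D I K w m k = sg (card K * (p + card I)) (Y (sec X) (- 1 - m) I (Y (sec X') (- 1 - k) K w)
        - sg ((p + card I) * (q + card K)) (Y (sec X') (- 1 - k) K (Y (sec X) (- 1 - m) I w)))" for I K w m k
      have "\<exists>r. \<forall>I\<subseteq>{1..N}. \<forall>K\<subseteq>{1..N}. \<forall>w. \<forall>m k. (zw ^^ r) (D I K w) m k = 0"
        unfolding D_def by (rule Y_local[OF Vgr[OF X] Vgr[OF X']])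
      then obtain r where r: "\<forall>I\<subseteq>{1..N}. \<forall>K\<subseteq>{1..N}. \<forall>w. \<forall>m k. (zw ^^ r) (D I K w) m k = 0" ..
      show ?thesis
      proof (intro exI[of _ r] allI impI ballI)
        fix I K W m k assume I: "I \<subseteq> {1..N}" and K: "K \<subseteq> {1..N}" and W: "W \<in> carrier V"
        have DC: "D I K w m k \<in> C" for w m k
          unfolding D_def sg_fconst by (intro letters_in_mult letters_in_fconst letters_in_diff YC)
        have "(- 1) ^ (card K * (p + card I)) \<odot>\<^bsub>V\<^esub> scomm V (p + card I) (q + card K) (YV X m I) (YV X' k K) W =
            Vc (D I K (sec W) (- 1 - m) (- 1 - k))" (is "?l = _") for m k
        proof (rule inj)
          have ix: "- 1 - (- 1 - j) = j" for j :: int by simp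
          have sc: "scomm V (p + card I) (q + card K) (YV X m I) (YV X' k K) W \<in> carrier V" by (simp add: scomm_def closed YVC)
          then show "?l \<in> carrier V" by (simp add: closed)
          show "Vc (D I K (sec W) (- 1 - m) (- 1 - k)) \<in> carrier V" by (simp add: V_simps DC)
          have "Pj (D I K (sec W) (- 1 - m) (- 1 - k)) = D I K (sec W) (- 1 - m) (- 1 - k)"
            by (simp add: D_def sg_fconst Pj_fscale Pj_diff YP)
          then show "sec ?l = sec (Vc (D I K (sec W) (- 1 - m) (- 1 - k)))"
            unfolding sec_smult[OF sc] scomm[where A = "YV X m I" and B = "YV X' k K" and X = W, OF YVC YVC] secYV sec_Vc[OF DC] sg_fconst[symmetric] by (simp only: D_def ix)
        qed
        then show "(mul_zw V ^^ r) (\<lambda>m k. (- 1) ^ (card K * (p + card I)) \<odot>\<^bsub>V\<^esub>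
            scomm V (p + card I) (q + card K) (YV X m I) (YV X' k K) W) m k = \<zero>\<^bsub>V\<^esub>"
          using zw_mul_zw[of _ "D I K (sec W)", OF _ DC] r[rule_format, OF I K] z by simp
      qed
    qed
  qed
  then show ?thesis by blast
qed

end

section \<open>The generating fields\<close>

text \<open>The summand for j consists of the coefficients of W_j times the j-th divided derivative
  of the delta distribution, which (z - w)^(j+1) annihilates. In terms of coefficients, Pascal's
  rule makes z - w lower j by one.\<close>

lemma zw_gbinomial:
  "(zw ^^ M) (\<lambda>m n. \<Sum>j<M. fconst (of_int m gchoose j) * W j (m + n - int j)) = (\<lambda>m n. 0)"
proof (induction M arbitrary: W)
  case (Suc M)
  have "zw (\<lambda>m n. \<Sum>j<Suc M. fconst (of_int m gchoose j) * W j (m + n - int j)) =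
      (\<lambda>m n. \<Sum>j<M. fconst (of_int m gchoose j) * W (Suc j) (m + n - int j))"
  proof (intro ext)
    fix m n :: int
    have e: "m + 1 + n - int (Suc j) = m + n - int j" "m + (n + 1) - int (Suc j) = m + n - int j" for j by simp_all
    have "fconst (of_int (m + 1) gchoose Suc j) * W (Suc j) (m + n - int j) - fconst (of_int m gchoose Suc j) * W (Suc j) (m + n - int j) =
        fconst (of_int m gchoose j) * W (Suc j) (m + n - int j)" for j
      unfolding of_int_add of_int_1 gbinomial_Suc_Suc fconst_simps(3) distrib_right by simp
    then show "zw (\<lambda>m n. \<Sum>j<Suc M. fconst (of_int m gchoose j) * W j (m + n - int j)) m n =
        (\<Sum>j<M. fconst (of_int m gchoose j) * W (Suc j) (m + n - int j))"
      unfolding zw_def sum.lessThan_Suc_shift e by (simp add: add.commute add.left_commute flip: sum_subtractf)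
  qed
  then show ?case using Suc[of "\<lambda>j. W (Suc j)"] unfolding funpow_Suc_right comp_def by simp
qed simp

context susy_lie_conformal_algebra
begin

section \<open>The nonnegative modes and the commutator formula in the free algebra\<close>

abbreviation "Ll \<equiv> Lie_le N R"

lemma Lie_neg: "X \<in> carrier g \<Longrightarrow> \<ominus>\<^bsub>g\<^esub> X = (- 1) \<odot>\<^bsub>g\<^esub> X"
proof -
  assume "X \<in> carrier g"
  then obtain f where f: "f \<in> LC" "X = Lc f" by (auto simp: Lie_simps)
  then have "(- 1) \<odot>\<^bsub>g\<^esub> X \<oplus>\<^bsub>g\<^esub> X = \<zero>\<^bsub>g\<^esub>"
    by (simp add: Lie_simps LC_scale LP.subspace_neg[OF LC_subspace])
  moreover have "(- 1) \<odot>\<^bsub>g\<^esub> X \<in> carrier g" using f LP.subspace_neg[OF LC_subspace] by (simp add: Lie_simps)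
  ultimately show ?thesis using E.G.minus_equality[of "(- 1) \<odot>\<^bsub>g\<^esub> X" X] \<open>X \<in> carrier g\<close> by simp
qed

lemma Lie_submoduleI:
  assumes "H \<subseteq> carrier g" "\<zero>\<^bsub>g\<^esub> \<in> H" "\<And>X Y. X \<in> H \<Longrightarrow> Y \<in> H \<Longrightarrow> X \<oplus>\<^bsub>g\<^esub> Y \<in> H"
    "\<And>c X. X \<in> H \<Longrightarrow> c \<odot>\<^bsub>g\<^esub> X \<in> H"
  shows "submodule H complex_ring g"
  by (rule E.G.submoduleI) (use assms Lie_neg in \<open>auto simp: subset_iff\<close>)

lemma fmode_gr: "a \<in> cg p \<Longrightarrow> J \<subseteq> Fl \<Longrightarrow> fmode N R p a n J \<in> gr g (N + p + card J)"
proof -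
  assume a: "a \<in> cg p" and J: "J \<subseteq> Fl"
  have "cg (p + card J + card J) = cg p" by (rule cg_cong) (simp, blast)
  then have "sing (n, J) (s c a) \<in> Lgr (p + card J)" for c using a J by (intro Lgr_single) (simp_all add: cg_scale)
  moreover have "Lgr (N + (N + p + card J)) = Lgr (p + card J)" by (rule Lgr_cong) (simp, blast)
  ultimately show ?thesis by (auto simp: gr_Lie fmode_eq)
qed

lemma Ll_carrier: "Ll \<subseteq> carrier g" and Ll_fmode: "a \<in> cg p \<Longrightarrow> n \<ge> 0 \<Longrightarrow> J \<subseteq> Fl \<Longrightarrow> fmode N R p a n J \<in> Ll"
  and Ll_zero: "\<zero>\<^bsub>g\<^esub> \<in> Ll" and Ll_add: "X \<in> Ll \<Longrightarrow> Y \<in> Ll \<Longrightarrow> X \<oplus>\<^bsub>g\<^esub> Y \<in> Ll" and Ll_smult: "X \<in> Ll \<Longrightarrow> c \<odot>\<^bsub>g\<^esub> X \<in> Ll"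
  and Ll_minimal: "submodule H complex_ring g \<Longrightarrow>
    (\<And>p a n J. a \<in> cg p \<Longrightarrow> n \<ge> 0 \<Longrightarrow> J \<subseteq> Fl \<Longrightarrow> fmode N R p a n J \<in> H) \<Longrightarrow> Ll \<subseteq> H"
proof -
  define Q where "Q H \<longleftrightarrow> submodule H complex_ring g \<and> {fmode N R p a j J | p a j J. a \<in> cg p \<and> j \<ge> 0 \<and> J \<subseteq> Fl} \<subseteq> H" for H
  have Ll: "Ll = \<Inter>{H. Q H}" by (simp add: Lie_le_def lin_span_def Q_def)
  have sub: "submodule H complex_ring g" if "Q H" for H using that by (simp add: Q_def)
  have Ll_I: "X \<in> Ll" if "\<And>H. Q H \<Longrightarrow> X \<in> H" for X using that by (simp add: Ll)
  have Ll_D: "X \<in> Ll \<Longrightarrow> Q H \<Longrightarrow> X \<in> H" for X H by (simp add: Ll)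
  show min: "submodule H complex_ring g \<Longrightarrow>
    (\<And>p a n J. a \<in> cg p \<Longrightarrow> n \<ge> 0 \<Longrightarrow> J \<subseteq> Fl \<Longrightarrow> fmode N R p a n J \<in> H) \<Longrightarrow> Ll \<subseteq> H" for H
  proof (rule subsetI)
    fix X assume "submodule H complex_ring g" and gens: "\<And>p a n J. a \<in> cg p \<Longrightarrow> n \<ge> 0 \<Longrightarrow> J \<subseteq> Fl \<Longrightarrow> fmode N R p a n J \<in> H"
      and X: "X \<in> Ll"
    then have "Q H" using gens by (auto simp: Q_def)
    then show "X \<in> H" by (rule Ll_D[OF X])
  qed
  show "Ll \<subseteq> carrier g"
    by (rule min[OF E.G.carrier_is_submodule]) (rule E.gr_carrier[OF fmode_gr])
  show "fmode N R p a n J \<in> Ll" if "a \<in> cg p" "n \<ge> 0" "J \<subseteq> Fl"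
  proof (rule Ll_I)
    fix H assume "Q H"
    then have "{fmode N R p a j J | p a j J. a \<in> cg p \<and> j \<ge> 0 \<and> J \<subseteq> Fl} \<subseteq> H" unfolding Q_def by (rule conjunct2)
    moreover have "fmode N R p a n J \<in> {fmode N R p a j J | p a j J. a \<in> cg p \<and> j \<ge> 0 \<and> J \<subseteq> Fl}" using that by blast
    ultimately show "fmode N R p a n J \<in> H" by (rule subsetD)
  qed
  have zero: "\<zero>\<^bsub>g\<^esub> \<in> H" if "submodule H complex_ring g" for H
    using subgroup.one_closed[OF submodule.axioms(1)[OF that]] by simp
  show "\<zero>\<^bsub>g\<^esub> \<in> Ll" by (rule Ll_I) (rule zero[OF sub])
  have add: "X \<oplus>\<^bsub>g\<^esub> Y \<in> H" if "submodule H complex_ring g" "X \<in> H" "Y \<in> H" for H X Y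
    using subgroup.m_closed[OF submodule.axioms(1)[OF that(1)]] that by simp
  show "X \<oplus>\<^bsub>g\<^esub> Y \<in> Ll" if "X \<in> Ll" "Y \<in> Ll"
    by (rule Ll_I) (rule add[OF sub Ll_D[OF that(1)] Ll_D[OF that(2)]])
  have sm: "c \<odot>\<^bsub>g\<^esub> X \<in> H" if "submodule H complex_ring g" "X \<in> H" for H X
    using submodule.smult_closed[OF that(1), of c X] that by simp
  show "c \<odot>\<^bsub>g\<^esub> X \<in> Ll" if "X \<in> Ll"
    by (rule Ll_I) (rule sm[OF sub Ll_D[OF that]])
qed

lemma Ll_stable:
  assumes "A \<zero>\<^bsub>g\<^esub> = \<zero>\<^bsub>g\<^esub>" "\<And>X Y. X \<in> carrier g \<Longrightarrow> Y \<in> carrier g \<Longrightarrow> A (X \<oplus>\<^bsub>g\<^esub> Y) = A X \<oplus>\<^bsub>g\<^esub> A Y"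
    "\<And>c X. X \<in> carrier g \<Longrightarrow> A (c \<odot>\<^bsub>g\<^esub> X) = c \<odot>\<^bsub>g\<^esub> A X"
    "\<And>p a n J. a \<in> cg p \<Longrightarrow> n \<ge> 0 \<Longrightarrow> J \<subseteq> Fl \<Longrightarrow> A (fmode N R p a n J) \<in> Ll" and X: "X \<in> Ll"
  shows "A X \<in> Ll"
proof -
  have "Ll \<subseteq> {X \<in> Ll. A X \<in> Ll}"
    by (rule Ll_minimal[OF Lie_submoduleI]) (use Ll_carrier in \<open>auto simp: assms(1-4) Ll_zero Ll_add Ll_smult Ll_fmode subset_iff\<close>)
  then show ?thesis using X by auto
qed

lemma zero_smult: "X \<in> carrier g \<Longrightarrow> 0 \<odot>\<^bsub>g\<^esub> X = \<zero>\<^bsub>g\<^esub>"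
  by (auto simp: Lie_simps)

lemma der_zero: "lie_derivation g q A \<Longrightarrow> A \<zero>\<^bsub>g\<^esub> = \<zero>\<^bsub>g\<^esub>"
proof -
  assume "lie_derivation g q A"
  then interpret D: env_derivation g q A by unfold_locales
  show ?thesis using D.\<delta>_smult[of "\<zero>\<^bsub>g\<^esub>" 0] by (simp add: zero_smult D.\<delta>_closed)
qed

sublocale M: env_module g Ll
proof
  show "Ll \<subseteq> carrier g" by (rule Ll_carrier)
  fix X assume "X \<in> Ll"
  then show "E.gpar X \<in> Ll"
  proof (rule Ll_stable[of E.gpar, rotated -1])
    show "E.gpar \<zero>\<^bsub>g\<^esub> = \<zero>\<^bsub>g\<^esub>" using E.gpar_gr[OF E.gr_zero, of 0] by (simp add: Lie_simps LC_0)
  qed (auto simp: E.gpar_add E.gpar_smult E.gpar_gr[OF fmode_gr] Ll_smult Ll_fmode)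
qed

sublocale DT: env_module_derivation g Ll 0 dT
proof
  show "lie_derivation g 0 dT" by (rule der_T)
  then interpret D: env_derivation g 0 dT by unfold_locales
  fix X assume "X \<in> Ll"
  then show "dT X \<in> Ll"
  proof (rule Ll_stable[of dT, rotated -1])
    show "dT \<zero>\<^bsub>g\<^esub> = \<zero>\<^bsub>g\<^esub>" by (rule der_zero[OF der_T])
    fix p a J and n :: int assume a: "a \<in> cg p" and n: "0 \<le> n" and J: "J \<subseteq> Fl"
    have e: "dT (fmode N R p a n J) = - of_int n \<odot>\<^bsub>g\<^esub> fmode N R p a (n - 1) J"
      using is_Lie_T a J unfolding is_Lie_T_def by blast
    show "dT (fmode N R p a n J) \<in> Ll"
    \<comment> \<open>The mode n - 1 leaves the nonnegative range only for n = 0, where the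
      coefficient -n vanishes.\<close>
    proof (cases "n = 0")
      case True
      then show ?thesis unfolding e using E.gr_carrier[OF fmode_gr[OF a J]] by (simp add: zero_smult Ll_zero)
    next
      case False
      then show ?thesis unfolding e using a n J by (intro Ll_smult Ll_fmode) auto
    qed
  qed (simp_all add: D.\<delta>_add D.\<delta>_smult)
qed

lemma dS_module: assumes i: "i \<in> Fl" shows "env_module_derivation g Ll 1 (dS i)"
proof
  show "lie_derivation g 1 (dS i)" by (rule der_S[OF i])
  then interpret D: env_derivation g 1 "dS i" by unfold_locales
  fix X assume "X \<in> Ll"
  then show "dS i X \<in> Ll"
  proof (rule Ll_stable[of "dS i", rotated -1])
    show "dS i \<zero>\<^bsub>g\<^esub> = \<zero>\<^bsub>g\<^esub>" by (rule der_zero[OF der_S[OF i]])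
    fix p a J and n :: int assume a: "a \<in> cg p" and n: "0 \<le> n" and J: "J \<subseteq> Fl"
    have "dS i (fmode N R p a n J) = (if i \<in> J then sgm (Fl - J) {i} \<odot>\<^bsub>g\<^esub> fmode N R p a n (J - {i}) else \<zero>\<^bsub>g\<^esub>)"
      using is_Lie_S[OF i] a J unfolding is_Lie_S_def by blast
    then show "dS i (fmode N R p a n J) \<in> Ll" using a n J by (auto simp: Ll_zero intro!: Ll_smult Ll_fmode)
  qed (simp_all add: D.\<delta>_add D.\<delta>_smult)
qed

lemma md_gr: "a \<in> cg p \<Longrightarrow> md a n \<in> gr g p"
  using full_Lgr by (auto simp: md_def gr_Lie)

lemma md_carrier: "md a n \<in> carrier g"
  unfolding md_def Lie_simps(1) by (rule imageI[OF full_LC])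

lemma md_Ll: assumes a: "a \<in> cg p" and n: "n \<ge> 0" shows "md a n \<in> Ll"
proof -
  define c where "c = m1 (p * card Fl) * sgm Fl (Fl - Fl)"
  have "c \<noteq> 0" by (simp add: c_def)
  then have "md a n = fmode N R p (s (inverse c) a) n Fl" unfolding md_def fmode_eq c_def[symmetric] by simp
  then show ?thesis using Ll_fmode[OF cg_scale[OF a] n] by simp
qed

lemma letter_zero: "letter (Lc 0) \<in> E.I"
  using E.letter_smult[of "Lc 0" 0] by (simp add: Lie_simps LC_0 fconst_simps)

lemma letter_full_scale: "letter (Lc (sing (n, Fl) (s c a))) - fconst c * letter (md a n) \<in> E.I"
  using E.letter_smult[OF md_carrier, of c a n] by (simp add: md_def Lie_simps full_LC pscale_single del: One_nat_def)

lemma letter_sum: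
  fixes M :: nat
  shows "letter (Lc (\<Sum>j<M. sing (k j, Fl) (s (c j) (b j)))) - (\<Sum>j<M. fconst (c j) * letter (md (b j) (k j))) \<in> E.I"
proof (induction M)
  case (Suc M)
  define u where "u = (\<Sum>j<M. sing (k j, Fl) (s (c j) (b j)))"
  define v where "v = sing (k M, Fl) (s (c M) (b M))"
  have uv: "u \<in> LC" "v \<in> LC" unfolding u_def v_def by (auto intro: LP.subspace_sum[OF LC_subspace] full_LC simp del: One_nat_def)
  have "letter (Lc (u + v)) - (letter (Lc u) + letter (Lc v)) \<in> E.I"
    using E.letter_add[of "Lc u" "Lc v"] uv by (simp add: Lie_simps)
  note sum = E.I_add[OF E.I_add[OF this Suc[folded u_def]] letter_full_scale[of "k M" "c M" "b M", folded v_def]]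
  have uv_sum: "(\<Sum>j<Suc M. sing (k j, Fl) (s (c j) (b j))) = u + v" by (simp add: u_def v_def del: One_nat_def)
  show ?case unfolding uv_sum using sum by (simp add: algebra_simps)
qed (simp add: letter_zero)

text \<open>The bracket of full modes, lifted to the free algebra modulo I. The factor f on the
  right represents the vector on which the modes act.\<close>

lemma letter_comm:
  assumes a: "a \<in> cg p" and b: "b \<in> cg q" and M: "\<forall>j\<ge>M. \<forall>J. np a j J b = 0" and f: "f \<in> E.C"
  shows "letter (md a m) * (letter (md b n) * f) - sg (p * q) (letter (md b n) * (letter (md a m) * f)) -
    (\<Sum>j<M. fconst (of_int m gchoose j) * (letter (md (pd a j b) (m + n - int j)) * f)) \<in> E.I"
proof -
  define B where "B = letter (lie_br g (md a m) (md b n))"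
  define Z where "Z = (\<Sum>j<M. fconst (of_int m gchoose j) * letter (md (pd a j b) (m + n - int j)))"
  have "lie_br g (md a m) (md b n) = Lc (\<Sum>j<M. sing (m + n - int j, Fl) (s (of_int m gchoose j) (pd a j b)))"
    unfolding md_def lie_br_Lc[OF full_LC full_LC] lb_full[OF a b M] ..
  then have "B - Z \<in> E.I" unfolding B_def Z_def by (simp only: letter_sum)
  then have "(B - Z) * f \<in> E.I" by (rule E.I_mult(2)[OF _ f])
  moreover have "(letter (md a m) * letter (md b n) - fconst ((- 1) ^ (p * q)) * letter (md b n) * letter (md a m) - B) * f \<in> E.I"
    unfolding B_def by (rule E.I_mult(2)[OF E.letter_br[OF md_gr[OF a] md_gr[OF b]] f])
  ultimately have "(letter (md a m) * letter (md b n) - fconst ((- 1) ^ (p * q)) * letter (md b n) * letter (md a m) - B) * f + (B - Z) * f \<in> E.I"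
    by (rule E.I_add[rotated])
  moreover have "Z * f = (\<Sum>j<M. fconst (of_int m gchoose j) * (letter (md (pd a j b) (m + n - int j)) * f))"
    by (simp add: Z_def sum_distrib_right mult.assoc)
  ultimately show ?thesis by (simp add: M.sg_fconst left_diff_distrib mult.assoc)
qed

text \<open>Modulo I each letter is a sum of letters of full modes of homogeneous elements, so
  stability under left multiplication by these is enough.\<close>

lemma words_subset:
  assumes H: "FS.subspace H" "E.I \<subseteq> H" "1 \<in> H"
    and step: "\<And>p a n u. a \<in> cg p \<Longrightarrow> u \<in> H \<Longrightarrow> u \<in> E.C \<Longrightarrow> letter (md a n) * u \<in> H"
  shows "E.C \<subseteq> H"
proof
  fix f assume "f \<in> E.C"
  then show "f \<in> H"
  proof (induction rule: letters_in_induct)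
    case (word xs)
    then show ?case
    proof (induction xs)
      case (Cons x xs)
      define u where "u = wd xs"
      have u: "u \<in> H" "u \<in> E.C" using Cons by (auto simp: u_def letters_in_wd)
      have addH: "letter (X \<oplus>\<^bsub>g\<^esub> Y) * u \<in> H" if "X \<in> carrier g" "Y \<in> carrier g" "letter X * u \<in> H" "letter Y * u \<in> H" for X Y
      proof -
        have "(letter (X \<oplus>\<^bsub>g\<^esub> Y) - (letter X + letter Y)) * u \<in> H"
          using E.I_mult(2)[OF E.letter_add[OF that(1,2)] u(2)] H(2) by blast
        from FS.subspace_add[OF H(1) this FS.subspace_add[OF H(1) that(3,4)]] show ?thesis by (simp add: algebra_simps)
      qed
      have hom: "f \<in> LC \<and> letter (Lc f) * u \<in> H" if "f \<in> Lgr (N + q)" for f q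
        using that
      proof (induction rule: Lgr_full_induct)
        case zero show ?case using E.I_mult(2)[OF letter_zero u(2)] H(2) by (auto simp: LC_0)
      next
        case (full n a) then show ?case using step[of a q u n] u full_LC by (simp add: md_def)
      next
        case (add f h) then show ?case using addH[of "Lc f" "Lc h"] by (simp add: Lie_simps LC_add)
      next
        case (ker f h)
        then have "h \<in> LC" using ker_LC by blast
        then have "Lc (f + h) = Lc f" "f + h \<in> LC" using ker by (simp_all add: Lc_eq_iff LC_add)
        then show ?case using ker by simp
      qed
      obtain f where f: "f \<in> LC" "x = Lc f" using Cons.prems by (auto simp: Lie_simps)
      have "f = lp N f + lp (N + 1) f" "lp N f \<in> Lgr (N + 0)" "lp (N + 1) f \<in> Lgr (N + 1)"
        using lp_decomp[OF f(1), of N] lp_decomp[OF f(1), of "N + 1"] by simp_all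
      then have "letter x * u \<in> H"
        using addH[of "Lc (lp N f)" "Lc (lp (N + 1) f)"] hom f(2) by (metis Lie_simps(1,3) image_eqI)
      then show ?case by (simp add: wd_Cons u_def)
    qed (simp add: wd_Nil H(3))
  qed (use FS.subspace_0[OF H(1)] FS.subspace_add[OF H(1)] FS.subspace_scale[OF H(1)] in auto)
qed

end

lemma (in env_module) hat_simps:
  assumes "good A"
  shows "hat A (u + v) = hat A u + hat A v" "hat A (fconst c * v) = fconst c * hat A v" "hat A 0 = 0"
    "hat A (- v) = - hat A v" "hat A (u - v) = hat A u - hat A v" "hat A (sg p v) = sg p (hat A v)"
proof -
  have ad: "additive (hat A)" and "\<And>c v. hat A (fconst c * v) = fconst c * hat A v"
    using hat_lin[OF assms] by (auto simp: linear_iff_additive_homogeneous additive_def)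
  then show "hat A (u + v) = hat A u + hat A v" "hat A (fconst c * v) = fconst c * hat A v" "hat A 0 = 0"
    "hat A (- v) = - hat A v" "hat A (u - v) = hat A u - hat A v" "hat A (sg p v) = sg p (hat A v)"
    by (simp_all add: additive.add additive.zero additive.minus additive.diff additive_sg)
qed

lemma (in env_module) Pj_I: "f - h \<in> I \<Longrightarrow> Pj f = Pj h"
  using I_JF by (auto intro: Pj_cong)

lemma (in env_module) Pj_sg: "Pj (sg p f) = sg p (Pj f)"
  by (simp add: sg_fconst Pj_fscale)

lemma (in env_module) Pj_sum: "Pj (sum f X) = (\<Sum>x\<in>X. Pj (f x))"
  by (rule additive.sum) (simp add: additive_def Pj_add)

context susy_lie_conformal_algebra
begin

section \<open>Operators induced by modes, derivations and parity\<close>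

definition hx :: "'r \<Rightarrow> int \<Rightarrow> ('r loops set word \<Rightarrow>\<^sub>0 complex) \<Rightarrow> ('r loops set word \<Rightarrow>\<^sub>0 complex)" where
  "hx a n = M.hat (\<lambda>f. letter (md a n) * f)"

definition "Sr i = env_derivation.Dr g 1 (dS i)"
definition "HT = M.hat DT.Dr"
definition "HS i = M.hat (Sr i)"
definition "par = M.hat (E.tau 1)"

lemma good_x: "M.good (\<lambda>f. letter (md a n) * f)"
  by (rule M.good_letter[OF md_carrier])

lemma good_T: "M.good DT.Dr"
  by (auto simp: M.good_def DT.Dr_add DT.Dr_fscale DT.Dr_C DT.Dr_JF)

lemma good_S: assumes i: "i \<in> Fl" shows "M.good (Sr i)"
proof -
  interpret D: env_module_derivation g Ll 1 "dS i" by (rule dS_module[OF i])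
  show ?thesis unfolding Sr_def by (auto simp: M.good_def D.Dr_add D.Dr_fscale D.Dr_C D.Dr_JF simp del: One_nat_def)
qed

lemmas x_simps = M.hat_simps[OF good_x, folded hx_def] and T_simps = M.hat_simps[OF good_T, folded HT_def]
  and S_simps = M.hat_simps[OF good_S, folded HS_def] and par_simps = M.hat_simps[OF M.good_tau[of 1], folded par_def]

lemma letter_md_C: "letter (md a n) \<in> E.C"
  by (rule E.letter_C[OF md_carrier])

lemma x_Pj: "f \<in> E.C \<Longrightarrow> hx a n (M.Pj f) = M.Pj (letter (md a n) * f)"
  unfolding hx_def by (rule M.hat_Pj_C[OF good_x])

lemma x_eq: "hx a n v = M.Pj (letter (md a n) * M.rho v)"
  by (simp add: hx_def M.hat_def)

lemma x_hat: "A (M.rho v) \<in> E.C \<Longrightarrow> hx a n (M.hat A v) = M.Pj (letter (md a n) * A (M.rho v))"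
  unfolding hx_def by (rule M.hat_hat[OF good_x])

lemma hat_x: "M.good A \<Longrightarrow> M.hat A (hx a n v) = M.Pj (A (letter (md a n) * M.rho v))"
  using M.hat_hat[where A = A and B = "\<lambda>f. letter (md a n) * f" and v = v]
  by (simp add: hx_def letters_in_mult letter_md_C M.rho_in)

lemma x_scale: "hx (s c a) n v = fconst c * hx a n v"
proof -
  have "(letter (md (s c a) n) - fconst c * letter (md a n)) * M.rho v \<in> E.I"
    by (rule E.I_mult(2)[OF letter_full_scale[of n c a, folded md_def] M.rho_in])
  then have "letter (md (s c a) n) * M.rho v - fconst c * (letter (md a n) * M.rho v) \<in> E.I"
    by (simp only: left_diff_distrib mult.assoc)
  from M.Pj_I[OF this] show ?thesis by (simp only: x_eq M.Pj_fscale)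
qed

lemma x_neg: "hx (- a) n v = - hx a n v"
  using x_scale[of "-1" a n v] by (simp add: fconst_simps R.scale_minus_left)

lemma x_comm:
  assumes a: "a \<in> cg p" and b: "b \<in> cg q" and M: "\<forall>j\<ge>M. \<forall>J. np a j J b = 0"
  shows "hx a m (hx b n v) - sg (p * q) (hx b n (hx a m v)) =
    (\<Sum>j<M. fconst (of_int m gchoose j) * hx (pd a j b) (m + n - int j) v)"
proof -
  have C: "letter (md c k) * M.rho v \<in> E.C" for c k by (intro letters_in_mult letter_md_C M.rho_in)
  have hh: "hx c k (hx d l v) = M.Pj (letter (md c k) * (letter (md d l) * M.rho v))" for c k d l
    unfolding hx_def[of d] by (rule x_hat[where A = "\<lambda>f. letter (md d l) * f", OF C])
  show ?thesis
    using M.Pj_JF[OF subsetD[OF M.I_JF letter_comm[OF a b M M.rho_in[of v], of m n]]]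
    unfolding hh M.Pj_diff M.Pj_sg M.Pj_sum M.Pj_fscale x_eq[symmetric] by simp
qed

lemma md_T: "md (conf_T R a) n = Lc (sing (n - 1, Fl) (s (- of_int n) a))"
proof -
  have "sing (n, Fl) (conf_T R a) - sing (n - 1, Fl) (s (- of_int n) a) \<in> ker"
    using ker_T[of Fl n a] by (simp add: R.scale_minus_left single_uminus del: One_nat_def)
  then show ?thesis unfolding md_def Lc_eq_iff[OF full_LC full_LC] .
qed

lemma dT_md: "dT (md a n) = md (conf_T R a) n"
  unfolding md_def dT_Lc[OF full_LC] mop_single[OF linear_T] ..

lemma dS_md: "i \<in> Fl \<Longrightarrow> dS i (md a n) = md (SN i a) n"
  unfolding md_def by (simp only: dS_Lc full_LC mop_single linear_SN)

text \<open>The relation for T in L(R), read on fields: (T a)(z) is the derivative of a(z).\<close>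

lemma x_T_left: "hx (conf_T R a) n v = fconst (- of_int n) * hx a (n - 1) v"
  using x_scale[of "- of_int n" a "n - 1" v] unfolding x_eq md_T by (simp only: md_def)

lemma x_T: "HT (hx a n v) - hx a n (HT v) = fconst (- of_int n) * hx a (n - 1) v"
proof -
  have "HT (hx a n v) = M.Pj (DT.Dr (letter (md a n) * M.rho v))"
    unfolding HT_def by (rule hat_x[OF good_T])
  also have "DT.Dr (letter (md a n) * M.rho v) = letter (md (conf_T R a) n) * M.rho v + letter (md a n) * DT.Dr (M.rho v)"
    by (simp add: DT.Dr_mult DT.Dr_letter dT_md E.tau_def E.tp_def lmap_id)
  also have "M.Pj \<dots> = hx (conf_T R a) n v + hx a n (HT v)"
    unfolding M.Pj_add x_eq[of _ _ v] HT_def by (simp only: x_hat[where A = DT.Dr and v = v, OF DT.Dr_C[OF M.rho_in]])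
  finally show ?thesis by (simp add: x_T_left)
qed

lemma tau_md: "a \<in> cg p \<Longrightarrow> M.Pj (E.tau 1 (letter (md a n)) * f) = sg p (M.Pj (letter (md a n) * f))" if f: "f \<in> E.C"
proof -
  assume a: "a \<in> cg p"
  have "(E.tau 1 (letter (md a n)) - fconst ((- 1) ^ (1 * p)) * letter (md a n)) * f \<in> E.I"
    unfolding E.tau_letter by (rule E.I_mult(2)[OF E.letter_tp[OF md_gr[OF a]] f])
  then have "E.tau 1 (letter (md a n)) * f - sg p (letter (md a n) * f) \<in> E.I"
    unfolding M.sg_fconst mult_1 by (simp only: left_diff_distrib mult.assoc)
  from M.Pj_I[OF this] show ?thesis by (simp only: M.Pj_sg)
qed

lemma x_S:
  assumes i: "i \<in> Fl" and a: "a \<in> cg p"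
  shows "HS i (hx a n v) = hx (SN i a) n v + sg p (hx a n (HS i v))"
proof -
  interpret D: env_module_derivation g Ll 1 "dS i" by (rule dS_module[OF i])
  have DC: "D.Dr (M.rho v) \<in> E.C" by (rule D.Dr_C[OF M.rho_in])
  have "HS i (hx a n v) = M.Pj (Sr i (letter (md a n) * M.rho v))"
    unfolding HS_def by (rule hat_x[OF good_S[OF i]])
  also have "Sr i (letter (md a n) * M.rho v) = letter (md (SN i a) n) * M.rho v + E.tau 1 (letter (md a n)) * D.Dr (M.rho v)"
    unfolding Sr_def D.Dr_mult D.Dr_letter dS_md[OF i] ..
  also have "M.Pj \<dots> = hx (SN i a) n v + sg p (hx a n (HS i v))"
    unfolding M.Pj_add x_eq[of _ _ v] HS_def Sr_def tau_md[OF DC a] by (simp only: x_hat[where A = D.Dr and v = v, OF DC])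
  finally show ?thesis .
qed

lemma x_par: assumes a: "a \<in> cg p" shows "par (hx a n v) = sg p (hx a n (par v))"
proof -
  have tC: "E.tau 1 (M.rho v) \<in> E.C" by (rule E.tau_C[OF M.rho_in])
  have "par (hx a n v) = M.Pj (E.tau 1 (letter (md a n) * M.rho v))"
    unfolding par_def by (rule hat_x[OF M.good_tau])
  then show ?thesis unfolding E.tau_mult tau_md[OF tC a] par_def by (simp only: x_hat[where A = "E.tau 1" and v = v, OF tC])
qed

lemma x_vac: "a \<in> cg p \<Longrightarrow> n \<ge> 0 \<Longrightarrow> hx a n (M.Pj 1) = 0"
  using M.Pj_JF[OF M.JF_letter[OF md_Ll]] by (simp add: x_Pj letters_in_1)

lemma vac_simps: "HT (M.Pj 1) = 0" "i \<in> Fl \<Longrightarrow> HS i (M.Pj 1) = 0" "par (M.Pj 1) = M.Pj 1" "M.Pj (M.Pj 1) = M.Pj 1"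
proof -
  show "HT (M.Pj 1) = 0"
    unfolding HT_def M.hat_Pj_C[OF good_T letters_in_1] using DT.Dr_fconst[of 1] by (simp add: fconst_simps M.Pj_0)
  show "HS i (M.Pj 1) = 0" if i: "i \<in> Fl"
  proof -
    interpret D: env_module_derivation g Ll 1 "dS i" by (rule dS_module[OF i])
    show ?thesis unfolding HS_def M.hat_Pj_C[OF good_S[OF i] letters_in_1] unfolding Sr_def
      using D.Dr_fconst[of 1] unfolding fconst_simps by (simp only: M.Pj_0)
  qed
  show "par (M.Pj 1) = M.Pj 1"
    unfolding par_def M.hat_Pj_C[OF M.good_tau letters_in_1] using E.tau_fconst[of 1 1] unfolding fconst_simps by (simp only:)
qed (rule M.Pj_Pj)

text \<open>The span of \<open>JF\<close> and of the vectors obtained from 1 by negative full modes.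
  That it is all of C is the spanning half of an ordering argument in the style of Poincare,
  Birkhoff and Witt.\<close>

inductive_set Mon :: "('r loops set word \<Rightarrow>\<^sub>0 complex) set" where
  Mon_JF: "f \<in> M.JF \<Longrightarrow> f \<in> Mon"
| Mon_1: "1 \<in> Mon"
| Mon_add: "f \<in> Mon \<Longrightarrow> h \<in> Mon \<Longrightarrow> f + h \<in> Mon"
| Mon_scale: "f \<in> Mon \<Longrightarrow> fconst c * f \<in> Mon"
| Mon_step: "a \<in> cg p \<Longrightarrow> n < 0 \<Longrightarrow> f \<in> Mon \<Longrightarrow> letter (md a n) * f \<in> Mon"

lemma Mon_C: "f \<in> Mon \<Longrightarrow> f \<in> E.C"
  by (induction rule: Mon.induct)
    (use M.JF_C in \<open>auto intro: letters_in_add letters_in_mult letters_in_fconst letters_in_1 letter_md_C\<close>)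

lemma Mon_subspace: "FS.subspace Mon"
  using Mon_JF[OF M.JF_0] by (simp add: FS.subspace_def Mon_add Mon_scale)

text \<open>A nonnegative mode is commuted to the right until it meets 1, where it lies in the left
  ideal. The commutator terms act on the shorter f, for which the induction hypothesis covers all
  nonnegative modes.\<close>

lemma Mon_letter_nonneg: "f \<in> Mon \<Longrightarrow> a \<in> cg p \<Longrightarrow> n \<ge> 0 \<Longrightarrow> letter (md a n) * f \<in> Mon"
proof (induction arbitrary: a p n rule: Mon.induct)
  case (Mon_JF f)
  then show ?case by (intro Mon.Mon_JF M.JF_mult letter_md_C)
next
  case Mon_1
  then show ?case using Mon.Mon_JF[OF M.JF_letter[OF md_Ll]] by simp
next
  case (Mon_add f h)
  then show ?case unfolding distrib_left by (intro Mon.Mon_add) blast+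
next
  case (Mon_scale f c)
  then show ?case unfolding fconst_left_commute[of "letter (md a n)"] by (intro Mon.Mon_scale) blast
next
  case (Mon_step b q k f)
  note a = \<open>a \<in> cg p\<close> and b = \<open>b \<in> cg q\<close>
  obtain M where M: "\<forall>j\<ge>M. \<forall>J. np a j J b = 0" using np_bounded by blast
  define X where "X = letter (md a n) * (letter (md b k) * f)"
  define Y where "Y = sg (p * q) (letter (md b k) * (letter (md a n) * f))"
  define Z where "Z = (\<Sum>j<M. fconst (of_int n gchoose j) * (letter (md (pd a j b) (n + k - int j)) * f))"
  have "X - Y - Z \<in> Mon"
    unfolding X_def Y_def Z_def
    by (rule Mon.Mon_JF[OF subsetD[OF M.I_JF letter_comm[OF a b M Mon_C[OF Mon_step.hyps(3)]]]])
  moreover have "Y \<in> Mon"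
    unfolding Y_def M.sg_fconst using Mon_step by (intro Mon.Mon_scale Mon.Mon_step[OF b]) blast+
  moreover have "Z \<in> Mon"
    unfolding Z_def
  proof (intro FS.subspace_sum[OF Mon_subspace] Mon.Mon_scale)
    fix j
    show "letter (md (pd a j b) (n + k - int j)) * f \<in> Mon"
      using Mon.Mon_step[OF pd_gr[OF a b]] Mon_step.IH[OF pd_gr[OF a b]] Mon_step.hyps(3) by (metis not_less)
  qed
  ultimately have "(X - Y - Z) + Y + Z \<in> Mon" by (intro Mon.Mon_add)
  then show ?case by (simp add: X_def)
qed

lemma C_Mon: "E.C \<subseteq> Mon"
proof (rule words_subset[OF Mon_subspace _ Mon_1])
  show "E.I \<subseteq> Mon" using M.I_JF Mon_JF by blast
  show "letter (md a n) * u \<in> Mon" if "a \<in> cg p" "u \<in> Mon" for p a n u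
    using Mon_step[OF that(1) _ that(2)] Mon_letter_nonneg[OF that(2,1)] by (cases "n < 0") auto
qed

text \<open>Modes below -1 reduce to the mode -1: by (T a)_n = -n a_{n-1}, the element T a reaches
  one mode lower, with a nonzero factor for negative n.\<close>

lemma x_span:
  assumes H: "FS.subspace H" "M.Pj 1 \<in> H" and step: "\<And>p a v. a \<in> cg p \<Longrightarrow> v \<in> H \<Longrightarrow> hx a (- 1) v \<in> H"
  shows "M.Pj v \<in> H"
proof -
  have neg: "hx a (- 1 - int k) v \<in> H" if "a \<in> cg p" "v \<in> H" for a p k v
    using that(1)
  proof (induction k arbitrary: a)
    case 0 then show ?case using step that(2) by simp
  next
    case (Suc k)
    have c: "(1 / of_nat (Suc k)) * (- of_int (- 1 - int k)) = (1 :: complex)"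
      by (simp add: add.commute del: of_nat_Suc) (simp add: field_simps)
    have "fconst (1 / of_nat (Suc k)) * hx (conf_T R a) (- 1 - int k) v = hx a (- 1 - int (Suc k)) v"
      unfolding x_T_left fconst_fconst unfolding c fconst_simps(2) by (simp add: algebra_simps)
    moreover have "hx (conf_T R a) (- 1 - int k) v \<in> H" by (rule Suc.IH[OF even_T[OF Suc.prems]])
    ultimately show ?case using FS.subspace_scale[OF H(1)] by metis
  qed
  have "M.Pj f \<in> H" if "f \<in> Mon" for f
    using that
  proof (induction rule: Mon.induct)
    case (Mon_JF f) then show ?case using FS.subspace_0[OF H(1)] by (simp add: M.Pj_JF)
  next
    case (Mon_step a p n f)
    have "n = - 1 - int (nat (- 1 - n))" using Mon_step by simp
    then show ?case using neg[OF Mon_step(1,4), of "nat (- 1 - n)"] by (simp add: x_Pj Mon_C[OF Mon_step(3)])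
  qed (use H FS.subspace_add[OF H(1)] FS.subspace_scale[OF H(1)] in \<open>auto simp: M.Pj_add M.Pj_fscale\<close>)
  from this[of "M.rho v"] show ?thesis using C_Mon M.rho_in by (auto simp: M.Pj_rho)
qed

text \<open>H consists of the f that each a_n sends into \<open>JF\<close> for large n. It contains
  1 since nonnegative modes lie in the left ideal, and it is stable under b_k as the commutator of
  a_n and b_k is a sum of modes n + k - j with a bound on j that does not depend on n.\<close>

lemma x_field: assumes "a \<in> cg p" shows "is_field (hx a)"
proof -
  define H where "H = {f \<in> E.C. \<forall>p. \<forall>a\<in>cg p. eventually (\<lambda>n. letter (md a n) * f \<in> M.JF) at_top}"
  have scale: "letter (md a n) * (fconst c * f) \<in> M.JF" if "letter (md a n) * f \<in> M.JF" for a n c f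
    unfolding fconst_left_commute[of "letter (md a n)"] by (rule FS.subspace_scale[OF M.JF_subspace that])
  have "E.C \<subseteq> H"
  proof (rule words_subset)
    show "FS.subspace H"
      unfolding FS.subspace_def
    proof (intro conjI allI ballI)
      show "0 \<in> H" by (simp add: H_def M.JF_0 letters_in_0)
      fix f assume f: "f \<in> H"
      show "f + h \<in> H" if h: "h \<in> H" for h
        unfolding H_def
      proof (safe intro!: letters_in_add)
        show "f \<in> E.C" "h \<in> E.C" using f h by (simp_all add: H_def)
        fix p a assume "a \<in> cg p"
        then have "eventually (\<lambda>n. letter (md a n) * f \<in> M.JF \<and> letter (md a n) * h \<in> M.JF) at_top"
          using f h by (auto simp: H_def intro: eventually_conj)
        then show "eventually (\<lambda>n. letter (md a n) * (f + h) \<in> M.JF) at_top"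
          by (rule eventually_mono) (simp add: distrib_left M.JF_add)
      qed
      show "fconst c * f \<in> H" for c
        unfolding H_def
      proof (safe intro!: letters_in_mult letters_in_fconst)
        show "f \<in> E.C" using f by (simp add: H_def)
        fix p a assume "a \<in> cg p"
        then have "eventually (\<lambda>n. letter (md a n) * f \<in> M.JF) at_top" using f by (auto simp: H_def)
        then show "eventually (\<lambda>n. letter (md a n) * (fconst c * f) \<in> M.JF) at_top"
          by (rule eventually_mono) (rule scale)
      qed
    qed
    show "E.I \<subseteq> H"
    proof
      fix f assume f: "f \<in> E.I"
      then have "letter (md a n) * f \<in> M.JF" for a n using E.I_mult(1)[OF f letter_md_C] M.I_JF by blast
      then show "f \<in> H" using f E.I_C by (auto simp: H_def)
    qed
    have "eventually (\<lambda>n. letter (md a n) \<in> M.JF) at_top" if "a \<in> cg p" for a p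
      unfolding eventually_at_top_linorder using M.JF_letter[OF md_Ll[OF that]] by blast
    then show "1 \<in> H" by (auto simp: H_def letters_in_1)
    fix q b k u assume b: "b \<in> cg q" and u: "u \<in> H" and uC: "u \<in> E.C"
    show "letter (md b k) * u \<in> H"
      unfolding H_def
    proof (safe intro!: letters_in_mult letter_md_C uC)
      fix p a assume a: "a \<in> cg p"
      obtain M where M: "\<forall>j\<ge>M. \<forall>J. np a j J b = 0" using np_bounded by blast
      have "eventually (\<lambda>n. letter (md (pd a j b) (n + k - int j)) * u \<in> M.JF) at_top" for j
      proof -
        have "eventually (\<lambda>n. letter (md (pd a j b) n) * u \<in> M.JF) at_top" using u pd_gr[OF a b] by (auto simp: H_def)
        then obtain n0 where "\<forall>n\<ge>n0. letter (md (pd a j b) n) * u \<in> M.JF" unfolding eventually_at_top_linorder ..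
        then have "\<forall>n\<ge>n0 - k + int j. letter (md (pd a j b) (n + k - int j)) * u \<in> M.JF" by simp
        then show ?thesis unfolding eventually_at_top_linorder ..
      qed
      then have "eventually (\<lambda>n. \<forall>j\<in>{..<M}. letter (md (pd a j b) (n + k - int j)) * u \<in> M.JF) at_top"
        by (simp add: eventually_ball_finite)
      moreover have "eventually (\<lambda>n. letter (md a n) * u \<in> M.JF) at_top" using u a by (auto simp: H_def)
      ultimately show "eventually (\<lambda>n. letter (md a n) * (letter (md b k) * u) \<in> M.JF) at_top"
      proof eventually_elim
        case (elim n)
        define X where "X = letter (md a n) * (letter (md b k) * u)"
        define Y where "Y = sg (p * q) (letter (md b k) * (letter (md a n) * u))"
        define Z where "Z = (\<Sum>j<M. fconst (of_int n gchoose j) * (letter (md (pd a j b) (n + k - int j)) * u))"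
        have "X - Y - Z \<in> M.JF" unfolding X_def Y_def Z_def by (rule subsetD[OF M.I_JF letter_comm[OF a b M uC]])
        moreover have "Y \<in> M.JF" unfolding Y_def M.sg_fconst
          by (rule FS.subspace_scale[OF M.JF_subspace M.JF_mult[OF letter_md_C elim(2)]])
        moreover have "Z \<in> M.JF" unfolding Z_def
          using elim by (intro FS.subspace_sum[OF M.JF_subspace] FS.subspace_scale[OF M.JF_subspace]) simp
        ultimately have "(X - Y - Z) + Y + Z \<in> M.JF" by (intro M.JF_add)
        then show ?case by (simp add: X_def)
      qed
    qed
  qed
  then have "M.rho v \<in> H" for v using M.rho_in by blast
  then show ?thesis
    unfolding is_field_def x_eq
    using assms M.Pj_JF by (fastforce simp: H_def eventually_at_top_linorder)
qed

text \<open>The commutator involves only products with j < M, so M is an order of locality.\<close>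

lemma x_local: assumes a: "a \<in> cg p" and b: "b \<in> cg q" shows "\<exists>r. mutually_local (p * q) r (hx a) (hx b)"
proof -
  obtain M where M: "\<forall>j\<ge>M. \<forall>J. np a j J b = 0" using np_bounded by blast
  have "mutually_local (p * q) M (hx a) (hx b)"
    unfolding mutually_local_def x_comm[OF a b M]
    by (intro allI) (rule zw_gbinomial[where W = "\<lambda>j k. hx (pd a j b) k v" for v])
  then show ?thesis ..
qed

text \<open>The span property as an induction principle for operators: relations among T, S^i and
  the parity hold on the vacuum and are carried along by the commutators with the modes -1.\<close>

lemma ops_eqI:
  assumes A: "\<And>u v. A (u + v) = A u + A v" "\<And>c v. A (fconst c * v) = fconst c * A v" "\<And>v. A (M.Pj v) = A v"
    and B: "\<And>u v. B (u + v) = B u + B v" "\<And>c v. B (fconst c * v) = fconst c * B v" "\<And>v. B (M.Pj v) = B v"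
    and vac: "A (M.Pj 1) = B (M.Pj 1)"
    and step: "\<And>p a v. a \<in> cg p \<Longrightarrow> A v = B v \<Longrightarrow> A (hx a (- 1) v) = B (hx a (- 1) v)"
  shows "A v = B v"
proof -
  have 0: "A 0 = 0" "B 0 = 0" using A(2)[of 0 0] B(2)[of 0 0] by (simp_all add: fconst_simps)
  have "M.Pj v \<in> {v. A v = B v}"
    by (rule x_span) (use 0 vac step in \<open>auto simp: FS.subspace_def A(1,2) B(1,2)\<close>)
  then show ?thesis by (simp add: A(3) B(3))
qed

lemma hat_proj: "HT (M.Pj v) = HT v" "i \<in> Fl \<Longrightarrow> HS i (M.Pj v) = HS i v" "par (M.Pj v) = par v" "hx a n (M.Pj v) = hx a n v"
  "M.Pj (HT v) = HT v" "M.Pj (HS i v) = HS i v" "M.Pj (par v) = par v" "M.Pj (hx a n v) = hx a n v"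
  using M.hat_Pj[OF good_T] M.hat_Pj[OF good_S] M.hat_Pj[OF M.good_tau] M.hat_Pj[OF good_x]
  by (simp_all add: HT_def HS_def par_def hx_def M.Pj_hat)

lemma vac_simps_1: "HT 1 = 0" "i \<in> Fl \<Longrightarrow> HS i 1 = 0" "par 1 = M.Pj 1"
  using vac_simps(1,3) vac_simps(2)[of i] hat_proj(1)[where v = 1] hat_proj(2)[where v = 1 and i = i] hat_proj(3)[where v = 1]
  by simp_all

lemma SN_SN: assumes "i \<in> Fl" "k \<in> Fl" shows "SN i (SN k a) = - SN k (SN i a)"
  using assms by (simp add: SN_def S_scale S_S[OF assms] R.scale_minus_right)

lemma SN_gr': "i \<in> Fl \<Longrightarrow> a \<in> cg p \<Longrightarrow> SN i a \<in> cg (Suc p)"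
  using SN_gr[of i a p] by simp

lemma par_par: "par (par v) = M.Pj v"
  by (rule ops_eqI[where A = "\<lambda>v. par (par v)" and B = M.Pj])
    (simp_all add: par_simps M.Pj_add M.Pj_fscale M.Pj_Pj hat_proj vac_simps_1 x_par)

lemma par_T: "par (HT v) = HT (par v)"
proof (rule ops_eqI[where A = "\<lambda>v. par (HT v)" and B = "\<lambda>v. HT (par v)"])
  fix p a v assume a: "a \<in> cg p" and IH: "par (HT v) = HT (par v)"
  have T: "HT (hx a n v) = hx a n (HT v) + fconst (- of_int n) * hx a (n - 1) v" for n v using x_T[of a n v] by (simp add: algebra_simps)
  show "par (HT (hx a (- 1) v)) = HT (par (hx a (- 1) v))"
    unfolding T x_par[OF a] par_simps T_simps by (simp only: IH T x_par[OF a] sg_add M.sg_fconst fconst_left_commute[of "fconst _"] distrib_left)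
qed (simp_all add: par_simps T_simps hat_proj vac_simps_1)

lemma par_S: assumes i: "i \<in> Fl" shows "par (HS i v) = - HS i (par v)"
proof (rule ops_eqI[where A = "\<lambda>v. par (HS i v)" and B = "\<lambda>v. - HS i (par v)"])
  fix p a v assume a: "a \<in> cg p" and IH: "par (HS i v) = - HS i (par v)"
  show "par (HS i (hx a (- 1) v)) = - HS i (par (hx a (- 1) v))"
    unfolding x_S[OF i a] x_par[OF a] par_simps S_simps[OF i] x_par[OF SN_gr'[OF i a]] IH x_simps
    by (simp add: sg_Suc sg_add sg_minus sg_sg)
qed (simp_all add: par_simps S_simps[OF i] hat_proj(1,3-) hat_proj(2)[OF i] vac_simps_1(1,3) vac_simps_1(2)[OF i])

lemma S_T: assumes i: "i \<in> Fl" shows "HS i (HT v) = HT (HS i v)"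
proof (rule ops_eqI[where A = "\<lambda>v. HS i (HT v)" and B = "\<lambda>v. HT (HS i v)"])
  fix p a v assume a: "a \<in> cg p" and IH: "HS i (HT v) = HT (HS i v)"
  have T: "HT (hx a n v) = hx a n (HT v) + fconst (- of_int n) * hx a (n - 1) v" for a n v using x_T[of a n v] by (simp add: algebra_simps)
  show "HS i (HT (hx a (- 1) v)) = HT (HS i (hx a (- 1) v))"
    unfolding T x_S[OF i a] T_simps S_simps[OF i] IH
    by (simp only: sg_add M.sg_fconst fconst_left_commute[of "fconst _"] distrib_left add_ac)
qed (simp_all add: S_simps[OF i] T_simps hat_proj(1,3-) hat_proj(2)[OF i] vac_simps_1(1,3) vac_simps_1(2)[OF i])

text \<open>Moving both operators past a_{-1} leaves cross terms that are antisymmetric in i and k,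
  and so is \<open>SN i (SN k a)\<close>.\<close>

lemma HS_HS: assumes i: "i \<in> Fl" and k: "k \<in> Fl" shows "HS i (HS k v) = - HS k (HS i v)"
proof (rule ops_eqI[where A = "\<lambda>v. HS i (HS k v)" and B = "\<lambda>v. - HS k (HS i v)"])
  fix p a v assume a: "a \<in> cg p" and IH: "HS i (HS k v) = - HS k (HS i v)"
  have "HS i (HS k (hx a (- 1) v)) = hx (SN i (SN k a)) (- 1) v - sg p (hx (SN k a) (- 1) (HS i v))
      + sg p (hx (SN i a) (- 1) (HS k v)) + hx a (- 1) (HS i (HS k v))"
    unfolding x_S[OF k a] S_simps[OF i] x_S[OF i a] x_S[OF i SN_gr'[OF k a]] sg_add sg_involutive by (simp add: sg_Suc)
  moreover have "HS k (HS i (hx a (- 1) v)) = hx (SN k (SN i a)) (- 1) v - sg p (hx (SN i a) (- 1) (HS k v))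
      + sg p (hx (SN k a) (- 1) (HS i v)) + hx a (- 1) (HS k (HS i v))"
    unfolding x_S[OF i a] S_simps[OF k] x_S[OF k a] x_S[OF k SN_gr'[OF i a]] sg_add sg_involutive by (simp add: sg_Suc)
  ultimately show "HS i (HS k (hx a (- 1) v)) = - HS k (HS i (hx a (- 1) v))"
    unfolding SN_SN[OF i k] x_neg IH x_simps by simp
qed (simp_all add: S_simps[OF i] S_simps[OF k] hat_proj(1,3-) hat_proj(2)[OF i] hat_proj(2)[OF k] vac_simps_1(1,3) vac_simps_1(2)[OF i] vac_simps_1(2)[OF k])

lemma generating: "generating_fields fscale N M.Pj HT par HS (M.Pj 1) cg hx"
proof (intro generating_fields.intro generating_fields_axioms.intro vector_space_fscale)
  note lin = M.hat_lin
  show "Vector_Spaces.linear fscale fscale M.Pj" by (rule M.Pj_lin)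
  show "Vector_Spaces.linear fscale fscale HT" unfolding HT_def by (rule lin[OF good_T])
  show "Vector_Spaces.linear fscale fscale par" unfolding par_def by (rule lin[OF M.good_tau])
  show "Vector_Spaces.linear fscale fscale (HS i)" if "i \<in> {1..N}" for i unfolding HS_def by (rule lin[OF good_S[OF that]])
  show "Vector_Spaces.linear fscale fscale (hx a n)" for a n unfolding hx_def by (rule lin[OF good_x])
  show "M.Pj v \<in> H" if "FS.subspace H" "M.Pj 1 \<in> H" "\<And>p a v. a \<in> cg p \<Longrightarrow> v \<in> H \<Longrightarrow> hx a (- 1) v \<in> H" for H v
    by (rule x_span[OF that])
  show "\<exists>b\<in>cg (p + 1). \<forall>n v. HS i (hx a n v) - sg p (hx a n (HS i v)) = hx b n v" if i: "i \<in> {1..N}" and a: "a \<in> cg p" for i p a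
    by (rule bexI[OF _ SN_gr'[OF i a, unfolded Suc_eq_plus1]]) (simp add: x_S[OF i a])
  show "hx a n (par v) = sg p (par (hx a n v))" if "a \<in> cg p" for p a n v using x_par[OF that, of n v] by simp
  show "is_field (hx a)" if "a \<in> cg p" for p a by (rule x_field[OF that])
  show "\<exists>r. mutually_local (p * q) r (hx a) (hx b)" if "a \<in> cg p" "b \<in> cg q" for p q a b by (rule x_local[OF that])
  show "hx a n (M.Pj 1) = 0" if "a \<in> cg p" "n \<ge> 0" for p a n by (rule x_vac[OF that])
  show "HS i (HS k v) = - HS k (HS i v)" if "i \<in> {1..N}" "k \<in> {1..N}" for i k v by (rule HS_HS[OF that])
  show "par (HS i v) = - HS i (par v)" "HS i (HT v) = HT (HS i v)" if "i \<in> {1..N}" for i v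
    using par_S[OF that] S_T[OF that] by auto
qed (use hat_proj(2) vac_simps_1(2) in \<open>simp_all add: M.Pj_Pj hat_proj vac_simps_1(1,3) par_par par_T x_T\<close>)

text \<open>T and S^i on V and their Leibniz extensions to U(Lie(R)) come from the same twisted
  derivations \<open>Dr\<close> of the free algebra, which makes them compatible by
  construction.\<close>

theorem vertex_algebra_V_space:
  "\<exists>\<delta>\<^sub>T \<delta>\<^sub>S T S Y. is_Lie_T N R \<delta>\<^sub>T \<and> (\<forall>i\<in>{1..N}. is_Lie_S N R i (\<delta>\<^sub>S i)) \<and>
    V_leibniz N R 0 \<delta>\<^sub>T T \<and> (\<forall>i\<in>{1..N}. V_leibniz N R 1 (\<delta>\<^sub>S i) (S i)) \<and>
    susy_vertex_algebra N (V_space N R) (V_vacuum N R) T S Y"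
proof -
  define Sv where "Sv i = env_module_derivation.Dv g Ll 1 (dS i)" for i
  have V: "V_ideal N R = M.J" "V_space N R = M.V" "V_vacuum N R = M.Vc 1" "V_class N R (E.cl f) = M.Vc f" for f
    by (simp_all add: V_ideal_def M.J_def V_space_def V_vacuum_def V_class_def M.Vc_def E.E_simps)
  have S: "V_leibniz N R 1 (dS i) (Sv i) \<and> (\<forall>f\<in>E.C. Sv i (M.Vc f) = M.Vc (Sr i f))" if i: "i \<in> {1..N}" for i
  proof -
    interpret D: env_module_derivation g Ll 1 "dS i" by (rule dS_module[OF i])
    have "V_leibniz N R 1 (dS i) (Sv i)"
      unfolding V_leibniz_def
      by (rule exI[of _ D.Dl]) (use D.Dl_leibniz in \<open>auto simp: E.E_simps V D.Dl_cl D.Dv_Vc Sv_def simp del: One_nat_def\<close>)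
    then show ?thesis by (simp add: Sv_def Sr_def D.Dv_Vc del: One_nat_def)
  qed
  have T: "V_leibniz N R 0 dT DT.Dv"
    unfolding V_leibniz_def
    by (rule exI[of _ DT.Dl]) (use DT.Dl_leibniz in \<open>auto simp: E.E_simps V DT.Dl_cl DT.Dv_Vc\<close>)
  have "\<exists>Y. susy_vertex_algebra N M.V (M.Vc 1) DT.Dv Sv Y"
  proof (rule M.vertex_algebra_V[OF _ par_def good_T])
    show "generating_fields fscale N M.Pj (M.hat DT.Dr) par (\<lambda>i. M.hat (Sr i)) (M.Pj 1) cg hx"
      using generating unfolding HT_def HS_def[abs_def] .
  qed (use S good_S in \<open>auto simp: DT.Dv_Vc\<close>)
  then show ?thesis unfolding V using T S is_Lie_T is_Lie_S by blast
qed

end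

theorem theorem3p4p4:
  fixes N :: nat and R :: "'r::ab_group_add conf_data"
  assumes "susy_lie_conformal_algebra N R"
  shows "\<exists>\<delta>\<^sub>T \<delta>\<^sub>S T S Y.
    is_Lie_T N R \<delta>\<^sub>T \<and> (\<forall>i\<in>{1..N}. is_Lie_S N R i (\<delta>\<^sub>S i)) \<and>
    V_leibniz N R 0 \<delta>\<^sub>T T \<and> (\<forall>i\<in>{1..N}. V_leibniz N R 1 (\<delta>\<^sub>S i) (S i)) \<and>
    susy_vertex_algebra N (V_space N R) (V_vacuum N R) T S Y"
  by (rule susy_lie_conformal_algebra.vertex_algebra_V_space[OF assms])

end
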